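(* Let $m,n\ge 1$, $N\ge 2$, let $\Omega\subset\mathbb R^n$ be a bounded domain, $T>0$, $\Omega_T=\Omega\times(0,T)$. Let $\sigma\colon\mathbb R^{m\times n}\to\mathbb R^{m\times n}$ be locally Lipschitz and satisfy Condition $O_N$, and let $\Sigma(1)$ be the corresponding open set. Assume $(\bar u,\bar v)\in C^1(\bar\Omega_T;\mathbb R^m\times\mathbb R^{m\times n})$ satisfies $$\bar u=\operatorname{div}\bar v\quad\text{and}\quad (D\bar u,\partial_t\bar v)\in\Sigma(1)\quad\text{on }\bar\Omega_T .$$ Then for every $\delta\in(0,1)$ the Dirichlet problem $$\partial_t u=\operatorname{div}\sigma(Du)\ \text{in }\Omega_T,\qquad u|_{\partial\Omega_T}=\bar u$$ admits a Lipschitz weak solution $u$ with $\|u-\bar u\|_{L^\infty(\Omega_T)}+\|\partial_t u-\partial_t\bar u\|_{L^\infty(\Omega_T)}<\delta$ such that $Du$ is nowhere essentially continuous in $\Omega_T$. In particular, this Dirichlet problem possesses infinitely many Lipschitz weak solutions $u$ with $Du$ nowhere essentially continuous in $\Omega_T$.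
   Context: Notation: $\mathbb R^{m\times n}$ carries the inner product $\langle A,B\rangle=\operatorname{tr}(A^TB)$ and norm $|A|=\langle A,A\rangle^{1/2}$. For $u\colon\Omega_T\to\mathbb R^m$, $Du=(\partial u^i/\partial x_j)\in\mathbb R^{m\times n}$ is the spatial gradient; for $v=(v_{ij})\colon\Omega_T\to\mathbb R^{m\times n}$, $\operatorname{div}v\in\mathbb R^m$ has components $(\operatorname{div} v)^i=\sum_j\partial_{x_j}v_{ij}$. For $p\in\mathbb R^m$, $a\in\mathbb R^n$, $p\otimes a=pa^T$. Weak solution: $u\in W^{1,\infty}(\Omega_T;\mathbb R^m)$ is a (Lipschitz) weak solution of the Dirichlet problem if $\int_{\Omega_T}(u\cdot\partial_t\varphi-\langle\sigma(Du),D\varphi\rangle)\,dx\,dt=0$ for all $\varphi\in C^\infty_0(\Omega_T;\mathbb R^m)$ and $u=\bar u$ on $\partial\Omega_T$ in the sense of traces. Essential continuity: for measurable $f$ on an open set $G$ and $y_0\in G$, $\omega_f(y_0)=\inf\{\|f(y)-f(z)\|_{L^\infty(U\times U)}: U\subset G\text{ open}, y_0\in U\}$; $f$ is essentially continuous at $y_0$ if $\omega_f(y_0)=0$. Wave cone: $\Gamma=\{(p\otimes a,B): p\in\mathbb R^m,\ a\in\mathbb R^n\setminus\{0\},\ B\in\mathbb R^{m\times n},\ Ba=0\}\subset\mathbb R^{m\times n}\times\mathbb R^{m\times n}$. Write $\rho=(\rho^1,\rho^2)\in\mathbb R^{m\times n}\times\mathbb R^{m\times n}$; $\mathbb B_r$,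 $\bar{\mathbb B}_r$ denote the open/closed balls of radius $r$ centered at $0$ in $\mathbb R^{m\times n}\times\mathbb R^{m\times n}$; $[\alpha,\beta]$ denotes the closed segment. Condition $O_N$: $\sigma$ is continuous with graph $\mathcal K=\{(A,\sigma(A))\}$, and there exist $r_0>0$, $0<\delta_1<\delta_2<1$ and continuous maps $(\kappa_i,\gamma_i)\colon\bar{\mathbb B}_{r_0}\to[1/\delta_2,1/\delta_1]\times\Gamma$ ($1\le i\le N$) with $\gamma_1(\rho)+\dots+\gamma_N(\rho)=0$ for all $\rho\in\bar{\mathbb B}_{r_0}$, such that, setting $\pi_1(\rho)=\rho$, $\pi_i(\rho)=\rho+\gamma_1(\rho)+\dots+\gamma_{i-1}(\rho)$ ($2\le i\le N$), $\xi_i(\rho)=\pi_i(\rho)+\kappa_i(\rho)\gamma_i(\rho)$: (P1)(i) $\xi_i(\rho)\in\mathcal K$ for all $\rho\in\bar{\mathbb B}_{r_0}$, $1\le i\le N$; (ii) $\xi_i^1(\bar{\mathbb B}_{r_0})\cap\xi_j^1(\bar{\mathbb B}_{r_0})=\pi_i^1(\bar{\mathbb B}_{r_0})\cap\pi_j^1(\bar{\mathbb B}_{r_0})=\emptyset$ for $i\ne j$ (superscript $1$ = first component); (P2) with $S_i^r(\lambda)=\{\lambda\xi_i(\rho)+(1-\lambda)\pi_i(\rho):\rho\in\mathbb B_r\}$ for $0<r\le r_0$, $0\le\lambda\le1$, there is $\delta_0\in(\delta_2,1)$ such that for each $0<r\le r_0$ and $\lambda\in\{0\}\cup[\delta_0,1)$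 the sets $S_1^r(\lambda),\dots,S_N^r(\lambda)$ are open and pairwise disjoint. Derived sets: $L_i^r(\lambda)=\bigcup\{[\alpha,\beta]:\alpha\in S_i^r(\lambda),\ \beta\in S_i^r(0),\ \alpha-\beta\in\Gamma\}$; $L^r(\lambda)=\bigcup_{i=1}^N L_i^r(\lambda)$; for $\delta_0\le\lambda<1$, $\Sigma^r(\lambda)=\bigcup_{\delta_0\le\lambda'\le\lambda}L^r(\lambda')$; and $\Sigma(1)=\bigcup_{\delta_0\le\lambda<1}\Sigma^{r_0}(\lambda)$. *)

theory Defs
  imports "HOL-Analysis.Analysis" "HOL-Probability.Essential_Supremum"
begin

fun Ck_fun :: "nat \<Rightarrow> ('a::euclidean_space \<Rightarrow> 'b::real_normed_vector) \<Rightarrow> bool" where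
  "Ck_fun 0 f = continuous_on UNIV f"
| "Ck_fun (Suc k) f = (f differentiable_on UNIV \<and>
      (\<forall>b\<in>Basis. Ck_fun k (\<lambda>x. frechet_derivative f (at x) b)))"

definition smooth_fun :: "('a::euclidean_space \<Rightarrow> 'b::real_normed_vector) \<Rightarrow> bool" where
  "smooth_fun f \<longleftrightarrow> (\<forall>k. Ck_fun k f)"

definition test_fun :: "'a::euclidean_space set \<Rightarrow> ('a \<Rightarrow> 'b::real_normed_vector) \<Rightarrow> bool" where
  "test_fun G f \<longleftrightarrow> smooth_fun f \<and> compact (closure {y. f y \<noteq> 0}) \<and> closure {y. f y \<noteq> 0} \<subseteq> G"

type_synonym ('n, 'm) mat = "real ^ 'n ^ 'm"

definition cyl :: "(real ^ 'n) set \<Rightarrow> real \<Rightarrow> ((real ^ 'n) \<times> real) set" where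
  "cyl \<Omega> T = \<Omega> \<times> {0<..<T}"

text \<open>Spatial gradient matrix of a linear map on space-time: entry (i,j) = d u^i / d x_j.\<close>
definition Dx :: "((real ^ 'n) \<times> real \<Rightarrow> real ^ 'm) \<Rightarrow> real ^ 'n ^ 'm" where
  "Dx L = (\<chi> i j. L (axis j 1, 0) $ i)"

definition Dt :: "((real ^ 'n) \<times> real \<Rightarrow> 'b) \<Rightarrow> 'b" where
  "Dt L = L (0, 1)"

text \<open>Divergence from the derivative of a matrix field v: (div v)^i = sum_j d v_ij / d x_j.\<close>
definition divx :: "((real ^ 'n) \<times> real \<Rightarrow> real ^ 'n ^ 'm) \<Rightarrow> real ^ 'm" where
  "divx L = (\<chi> i. \<Sum>j\<in>UNIV. L (axis j 1, 0) $ i $ j)"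

definition C1_closure :: "'a::euclidean_space set \<Rightarrow> ('a \<Rightarrow> 'b::real_normed_vector)
     \<Rightarrow> ('a \<Rightarrow> 'a \<Rightarrow>\<^sub>L 'b) \<Rightarrow> bool" where
  "C1_closure S f F \<longleftrightarrow> continuous_on (closure S) f \<and> continuous_on (closure S) F \<and>
     (\<forall>y\<in>S. (f has_derivative blinfun_apply (F y)) (at y))"

definition loc_lipschitz :: "('a::metric_space \<Rightarrow> 'b::metric_space) \<Rightarrow> bool" where
  "loc_lipschitz f \<longleftrightarrow> (\<forall>x. \<exists>e>0. \<exists>L. L-lipschitz_on (cball x e) f)"

definition outerp :: "real ^ 'm \<Rightarrow> real ^ 'n \<Rightarrow> real ^ 'n ^ 'm" where
  "outerp p a = (\<chi> i j. p $ i * a $ j)"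

definition wave_cone :: "((real ^ 'n ^ 'm) \<times> (real ^ 'n ^ 'm)) set" where
  "wave_cone = {(outerp p a, B) | p a B. a \<noteq> 0 \<and> B *v a = 0}"

definition graph_of :: "(real ^ 'n ^ 'm \<Rightarrow> real ^ 'n ^ 'm) \<Rightarrow> ((real ^ 'n ^ 'm) \<times> (real ^ 'n ^ 'm)) set" where
  "graph_of \<sigma> = {(A, \<sigma> A) | A. True}"

type_synonym ('n, 'm) pt = "(real ^ 'n ^ 'm) \<times> (real ^ 'n ^ 'm)"

definition piN :: "(nat \<Rightarrow> ('n::finite,'m::finite) pt \<Rightarrow> ('n::finite,'m::finite) pt) \<Rightarrow> nat \<Rightarrow> ('n::finite,'m::finite) pt \<Rightarrow> ('n::finite,'m::finite) pt" where
  "piN \<gamma> i \<rho> = \<rho> + (\<Sum>k\<in>{1..<i}. \<gamma> k \<rho>)"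

definition xiN :: "(nat \<Rightarrow> ('n::finite,'m::finite) pt \<Rightarrow> real) \<Rightarrow> (nat \<Rightarrow> ('n::finite,'m::finite) pt \<Rightarrow> ('n::finite,'m::finite) pt)
     \<Rightarrow> nat \<Rightarrow> ('n::finite,'m::finite) pt \<Rightarrow> ('n::finite,'m::finite) pt" where
  "xiN \<kappa> \<gamma> i \<rho> = piN \<gamma> i \<rho> + \<kappa> i \<rho> *\<^sub>R \<gamma> i \<rho>"

definition S_set :: "(nat \<Rightarrow> ('n::finite,'m::finite) pt \<Rightarrow> real) \<Rightarrow> (nat \<Rightarrow> ('n::finite,'m::finite) pt \<Rightarrow> ('n::finite,'m::finite) pt)
     \<Rightarrow> nat \<Rightarrow> real \<Rightarrow> real \<Rightarrow> ('n::finite,'m::finite) pt set" where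
  "S_set \<kappa> \<gamma> i r lam = (\<lambda>\<rho>. lam *\<^sub>R xiN \<kappa> \<gamma> i \<rho> + (1 - lam) *\<^sub>R piN \<gamma> i \<rho>) ` ball 0 r"

definition condition_O :: "nat \<Rightarrow> (real ^ 'n ^ 'm \<Rightarrow> real ^ 'n ^ 'm) \<Rightarrow> real \<Rightarrow> real \<Rightarrow> real \<Rightarrow> real
     \<Rightarrow> (nat \<Rightarrow> ('n::finite,'m::finite) pt \<Rightarrow> real) \<Rightarrow> (nat \<Rightarrow> ('n::finite,'m::finite) pt \<Rightarrow> ('n::finite,'m::finite) pt) \<Rightarrow> bool" where
  "condition_O N \<sigma> r0 \<delta>1 \<delta>2 \<delta>0 \<kappa> \<gamma> \<longleftrightarrow>
     continuous_on UNIV \<sigma> \<and> r0 > 0 \<and> 0 < \<delta>1 \<and> \<delta>1 < \<delta>2 \<and> \<delta>2 < 1 \<and>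
     (\<forall>i\<in>{1..N}. continuous_on (cball 0 r0) (\<kappa> i) \<and> continuous_on (cball 0 r0) (\<gamma> i) \<and>
        (\<forall>\<rho>\<in>cball 0 r0. \<kappa> i \<rho> \<in> {1/\<delta>2..1/\<delta>1} \<and> \<gamma> i \<rho> \<in> wave_cone)) \<and>
     (\<forall>\<rho>\<in>cball 0 r0. (\<Sum>i\<in>{1..N}. \<gamma> i \<rho>) = 0) \<and>
     \<comment> \<open>(P1)(i)\<close>
     (\<forall>\<rho>\<in>cball 0 r0. \<forall>i\<in>{1..N}. xiN \<kappa> \<gamma> i \<rho> \<in> graph_of \<sigma>) \<and>
     \<comment> \<open>(P1)(ii)\<close>
     (\<forall>i\<in>{1..N}. \<forall>j\<in>{1..N}. i \<noteq> j \<longrightarrow>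
        (fst ` xiN \<kappa> \<gamma> i ` cball 0 r0) \<inter> (fst ` xiN \<kappa> \<gamma> j ` cball 0 r0) = {} \<and>
        (fst ` piN \<gamma> i ` cball 0 r0) \<inter> (fst ` piN \<gamma> j ` cball 0 r0) = {}) \<and>
     \<comment> \<open>(P2)\<close>
     \<delta>2 < \<delta>0 \<and> \<delta>0 < 1 \<and>
     (\<forall>r. 0 < r \<and> r \<le> r0 \<longrightarrow> (\<forall>lam\<in>{0} \<union> {\<delta>0..<1}.
        (\<forall>i\<in>{1..N}. open (S_set \<kappa> \<gamma> i r lam)) \<and>
        (\<forall>i\<in>{1..N}. \<forall>j\<in>{1..N}. i \<noteq> j \<longrightarrow> S_set \<kappa> \<gamma> i r lam \<inter> S_set \<kappa> \<gamma> j r lam = {})))"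

definition L_set :: "(nat \<Rightarrow> ('n::finite,'m::finite) pt \<Rightarrow> real) \<Rightarrow> (nat \<Rightarrow> ('n::finite,'m::finite) pt \<Rightarrow> ('n::finite,'m::finite) pt)
     \<Rightarrow> nat \<Rightarrow> real \<Rightarrow> real \<Rightarrow> ('n::finite,'m::finite) pt set" where
  "L_set \<kappa> \<gamma> i r lam = \<Union>{closed_segment \<alpha> \<beta> | \<alpha> \<beta>.
      \<alpha> \<in> S_set \<kappa> \<gamma> i r lam \<and> \<beta> \<in> S_set \<kappa> \<gamma> i r 0 \<and> \<alpha> - \<beta> \<in> wave_cone}"

definition Lall :: "nat \<Rightarrow> (nat \<Rightarrow> ('n::finite,'m::finite) pt \<Rightarrow> real) \<Rightarrow> (nat \<Rightarrow> ('n::finite,'m::finite) pt \<Rightarrow> ('n::finite,'m::finite) pt)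
     \<Rightarrow> real \<Rightarrow> real \<Rightarrow> ('n::finite,'m::finite) pt set" where
  "Lall N \<kappa> \<gamma> r lam = (\<Union>i\<in>{1..N}. L_set \<kappa> \<gamma> i r lam)"

definition Sigma_r :: "nat \<Rightarrow> real \<Rightarrow> (nat \<Rightarrow> ('n::finite,'m::finite) pt \<Rightarrow> real) \<Rightarrow> (nat \<Rightarrow> ('n::finite,'m::finite) pt \<Rightarrow> ('n::finite,'m::finite) pt)
     \<Rightarrow> real \<Rightarrow> real \<Rightarrow> ('n::finite,'m::finite) pt set" where
  "Sigma_r N \<delta>0 \<kappa> \<gamma> r lam = (\<Union>lam'\<in>{\<delta>0..lam}. Lall N \<kappa> \<gamma> r lam')"

definition Sigma1 :: "nat \<Rightarrow> real \<Rightarrow> real \<Rightarrow> (nat \<Rightarrow> ('n::finite,'m::finite) pt \<Rightarrow> real) \<Rightarrow> (nat \<Rightarrow> ('n::finite,'m::finite) pt \<Rightarrow> ('n::finite,'m::finite) pt)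
     \<Rightarrow> ('n::finite,'m::finite) pt set" where
  "Sigma1 N r0 \<delta>0 \<kappa> \<gamma> = (\<Union>lam\<in>{\<delta>0..<1}. Sigma_r N \<delta>0 \<kappa> \<gamma> r0 lam)"

definition ess_osc :: "('a::euclidean_space \<Rightarrow> 'b::real_normed_vector) \<Rightarrow> 'a set \<Rightarrow> 'a \<Rightarrow> ereal" where
  "ess_osc f G y0 = (INF U\<in>{U. open U \<and> U \<subseteq> G \<and> y0 \<in> U}.
      esssup (lebesgue_on (U \<times> U)) (\<lambda>p. ereal (norm (f (fst p) - f (snd p)))))"

definition ess_continuous_at :: "('a::euclidean_space \<Rightarrow> 'b::real_normed_vector) \<Rightarrow> 'a set \<Rightarrow> 'a \<Rightarrow> bool" where
  "ess_continuous_at f G y0 \<longleftrightarrow> ess_osc f G y0 = 0"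

definition Linf_norm :: "'a::euclidean_space set \<Rightarrow> ('a \<Rightarrow> 'b::real_normed_vector) \<Rightarrow> ereal" where
  "Linf_norm S f = esssup (lebesgue_on S) (\<lambda>y. ereal (norm (f y)))"

definition Linf_fun :: "'a::euclidean_space set \<Rightarrow> ('a \<Rightarrow> 'b::euclidean_space) \<Rightarrow> bool" where
  "Linf_fun S f \<longleftrightarrow> f \<in> borel_measurable (lebesgue_on S) \<and> (\<exists>C. AE y in lebesgue_on S. norm (f y) \<le> C)"

definition W1inf :: "((real ^ 'n) \<times> real) set \<Rightarrow> ((real ^ 'n) \<times> real \<Rightarrow> real ^ 'm)
     \<Rightarrow> ((real ^ 'n) \<times> real \<Rightarrow> real ^ 'n ^ 'm) \<Rightarrow> ((real ^ 'n) \<times> real \<Rightarrow> real ^ 'm) \<Rightarrow> bool" where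
  "W1inf Q u Du ut \<longleftrightarrow> Linf_fun Q u \<and> Linf_fun Q Du \<and> Linf_fun Q ut \<and>
     (\<forall>\<phi>::(real ^ 'n) \<times> real \<Rightarrow> real. test_fun Q \<phi> \<longrightarrow>
        (\<forall>j. integral\<^sup>L (lebesgue_on Q) (\<lambda>y. frechet_derivative \<phi> (at y) (axis j 1, 0) *\<^sub>R u y)
              = - integral\<^sup>L (lebesgue_on Q) (\<lambda>y. \<phi> y *\<^sub>R (\<chi> i. Du y $ i $ j))) \<and>
        integral\<^sup>L (lebesgue_on Q) (\<lambda>y. frechet_derivative \<phi> (at y) (0, 1) *\<^sub>R u y)
              = - integral\<^sup>L (lebesgue_on Q) (\<lambda>y. \<phi> y *\<^sub>R ut y))"

text \<open>Lipschitz weak solution of  u_t = div sigma(Du)  in Q = Omega_T with u = ubar on the boundary.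
  The boundary condition is read as: u is continuous up to the boundary and agrees with ubar there.\<close>
definition weak_solution :: "(real ^ 'n ^ 'm \<Rightarrow> real ^ 'n ^ 'm) \<Rightarrow> ((real ^ 'n) \<times> real) set
     \<Rightarrow> ((real ^ 'n) \<times> real \<Rightarrow> real ^ 'm) \<Rightarrow> ((real ^ 'n) \<times> real \<Rightarrow> real ^ 'm)
     \<Rightarrow> ((real ^ 'n) \<times> real \<Rightarrow> real ^ 'n ^ 'm) \<Rightarrow> ((real ^ 'n) \<times> real \<Rightarrow> real ^ 'm) \<Rightarrow> bool" where
  "weak_solution \<sigma> Q ubar u Du ut \<longleftrightarrow> W1inf Q u Du ut \<and>
     (\<forall>\<phi>::(real ^ 'n) \<times> real \<Rightarrow> real ^ 'm. test_fun Q \<phi> \<longrightarrow>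
        integral\<^sup>L (lebesgue_on Q) (\<lambda>y. u y \<bullet> Dt (frechet_derivative \<phi> (at y))
             - \<sigma> (Du y) \<bullet> Dx (frechet_derivative \<phi> (at y))) = 0) \<and>
     continuous_on (closure Q) u \<and> (\<forall>y\<in>frontier Q. u y = ubar y)"

end

theory Submission
  imports Defs
begin

section \<open>Profiles and cut-offs\<close>

text \<open>The equation is read as a differential inclusion: if \<open>u = div v\<close> and
  \<open>(Du, v_t)\<close> lies on the graph of \<sigma> almost everywhere, then
  \<open>u_t = div v_t = div \<sigma>(Du)\<close> weakly. The boundary data satisfy the constraint
  with \<open>(Du, v_t)\<close> in the open set \<open>Sigma1\<close>. Convex integration pushes
  this field onto the graph by adding compactly supported pairs (\<phi>, \<psi>) with \<phi> = div
  \<psi>.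

  One oscillation: for (p \<otimes> a, B) in the wave cone, a cut-off plane wave of high frequency
  in the space-time direction (a, s) gives a pair whose jet (D\<phi>, \<psi>_t) is close to 1 -
  \<theta> times (p \<otimes> a, B) on a volume fraction of about \<theta>, and close to -\<theta>
  times it on most of the rest, while \<phi>, \<psi> and the time derivative of \<phi> are small
  (\<open>div_pair_wave_potential\<close>, \<open>modulated_wave\<close>,
  \<open>building_block\<close>). Thus a field near \<theta>\<alpha> + (1 - \<theta>)\<beta>, with
  \<alpha> - \<beta> in the cone, splits into a part near \<alpha> and a part near \<beta>. Pasting
  over disjoint balls lets the splitting be repeated on each part
  (\<open>paste_local_perturbations\<close>, \<open>attainable_split\<close>).

  The loop: for fixed \<rho> the corners form a closed polygon with edges in the cone, and on each
  edge, prolonged beyond the next corner, sits a tip that lies on the graph (a T_N-configuration).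
  Each corner is therefore a mixture of a point near a tip and of the preceding corner, with weight
  at least \<delta>1 on the former. After n splittings around the loop at most the fraction (1 -
  \<delta>1)^n has missed the target \<open>TT l\<close>, and the same holds from every point of
  \<open>Sig l\<close> (\<open>attainable_corner\<close>, \<open>attainable_Sig\<close>).

  The iteration: let \<lambda>_k increase to 1. \<open>iteration_step\<close> turns a field with
  values in \<open>Sig\<close> at \<lambda>_k into one with values in \<open>Sig\<close> at
  \<lambda>_(k+1) that lies in the next target up to a small volume. A point of a target component
  at \<lambda>_k divides the segment from its corner to the component at \<lambda>_(k+1) in the
  ratio given by \<lambda>_k / \<lambda>_(k+1), so most of the volume moves only by a distance of
  order 1 - \<lambda>_k, and the exceptional volumes are summable. By Borel-Cantelli the fields
  converge almost everywhere, to a limit on the graph (\<open>approximating_sequence\<close>). The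
  functions and their time derivatives converge uniformly, and the weak equation passes to the limit
  by dominated convergence (\<open>weak_identity\<close>, \<open>weak_equation\<close>).

  Nowhere continuity: the fraction of order 1 - \<lambda>_k that is sent back to a corner puts a
  fixed share into the preceding component of the target. At stage k this is arranged inside the
  k-th member of a countable family of open sets, so that two different components receive positive
  volume there; later parameters are so small that later steps cannot undo it. First components of
  tips with different indices keep a distance \<open>d0\<close>, so Du oscillates by at least d0/2
  on every nonempty open subset.

  Infinitely many solutions: the limit is never \<open>ubar\<close> itself, since Du would then
  agree almost everywhere with a continuous gradient (\<open>nontrivial\<close>). A solution closer
  to \<open>ubar\<close> than each of finitely many others is new
  (\<open>infinitely_many\<close>).\<close>

lemma periodic_int_shift:
  fixes f :: "real \<Rightarrow> 'a"
  assumes per: "\<And>x. f (x + 1) = f x"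
  shows "f (x + of_int n) = f x"
proof (induction n rule: int_induct[where k = 0])
  case base then show ?case by simp
next
  case (step1 i)
  then show ?case using per[of "x + of_int i"] by (simp add: algebra_simps)
next
  case (step2 i)
  then show ?case using per[of "x + of_int (i - 1)"] by (simp add: algebra_simps)
qed

lemma periodic_frac:
  fixes f :: "real \<Rightarrow> 'a"
  assumes "\<And>x. f (x + 1) = f x"
  shows "f x = f (frac x)"
  using periodic_int_shift[where f = f and x = "frac x" and n = "\<lfloor>x\<rfloor>"] assms by (simp add: frac_def)

lemma periodic_bounded:
  fixes f :: "real \<Rightarrow> real"
  assumes cont: "continuous_on UNIV f" and per: "\<And>x. f (x + 1) = f x"
  shows "\<exists>B>0. \<forall>x. \<bar>f x\<bar> \<le> B"
proof -
  have "compact (f ` {0..1})"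
    by (rule compact_continuous_image) (auto intro: continuous_on_subset[OF cont])
  then obtain B where B: "B > 0" "\<forall>y\<in>f ` {0..1}. norm y \<le> B"
    using compact_imp_bounded bounded_pos by blast
  have "\<bar>f x\<bar> \<le> B" for x
    using B(2) frac_ge_0[of x] frac_lt_1[of x] periodic_frac[where f = f and x = x] per by (auto simp: less_imp_le)
  with B show ?thesis by blast
qed

text \<open>Zero mean is what makes the antiderivative periodic. Normalising its own mean to zero
  allows the lemma to be applied to it once more.\<close>

lemma periodic_antiderivative:
  fixes f :: "real \<Rightarrow> real"
  assumes cont: "continuous_on UNIV f" and per: "\<And>x. f (x + 1) = f x"
    and mean: "integral {0..1} f = 0"
  shows "\<exists>h. (\<forall>x. (h has_real_derivative f x) (at x)) \<and> (\<forall>x. h (x + 1) = h x) \<and>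
    continuous_on UNIV h \<and> integral {0..1} h = 0"
proof -
  have "\<exists>F. \<forall>x::real. -\<infinity> < ereal x \<longrightarrow> ereal x < \<infinity> \<longrightarrow> (F has_vector_derivative f x) (at x)"
    using cont by (intro einterval_antiderivative) (auto simp: continuous_on_eq_continuous_at)
  then obtain F where F: "\<And>x. (F has_real_derivative f x) (at x)"
    by (auto simp: has_real_derivative_iff_has_vector_derivative)
  have "((\<lambda>x. F (x + 1) - F x) has_real_derivative 0) (at x)" for x
    using DERIV_diff[OF DERIV_shift[THEN iffD1, OF F[of "x + 1"]] F[of x]] per[of x] by simp
  then have const: "F (x + 1) - F x = F (0 + 1) - F 0" for x
    using DERIV_const_ratio_const by (metis (no_types, lifting) DERIV_isconst_all)
  have "(f has_integral (F 1 - F 0)) {0..1}"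
    by (rule fundamental_theorem_of_calculus)
       (auto intro!: has_vector_derivative_at_within F[unfolded has_real_derivative_iff_has_vector_derivative])
  with mean have "F 1 - F 0 = 0" by (simp add: integral_unique)
  with const have perF: "F (x + 1) = F x" for x by (metis add_0 eq_iff_diff_eq_0)
  define h where "h x = F x - integral {0..1} F" for x
  have h: "(h has_real_derivative f x) (at x)" for x
    unfolding h_def using DERIV_diff[OF F[of x] DERIV_const] by simp
  have contF: "continuous_on UNIV F" using F by (meson DERIV_isCont continuous_at_imp_continuous_on)
  have conth: "continuous_on UNIV h" using h by (meson DERIV_isCont continuous_at_imp_continuous_on)
  have "F integrable_on {0..1}" by (rule integrable_continuous_real) (rule continuous_on_subset[OF contF], simp)
  then have "integral {0..1} h = 0" unfolding h_def by (subst integral_diff) auto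
  with h conth perF show ?thesis by (intro exI[of _ h]) (auto simp: h_def)
qed

text \<open>A square wave of duty cycle \<theta> with ramps of width \<epsilon>, minus its mean
  \<open>M\<close>. Two successive antiderivatives are then periodic, hence bounded, which makes the
  corresponding high-frequency potentials small.\<close>

lemma oscillating_profile:
  fixes \<theta> \<epsilon> :: real
  assumes th: "0 < \<theta>" "\<theta> < 1" and eps: "\<epsilon> > 0"
  shows "\<exists>f h H M B. continuous_on UNIV f \<and> (\<forall>x. (h has_real_derivative f x) (at x)) \<and>
    (\<forall>x. (H has_real_derivative h x) (at x)) \<and>
    0 \<le> M \<and> M \<le> 1 \<and> \<bar>M - \<theta>\<bar> \<le> 2 * \<epsilon> \<and> B > 0 \<and> (\<forall>x. \<bar>h x\<bar> \<le> B \<and> \<bar>H x\<bar> \<le> B) \<and>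
    (\<forall>x. - M \<le> f x \<and> f x \<le> 1 - M) \<and>
    (\<forall>x. frac x \<in> {\<epsilon>..\<theta> - \<epsilon>} \<longrightarrow> f x = 1 - M) \<and> (\<forall>x. frac x \<in> {\<theta>..1} \<longrightarrow> f x = - M)"
proof -
  \<comment> \<open>Distance to the integers shifted by \<theta>/2, so that \<open>f0\<close> below
    is a trapezoid supported on [0, \<theta>] modulo 1 with slopes of modulus 1/\<epsilon>.\<close>
  define d where "d x = infdist (x - \<theta>/2) (\<int>::real set)" for x
  define f0 where "f0 x = min 1 (max 0 ((\<theta>/2 - d x) / \<epsilon>))" for x
  have contf0: "continuous_on UNIV f0" unfolding f0_def d_def
    by (intro continuous_intros) (use eps in auto)
  have dper: "d (x + 1) = d x" for x
  proof -
    have "infdist (x + 1 - \<theta>/2) \<int> = infdist (x - \<theta>/2) (\<int>::real set)"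
    proof -
      have "(INF a\<in>\<int>. dist (x + 1 - \<theta>/2) a) = (INF a\<in>(\<lambda>z. z + 1) ` (\<int>::real set). dist (x + 1 - \<theta>/2) a)"
      proof -
        have "(\<lambda>z. z + 1) ` (\<int>::real set) = \<int>"
        proof
          show "\<int> \<subseteq> (\<lambda>z. z + 1) ` (\<int>::real set)"
          proof
            fix z :: real assume "z \<in> \<int>"
            then have "z - 1 \<in> \<int>" by simp
            then show "z \<in> (\<lambda>z. z + 1) ` \<int>" by (intro image_eqI[of _ _ "z - 1"]) auto
          qed
        qed auto
        then show ?thesis by simp
      qed
      also have "\<dots> = (INF a\<in>\<int>. dist (x - \<theta>/2) a)"
        by (simp add: image_image dist_real_def algebra_simps)
      finally show ?thesis by (simp add: infdist_def)
    qed
    then show ?thesis by (simp add: d_def)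
  qed
  have f0per: "f0 (x + 1) = f0 x" for x by (simp add: f0_def dper)
  have f0r: "0 \<le> f0 x" "f0 x \<le> 1" for x by (auto simp: f0_def)
  have f01: "f0 x = 1" if "frac x \<in> {\<epsilon>..\<theta> - \<epsilon>}" for x
  proof -
    have "d x \<le> dist (x - \<theta>/2) (of_int \<lfloor>x\<rfloor>)" unfolding d_def by (rule infdist_le) auto
    also have "\<dots> \<le> \<theta>/2 - \<epsilon>" using that by (auto simp: dist_real_def frac_def abs_le_iff)
    finally have "(\<theta>/2 - d x) / \<epsilon> \<ge> 1" using eps by (simp add: field_simps)
    then show ?thesis by (simp add: f0_def)
  qed
  have f02: "f0 x = 0" if "frac x \<in> {\<theta>..1}" for x
  proof -
    have "\<theta>/2 \<le> dist (x - \<theta>/2) z" if "z \<in> \<int>" for z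
    proof -
      obtain n where n: "z = of_int n" using \<open>z \<in> \<int>\<close> by (auto elim: Ints_cases)
      have x: "x = of_int \<lfloor>x\<rfloor> + frac x" by (simp add: frac_def)
      show ?thesis
      proof (cases "n \<le> \<lfloor>x\<rfloor>")
        case True
        then have "real_of_int n \<le> of_int \<lfloor>x\<rfloor>" by simp
        then show ?thesis using \<open>frac x \<in> _\<close> n x th by (simp add: dist_real_def)
      next
        case False
        then have "real_of_int n \<ge> of_int \<lfloor>x\<rfloor> + 1" by linarith
        then show ?thesis using \<open>frac x \<in> _\<close> n x th frac_lt_1[of x] by (simp add: dist_real_def)
      qed
    qed
    then have "\<theta>/2 \<le> d x" unfolding d_def infdist_def
      using cINF_greatest[of "\<int>" "\<theta>/2" "dist (x - \<theta>/2)"] Ints_0 by auto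
    then have "(\<theta>/2 - d x) / \<epsilon> \<le> 0" using eps by (simp add: field_simps)
    then show ?thesis by (simp add: f0_def)
  qed
  define M where "M = integral {0..1} f0"
  have int: "f0 integrable_on {a..b}" for a b
    by (rule integrable_continuous_real) (rule continuous_on_subset[OF contf0], simp)
  have M0: "0 \<le> M" unfolding M_def by (rule integral_nonneg[OF int]) (simp add: f0r)
  have "M = integral {0..\<theta>} f0 + integral {\<theta>..1} f0"
    unfolding M_def using th by (intro Henstock_Kurzweil_Integration.integral_combine[symmetric] int) auto
  moreover have "integral {\<theta>..1} f0 = integral {\<theta>..1} (\<lambda>x. 0)"
  proof (rule integral_spike[of "{1}"])
    fix x assume "x \<in> {\<theta>..1} - {1}"
    then have "x \<in> {\<theta>..<1}" by auto
    then have "frac x = x" using th by (simp add: frac_eq)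
    then show "0 = f0 x" using f02[of x] \<open>x \<in> {\<theta>..<1}\<close> by simp
  qed simp
  moreover have "integral {0..\<theta>} f0 \<le> integral {0..\<theta>} (\<lambda>x. 1)"
    by (rule integral_le[OF int]) (auto simp: f0r)
  ultimately have M2: "M \<le> \<theta>" using th by simp
  have M3: "\<theta> - 2 * \<epsilon> \<le> M"
  proof (cases "\<epsilon> \<le> \<theta> - \<epsilon>")
    case True
    have "integral {\<epsilon>..\<theta>-\<epsilon>} (\<lambda>x. 1::real) = integral {\<epsilon>..\<theta>-\<epsilon>} f0"
    proof (rule Henstock_Kurzweil_Integration.integral_cong)
      fix x assume x: "x \<in> {\<epsilon>..\<theta> - \<epsilon>}"
      then have "frac x = x" using th eps by (simp add: frac_eq)
      then show "1 = f0 x" using f01[of x] x by simp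
    qed
    also have "\<dots> \<le> integral {0..1} f0"
      by (rule integral_subset_le) (use th eps in \<open>auto simp: int f0r\<close>)
    finally show ?thesis using True by (simp add: M_def)
  next
    case False then show ?thesis using M0 by simp
  qed
  define f where "f x = f0 x - M" for x
  have contf: "continuous_on UNIV f" unfolding f_def by (intro continuous_intros contf0)
  have perf: "f (x + 1) = f x" for x by (simp add: f_def f0per)
  have "integral {0..1} f = 0" unfolding f_def by (subst integral_diff) (auto simp: int M_def)
  from periodic_antiderivative[OF contf perf this] obtain h where
    h: "\<And>x. (h has_real_derivative f x) (at x)" "\<And>x. h (x + 1) = h x"
    "continuous_on UNIV h" "integral {0..1} h = 0" by blast
  obtain H where
    H: "\<And>x. (H has_real_derivative h x) (at x)" "\<And>x. H (x + 1) = H x" "continuous_on UNIV H" "integral {0..1} H = 0"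
    using periodic_antiderivative[OF h(3) h(2) h(4)] by blast
  obtain B1 where B1: "B1 > 0" "\<And>x. \<bar>h x\<bar> \<le> B1" using periodic_bounded[OF h(3) h(2)] by blast
  obtain B2 where B2: "B2 > 0" "\<And>x. \<bar>H x\<bar> \<le> B2" using periodic_bounded[OF H(3) H(2)] by blast
  show ?thesis
  proof (intro exI conjI allI impI)
    show "\<bar>M - \<theta>\<bar> \<le> 2 * \<epsilon>" using M2 M3 eps by simp
    show "M \<le> 1" using M2 th by simp
    show "\<bar>h x\<bar> \<le> max B1 B2" for x using B1(2) by (simp add: max.coboundedI1)
    show "\<bar>H x\<bar> \<le> max B1 B2" for x using B2(2) by (simp add: max.coboundedI2)
    show "max B1 B2 > 0" using B1(1) by simp
    show "- M \<le> f x" "f x \<le> 1 - M" for x using f0r[of x] by (auto simp: f_def)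
    show "f x = 1 - M" if "frac x \<in> {\<epsilon>..\<theta> - \<epsilon>}" for x using f01[OF that] by (simp add: f_def)
    show "f x = - M" if "frac x \<in> {\<theta>..1}" for x using f02[OF that] by (simp add: f_def)
  qed (use contf h(1) H(1) M0 in auto)
qed

section \<open>Functions of class C^2: smooth steps, plane waves and ball cut-offs\<close>

lemma has_real_derivative_pos_power:
  "((\<lambda>x. (max 0 x) ^ Suc (Suc n)) has_real_derivative real (Suc (Suc n)) * (max 0 x) ^ Suc n) (at x)"
proof -
  have "((\<lambda>x::real. if x \<in> {0..} then x ^ Suc (Suc n) else 0) has_vector_derivative
      (if x \<in> {0..} then real (Suc (Suc n)) * x ^ Suc n else 0)) (at x within UNIV)"
  proof (rule has_vector_derivative_If_within_closures[where T = "{..<0}"])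
    show "((\<lambda>x::real. x ^ Suc (Suc n)) has_vector_derivative real (Suc (Suc n)) * x ^ Suc n)
       (at x within {0..} \<union> closure {0..} \<inter> closure {..<0})"
      by (intro has_vector_derivative_at_within[OF iffD1[OF has_real_derivative_iff_has_vector_derivative]])
         (rule derivative_eq_intros refl | simp)+
  qed (auto simp: set_eq_iff)
  then have "((\<lambda>x::real. if x \<in> {0..} then x ^ Suc (Suc n) else 0) has_real_derivative
      (if x \<in> {0..} then real (Suc (Suc n)) * x ^ Suc n else 0)) (at x)"
    by (simp add: has_real_derivative_iff_has_vector_derivative)
  moreover have 1: "(\<lambda>x::real. if x \<in> {0..} then x ^ Suc (Suc n) else 0) = (\<lambda>x. (max 0 x) ^ Suc (Suc n))"
    by (auto simp: fun_eq_iff max_def)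
  moreover have 2: "(if x \<in> {0..} then real (Suc (Suc n)) * x ^ Suc n else 0) = real (Suc (Suc n)) * (max 0 x) ^ Suc n"
    by (auto simp: max_def)
  ultimately show ?thesis by (simp only: 1 2)
qed

text \<open>The quotient of one-sided cubes \<open>a = x\<^sub>+\<^sup>3\<close> and \<open>a + b\<close>, \<open>b = (1 - x)\<^sub>+\<^sup>3\<close>.\<close>
lemma smoothstep:
  "\<exists>\<psi> \<psi>1 \<psi>2 :: real \<Rightarrow> real.
    (\<forall>x. (\<psi> has_real_derivative \<psi>1 x) (at x)) \<and> (\<forall>x. (\<psi>1 has_real_derivative \<psi>2 x) (at x)) \<and>
    continuous_on UNIV \<psi>2 \<and> (\<forall>x. 0 \<le> \<psi> x \<and> \<psi> x \<le> 1) \<and>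
    (\<forall>x\<ge>1. \<psi> x = 1) \<and> (\<forall>x\<le>0. \<psi> x = 0 \<and> \<psi>1 x = 0 \<and> \<psi>2 x = 0)"
proof -
  define a b where "a x = (max 0 x) ^ 3" and "b x = (max 0 (1 - x)) ^ 3" for x :: real
  define a1 b1 where "a1 x = 3 * (max 0 x) ^ 2" and "b1 x = - 3 * (max 0 (1 - x)) ^ 2" for x :: real
  define a2 b2 where "a2 x = 6 * max 0 x" and "b2 x = 6 * max 0 (1 - x)" for x :: real
  have a: "(a has_real_derivative a1 x) (at x)" for x
    using has_real_derivative_pos_power[of 1 x] by (simp add: a_def [abs_def] a1_def eval_nat_numeral)
  have a1: "(a1 has_real_derivative a2 x) (at x)" for x
    using DERIV_cmult[OF has_real_derivative_pos_power[of 0 x], of 3]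
    by (simp add: a1_def [abs_def] a2_def eval_nat_numeral)
  have sub: "((\<lambda>x::real. 1 - x) has_real_derivative - 1) (at x)" for x
    by (auto intro!: derivative_eq_intros)
  have b: "(b has_real_derivative b1 x) (at x)" for x
    using DERIV_chain2[OF a sub, of x] by (simp add: a_def b_def[abs_def] a1_def b1_def)
  have b1: "(b1 has_real_derivative b2 x) (at x)" for x
    using DERIV_minus[OF DERIV_chain2[OF a1 sub, of x]] by (simp add: a1_def b1_def[abs_def] a2_def b2_def)
  have pos: "a x + b x > 0" for x
    by (cases "x > 0") (auto simp: a_def b_def add_pos_nonneg add_nonneg_pos)
  have s: "((\<lambda>x. a x + b x) has_real_derivative a1 x + b1 x) (at x)" for x by (intro DERIV_add a b)
  have s1: "((\<lambda>x. a1 x + b1 x) has_real_derivative a2 x + b2 x) (at x)" for x by (intro DERIV_add a1 b1)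
  define \<psi>1 where "\<psi>1 x = (a1 x * (a x + b x) - a x * (a1 x + b1 x)) / ((a x + b x) * (a x + b x))" for x
  define \<psi>2 where "\<psi>2 x = ((a2 x * (a x + b x) - a x * (a2 x + b2 x)) * ((a x + b x) * (a x + b x))
      - (a1 x * (a x + b x) - a x * (a1 x + b1 x)) * (2 * (a x + b x) * (a1 x + b1 x)))
      / (((a x + b x) * (a x + b x)) * ((a x + b x) * (a x + b x)))" for x
  show ?thesis
  proof (rule exI[of _ "\<lambda>x. a x / (a x + b x)"], rule exI[of _ \<psi>1], rule exI[of _ \<psi>2], intro conjI allI impI)
    fix x
    show "((\<lambda>x. a x / (a x + b x)) has_real_derivative \<psi>1 x) (at x)"
      unfolding \<psi>1_def using DERIV_divide[OF a s, of x] pos[of x] by simp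
    have n: "((\<lambda>x. a1 x * (a x + b x) - a x * (a1 x + b1 x)) has_real_derivative
         a2 x * (a x + b x) - a x * (a2 x + b2 x)) (at x)"
      by (rule DERIV_cong[OF DERIV_diff[OF DERIV_mult[OF a1 s] DERIV_mult[OF a s1]]]) (simp add: algebra_simps)
    have dd: "((\<lambda>x. (a x + b x) * (a x + b x)) has_real_derivative 2 * (a x + b x) * (a1 x + b1 x)) (at x)"
      by (rule DERIV_cong[OF DERIV_mult[OF s s]]) (simp add: algebra_simps)
    show "(\<psi>1 has_real_derivative \<psi>2 x) (at x)"
      unfolding \<psi>1_def[abs_def] \<psi>2_def using DERIV_divide[OF n dd] pos[of x] by simp
  next
    show "continuous_on UNIV \<psi>2"
      unfolding \<psi>2_def using pos unfolding a_def b_def a1_def b1_def a2_def b2_def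
      by (intro continuous_intros) (auto simp: less_imp_neq[symmetric])
  next
    fix x show "0 \<le> a x / (a x + b x)" "a x / (a x + b x) \<le> 1"
      using pos[of x] by (auto simp: a_def b_def divide_simps)
  next
    fix x :: real assume "1 \<le> x"
    then show "a x / (a x + b x) = 1" using pos[of x] by (simp add: b_def)
  next
    fix x :: real assume "x \<le> 0"
    then show "a x / (a x + b x) = 0" "\<psi>1 x = 0" "\<psi>2 x = 0"
      by (simp_all add: a_def a1_def a2_def \<psi>1_def \<psi>2_def)
  qed
qed

text \<open>\<open>g\<close> is the gradient and \<open>G y h\<close> the Hessian applied to
  \<open>h\<close>. Symmetry of the Hessian is built in, because the double divergence of the wave
  potentials cancels through it; for the explicit functions used here it is checked by hand.\<close>

definition C2_fun :: "('a::euclidean_space \<Rightarrow> real) \<Rightarrow> ('a \<Rightarrow> 'a) \<Rightarrow> ('a \<Rightarrow> 'a \<Rightarrow> 'a) \<Rightarrow> bool" where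
  "C2_fun \<eta> g G \<longleftrightarrow> (\<forall>y. (\<eta> has_derivative (\<lambda>h. g y \<bullet> h)) (at y)) \<and>
     (\<forall>y. (g has_derivative G y) (at y)) \<and> (\<forall>h. continuous_on UNIV (\<lambda>y. G y h)) \<and>
     (\<forall>y h k. G y h \<bullet> k = h \<bullet> G y k)"

lemma C2_fun_continuous:
  assumes "C2_fun \<eta> g G"
  shows "continuous_on UNIV \<eta>" "continuous_on UNIV g"
  using assms unfolding C2_fun_def
  by (meson continuous_at_imp_continuous_on has_derivative_continuous)+

lemma C2_fun_mult:
  assumes a: "C2_fun a g G" and b: "C2_fun b g' G'"
  shows "C2_fun (\<lambda>y. a y * b y) (\<lambda>y. a y *\<^sub>R g' y + b y *\<^sub>R g y)
     (\<lambda>y h. a y *\<^sub>R G' y h + (g y \<bullet> h) *\<^sub>R g' y + (b y *\<^sub>R G y h + (g' y \<bullet> h) *\<^sub>R g y))"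
proof -
  have ad: "(a has_derivative (\<lambda>h. g y \<bullet> h)) (at y)" "(g has_derivative G y) (at y)" for y
    using a by (auto simp: C2_fun_def)
  have bd: "(b has_derivative (\<lambda>h. g' y \<bullet> h)) (at y)" "(g' has_derivative G' y) (at y)" for y
    using b by (auto simp: C2_fun_def)
  note c = C2_fun_continuous[OF a] C2_fun_continuous[OF b]
  show ?thesis
    unfolding C2_fun_def
  proof (intro conjI allI)
    fix y
    show "((\<lambda>y. a y * b y) has_derivative (\<lambda>h. (a y *\<^sub>R g' y + b y *\<^sub>R g y) \<bullet> h)) (at y)"
      by (rule has_derivative_eq_rhs[OF has_derivative_mult[OF ad(1) bd(1)]])
         (simp add: fun_eq_iff inner_add_left algebra_simps)
    show "((\<lambda>y. a y *\<^sub>R g' y + b y *\<^sub>R g y) has_derivative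
        (\<lambda>h. a y *\<^sub>R G' y h + (g y \<bullet> h) *\<^sub>R g' y + (b y *\<^sub>R G y h + (g' y \<bullet> h) *\<^sub>R g y))) (at y)"
      by (rule has_derivative_add has_derivative_scaleR ad bd)+
  next
    fix h
    have "continuous_on UNIV (\<lambda>y. G y h)" "continuous_on UNIV (\<lambda>y. G' y h)"
      using a b by (auto simp: C2_fun_def)
    then show "continuous_on UNIV
       (\<lambda>y. a y *\<^sub>R G' y h + (g y \<bullet> h) *\<^sub>R g' y + (b y *\<^sub>R G y h + (g' y \<bullet> h) *\<^sub>R g y))"
      by (intro continuous_intros c)
  next
    fix y h k
    have "G y h \<bullet> k = h \<bullet> G y k" "G' y h \<bullet> k = h \<bullet> G' y k" using a b by (auto simp: C2_fun_def)
    then show "(a y *\<^sub>R G' y h + (g y \<bullet> h) *\<^sub>R g' y + (b y *\<^sub>R G y h + (g' y \<bullet> h) *\<^sub>R g y)) \<bullet> k =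
      h \<bullet> (a y *\<^sub>R G' y k + (g y \<bullet> k) *\<^sub>R g' y + (b y *\<^sub>R G y k + (g' y \<bullet> k) *\<^sub>R g y))"
      by (simp add: inner_add_left inner_add_right inner_commute[of h] algebra_simps)
  qed
qed

text \<open>The division by the square of the frequency leaves the Hessian of order one, while the
  gradient is of order 1/k and the function itself of order 1/k^2 for bounded \<open>h\<close> and
  \<open>H\<close>.\<close>

lemma C2_fun_plane_wave:
  fixes e :: "'a::euclidean_space"
  assumes h: "\<And>x. (h has_real_derivative f x) (at x)" and H: "\<And>x. (H has_real_derivative h x) (at x)"
    and f: "continuous_on UNIV f" and k: "k \<noteq> 0"
  shows "C2_fun (\<lambda>y. H (k * (e \<bullet> y)) / k\<^sup>2) (\<lambda>y. (h (k * (e \<bullet> y)) / k) *\<^sub>R e)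
     (\<lambda>y v. (f (k * (e \<bullet> y)) * (e \<bullet> v)) *\<^sub>R e)"
proof -
  have l: "((\<lambda>y. k * (e \<bullet> y)) has_derivative (\<lambda>v. k * (e \<bullet> v))) (at y)" for y
    by (auto intro!: derivative_eq_intros)
  have dh: "((\<lambda>y. h (k * (e \<bullet> y))) has_derivative (\<lambda>v. f (k * (e \<bullet> y)) * (k * (e \<bullet> v)))) (at y)" for y
    by (rule has_derivative_compose[OF l]) (use h in \<open>simp add: has_field_derivative_def\<close>)
  have dH: "((\<lambda>y. H (k * (e \<bullet> y))) has_derivative (\<lambda>v. h (k * (e \<bullet> y)) * (k * (e \<bullet> v)))) (at y)" for y
    by (rule has_derivative_compose[OF l]) (use H in \<open>simp add: has_field_derivative_def\<close>)
  show ?thesis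
    unfolding C2_fun_def
  proof (intro conjI allI)
    fix y
    show "((\<lambda>y. H (k * (e \<bullet> y)) / k\<^sup>2) has_derivative (\<lambda>v. ((h (k * (e \<bullet> y)) / k) *\<^sub>R e) \<bullet> v)) (at y)"
      by (rule has_derivative_eq_rhs[OF has_derivative_divide'[OF dH has_derivative_const]])
         (use k in \<open>auto simp: fun_eq_iff power2_eq_square\<close>)
    show "((\<lambda>y. (h (k * (e \<bullet> y)) / k) *\<^sub>R e) has_derivative (\<lambda>v. (f (k * (e \<bullet> y)) * (e \<bullet> v)) *\<^sub>R e)) (at y)"
      by (rule has_derivative_eq_rhs[OF has_derivative_scaleR[OF has_derivative_divide'[OF dh has_derivative_const] has_derivative_const]])
         (use k in \<open>auto simp: fun_eq_iff power2_eq_square\<close>)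
  next
    fix v
    show "continuous_on UNIV (\<lambda>y. (f (k * (e \<bullet> y)) * (e \<bullet> v)) *\<^sub>R e)"
      by (intro continuous_intros continuous_on_compose2[OF f]) auto
  qed (simp add: inner_commute)
qed

text \<open>The smooth step is composed with a quadratic function of the distance to
  \<open>c\<close> that is 1 at radius \<open>r1\<close> and 0 at radius \<open>r2\<close>; the
  squared distance is differentiable at the centre too.\<close>

lemma C2_fun_ball_cutoff:
  fixes c :: "'a::euclidean_space"
  assumes "0 \<le> r1" "r1 < r2"
  shows "\<exists>\<zeta> g G. C2_fun \<zeta> g G \<and> (\<forall>y. 0 \<le> \<zeta> y \<and> \<zeta> y \<le> 1) \<and> (\<forall>y\<in>cball c r1. \<zeta> y = 1) \<and>
    (\<forall>y. y \<notin> cball c r2 \<longrightarrow> \<zeta> y = 0 \<and> g y = 0 \<and> (\<forall>h. G y h = 0))"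
proof -
  obtain \<psi> \<psi>1 \<psi>2 where X: "\<And>x. (\<psi> has_real_derivative \<psi>1 x) (at x)" "\<And>x. (\<psi>1 has_real_derivative \<psi>2 x) (at x)"
    "continuous_on UNIV \<psi>2" "\<And>x. 0 \<le> \<psi> x" "\<And>x. \<psi> x \<le> 1"
    "\<And>x. x \<ge> 1 \<Longrightarrow> \<psi> x = 1" "\<And>x. x \<le> 0 \<Longrightarrow> \<psi> x = 0 \<and> \<psi>1 x = 0 \<and> \<psi>2 x = 0"
    using smoothstep by metis
  define w where "w = 1 / (r2\<^sup>2 - r1\<^sup>2)"
  have "r1\<^sup>2 < r2\<^sup>2" using assms by (simp add: power_strict_mono)
  then have w: "w > 0" by (simp add: w_def)
  define q where "q y = w * (r2\<^sup>2 - (y - c) \<bullet> (y - c))" for y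
  have dq: "(q has_derivative (\<lambda>h. - 2 * w * ((y - c) \<bullet> h))) (at y)" for y
  proof -
    have i: "((\<lambda>y. y - c) has_derivative (\<lambda>h. h)) (at y)"
      by (auto intro!: derivative_eq_intros)
    show ?thesis unfolding q_def
      by (rule has_derivative_eq_rhs[OF has_derivative_mult_right[OF has_derivative_diff[OF has_derivative_const
            has_derivative_inner[OF i i]]]])
         (simp add: fun_eq_iff inner_commute algebra_simps)
  qed
  have contq: "continuous_on UNIV q" unfolding q_def by (intro continuous_intros)
  have c1: "continuous_on UNIV \<psi>1" using X(2) by (meson DERIV_isCont continuous_at_imp_continuous_on)
  define g where "g y = (- 2 * w * \<psi>1 (q y)) *\<^sub>R (y - c)" for y
  define G where "G y h = (- 2 * w * (\<psi>2 (q y) * (- 2 * w * ((y - c) \<bullet> h)))) *\<^sub>R (y - c) + (- 2 * w * \<psi>1 (q y)) *\<^sub>R h" for y h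
  have "C2_fun (\<lambda>y. \<psi> (q y)) g G"
      unfolding C2_fun_def
    proof (intro conjI allI)
      fix y
      have "((\<lambda>y. \<psi> (q y)) has_derivative (\<lambda>h. \<psi>1 (q y) * (- 2 * w * ((y - c) \<bullet> h)))) (at y)"
        by (rule has_derivative_compose[OF dq]) (use X(1) in \<open>simp add: has_field_derivative_def\<close>)
      then show "((\<lambda>y. \<psi> (q y)) has_derivative (\<lambda>h. g y \<bullet> h)) (at y)"
        by (rule has_derivative_eq_rhs) (simp add: g_def fun_eq_iff)
      have 1: "((\<lambda>y. \<psi>1 (q y)) has_derivative (\<lambda>h. \<psi>2 (q y) * (- 2 * w * ((y - c) \<bullet> h)))) (at y)"
        by (rule has_derivative_compose[OF dq]) (use X(2) in \<open>simp add: has_field_derivative_def\<close>)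
      show "(g has_derivative G y) (at y)"
        unfolding g_def[abs_def] G_def[abs_def]
        by (rule has_derivative_eq_rhs,
            rule has_derivative_scaleR[OF has_derivative_mult_right[OF 1] has_derivative_diff[OF has_derivative_ident has_derivative_const]])
           (simp add: fun_eq_iff algebra_simps)
    next
      fix h
      show "continuous_on UNIV (\<lambda>y. G y h)"
        unfolding G_def by (intro continuous_intros continuous_on_compose2[OF c1 contq] continuous_on_compose2[OF X(3) contq]) auto
    next
      fix y h k show "G y h \<bullet> k = h \<bullet> G y k"
        by (simp add: G_def inner_add_left inner_add_right inner_commute algebra_simps)
    qed
  moreover have "\<psi> (q y) = 1" if "y \<in> cball c r1" for y
  proof -
    from that have "norm (y - c) \<le> r1" by (simp add: dist_norm norm_minus_commute)
    then have "(y - c) \<bullet> (y - c) \<le> r1\<^sup>2" by (metis norm_ge_zero power2_norm_eq_inner power_mono)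
    then have "q y \<ge> w * (r2\<^sup>2 - r1\<^sup>2)" using w by (simp add: q_def)
    then have "q y \<ge> 1" using \<open>r1\<^sup>2 < r2\<^sup>2\<close> by (simp add: w_def)
    then show "\<psi> (q y) = 1" using X(6) by simp
  qed
  moreover have "\<psi> (q y) = 0 \<and> g y = 0 \<and> (\<forall>h. G y h = 0)" if "y \<notin> cball c r2" for y
  proof -
    from that have "norm (y - c) \<ge> r2" by (simp add: dist_norm norm_minus_commute)
    then have "(y - c) \<bullet> (y - c) \<ge> r2\<^sup>2" using assms by (metis less_eq_real_def order_trans not_less power2_norm_eq_inner power_mono)
    then have "q y \<le> 0" using w by (simp add: q_def mult_nonneg_nonpos)
    then show "\<psi> (q y) = 0 \<and> g y = 0 \<and> (\<forall>h. G y h = 0)" using X(7)[of "q y"] by (simp add: g_def G_def)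
  qed
  ultimately show ?thesis using X(4,5) by (intro exI[of _ "\<lambda>y. \<psi> (q y)"] exI[of _ g] exI[of _ G]) blast
qed

declare split_paired_All [simp del] split_paired_Ex [simp del]

section \<open>Compactly supported perturbations\<close>

text \<open>For a pair (u, v) with derivative \<open>L\<close> this is (Du, v_t): exactly the part
  of the derivative that the differential inclusion constrains.\<close>

definition jet :: "((real ^ 'n) \<times> real \<Rightarrow> (real ^ 'm) \<times> (real ^ 'n ^ 'm)) \<Rightarrow> ('n::finite, 'm::finite) pt" where
  "jet L = (Dx (\<lambda>h. fst (L h)), Dt (\<lambda>h. snd (L h)))"

text \<open>A pair \<open>f = (\<phi>, \<psi>)\<close> with derivative \<open>F\<close> and the constraint \<open>\<phi> = div \<psi>\<close>.\<close>
definition div_pair :: "((real ^ 'n) \<times> real \<Rightarrow> (real ^ 'm) \<times> (real ^ 'n ^ 'm)) \<Rightarrow>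
    ((real ^ 'n) \<times> real \<Rightarrow> (real ^ 'n) \<times> real \<Rightarrow> (real ^ 'm) \<times> (real ^ 'n ^ 'm)) \<Rightarrow> bool" where
  "div_pair f F \<longleftrightarrow> (\<forall>y. (f has_derivative F y) (at y)) \<and> (\<forall>h. continuous_on UNIV (\<lambda>y. F y h)) \<and>
     (\<forall>y. fst (f y) = divx (\<lambda>h. snd (F y h)))"

definition pert :: "((real ^ 'n) \<times> real) set \<Rightarrow> ((real ^ 'n) \<times> real \<Rightarrow> (real ^ 'm) \<times> (real ^ 'n ^ 'm)) \<Rightarrow>
    ((real ^ 'n) \<times> real \<Rightarrow> (real ^ 'n) \<times> real \<Rightarrow> (real ^ 'm) \<times> (real ^ 'n ^ 'm)) \<Rightarrow> bool" where
  "pert G f F \<longleftrightarrow> div_pair f F \<and>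
     (\<exists>C. compact C \<and> C \<subseteq> G \<and> (\<forall>y. y \<notin> C \<longrightarrow> f y = 0 \<and> (\<forall>h. F y h = 0)))"

text \<open>Bounds the pair and the time derivative of its first component, whereas the jet may stay
  of order one. These are the quantities whose increments are summed to get uniform limits of u and
  of u_t.\<close>

definition small :: "real \<Rightarrow> ((real ^ 'n) \<times> real \<Rightarrow> (real ^ 'm) \<times> (real ^ 'n ^ 'm)) \<Rightarrow>
    ((real ^ 'n) \<times> real \<Rightarrow> (real ^ 'n) \<times> real \<Rightarrow> (real ^ 'm) \<times> (real ^ 'n ^ 'm)) \<Rightarrow> bool" where
  "small e f F \<longleftrightarrow> (\<forall>y. norm (f y) \<le> e \<and> norm (fst (F y (0, 1))) \<le> e)"

lemma jet_0 [simp]: "jet (\<lambda>h. 0) = 0"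
  by (simp add: jet_def Dx_def Dt_def vec_eq_iff prod_eq_iff)

lemma jet_add: "jet (\<lambda>h. L h + K h) = jet L + jet K"
  by (simp add: jet_def Dx_def Dt_def vec_eq_iff prod_eq_iff)

lemma jet_diff: "jet (\<lambda>h. L h - K h) = jet L - jet K"
  by (simp add: jet_def Dx_def Dt_def vec_eq_iff prod_eq_iff)

lemma divx_add: "divx (\<lambda>h. L h + K h) = divx L + divx K"
  by (simp add: divx_def vec_eq_iff sum.distrib)

lemma continuous_on_jet:
  assumes "\<And>h. continuous_on S (\<lambda>y. F y h)"
  shows "continuous_on S (\<lambda>y. jet (F y))"
  unfolding jet_def Dx_def Dt_def
  by (intro continuous_intros continuous_on_vec_lambda assms)

lemma pert_0 [simp]: "pert G (\<lambda>y. 0) (\<lambda>y h. 0)"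
  by (auto simp: pert_def div_pair_def divx_def vec_eq_iff intro!: exI[of _ "{}"])

lemma small_0 [simp]: "e \<ge> 0 \<Longrightarrow> small e (\<lambda>y. 0) (\<lambda>y h. 0)"
  by (simp add: small_def)

lemma div_pair_add:
  "div_pair f F \<Longrightarrow> div_pair g K \<Longrightarrow> div_pair (\<lambda>y. f y + g y) (\<lambda>y h. F y h + K y h)"
  unfolding div_pair_def by (auto intro!: continuous_intros has_derivative_add simp: divx_add)

lemma pert_add:
  assumes "pert G f F" "pert G g K"
  shows "pert G (\<lambda>y. f y + g y) (\<lambda>y h. F y h + K y h)"
proof -
  obtain C D where "compact C" "C \<subseteq> G" "\<forall>y. y \<notin> C \<longrightarrow> f y = 0 \<and> (\<forall>h. F y h = 0)"
    "compact D" "D \<subseteq> G" "\<forall>y. y \<notin> D \<longrightarrow> g y = 0 \<and> (\<forall>h. K y h = 0)"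
    using assms unfolding pert_def by blast
  then have "compact (C \<union> D) \<and> C \<union> D \<subseteq> G \<and> (\<forall>y. y \<notin> C \<union> D \<longrightarrow> f y + g y = 0 \<and> (\<forall>h. F y h + K y h = 0))"
    by auto
  then show ?thesis using div_pair_add assms unfolding pert_def by blast
qed

lemma pert_mono: "pert G f F \<Longrightarrow> G \<subseteq> G' \<Longrightarrow> pert G' f F"
  unfolding pert_def by blast

lemma pert_outside:
  assumes "pert G f F" "y \<notin> G" shows "f y = 0" "F y h = 0" "jet (F y) = 0"
proof -
  show "f y = 0" "F y h = 0" for h using assms by (auto simp: pert_def)
  then have "F y = (\<lambda>h. 0)" using assms by (auto simp: pert_def)
  then show "jet (F y) = 0" by simp
qed

lemma pert_jet_continuous: "pert G f F \<Longrightarrow> continuous_on UNIV (\<lambda>y. jet (F y))"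
  by (intro continuous_on_jet) (auto simp: pert_def div_pair_def)

lemma pert_continuous: "pert G f F \<Longrightarrow> continuous_on UNIV f"
  unfolding pert_def div_pair_def
  by (meson continuous_at_imp_continuous_on has_derivative_continuous)

lemma small_add:
  assumes "small a f F" "small b g K"
  shows "small (a + b) (\<lambda>y. f y + g y) (\<lambda>y h. F y h + K y h)"
  unfolding small_def
proof (intro allI conjI)
  fix y
  show "norm (f y + g y) \<le> a + b"
    using assms norm_triangle_mono unfolding small_def by blast
  show "norm (fst (F y (0, 1) + K y (0, 1))) \<le> a + b"
    using assms norm_triangle_mono unfolding small_def fst_add by blast
qed

lemma small_mono: "small a f F \<Longrightarrow> a \<le> b \<Longrightarrow> small b f F"
  unfolding small_def by (meson order_trans)

lemma small_add_disjoint: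
  assumes "small a f F" "small a g K" "pert G f F" "pert G' g K" "G \<inter> G' = {}"
  shows "small a (\<lambda>y. f y + g y) (\<lambda>y h. F y h + K y h)"
  unfolding small_def
proof (rule allI)
  fix y
  consider "y \<notin> G" | "y \<notin> G'" using assms by blast
  then show "norm (f y + g y) \<le> a \<and> norm (fst (F y (0, 1) + K y (0, 1))) \<le> a"
    using assms pert_outside[OF assms(3), of y] pert_outside[OF assms(4), of y]
    by cases (auto simp: small_def)
qed

section \<open>Plane waves compatible with the divergence constraint\<close>

text \<open>A linear map applied to the value and gradient of a scalar function \<eta>. The
  divergence of \<eta> p \<otimes> a is (a \<bullet> \<nabla>\<eta>) p, which matches the first
  component. The term with \<open>1 / s\<close> has spatial divergence zero and produces
  \<open>B\<close> in the time derivative of a wave with direction (a, s).\<close>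

definition wave_potential :: "real ^ 'm \<Rightarrow> real ^ 'n \<Rightarrow> real ^ 'n ^ 'm \<Rightarrow> real \<Rightarrow> real \<times> ((real ^ 'n) \<times> real)
    \<Rightarrow> (real ^ 'm) \<times> (real ^ 'n ^ 'm)" where
  "wave_potential p a B s x = (1 / (a \<bullet> a)) *\<^sub>R
     ((a \<bullet> fst (snd x)) *\<^sub>R p,
      fst x *\<^sub>R outerp p a + (1 / s) *\<^sub>R ((a \<bullet> fst (snd x)) *\<^sub>R B - outerp (B *v fst (snd x)) a))"

lemma linear_wave_potential: "linear (wave_potential p a B s)"
  by (rule linearI)
     (auto simp: wave_potential_def outerp_def prod_eq_iff vec_eq_iff inner_add_right algebra_simps
       matrix_vector_right_distrib matrix_vector_mult_scaleR)

text \<open>The potential of \<open>B f(e \<bullet> y)\<close> is antisymmetric in its last two indices, so that its double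
  divergence vanishes by symmetry of the Hessian.\<close>
lemma div_pair_wave_potential:
  fixes a :: "real ^ 'n" and p :: "real ^ 'm"
  assumes C2: "C2_fun \<eta> g G" and a: "a \<noteq> 0"
  shows "div_pair (\<lambda>y. wave_potential p a B s (\<eta> y, g y)) (\<lambda>y h. wave_potential p a B s (g y \<bullet> h, G y h))"
  unfolding div_pair_def
proof (intro conjI allI)
  interpret W: bounded_linear "wave_potential p a B s"
    by (rule linear_conv_bounded_linear[THEN iffD1, OF linear_wave_potential])
  fix y
  have "((\<lambda>y. (\<eta> y, g y)) has_derivative (\<lambda>h. (g y \<bullet> h, G y h))) (at y)"
    using C2 by (auto simp: C2_fun_def intro!: has_derivative_Pair)
  then show "((\<lambda>y. wave_potential p a B s (\<eta> y, g y)) has_derivative (\<lambda>h. wave_potential p a B s (g y \<bullet> h, G y h))) (at y)"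
    by (rule W.has_derivative)
next
  interpret W: bounded_linear "wave_potential p a B s"
    by (rule linear_conv_bounded_linear[THEN iffD1, OF linear_wave_potential])
  fix h
  have "continuous_on UNIV (\<lambda>y. G y h)" using C2 by (auto simp: C2_fun_def)
  then show "continuous_on UNIV (\<lambda>y. wave_potential p a B s (g y \<bullet> h, G y h))"
    by (intro W.continuous_on continuous_intros C2_fun_continuous(2)[OF C2])
next
  fix y
  have sym: "G y h \<bullet> k = h \<bullet> G y k" for h k using C2 by (auto simp: C2_fun_def)
  have comp: "fst (G y (axis j 1, 0)) \<bullet> w = fst (G y (w, 0)) $ j" for j and w :: "real ^ 'n"
    using sym[of "(axis j 1, 0)" "(w, 0)"] by (simp add: inner_prod_def inner_axis inner_axis')
  have BG: "(\<Sum>j\<in>UNIV. (\<Sum>l\<in>UNIV. B $ i $ l * fst (G y (axis j 1, 0)) $ l) * a $ j) =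
      (\<Sum>l\<in>UNIV. (a \<bullet> fst (G y (axis l 1, 0))) * B $ i $ l)" for i
  proof -
    have "fst (G y (axis j 1, 0)) $ l = fst (G y (axis l 1, 0)) $ j" for j l
      using comp[of j "axis l 1"] by (simp add: inner_axis)
    then have "(\<Sum>j\<in>UNIV. (\<Sum>l\<in>UNIV. B $ i $ l * fst (G y (axis j 1, 0)) $ l) * a $ j) =
      (\<Sum>j\<in>UNIV. \<Sum>l\<in>UNIV. a $ j * (B $ i $ l * fst (G y (axis l 1, 0)) $ j))"
      unfolding sum_distrib_right by (intro sum.cong refl) (simp add: mult_ac)
    also have "\<dots> = (\<Sum>l\<in>UNIV. \<Sum>j\<in>UNIV. a $ j * (B $ i $ l * fst (G y (axis l 1, 0)) $ j))"
      by (rule sum.swap)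
    also have "\<dots> = (\<Sum>l\<in>UNIV. (a \<bullet> fst (G y (axis l 1, 0))) * B $ i $ l)"
      unfolding inner_vec_def sum_distrib_right by (intro sum.cong refl) (simp add: mult_ac)
    finally show ?thesis .
  qed
  have pa: "(\<Sum>j\<in>UNIV. (g y \<bullet> (axis j 1, 0)) * (p $ i * a $ j)) = (a \<bullet> fst (g y)) * p $ i" for i
  proof -
    have "g y \<bullet> (axis j 1, 0) = fst (g y) $ j" for j by (simp add: inner_prod_def inner_axis)
    then show ?thesis unfolding inner_vec_def sum_distrib_right by (intro sum.cong) (simp_all add: mult_ac)
  qed
  show "fst (wave_potential p a B s (\<eta> y, g y)) = divx (\<lambda>h. snd (wave_potential p a B s (g y \<bullet> h, G y h)))"
  proof (subst vec_eq_iff, rule allI)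
    fix i
    have "divx (\<lambda>h. snd (wave_potential p a B s (g y \<bullet> h, G y h))) $ i =
      (\<Sum>j\<in>UNIV. (1 / (a \<bullet> a)) * ((g y \<bullet> (axis j 1, 0)) * (p $ i * a $ j) + (1 / s) *
        ((a \<bullet> fst (G y (axis j 1, 0))) * B $ i $ j - (\<Sum>l\<in>UNIV. B $ i $ l * fst (G y (axis j 1, 0)) $ l) * a $ j)))"
      by (simp add: divx_def wave_potential_def outerp_def matrix_vector_mult_def)
    also have "\<dots> = (1 / (a \<bullet> a)) * ((a \<bullet> fst (g y)) * p $ i)"
      by (simp only: sum_distrib_left[symmetric] sum.distrib sum_subtractf BG pa) simp
    finally show "fst (wave_potential p a B s (\<eta> y, g y)) $ i = divx (\<lambda>h. snd (wave_potential p a B s (g y \<bullet> h, G y h))) $ i"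
      by (simp add: wave_potential_def)
  qed
qed

section \<open>Volumes of periodic strips in a ball\<close>

lemma frac_eq_add:
  fixes x d :: real
  assumes "0 \<le> frac x + d" "frac x + d < 1"
  shows "frac (x + d) = frac x + d"
proof -
  have "\<lfloor>x + d\<rfloor> = \<lfloor>x\<rfloor>" using assms unfolding frac_def by linarith
  then show ?thesis by (simp add: frac_def)
qed

lemma strip_sets:
  fixes e c :: "'a::euclidean_space"
  shows "{y \<in> ball c r. frac (k * (e \<bullet> y)) \<in> {a..b}} \<in> sets lebesgue"
proof -
  have "{y. frac (k * (e \<bullet> y)) \<in> {a..b}} \<in> sets borel" unfolding frac_def by measurable
  then have "ball c r \<inter> {y. frac (k * (e \<bullet> y)) \<in> {a..b}} \<in> sets borel" by (intro sets.Int) auto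
  also have "ball c r \<inter> {y. frac (k * (e \<bullet> y)) \<in> {a..b}} = {y \<in> ball c r. frac (k * (e \<bullet> y)) \<in> {a..b}}" by auto
  finally show ?thesis by (simp add: sets_completionI_sets)
qed

text \<open>Translating by less than one period permutes the strips, up to a boundary layer of the ball.\<close>
lemma strip_measure:
  fixes e c :: "'a::euclidean_space"
  assumes e: "e \<noteq> 0" and r: "r > 0" and ab: "0 \<le> a" "a \<le> b" "b \<le> 1" and eps: "\<epsilon> > 0"
  shows "\<forall>\<^sub>F k in at_top. measure lebesgue {y \<in> ball c r. frac (k * (e \<bullet> y)) \<in> {a..b}}
     \<ge> (b - a) * measure lebesgue (ball c r) - \<epsilon>"
proof -
  let ?m = "measure lebesgue"
  define V where "V = ?m (ball c r)"
  have V: "V \<ge> 0" by (simp add: V_def)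
  \<comment> \<open>A period is cut into \<open>M\<close> equal strips. At most about two of them
    are lost at the end points of [a, b], and 2V/M pays for these.\<close>
  obtain M :: nat where M: "M > 0" "2 * V / M < \<epsilon> / 2"
  proof -
    obtain M :: nat where "4 * V / \<epsilon> + 1 < real M" using reals_Archimedean2 by blast
    moreover have "4 * V / \<epsilon> \<ge> 0" using V eps by simp
    ultimately have "real M > 0" "4 * V / \<epsilon> < real M" by linarith+
    then have "M > 0" "2 * V / M < \<epsilon> / 2" using eps by (auto simp: field_simps)
    then show thesis by (rule that)
  qed
  \<comment> \<open>Volume of the boundary layer whose width 1/(k |e|) bounds every translation used
    below.\<close>
  define D where "D k = V - ?m (ball c (r - 1 / (k * norm e)))" for k
  have lim0: "((\<lambda>k. 1 / (k * norm e)) \<longlongrightarrow> 0) at_top"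
    using e by (intro tendsto_divide_0[OF tendsto_const] filterlim_at_top_imp_at_infinity
      filterlim_at_top_mult_tendsto_pos[OF tendsto_const] filterlim_ident) auto
  have "((\<lambda>k. unit_ball_vol (real DIM('a)) * (r - 1 / (k * norm e)) ^ DIM('a)) \<longlongrightarrow>
      unit_ball_vol (real DIM('a)) * (r - 0) ^ DIM('a)) at_top"
    by (intro tendsto_intros lim0)
  moreover have "\<forall>\<^sub>F k in at_top. r - 1 / (k * norm e) > 0"
  proof -
    have "((\<lambda>k. r - 1 / (k * norm e)) \<longlongrightarrow> r - 0) at_top" by (intro tendsto_intros lim0)
    then show ?thesis using r by (intro order_tendstoD) auto
  qed
  ultimately have "(D \<longlongrightarrow> V - unit_ball_vol (real DIM('a)) * (r - 0) ^ DIM('a)) at_top"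
    unfolding D_def
    by (intro tendsto_diff tendsto_const, elim Lim_transform_eventually)
       (auto elim!: eventually_mono simp: content_ball)
  then have "(D \<longlongrightarrow> 0) at_top" using r by (simp add: V_def content_ball)
  then have "\<forall>\<^sub>F k in at_top. D k < \<epsilon> / 2 / M" using M eps by (intro order_tendstoD) auto
  moreover have "\<forall>\<^sub>F k::real in at_top. k > 0" by (rule eventually_gt_at_top)
  ultimately show ?thesis
  proof eventually_elim
    fix k :: real assume Dk: "D k < \<epsilon> / 2 / M" and k: "k > 0"
    define I where "I j = {y \<in> ball c r. frac (k * (e \<bullet> y)) \<in> {real j / M..<(real j + 1) / M}}" for j :: nat
    have fr: "(\<lambda>y. frac (k * (e \<bullet> y))) \<in> borel_measurable borel"
      unfolding frac_def by measurable
    have frb: "{y \<in> ball c r. frac (k * (e \<bullet> y)) \<in> A} \<in> sets borel" if "A \<in> sets borel" for A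
    proof -
      have "{y \<in> ball c r. frac (k * (e \<bullet> y)) \<in> A} = ball c r \<inter> ((\<lambda>y. frac (k * (e \<bullet> y))) -` A \<inter> space borel)"
        by auto
      also have "\<dots> \<in> sets borel" using measurable_sets[OF fr that] by (intro sets.Int) auto
      finally show ?thesis .
    qed
    have Ib: "I j \<in> sets borel" for j unfolding I_def by (intro frb) simp
    have Im: "I j \<in> lmeasurable" for j
      by (rule bounded_set_imp_lmeasurable) (use Ib in \<open>auto simp: I_def intro: bounded_subset[OF bounded_ball[of c r]]\<close>)
    have Icov: "(\<Union>j<M. I j) = ball c r"
    proof
      show "ball c r \<subseteq> (\<Union>j<M. I j)"
      proof
        fix y assume y: "y \<in> ball c r"
        define x where "x = frac (k * (e \<bullet> y))"
        have x: "0 \<le> x" "x < 1" by (auto simp: x_def frac_lt_1)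
        define j where "j = nat \<lfloor>x * M\<rfloor>"
        have j: "real j = of_int \<lfloor>x * M\<rfloor>" using x M by (simp add: j_def)
        have 1: "real j \<le> x * M" "x * M < real j + 1" unfolding j by linarith+
        have "x * M < M" using x M by simp
        then have "j < M" using 1 by linarith
        moreover have "y \<in> I j" using 1 y M by (simp add: I_def x_def[symmetric] field_simps)
        ultimately show "y \<in> (\<Union>j<M. I j)" by blast
      qed
    qed (auto simp: I_def)
    have Idisj: "I i \<inter> I j = {}" if "i \<noteq> j" for i j
    proof -
      have "i = j" if "real i / M \<le> x" "x < (real i + 1) / M" "real j / M \<le> x" "x < (real j + 1) / M" for x
      proof -
        have "real i \<le> x * M" "x * M < real i + 1" "real j \<le> x * M" "x * M < real j + 1"
          using that M by (auto simp: field_simps)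
        then show ?thesis by linarith
      qed
      with that show ?thesis unfolding I_def by fastforce
    qed
    have shift: "?m (I j) \<ge> ?m (I i) - D k" if i: "i < M" and j: "j < M" for i j
    proof -
      \<comment> \<open>Moving by \<open>h\<close> along \<open>e\<close> changes the phase by
        \<open>d\<close> and carries strip \<open>i\<close> into strip \<open>j\<close>, as long as
        the point stays in the ball.\<close>
      define d where "d = (real j - real i) / M"
      define h where "h = (d / (k * (e \<bullet> e))) *\<^sub>R e"
      have ee: "e \<bullet> e = norm e * norm e" by (simp add: power2_norm_eq_inner[symmetric] power2_eq_square)
      have keh: "k * (e \<bullet> (y + h)) = k * (e \<bullet> y) + d" for y
        using k e by (simp add: h_def inner_add_right algebra_simps)
      have "\<bar>real j - real i\<bar> \<le> M" using i j by linarith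
      then have "\<bar>d\<bar> \<le> 1" using M by (simp add: d_def field_simps)
      have "norm h = \<bar>d\<bar> / (k * norm e)" using k e by (simp add: h_def ee abs_mult)
      with \<open>\<bar>d\<bar> \<le> 1\<close> have nh: "norm h \<le> 1 / (k * norm e)" using k e by (simp add: divide_right_mono)
      let ?S = "I i \<inter> ball c (r - 1 / (k * norm e))"
      have "(\<lambda>y. h + y) ` ?S \<subseteq> I j"
      proof
        fix z assume "z \<in> (\<lambda>y. h + y) ` ?S"
        then obtain y where y: "y \<in> I i" "dist c y < r - 1 / (k * norm e)" and z: "z = y + h"
          by (auto simp: add.commute)
        have "dist c z \<le> dist c y + norm h" unfolding z by (metis add.commute add_diff_cancel_left' dist_norm dist_triangle norm_minus_commute)
        with y nh have "z \<in> ball c r" by simp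
        moreover have "frac (k * (e \<bullet> z)) = frac (k * (e \<bullet> y)) + d"
        proof -
          have "real i / M \<le> frac (k * (e \<bullet> y))" "frac (k * (e \<bullet> y)) < (real i + 1) / M" using y by (auto simp: I_def)
          then have 1: "real j / M \<le> frac (k * (e \<bullet> y)) + d" "frac (k * (e \<bullet> y)) + d < (real j + 1) / M"
            by (auto simp: d_def diff_divide_distrib add_divide_distrib)
          moreover have "(real j + 1) / M \<le> 1" using j M by (simp add: field_simps)
          moreover have "0 \<le> real j / M" by simp
          ultimately have "0 \<le> frac (k * (e \<bullet> y)) + d" "frac (k * (e \<bullet> y)) + d < 1" by linarith+
          then show ?thesis unfolding z keh by (rule frac_eq_add)
        qed
        moreover have "frac (k * (e \<bullet> y)) + d \<in> {real j / M..<(real j + 1) / M}"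
          using y by (auto simp: I_def d_def diff_divide_distrib add_divide_distrib)
        ultimately show "z \<in> I j" by (simp add: I_def)
      qed
      then have "?m ((\<lambda>y. h + y) ` ?S) \<le> ?m (I j)"
        by (intro measure_mono_fmeasurable Im)
           (use Im in \<open>auto intro!: fmeasurableD measurable_translation fmeasurable.Int\<close>)
      then have 1: "?m ?S \<le> ?m (I j)" by (simp add: measure_translation)
      have "?m (I i) \<le> ?m (?S \<union> (ball c r - ball c (r - 1 / (k * norm e))))"
        by (intro measure_mono_fmeasurable) (use Im in \<open>auto simp: I_def intro!: fmeasurable.Un fmeasurable.Int fmeasurable_Diff\<close>)
      also have "\<dots> \<le> ?m ?S + ?m (ball c r - ball c (r - 1 / (k * norm e)))"
        by (intro measure_Un_le) (use Im in \<open>auto intro!: fmeasurable.Int fmeasurable_Diff\<close>)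
      also have "?m (ball c r - ball c (r - 1 / (k * norm e))) = D k"
        unfolding D_def V_def by (intro measurable_measure_Diff subset_ball) (use k e in auto)
      finally show ?thesis using 1 by simp
    qed
    have sumI: "(\<Sum>i<M. ?m (I i)) = V"
    proof -
      have "?m (\<Union>i\<in>{..<M}. I i) = (\<Sum>i<M. ?m (I i))"
        by (rule measure_UNION_AE[of "{..<M}" I lebesgue, simplified]) (use Idisj Im in \<open>auto simp: disjoint_family_on_def pairwise_def\<close>)
      then show ?thesis by (simp add: Icov V_def)
    qed
    \<comment> \<open>Averaging: the volumes of the \<open>M\<close> strips sum to \<open>V\<close>
      and differ pairwise by at most \<open>D k\<close>.\<close>
    have low: "V / M - D k \<le> ?m (I j)" if "j < M" for j
    proof -
      have "V - M * D k = (\<Sum>i<M. ?m (I i) - D k)" by (simp add: sum_subtractf sumI)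
      also have "\<dots> \<le> (\<Sum>i<M. ?m (I j))" by (rule sum_mono) (use shift that in auto)
      also have "\<dots> = M * ?m (I j)" by simp
      finally show ?thesis using M by (simp add: field_simps)
    qed
    \<comment> \<open>Indices of the strips that lie entirely in [a, b].\<close>
    define J where "J = {nat \<lceil>a * M\<rceil>..<nat \<lfloor>b * M\<rfloor>}"
    have bM: "b * M \<le> M" using ab M by (simp add: mult_left_le_one_le)
    have fl: "\<lfloor>b * M\<rfloor> \<le> int M" using bM by linarith
    have J1: "real (card J) \<ge> (b - a) * M - 2"
    proof -
      have "real (card J) \<ge> of_int \<lfloor>b * M\<rfloor> - of_int \<lceil>a * M\<rceil>"
      proof -
        have "0 \<le> a * M" "0 \<le> b * M" using ab M by auto
        then have "0 \<le> \<lfloor>b * M\<rfloor>" "0 \<le> \<lceil>a * M\<rceil>" by (simp, linarith)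
        then have "real (nat \<lfloor>b * M\<rfloor>) = of_int \<lfloor>b * M\<rfloor>" "real (nat \<lceil>a * M\<rceil>) = of_int \<lceil>a * M\<rceil>" by auto
        moreover have "real (card J) \<ge> real (nat \<lfloor>b * M\<rfloor>) - real (nat \<lceil>a * M\<rceil>)" by (simp add: J_def)
        ultimately show ?thesis by simp
      qed
      then show ?thesis by (simp add: algebra_simps) linarith
    qed
    have JM: "J \<subseteq> {..<M}" using fl by (auto simp: J_def)
    have J2: "I j \<subseteq> {y \<in> ball c r. frac (k * (e \<bullet> y)) \<in> {a..b}}" if "j \<in> J" for j
    proof -
      have "nat \<lceil>a * M\<rceil> \<le> j" "j < nat \<lfloor>b * M\<rfloor>" using that by (auto simp: J_def)
      then have "a * M \<le> real j" "real j + 1 \<le> b * M" by linarith+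
      then have "a \<le> real j / M" "(real j + 1) / M \<le> b" using M by (auto simp: field_simps)
      then show ?thesis by (auto simp: I_def)
    qed
    have "(b - a) * V - \<epsilon> \<le> card J * (V / M - D k)"
    proof (cases "V / M - D k \<ge> 0")
      case True
      have "ball c (r - 1 / (k * norm e)) \<subseteq> ball c r" using k e by (intro subset_ball) simp
      then have "D k \<ge> 0" using measure_mono_fmeasurable[of "ball c (r - 1 / (k * norm e))" "ball c r" lebesgue]
        by (auto simp: D_def V_def)
      have "(b - a) * V - \<epsilon> \<le> (b - a) * V - 2 * V / M - M * D k"
      proof -
        have "M * D k < \<epsilon> / 2" using M Dk by (simp add: field_simps)
        with M(2) show ?thesis by linarith
      qed
      also have "\<dots> \<le> ((b - a) * M - 2) * (V / M - D k)"
      proof -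
        have "(b - a) * M * D k \<le> M * D k" using ab \<open>D k \<ge> 0\<close> by (intro mult_right_mono mult_left_le_one_le) auto
        moreover have "((b - a) * M - 2) * (V / M - D k) = (b - a) * V - 2 * V / M - (b - a) * M * D k + 2 * D k"
          using M(1) by (simp add: field_simps)
        ultimately show ?thesis using \<open>D k \<ge> 0\<close> by linarith
      qed
      also have "\<dots> \<le> card J * (V / M - D k)" using J1 True by (rule mult_right_mono)
      finally show ?thesis .
    next
      case False
      then have "V < M * D k" using M by (simp add: field_simps)
      also have "\<dots> < \<epsilon> / 2" using Dk M by (simp add: field_simps)
      finally have "V < \<epsilon> / 2" .
      have "(b - a) * V \<le> 1 * V" using ab V by (intro mult_right_mono) auto
      have "card J \<le> M" using card_mono[OF _ JM] by simp
      then have "real (card J) * (V / M - D k) \<ge> M * (V / M - D k)" using False by (intro mult_right_mono_neg) auto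
      moreover have "M * (V / M - D k) = V - M * D k" using M by (simp add: field_simps)
      ultimately show ?thesis using \<open>(b - a) * V \<le> 1 * V\<close> \<open>M * D k < \<epsilon> / 2\<close> V eps by linarith
    qed
    also have "\<dots> \<le> (\<Sum>j\<in>J. ?m (I j))"
      using sum_mono[of J "\<lambda>_. V / M - D k" "\<lambda>j. ?m (I j)"] low JM by auto
    also have "\<dots> = ?m (\<Union>j\<in>J. I j)"
      by (rule measure_UNION_AE[of J I lebesgue, simplified, symmetric])
         (use Idisj Im in \<open>auto simp: J_def disjoint_family_on_def pairwise_def\<close>)
    also have "\<dots> \<le> ?m {y \<in> ball c r. frac (k * (e \<bullet> y)) \<in> {a..b}}"
    proof (rule measure_mono_fmeasurable)
      show "(\<Union>j\<in>J. I j) \<subseteq> {y \<in> ball c r. frac (k * (e \<bullet> y)) \<in> {a..b}}" using J2 by blast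
      show "(\<Union>j\<in>J. I j) \<in> sets lebesgue" using Im by (intro sets.finite_UN) (auto simp: J_def)
      have "{y \<in> ball c r. frac (k * (e \<bullet> y)) \<in> {a..b}} \<in> sets borel" by (intro frb) simp
      then show "{y \<in> ball c r. frac (k * (e \<bullet> y)) \<in> {a..b}} \<in> lmeasurable"
        by (intro bounded_set_imp_lmeasurable) (auto intro: bounded_subset[OF bounded_ball[of c r]])
    qed
    finally show "(b - a) * measure lebesgue (ball c r) - \<epsilon> \<le> ?m {y \<in> ball c r. frac (k * (e \<bullet> y)) \<in> {a..b}}"
      by (simp add: V_def)
  qed
qed

section \<open>High-frequency waves with prescribed jets\<close>

text \<open>The jet of a wave potential as a linear function of the gradient and of the Hessian in
  the directions (a, 0) and (0, 1). By linearity, errors in these three vectors bound the error of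
  the jet.\<close>

definition wave_jet :: "real ^ 'm \<Rightarrow> real ^ 'n \<Rightarrow> real ^ 'n ^ 'm \<Rightarrow> real \<Rightarrow>
    ((real ^ 'n) \<times> real) \<times> ((real ^ 'n) \<times> real) \<times> ((real ^ 'n) \<times> real) \<Rightarrow> ('n::finite, 'm::finite) pt" where
  "wave_jet p a B s x = (1 / (a \<bullet> a)) *\<^sub>R
     (outerp p (fst (fst (snd x))),
      snd (fst x) *\<^sub>R outerp p a
      + (1 / s) *\<^sub>R ((a \<bullet> fst (snd (snd x))) *\<^sub>R B - outerp (B *v fst (snd (snd x))) a))"

lemma linear_wave_jet: "linear (wave_jet p a B s)"
  by (rule linearI)
     (auto simp: wave_jet_def outerp_def prod_eq_iff vec_eq_iff inner_add_right algebra_simps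
       matrix_vector_right_distrib matrix_vector_mult_scaleR)

lemma jet_wave_potential:
  fixes a :: "real ^ 'n" and p :: "real ^ 'm"
  assumes C2: "C2_fun \<eta> g G"
  shows "jet (\<lambda>h. wave_potential p a B s (g y \<bullet> h, G y h)) = wave_jet p a B s (g y, G y (a, 0), G y (0, 1))"
proof -
  have "fst (G y (axis j 1, 0)) \<bullet> a = fst (G y (a, 0)) $ j" for j
  proof -
    have "G y (axis j 1, 0) \<bullet> (a, 0) = (axis j 1, 0) \<bullet> G y (a, 0)" using C2 by (auto simp: C2_fun_def)
    then show ?thesis by (simp add: inner_prod_def inner_axis inner_axis')
  qed
  then show ?thesis
    by (simp add: jet_def Dx_def Dt_def wave_potential_def wave_jet_def outerp_def vec_eq_iff inner_prod_def inner_commute)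
qed

text \<open>The ideal wave: negligible gradient and Hessian w e \<otimes> e with e = (a, s). The
  term \<open>B *v a\<close> drops out by the cone condition, and the factor \<open>s\<close> of the
  time direction cancels \<open>1 / s\<close>.\<close>

lemma wave_jet_rank_one:
  fixes a :: "real ^ 'n"
  assumes "a \<noteq> 0" "B *v a = 0" "s \<noteq> 0"
  shows "wave_jet p a B s (0, (w * (a \<bullet> a)) *\<^sub>R (a, s), (w * s) *\<^sub>R (a, s)) = w *\<^sub>R (outerp p a, B)"
  using assms by (auto simp: wave_jet_def outerp_def prod_eq_iff vec_eq_iff matrix_vector_mult_scaleR)

lemma continuous_compact_support_bounded:
  fixes f :: "'a::topological_space \<Rightarrow> 'b::real_normed_vector"
  assumes "continuous_on UNIV f" "compact C" "\<And>y. y \<notin> C \<Longrightarrow> f y = 0"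
  shows "\<exists>B>0. \<forall>y. norm (f y) \<le> B"
proof -
  have "compact (f ` C)" using assms by (intro compact_continuous_image) (auto intro: continuous_on_subset)
  then obtain B where B: "B > 0" "\<forall>z\<in>f ` C. norm z \<le> B" using compact_imp_bounded bounded_pos by blast
  have "norm (f y) \<le> B" for y using B assms(3)[of y] by (cases "y \<in> C") auto
  then show ?thesis using B by blast
qed

text \<open>In the Hessian of cut-off times plane wave, only the term with both derivatives on the
  wave is of order one; each derivative that falls on the cut-off costs a factor 1/k.
  \<open>K\<close> collects these errors. The time derivative of the first component has the leading
  size s |p|, which is small if the wave vector points almost entirely into space.\<close>

lemma modulated_wave:
  fixes a :: "real ^ 'n" and p :: "real ^ 'm" and c :: "(real ^ 'n) \<times> real"
  assumes a: "a \<noteq> 0" "B *v a = 0" and s: "s > 0"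
    and Z: "C2_fun \<zeta> zg zG" "\<And>y. 0 \<le> \<zeta> y \<and> \<zeta> y \<le> 1"
       "\<And>y. y \<notin> cball c r' \<Longrightarrow> \<zeta> y = 0 \<and> zg y = 0 \<and> (\<forall>h. zG y h = 0)" and r: "r' < r"
    and f: "continuous_on UNIV f" "\<And>x. (h has_real_derivative f x) (at x)" "\<And>x. (H has_real_derivative h x) (at x)"
       "\<And>x. \<bar>h x\<bar> \<le> b" "\<And>x. \<bar>H x\<bar> \<le> b" "\<And>x. \<bar>f x\<bar> \<le> 1"
  shows "\<exists>K>0. \<forall>k\<ge>1. \<exists>u U. pert (ball c r) u U \<and> small (s * norm p + K / k) u U \<and>
     (\<forall>y. dist (jet (U y)) ((\<zeta> y * f (k * ((a, s) \<bullet> y))) *\<^sub>R (outerp p a, B)) \<le> K / k)"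
proof -
  define e where "e = (a, s)"
  have ea: "e \<bullet> (a, 0) = a \<bullet> a" and es: "e \<bullet> (0, 1) = s" by (simp_all add: e_def inner_prod_def)
  have aa: "a \<bullet> a > 0" using a by simp
  have b: "b \<ge> 0" using f(4)[of 0] abs_ge_zero order_trans by blast
  have zc: "continuous_on UNIV \<zeta>" "continuous_on UNIV zg" "\<And>v. continuous_on UNIV (\<lambda>y. zG y v)"
    using C2_fun_continuous[OF Z(1)] Z(1) by (auto simp: C2_fun_def)
  obtain Z0 where Z0: "Z0 > 0" "\<forall>y. norm (zg y) \<le> Z0"
    using continuous_compact_support_bounded[OF zc(2) compact_cball] Z(3) by blast
  obtain Z1 where Z1: "Z1 > 0" "\<forall>y. norm (zG y (a, 0)) \<le> Z1"
    using continuous_compact_support_bounded[OF zc(3) compact_cball] Z(3) by blast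
  obtain Z2 where Z2: "Z2 > 0" "\<forall>y. norm (zG y (0, 1)) \<le> Z2"
    using continuous_compact_support_bounded[OF zc(3) compact_cball] Z(3) by blast
  obtain K1 where K1: "K1 > 0" "\<And>x. norm (wave_potential p a B s x) \<le> norm x * K1"
    using bounded_linear.pos_bounded[OF linear_conv_bounded_linear[THEN iffD1, OF linear_wave_potential, of p a B s]] by blast
  obtain K2 where K2: "K2 > 0" "\<And>x. norm (wave_jet p a B s x) \<le> norm x * K2"
    using bounded_linear.pos_bounded[OF linear_conv_bounded_linear[THEN iffD1, OF linear_wave_jet, of p a B s]] by blast
  define g0 where "g0 = b * norm e + b * Z0"
  define err where "err v Zv = b * (2 * Z0 * norm v * norm e + Zv)" for v :: "(real ^ 'n) \<times> real" and Zv :: real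
  define K where "K = K1 * (b + g0) + K2 * (g0 + (err (a, 0) Z1 + err (0, 1) Z2))
      + (1 / (a \<bullet> a)) * (norm a * err (0, 1) Z2 * norm p) + 1"
  have nn: "g0 \<ge> 0" "err (a, 0) Z1 \<ge> 0" "err (0, 1) Z2 \<ge> 0"
    using b Z0 Z1 Z2 by (auto simp: g0_def err_def)
  show ?thesis
  proof (intro exI[of _ K] conjI allI impI)
    show "K > 0" using nn K1 K2 b aa unfolding K_def
      by (intro add_nonneg_pos add_nonneg_nonneg mult_nonneg_nonneg) auto
    fix k :: real assume k: "k \<ge> 1"
    define \<eta> where "\<eta> y = \<zeta> y * (H (k * (e \<bullet> y)) / k\<^sup>2)" for y
    define g where "g y = \<zeta> y *\<^sub>R ((h (k * (e \<bullet> y)) / k) *\<^sub>R e) + (H (k * (e \<bullet> y)) / k\<^sup>2) *\<^sub>R zg y" for y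
    define G where "G y v = \<zeta> y *\<^sub>R ((f (k * (e \<bullet> y)) * (e \<bullet> v)) *\<^sub>R e) + (zg y \<bullet> v) *\<^sub>R ((h (k * (e \<bullet> y)) / k) *\<^sub>R e)
       + ((H (k * (e \<bullet> y)) / k\<^sup>2) *\<^sub>R zG y v + (((h (k * (e \<bullet> y)) / k) *\<^sub>R e) \<bullet> v) *\<^sub>R zg y)" for y v
    have C2: "C2_fun \<eta> g G"
      unfolding \<eta>_def[abs_def] g_def[abs_def] G_def[abs_def]
      by (rule C2_fun_mult[OF Z(1) C2_fun_plane_wave]) (use f k in auto)
    define u where "u y = wave_potential p a B s (\<eta> y, g y)" for y
    define U where "U y v = wave_potential p a B s (g y \<bullet> v, G y v)" for y v
    have k2: "1 / k\<^sup>2 \<le> 1 / k" using k by (simp add: divide_simps power2_eq_square)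
    have Hk: "\<bar>H x / k\<^sup>2\<bar> \<le> b / k" for x
    proof -
      have "\<bar>H x / k\<^sup>2\<bar> = \<bar>H x\<bar> * (1 / k\<^sup>2)" by simp
      also have "\<dots> \<le> b * (1 / k)" by (rule mult_mono) (use f(5) k2 b k in auto)
      finally show ?thesis by simp
    qed
    have hk: "\<bar>h x / k\<bar> \<le> b / k" for x using f(4)[of x] k by (simp add: divide_right_mono)
    have bk: "b / k \<ge> 0" using b k by simp
    have eta: "\<bar>\<eta> y\<bar> \<le> b / k" for y
    proof -
      have "\<bar>\<eta> y\<bar> = \<zeta> y * \<bar>H (k * (e \<bullet> y)) / k\<^sup>2\<bar>" using Z(2)[of y] by (simp add: \<eta>_def abs_mult)
      also have "\<dots> \<le> 1 * (b / k)" by (rule mult_mono) (use Z(2)[of y] Hk bk in auto)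
      finally show ?thesis by simp
    qed
    have g0: "norm (g y) \<le> g0 / k" for y
    proof -
      have "norm (g y) \<le> \<bar>\<zeta> y\<bar> * (\<bar>h (k * (e \<bullet> y)) / k\<bar> * norm e) + \<bar>H (k * (e \<bullet> y)) / k\<^sup>2\<bar> * norm (zg y)"
        unfolding g_def by (rule order_trans[OF norm_triangle_ineq]) (simp only: norm_scaleR order_refl)
      also have "\<dots> \<le> 1 * ((b / k) * norm e) + (b / k) * Z0"
        by (intro add_mono mult_mono) (use Z(2)[of y] Hk hk bk Z0 in auto)
      also have "\<dots> = g0 / k" by (simp add: g0_def add_divide_distrib)
      finally show ?thesis .
    qed
    have errb: "norm (G y v - (\<zeta> y * f (k * (e \<bullet> y)) * (e \<bullet> v)) *\<^sub>R e) \<le> err v Zv / k"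
      if "norm (zG y v) \<le> Zv" for y v Zv
    proof -
      have "norm (G y v - (\<zeta> y * f (k * (e \<bullet> y)) * (e \<bullet> v)) *\<^sub>R e)
        = norm (((zg y \<bullet> v) * (h (k * (e \<bullet> y)) / k)) *\<^sub>R e + ((H (k * (e \<bullet> y)) / k\<^sup>2) *\<^sub>R zG y v + ((h (k * (e \<bullet> y)) / k) * (e \<bullet> v)) *\<^sub>R zg y))"
        by (simp add: G_def algebra_simps inner_scaleR_left)
      also have "\<dots> \<le> \<bar>zg y \<bullet> v\<bar> * \<bar>h (k * (e \<bullet> y)) / k\<bar> * norm e + (\<bar>H (k * (e \<bullet> y)) / k\<^sup>2\<bar> * norm (zG y v)
           + \<bar>h (k * (e \<bullet> y)) / k\<bar> * \<bar>e \<bullet> v\<bar> * norm (zg y))"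
        by (intro order_trans[OF norm_triangle_ineq] add_mono) (simp_all only: norm_scaleR abs_mult order_refl)
      also have "\<dots> \<le> (Z0 * norm v) * (b / k) * norm e + ((b / k) * Zv + (b / k) * (norm e * norm v) * Z0)"
      proof (intro add_mono mult_mono)
        show "\<bar>zg y \<bullet> v\<bar> \<le> Z0 * norm v"
          by (rule order_trans[OF Cauchy_Schwarz_ineq2]) (use Z0 in \<open>auto intro: mult_right_mono\<close>)
        show "0 \<le> Z0 * norm v * (b / k)" using Z0 bk by (intro mult_nonneg_nonneg) auto
        show "0 \<le> b / k * (norm e * norm v)" using bk by (intro mult_nonneg_nonneg) auto
      qed (use that Z0 bk Hk hk Cauchy_Schwarz_ineq2[of e v] in auto)
      also have "\<dots> = err v Zv / k" using k by (simp add: err_def field_simps)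
      finally show ?thesis .
    qed
    have e1: "norm (G y (a, 0) - (\<zeta> y * f (k * (e \<bullet> y)) * (a \<bullet> a)) *\<^sub>R e) \<le> err (a, 0) Z1 / k" for y
      using errb[of y "(a, 0)" Z1] Z1(2) ea by metis
    have e2: "norm (G y (0, 1) - (\<zeta> y * f (k * (e \<bullet> y)) * s) *\<^sub>R e) \<le> err (0, 1) Z2 / k" for y
      using errb[of y "(0, 1)" Z2] Z2(2) es by metis
    have out: "\<eta> y = 0 \<and> g y = 0 \<and> (\<forall>v. G y v = 0)" if "y \<notin> cball c r'" for y
      using Z(3)[OF that] by (simp add: \<eta>_def g_def G_def)
    have wp0: "wave_potential p a B s 0 = 0" by (rule linear_0[OF linear_wave_potential])
    have "pert (ball c r) u U"
      unfolding pert_def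
    proof
      show "div_pair u U" unfolding u_def[abs_def] U_def[abs_def] by (rule div_pair_wave_potential[OF C2 a(1)])
      show "\<exists>C. compact C \<and> C \<subseteq> ball c r \<and> (\<forall>y. y \<notin> C \<longrightarrow> u y = 0 \<and> (\<forall>h. U y h = 0))"
      proof (intro exI[of _ "cball c r'"] conjI allI impI)
        show "u y = 0" "U y v = 0" if "y \<notin> cball c r'" for y v
          using out[OF that] wp0 by (simp_all add: u_def U_def flip: zero_prod_def)
      qed (use r in auto)
    qed
    moreover have "small (s * norm p + K / k) u U"
      unfolding small_def
    proof (intro allI conjI)
      fix y
      have "norm (u y) \<le> norm (\<eta> y, g y) * K1" unfolding u_def by (rule K1)
      also have "\<dots> \<le> (b / k + g0 / k) * K1"
        using norm_Pair_le[of "\<eta> y" "g y"] eta[of y] g0[of y] K1 by (intro mult_right_mono) auto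
      also have "\<dots> = K1 * (b + g0) / k" by (simp add: add_divide_distrib algebra_simps)
      also have "\<dots> \<le> K / k" using k nn K2 aa unfolding K_def by (intro divide_right_mono) auto
      finally show "norm (u y) \<le> s * norm p + K / k" using s by (simp add: add_increasing)
      let ?G = "G y (0, 1)" and ?w = "\<zeta> y * f (k * (e \<bullet> y))"
      have "\<bar>?w\<bar> \<le> 1 * 1" unfolding abs_mult by (rule mult_mono) (use Z(2)[of y] f(6) in auto)
      then have w: "\<bar>?w\<bar> \<le> 1" by simp
      have fG: "norm (fst ?G - (?w * s) *\<^sub>R a) \<le> err (0, 1) Z2 / k"
      proof -
        have "fst ?G - (?w * s) *\<^sub>R a = fst (?G - (?w * s) *\<^sub>R e)" by (simp add: e_def)
        also have "norm \<dots> \<le> norm (?G - (?w * s) *\<^sub>R e)" by (metis norm_fst_le prod.collapse)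
        finally show ?thesis using e2[of y] by linarith
      qed
      have "fst (U y (0, 1)) = (1 / (a \<bullet> a)) *\<^sub>R ((a \<bullet> fst ?G) *\<^sub>R p)" by (simp add: U_def wave_potential_def)
      also have "a \<bullet> fst ?G = a \<bullet> (fst ?G - (?w * s) *\<^sub>R a) + ?w * s * (a \<bullet> a)" by (simp add: inner_diff_right)
      also have "(1 / (a \<bullet> a)) *\<^sub>R (\<dots> *\<^sub>R p) = ((1 / (a \<bullet> a)) * (a \<bullet> (fst ?G - (?w * s) *\<^sub>R a))) *\<^sub>R p + (?w * s) *\<^sub>R p"
        using aa by (simp add: algebra_simps)
      finally have "norm (fst (U y (0, 1))) \<le> \<bar>(1 / (a \<bullet> a)) * (a \<bullet> (fst ?G - (?w * s) *\<^sub>R a))\<bar> * norm p + \<bar>?w * s\<bar> * norm p"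
        using norm_triangle_ineq by (metis norm_scaleR)
      also have "\<dots> \<le> (1 / (a \<bullet> a)) * (norm a * (err (0, 1) Z2 / k)) * norm p + (1 * s) * norm p"
      proof (intro add_mono mult_right_mono)
        have "\<bar>a \<bullet> (fst ?G - (?w * s) *\<^sub>R a)\<bar> \<le> norm a * (err (0, 1) Z2 / k)"
          by (rule order_trans[OF Cauchy_Schwarz_ineq2 mult_left_mono[OF fG norm_ge_zero]])
        then show "\<bar>(1 / (a \<bullet> a)) * (a \<bullet> (fst ?G - (?w * s) *\<^sub>R a))\<bar> \<le> (1 / (a \<bullet> a)) * (norm a * (err (0, 1) Z2 / k))"
          unfolding abs_mult using aa by (intro mult_mono) auto
        show "\<bar>?w * s\<bar> \<le> 1 * s" unfolding abs_mult using w s by (intro mult_mono) auto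
      qed auto
      also have "\<dots> = s * norm p + ((1 / (a \<bullet> a)) * (norm a * err (0, 1) Z2 * norm p)) / k" by (simp add: field_simps)
      also have "\<dots> \<le> s * norm p + K / k"
        using k nn K1 K2 b unfolding K_def by (intro add_left_mono divide_right_mono) auto
      finally show "norm (fst (U y (0, 1))) \<le> s * norm p + K / k" .
    qed
    moreover have "\<forall>y. dist (jet (U y)) ((\<zeta> y * f (k * (e \<bullet> y))) *\<^sub>R (outerp p a, B)) \<le> K / k"
    proof
      fix y
      let ?w = "\<zeta> y * f (k * (e \<bullet> y))"
      have "jet (U y) = wave_jet p a B s (g y, G y (a, 0), G y (0, 1))"
        unfolding U_def[abs_def] by (rule jet_wave_potential[OF C2])
      moreover have "?w *\<^sub>R (outerp p a, B) = wave_jet p a B s (0, (?w * (a \<bullet> a)) *\<^sub>R e, (?w * s) *\<^sub>R e)"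
        unfolding e_def by (rule wave_jet_rank_one[symmetric]) (use a s in auto)
      ultimately have "jet (U y) - ?w *\<^sub>R (outerp p a, B) =
         wave_jet p a B s ((g y, G y (a, 0), G y (0, 1)) - (0, (?w * (a \<bullet> a)) *\<^sub>R e, (?w * s) *\<^sub>R e))"
        by (simp only: linear_diff[OF linear_wave_jet])
      then have "dist (jet (U y)) (?w *\<^sub>R (outerp p a, B)) \<le>
         norm (g y, G y (a, 0) - (?w * (a \<bullet> a)) *\<^sub>R e, G y (0, 1) - (?w * s) *\<^sub>R e) * K2"
        using K2(2) by (simp add: dist_norm)
      also have "\<dots> \<le> (g0 / k + (err (a, 0) Z1 / k + err (0, 1) Z2 / k)) * K2"
        by (intro mult_right_mono order_trans[OF norm_Pair_le] add_mono g0 e1 e2) (use K2 in auto)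
      also have "\<dots> = K2 * (g0 + (err (a, 0) Z1 + err (0, 1) Z2)) / k" by (simp add: add_divide_distrib algebra_simps)
      also have "\<dots> \<le> K / k" using k nn K1 b aa unfolding K_def by (intro divide_right_mono) auto
      finally show "dist (jet (U y)) (?w *\<^sub>R (outerp p a, B)) \<le> K / k" .
    qed
    ultimately show "\<exists>u U. pert (ball c r) u U \<and> small (s * norm p + K / k) u U \<and>
      (\<forall>y. dist (jet (U y)) ((\<zeta> y * f (k * ((a, s) \<bullet> y))) *\<^sub>R (outerp p a, B)) \<le> K / k)" unfolding e_def by blast
  qed
qed

text \<open>The oscillation profile takes the values \<open>1 - M\<close> and \<open>-M\<close>, with \<open>M\<close> close to \<open>\<theta>\<close>, on strips of
  relative width close to \<open>\<theta>\<close> and \<open>1 - \<theta>\<close>; a small component \<open>s\<close> of the wave vector in time keeps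
  \<open>\<partial>\<^sub>t \<phi>\<close> small.\<close>
lemma building_block:
  fixes a :: "real ^ 'n" and p :: "real ^ 'm" and c :: "(real ^ 'n) \<times> real"
  assumes a: "a \<noteq> 0" "B *v a = 0" and th: "0 < \<theta>" "\<theta> < 1" and eps: "\<epsilon> > 0" and r: "r > 0"
  shows "\<exists>f F. pert (ball c r) f F \<and> small \<epsilon> f F \<and>
     (\<forall>y. \<exists>t\<in>{-\<theta>..1-\<theta>}. dist (jet (F y)) (t *\<^sub>R (outerp p a, B)) \<le> \<epsilon>) \<and>
     measure lebesgue {y \<in> ball c r. dist (jet (F y)) ((1 - \<theta>) *\<^sub>R (outerp p a, B)) < \<epsilon>} \<ge> (\<theta> - \<epsilon>) * measure lebesgue (ball c r) \<and>
     measure lebesgue {y \<in> ball c r. dist (jet (F y)) ((- \<theta>) *\<^sub>R (outerp p a, B)) < \<epsilon>} \<ge> (1 - \<theta> - \<epsilon>) * measure lebesgue (ball c r)"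
proof -
  let ?\<gamma> = "(outerp p a, B)" and ?m = "measure lebesgue"
  define V where "V = ?m (ball c r)"
  have V: "V > 0" using r by (simp add: V_def content_ball)
  \<comment> \<open>The three bounds pay for the amplitude error times the norm of the jump, for the
    strip from \<epsilon>1 to \<theta> - \<epsilon>1 to be a genuine interval, and for the volume
    lost on the ramps.\<close>
  define \<epsilon>1 where "\<epsilon>1 = min (\<epsilon> / (8 * (norm ?\<gamma> + 1))) (min (\<theta> / 2) (\<epsilon> / 8))"
  have e1: "\<epsilon>1 > 0" "2 * \<epsilon>1 * norm ?\<gamma> \<le> \<epsilon> / 4" "\<epsilon>1 \<le> \<theta> / 2" "\<epsilon>1 \<le> \<epsilon> / 8"
  proof -
    have "norm ?\<gamma> + 1 > 0" by (simp add: add_nonneg_pos)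
    then show "\<epsilon>1 > 0" using eps th by (simp add: \<epsilon>1_def)
    have "\<epsilon>1 * norm ?\<gamma> \<le> \<epsilon> / (8 * (norm ?\<gamma> + 1)) * (norm ?\<gamma> + 1)"
      by (intro mult_mono) (use \<open>\<epsilon>1 > 0\<close> eps in \<open>auto simp: \<epsilon>1_def\<close>)
    also have "\<dots> = \<epsilon> / 8" using \<open>norm ?\<gamma> + 1 > 0\<close> by (simp add: divide_simps)
    finally show "2 * \<epsilon>1 * norm ?\<gamma> \<le> \<epsilon> / 4" by simp
    show "\<epsilon>1 \<le> \<theta> / 2" "\<epsilon>1 \<le> \<epsilon> / 8" unfolding \<epsilon>1_def by linarith+
  qed
  obtain f h H M b where P: "continuous_on UNIV f" "\<And>x. (h has_real_derivative f x) (at x)"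
    "\<And>x. (H has_real_derivative h x) (at x)" "0 \<le> M" "M \<le> 1" "\<bar>M - \<theta>\<bar> \<le> 2 * \<epsilon>1" "b > 0"
    "\<And>x. \<bar>h x\<bar> \<le> b" "\<And>x. \<bar>H x\<bar> \<le> b" "\<And>x. - M \<le> f x" "\<And>x. f x \<le> 1 - M"
    "\<And>x. frac x \<in> {\<epsilon>1..\<theta> - \<epsilon>1} \<Longrightarrow> f x = 1 - M" "\<And>x. frac x \<in> {\<theta>..1} \<Longrightarrow> f x = - M"
    using oscillating_profile[OF th e1(1)] by metis
  \<comment> \<open>By left continuity of the volume in the radius, a concentric ball of radius
    \<open>r1\<close> fills all but \<epsilon>/4 of the ball. The cut-off equals 1 on it and
    vanishes outside radius \<open>r2\<close>.\<close>
  have "((\<lambda>x. unit_ball_vol (real DIM((real ^ 'n) \<times> real)) * x ^ DIM((real ^ 'n) \<times> real)) \<longlongrightarrow>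
      unit_ball_vol (real DIM((real ^ 'n) \<times> real)) * r ^ DIM((real ^ 'n) \<times> real)) (at_left r)"
    by (intro tendsto_intros)
  then have "\<forall>\<^sub>F x in at_left r. unit_ball_vol (real DIM((real ^ 'n) \<times> real)) * x ^ DIM((real ^ 'n) \<times> real) > V - \<epsilon> / 4 * V"
    using r eps V by (intro order_tendstoD) (auto simp: V_def content_ball)
  moreover have "\<forall>\<^sub>F x in at_left r. x \<in> {0<..<r}" using r by (rule eventually_at_left_real)
  ultimately have "\<forall>\<^sub>F x in at_left r. x \<in> {0<..<r} \<and> ?m (ball c x) > V - \<epsilon> / 4 * V"
    by eventually_elim (simp add: content_ball)
  then obtain r1 where r1: "0 < r1" "r1 < r" "?m (ball c r1) > V - \<epsilon> / 4 * V"
    by (auto dest!: eventually_happens'[OF trivial_limit_at_left_real])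
  define r2 where "r2 = (r1 + r) / 2"
  have r2: "r1 < r2" "r2 < r" using r1 by (auto simp: r2_def)
  obtain \<zeta> zg zG where Z: "C2_fun \<zeta> zg zG" "\<And>y. 0 \<le> \<zeta> y \<and> \<zeta> y \<le> 1" "\<And>y. y \<in> cball c r1 \<Longrightarrow> \<zeta> y = 1"
    "\<And>y. y \<notin> cball c r2 \<Longrightarrow> \<zeta> y = 0 \<and> zg y = 0 \<and> (\<forall>h. zG y h = 0)"
    using C2_fun_ball_cutoff[of r1 r2 c] r1(1) r2(1) by (metis less_imp_le)
  define s where "s = \<epsilon> / (2 * (norm p + 1))"
  have np: "norm p + 1 > 0" by (simp add: add_nonneg_pos)
  have s: "s > 0" "s * norm p \<le> \<epsilon> / 2" using eps np by (auto simp: s_def field_simps)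
  have fb: "\<bar>f x\<bar> \<le> 1" for x using P(4,5) P(10)[of x] P(11)[of x] by auto
  have "\<exists>K>0. \<forall>k\<ge>1. \<exists>u U. pert (ball c r) u U \<and> small (s * norm p + K / k) u U \<and>
     (\<forall>y. dist (jet (U y)) ((\<zeta> y * f (k * ((a, s) \<bullet> y))) *\<^sub>R ?\<gamma>) \<le> K / k)"
    by (rule modulated_wave[OF a s(1) Z(1) Z(2) Z(4) r2(2) P(1) P(2) P(3) P(8) P(9) fb])
  then obtain K where K: "K > 0" "\<And>k. k \<ge> 1 \<Longrightarrow> \<exists>u U. pert (ball c r) u U \<and> small (s * norm p + K / k) u U \<and>
     (\<forall>y. dist (jet (U y)) ((\<zeta> y * f (k * ((a, s) \<bullet> y))) *\<^sub>R ?\<gamma>) \<le> K / k)"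
    by blast
  let ?x = "\<lambda>k y. frac (k * ((a, s) \<bullet> y))"
  have "(a, s) \<noteq> 0" using a by (simp add: zero_prod_def)
  have "\<epsilon> / 4 * V > 0" using eps V by simp
  have "\<forall>\<^sub>F k in at_top. ?m {y \<in> ball c r1. ?x k y \<in> {\<epsilon>1..\<theta> - \<epsilon>1}} \<ge> (\<theta> - \<epsilon>1 - \<epsilon>1) * ?m (ball c r1) - \<epsilon> / 4 * V"
    by (rule strip_measure) (use \<open>(a, s) \<noteq> 0\<close> \<open>\<epsilon> / 4 * V > 0\<close> r1(1) e1 th in linarith)+
  moreover have "\<forall>\<^sub>F k in at_top. ?m {y \<in> ball c r1. ?x k y \<in> {\<theta>..1}} \<ge> (1 - \<theta>) * ?m (ball c r1) - \<epsilon> / 4 * V"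
    by (rule strip_measure) (use \<open>(a, s) \<noteq> 0\<close> \<open>\<epsilon> / 4 * V > 0\<close> r1(1) th in linarith)+
  moreover have "\<forall>\<^sub>F k::real in at_top. k \<ge> max 1 (8 * K / \<epsilon>)" by (rule eventually_ge_at_top)
  ultimately have "\<forall>\<^sub>F k in at_top. ?m {y \<in> ball c r1. ?x k y \<in> {\<epsilon>1..\<theta> - \<epsilon>1}} \<ge> (\<theta> - \<epsilon>1 - \<epsilon>1) * ?m (ball c r1) - \<epsilon> / 4 * V \<and>
     ?m {y \<in> ball c r1. ?x k y \<in> {\<theta>..1}} \<ge> (1 - \<theta>) * ?m (ball c r1) - \<epsilon> / 4 * V \<and> k \<ge> max 1 (8 * K / \<epsilon>)"
    by (intro eventually_conj)
  from eventually_happens'[OF trivial_limit_at_top_linorder this] obtain k where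
    k: "?m {y \<in> ball c r1. ?x k y \<in> {\<epsilon>1..\<theta> - \<epsilon>1}} \<ge> (\<theta> - \<epsilon>1 - \<epsilon>1) * ?m (ball c r1) - \<epsilon> / 4 * V"
     "?m {y \<in> ball c r1. ?x k y \<in> {\<theta>..1}} \<ge> (1 - \<theta>) * ?m (ball c r1) - \<epsilon> / 4 * V" "k \<ge> max 1 (8 * K / \<epsilon>)"
    by (elim exE conjE)
  have k3: "k \<ge> 1" and k4: "k \<ge> 8 * K / \<epsilon>" using k(3) by simp_all
  have Kk: "K / k \<le> \<epsilon> / 8" using k3 k4 eps by (simp add: field_simps)
  obtain u U where U: "pert (ball c r) u U" "small (s * norm p + K / k) u U"
     "\<And>y. dist (jet (U y)) ((\<zeta> y * f (k * ((a, s) \<bullet> y))) *\<^sub>R ?\<gamma>) \<le> K / k"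
    using K(2)[OF k3] by blast
  have meas: "{y \<in> ball c r. dist (jet (U y)) w < \<epsilon>} \<in> lmeasurable" for w
  proof (rule bounded_set_imp_lmeasurable)
    have "open (ball c r \<inter> {y. dist (jet (U y)) w < \<epsilon>})"
      by (intro open_Int open_ball open_Collect_less continuous_intros pert_jet_continuous[OF U(1)])
    moreover have "ball c r \<inter> {y. dist (jet (U y)) w < \<epsilon>} = {y \<in> ball c r. dist (jet (U y)) w < \<epsilon>}" by auto
    ultimately show "{y \<in> ball c r. dist (jet (U y)) w < \<epsilon>} \<in> sets lebesgue" by simp
  qed (auto intro: bounded_subset[OF bounded_ball[of c r]])
  have close: "dist (jet (U y)) (t *\<^sub>R ?\<gamma>) < \<epsilon>" if "\<bar>\<zeta> y * f (k * ((a, s) \<bullet> y)) - t\<bar> \<le> 2 * \<epsilon>1" for y t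
  proof -
    have "dist (jet (U y)) (t *\<^sub>R ?\<gamma>) \<le> K / k + dist ((\<zeta> y * f (k * ((a, s) \<bullet> y))) *\<^sub>R ?\<gamma>) (t *\<^sub>R ?\<gamma>)"
      by (rule order_trans[OF dist_triangle add_right_mono[OF U(3)]])
    also have "dist ((\<zeta> y * f (k * ((a, s) \<bullet> y))) *\<^sub>R ?\<gamma>) (t *\<^sub>R ?\<gamma>) = \<bar>\<zeta> y * f (k * ((a, s) \<bullet> y)) - t\<bar> * norm ?\<gamma>"
      by (simp only: dist_norm scaleR_diff_left[symmetric] norm_scaleR)
    also have "\<dots> \<le> 2 * \<epsilon>1 * norm ?\<gamma>" using that by (intro mult_right_mono) auto
    finally show ?thesis using e1(2) Kk eps by linarith
  qed
  have vol: "?m (ball c r1) \<le> V" unfolding V_def using r1 by (intro measure_mono_fmeasurable) auto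
  define x where "x = \<epsilon> / 4 * V"
  have x: "x > 0" using eps V by (simp add: x_def)
  have vol2: "V - x \<le> ?m (ball c r1)" using r1 by (simp add: x_def)
  show ?thesis
  proof (intro exI[of _ u] exI[of _ U] conjI allI)
    show "pert (ball c r) u U" by fact
    show "small \<epsilon> u U" using U(2) by (rule small_mono) (use s Kk eps in linarith)
    fix y
    let ?w = "\<zeta> y * f (k * ((a, s) \<bullet> y))"
    have "- M \<le> ?w" "?w \<le> 1 - M"
    proof -
      have z: "0 \<le> \<zeta> y" "\<zeta> y \<le> 1" using Z(2) by auto
      have "\<zeta> y * f (k * ((a, s) \<bullet> y)) \<ge> \<zeta> y * (- M)" by (rule mult_left_mono) (use P z in auto)
      moreover have "\<zeta> y * M \<le> 1 * M" by (rule mult_right_mono) (use P z in auto)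
      ultimately show "- M \<le> ?w" by simp
      have "\<zeta> y * f (k * ((a, s) \<bullet> y)) \<le> \<zeta> y * (1 - M)" by (rule mult_left_mono) (use P z in auto)
      moreover have "\<zeta> y * (1 - M) \<le> 1 * (1 - M)" by (rule mult_right_mono) (use P z in auto)
      ultimately show "?w \<le> 1 - M" by simp
    qed
    \<comment> \<open>The modulated profile ranges over [-M, 1 - M], which differs from
      [-\<theta>, 1 - \<theta>] by at most 2\<epsilon>1; clamping gives the required value of
      \<open>t\<close>.\<close>
    then have "\<bar>?w - max (-\<theta>) (min (1 - \<theta>) ?w)\<bar> \<le> 2 * \<epsilon>1" using P(6) e1(1) th by (auto simp: max_def min_def)
    from close[OF this] show "\<exists>t\<in>{-\<theta>..1-\<theta>}. dist (jet (U y)) (t *\<^sub>R ?\<gamma>) \<le> \<epsilon>"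
      using th by (intro bexI[of _ "max (-\<theta>) (min (1 - \<theta>) ?w)"]) auto
  next
    have i1: "(\<theta> - \<epsilon>) * V \<le> (\<theta> - 2 * \<epsilon>1) * ?m (ball c r1) - x"
    proof -
      have "(\<theta> - 2 * \<epsilon>1) * (V - x) \<le> (\<theta> - 2 * \<epsilon>1) * ?m (ball c r1)"
        using vol2 e1(3) by (intro mult_left_mono) auto
      moreover have "(\<theta> - 2 * \<epsilon>1) * x \<le> 1 * x" using th e1(1) x by (intro mult_right_mono) auto
      moreover have "2 * \<epsilon>1 * V \<le> x" unfolding x_def using e1(4) less_imp_le[OF V] by (intro mult_right_mono) auto
      moreover have "(\<theta> - 2 * \<epsilon>1) * (V - x) = \<theta> * V - 2 * \<epsilon>1 * V - (\<theta> - 2 * \<epsilon>1) * x"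
        by (simp add: algebra_simps)
      ultimately have "\<theta> * V - 3 * x \<le> (\<theta> - 2 * \<epsilon>1) * ?m (ball c r1) - x" by linarith
      moreover have "(\<theta> - \<epsilon>) * V = \<theta> * V - 4 * x" by (simp add: x_def algebra_simps)
      ultimately show ?thesis using x by linarith
    qed
    have i2: "(\<theta> - 2 * \<epsilon>1) * ?m (ball c r1) - x \<le> ?m {y \<in> ball c r1. ?x k y \<in> {\<epsilon>1..\<theta> - \<epsilon>1}}" using k(1) by (simp add: x_def algebra_simps)
    have i3: "?m {y \<in> ball c r1. ?x k y \<in> {\<epsilon>1..\<theta> - \<epsilon>1}} \<le> ?m {y \<in> ball c r. dist (jet (U y)) ((1 - \<theta>) *\<^sub>R ?\<gamma>) < \<epsilon>}"
    proof (rule measure_mono_fmeasurable[OF _ _ meas])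
      show "{y \<in> ball c r1. ?x k y \<in> {\<epsilon>1..\<theta> - \<epsilon>1}} \<subseteq> {y \<in> ball c r. dist (jet (U y)) ((1 - \<theta>) *\<^sub>R ?\<gamma>) < \<epsilon>}"
      proof
        fix y assume y: "y \<in> {y \<in> ball c r1. ?x k y \<in> {\<epsilon>1..\<theta> - \<epsilon>1}}"
        then have "\<zeta> y = 1" "f (k * ((a, s) \<bullet> y)) = 1 - M" using Z(3)[of y] P(12) by auto
        then have "dist (jet (U y)) ((1 - \<theta>) *\<^sub>R ?\<gamma>) < \<epsilon>" using P(6) by (intro close) auto
        then show "y \<in> {y \<in> ball c r. dist (jet (U y)) ((1 - \<theta>) *\<^sub>R ?\<gamma>) < \<epsilon>}" using y r1 by auto
      qed
    qed (rule strip_sets)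
    show "(\<theta> - \<epsilon>) * ?m (ball c r) \<le> ?m {y \<in> ball c r. dist (jet (U y)) ((1 - \<theta>) *\<^sub>R ?\<gamma>) < \<epsilon>}"
      unfolding V_def[symmetric] by (rule order_trans[OF i1 order_trans[OF i2 i3]])
  next
    have i1: "(1 - \<theta> - \<epsilon>) * V \<le> (1 - \<theta>) * ?m (ball c r1) - x"
    proof -
      have "(1 - \<theta>) * (V - x) \<le> (1 - \<theta>) * ?m (ball c r1)"
        using vol2 th by (intro mult_left_mono) auto
      moreover have "(1 - \<theta>) * x \<le> 1 * x" using th x by (intro mult_right_mono) auto
      ultimately have "(1 - \<theta>) * V - 2 * x \<le> (1 - \<theta>) * ?m (ball c r1) - x" by (simp add: algebra_simps)
      moreover have "(1 - \<theta> - \<epsilon>) * V = (1 - \<theta>) * V - 4 * x" by (simp add: x_def algebra_simps)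
      ultimately show ?thesis using x by linarith
    qed
    have i2: "(1 - \<theta>) * ?m (ball c r1) - x \<le> ?m {y \<in> ball c r1. ?x k y \<in> {\<theta>..1}}" using k(2) by (simp add: x_def)
    have i3: "?m {y \<in> ball c r1. ?x k y \<in> {\<theta>..1}} \<le> ?m {y \<in> ball c r. dist (jet (U y)) ((- \<theta>) *\<^sub>R ?\<gamma>) < \<epsilon>}"
    proof (rule measure_mono_fmeasurable[OF _ _ meas])
      show "{y \<in> ball c r1. ?x k y \<in> {\<theta>..1}} \<subseteq> {y \<in> ball c r. dist (jet (U y)) ((- \<theta>) *\<^sub>R ?\<gamma>) < \<epsilon>}"
      proof
        fix y assume y: "y \<in> {y \<in> ball c r1. ?x k y \<in> {\<theta>..1}}"
        then have "\<zeta> y = 1" "f (k * ((a, s) \<bullet> y)) = - M" using Z(3)[of y] P(13) by auto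
        then have "dist (jet (U y)) ((- \<theta>) *\<^sub>R ?\<gamma>) < \<epsilon>" using P(6) by (intro close) auto
        then show "y \<in> {y \<in> ball c r. dist (jet (U y)) ((- \<theta>) *\<^sub>R ?\<gamma>) < \<epsilon>}" using y r1 by auto
      qed
    qed (rule strip_sets)
    show "(1 - \<theta> - \<epsilon>) * ?m (ball c r) \<le> ?m {y \<in> ball c r. dist (jet (U y)) ((- \<theta>) *\<^sub>R ?\<gamma>) < \<epsilon>}"
      unfolding V_def[symmetric] by (rule order_trans[OF i1 order_trans[OF i2 i3]])
  qed
qed

section \<open>Pasting and iterated splitting\<close>

lemma lmeasurable_open_bounded: "open S \<Longrightarrow> bounded S \<Longrightarrow> S \<in> lmeasurable"
  by (rule bounded_set_imp_lmeasurable) auto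

lemma open_level_set:
  assumes "open G" "continuous_on G W" "pert G' f F" "open V"
  shows "open {y \<in> G. W y + jet (F y) \<in> V}"
proof -
  have "continuous_on G (\<lambda>y. W y + jet (F y))"
    by (intro continuous_intros assms continuous_on_subset[OF pert_jet_continuous[OF assms(3)]]) auto
  from continuous_open_preimage[OF this assms(1,4)] show ?thesis by (simp add: vimage_def Int_def)
qed

lemma lmeasurable_level_set:
  assumes "open G" "bounded G" "continuous_on G W" "pert G' f F" "open V"
  shows "{y \<in> G. W y + jet (F y) \<in> V} \<in> lmeasurable"
  by (rule lmeasurable_open_bounded[OF open_level_set]) (use assms in \<open>auto intro: bounded_subset\<close>)

lemma pert_sum_disjoint:
  assumes "finite I" "\<And>i. i \<in> I \<Longrightarrow> pert (A i) (f i) (F i) \<and> small e (f i) (F i)"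
    "pairwise (\<lambda>i j. disjnt (A i) (A j)) I" "e \<ge> 0"
  shows "\<exists>g K. pert (\<Union>i\<in>I. A i) g K \<and> small e g K \<and> (\<forall>i\<in>I. \<forall>y\<in>A i. jet (K y) = jet (F i y)) \<and>
      (\<forall>y. y \<notin> (\<Union>i\<in>I. A i) \<longrightarrow> jet (K y) = 0)"
  using assms
proof (induction I rule: finite_induct)
  case empty
  then show ?case by (intro exI[of _ "\<lambda>y. 0"] exI[of _ "\<lambda>y h. 0"]) auto
next
  case (insert i I)
  then obtain g K where g: "pert (\<Union>i\<in>I. A i) g K" "small e g K"
    "\<forall>i\<in>I. \<forall>y\<in>A i. jet (K y) = jet (F i y)" "\<forall>y. y \<notin> (\<Union>i\<in>I. A i) \<longrightarrow> jet (K y) = 0"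
    by (auto simp: pairwise_insert)
  have i: "pert (A i) (f i) (F i)" "small e (f i) (F i)" using insert.prems by auto
  have disj: "A i \<inter> (\<Union>i\<in>I. A i) = {}"
    using insert.prems(2) insert.hyps(2) by (auto simp: pairwise_insert disjnt_def)
  have jK: "jet (\<lambda>h. F i y h + K y h) = jet (F i y) + jet (K y)" for y by (rule jet_add)
  show ?case
  proof (intro exI[of _ "\<lambda>y. f i y + g y"] exI[of _ "\<lambda>y h. F i y h + K y h"] conjI ballI allI impI)
    show "pert (\<Union>i\<in>insert i I. A i) (\<lambda>y. f i y + g y) (\<lambda>y h. F i y h + K y h)"
      by (intro pert_add pert_mono[OF i(1)] pert_mono[OF g(1)]) auto
    show "small e (\<lambda>y. f i y + g y) (\<lambda>y h. F i y h + K y h)"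
      by (rule small_add_disjoint[OF i(2) g(2) i(1) g(1) disj])
  next
    fix j y assume "j \<in> insert i I" "y \<in> A j"
    then show "jet (\<lambda>h. F i y h + K y h) = jet (F j y)"
      using disj g(3,4) pert_outside(3)[OF i(1), of y] unfolding jK by fastforce
  next
    fix y assume "y \<notin> (\<Union>i\<in>insert i I. A i)"
    then show "jet (\<lambda>h. F i y h + K y h) = 0" using g(4) pert_outside(3)[OF i(1), of y] unfolding jK by auto
  qed
qed

text \<open>Vitali's theorem covers G up to a null set by countably many disjoint balls whose radii
  stay below the gauge \<open>d\<close>; continuity of measure lets finitely many of them suffice up
  to \<eta>.\<close>

lemma finite_vitali_balls:
  fixes G :: "'a::euclidean_space set"
  assumes G: "open G" "bounded G" and d: "\<And>y. y \<in> G \<Longrightarrow> d y > 0" and \<eta>: "\<eta> > 0"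
  shows "\<exists>D. finite D \<and> (\<forall>(y, r)\<in>D. y \<in> G \<and> 0 < r \<and> r < d y \<and> ball y r \<subseteq> G) \<and>
     pairwise (\<lambda>i j. disjnt (ball (fst i) (snd i)) (ball (fst j) (snd j))) D \<and>
     measure lebesgue (\<Union>(y, r)\<in>D. ball y r) > measure lebesgue G - \<eta>"
proof -
  define K where "K = {(y, r). y \<in> G \<and> 0 < r \<and> r < d y \<and> ball y r \<subseteq> G}"
  have cov: "\<exists>i. i \<in> K \<and> x \<in> ball (fst i) (snd i) \<and> snd i < b" if "x \<in> G" "b > 0" for x b
  proof -
    obtain e where e: "e > 0" "ball x e \<subseteq> G" using G(1) \<open>x \<in> G\<close> open_contains_ball by blast
    define r where "r = min e (min b (d x)) / 2"
    have m: "min e (min b (d x)) > 0" using e d[OF \<open>x \<in> G\<close>] \<open>b > 0\<close> by auto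
    then have "r > 0" "r < e" "r < b" "r < d x" unfolding r_def by linarith+
    moreover have "ball x r \<subseteq> G" using e(2) \<open>r < e\<close> by (meson less_imp_le order_trans subset_ball)
    ultimately show ?thesis using \<open>x \<in> G\<close> by (intro exI[of _ "(x, r)"]) (auto simp: K_def)
  qed
  have "\<exists>C. countable C \<and> C \<subseteq> K \<and>
    pairwise (\<lambda>i j. disjnt (ball (fst i) (snd i)) (ball (fst j) (snd j))) C \<and>
    negligible (G - (\<Union>i\<in>C. ball (fst i) (snd i)))"
    (is "\<exists>C. ?P C")
  proof -
    show ?thesis
    proof (rule Vitali_covering_theorem_balls[of G K fst snd])
      show "\<exists>i. i \<in> K \<and> x \<in> ball (fst i) (snd i) \<and> snd i < b" if "x \<in> G" "b > 0" for x b
        by (rule cov[OF that])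
      fix C assume "countable C" "C \<subseteq> K" "pairwise (\<lambda>i j. disjnt (ball (fst i) (snd i)) (ball (fst j) (snd j))) C"
        "negligible (G - (\<Union>i\<in>C. ball (fst i) (snd i)))"
      then have "?P C" by (intro conjI)
      then show ?thesis by (rule exI)
    qed
  qed
  then obtain C where C: "countable C" "C \<subseteq> K"
    "pairwise (\<lambda>i j. disjnt (ball (fst i) (snd i)) (ball (fst j) (snd j))) C"
    "negligible (G - (\<Union>i\<in>C. ball (fst i) (snd i)))"
    by blast
  let ?B = "\<lambda>n. \<Union>i\<in>{c \<in> C. to_nat_on C c < n}. ball (fst i) (snd i)"
  let ?U = "\<Union>i\<in>C. ball (fst i) (snd i)"
  have KD: "fst i \<in> G \<and> 0 < snd i \<and> snd i < d (fst i) \<and> ball (fst i) (snd i) \<subseteq> G" if "i \<in> K" for i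
    using that by (auto simp: K_def case_prod_beta)
  have U: "?U \<subseteq> G" using C(2) KD by blast
  have Gm: "G \<in> lmeasurable" using G by (rule lmeasurable_open_bounded)
  have Um: "?U \<in> lmeasurable"
    by (rule lmeasurable_open_bounded) (use U G bounded_subset in auto)
  have "(\<lambda>n. measure lebesgue (?B n)) \<longlonglongrightarrow> measure lebesgue (\<Union>n. ?B n)"
  proof (rule Lim_measure_incseq)
    have "?B n \<in> sets lebesgue" for n
    proof -
      have "open (?B n)" by (intro open_UN ballI open_ball)
      then show ?thesis by simp
    qed
    then show "range ?B \<subseteq> sets lebesgue" by (intro image_subsetI)
    show "incseq ?B" by (rule incseq_SucI) (auto simp: less_Suc_eq)
    have "(\<Union>n. ?B n) = ?U" by auto
    then show "emeasure lebesgue (\<Union>n. ?B n) \<noteq> \<infinity>" using fmeasurableD2[OF Um] by simp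
  qed
  moreover have "(\<Union>n. ?B n) = ?U" by auto
  moreover have "measure lebesgue ?U = measure lebesgue G"
  proof (rule measure_negligible_symdiff)
    show "G \<in> lmeasurable" by fact
    show "negligible ((G - ?U) \<union> (?U - G))" using C(4) U by (simp add: Diff_eq_empty_iff[THEN iffD2])
  qed
  ultimately have "(\<lambda>n. measure lebesgue (?B n)) \<longlonglongrightarrow> measure lebesgue G" by simp
  from order_tendstoD(1)[OF this, of "measure lebesgue G - \<eta>"] \<eta>
  have "\<forall>\<^sub>F n in sequentially. measure lebesgue (?B n) > measure lebesgue G - \<eta>" by simp
  then obtain n where n: "measure lebesgue (?B n) > measure lebesgue G - \<eta>"
    using eventually_happens'[OF sequentially_bot] by blast
  have "finite {c \<in> C. to_nat_on C c < n}"
  proof (rule finite_imageD)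
    show "finite (to_nat_on C ` {c \<in> C. to_nat_on C c < n})" by (rule finite_subset[of _ "{..<n}"]) auto
    show "inj_on (to_nat_on C) {c \<in> C. to_nat_on C c < n}"
      by (rule inj_on_subset[OF inj_on_to_nat_on[OF C(1)]]) auto
  qed
  moreover have "pairwise (\<lambda>i j. disjnt (ball (fst i) (snd i)) (ball (fst j) (snd j))) {c \<in> C. to_nat_on C c < n}"
    by (rule pairwise_subset[OF C(3)]) auto
  moreover have "\<forall>(y, r)\<in>{c \<in> C. to_nat_on C c < n}. y \<in> G \<and> 0 < r \<and> r < d y \<and> ball y r \<subseteq> G"
    using C(2) by (auto simp: K_def)
  moreover have "?B n = (\<Union>(y, r)\<in>{c \<in> C. to_nat_on C c < n}. ball y r)" by (auto simp: case_prod_beta)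
  ultimately show ?thesis using n by (intro exI[of _ "{c \<in> C. to_nat_on C c < n}"]) simp
qed

text \<open>Local perturbations on finitely many disjoint balls are added up. Disjointness keeps the
  bound \<open>small e\<close> and lets the volumes add. Between the balls the perturbation
  vanishes, which is why \<open>Ok\<close> is required of the zero jet. Since the fractions
  \<open>c l\<close> are at most 1, the uncovered volume costs at most \<eta>.\<close>

lemma paste_local_perturbations:
  fixes G :: "((real ^ 'n) \<times> real) set" and Ok :: "(real ^ 'n) \<times> real \<Rightarrow> ('n::finite, 'm::finite) pt \<Rightarrow> bool"
    and R :: "'l \<Rightarrow> (real ^ 'n) \<times> real \<Rightarrow> ('n, 'm) pt \<Rightarrow> bool"
  assumes G: "open G" "bounded G" and e: "e \<ge> 0" and \<eta>: "\<eta> > 0"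
    and c: "\<And>l. l \<in> L \<Longrightarrow> c l \<le> 1"
    and ok0: "\<And>y. y \<in> G \<Longrightarrow> Ok y 0"
    and meas: "\<And>f F l. l \<in> L \<Longrightarrow> pert G f F \<Longrightarrow> {y \<in> G. R l y (jet (F y))} \<in> lmeasurable"
    and loc: "\<And>y. y \<in> G \<Longrightarrow> \<exists>d>0. \<forall>r. 0 < r \<longrightarrow> r < d \<longrightarrow> ball y r \<subseteq> G \<longrightarrow>
      (\<exists>f F. pert (ball y r) f F \<and> small e f F \<and> (\<forall>z\<in>ball y r. Ok z (jet (F z))) \<and>
        (\<forall>l\<in>L. measure lebesgue {z \<in> ball y r. R l z (jet (F z))} \<ge> c l * measure lebesgue (ball y r)))"
  shows "\<exists>f F. pert G f F \<and> small e f F \<and> (\<forall>z\<in>G. Ok z (jet (F z))) \<and>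
        (\<forall>l\<in>L. measure lebesgue {z \<in> G. R l z (jet (F z))} \<ge> c l * measure lebesgue G - \<eta>)"
proof -
  let ?m = "measure lebesgue"
  have "\<forall>y\<in>G. \<exists>d. d > 0 \<and> (\<forall>r. 0 < r \<longrightarrow> r < d \<longrightarrow> ball y r \<subseteq> G \<longrightarrow>
      (\<exists>f F. pert (ball y r) f F \<and> small e f F \<and> (\<forall>z\<in>ball y r. Ok z (jet (F z))) \<and>
        (\<forall>l\<in>L. ?m {z \<in> ball y r. R l z (jet (F z))} \<ge> c l * ?m (ball y r))))"
    using loc by blast
  from bchoice[OF this] obtain d where d: "\<forall>y\<in>G. d y > 0 \<and> (\<forall>r. 0 < r \<longrightarrow> r < d y \<longrightarrow> ball y r \<subseteq> G \<longrightarrow>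
      (\<exists>f F. pert (ball y r) f F \<and> small e f F \<and> (\<forall>z\<in>ball y r. Ok z (jet (F z))) \<and>
        (\<forall>l\<in>L. ?m {z \<in> ball y r. R l z (jet (F z))} \<ge> c l * ?m (ball y r))))" ..
  obtain D where D: "finite D" "\<forall>(y, r)\<in>D. y \<in> G \<and> 0 < r \<and> r < d y \<and> ball y r \<subseteq> G"
     "pairwise (\<lambda>i j. disjnt (ball (fst i) (snd i)) (ball (fst j) (snd j))) D"
     "?m (\<Union>(y, r)\<in>D. ball y r) > ?m G - \<eta>"
    using finite_vitali_balls[OF G _ \<eta>, of d] d by blast
  define B where "B i = ball (fst i) (snd i)" for i :: "((real ^ 'n) \<times> real) \<times> real"
  have DD: "fst i \<in> G \<and> 0 < snd i \<and> snd i < d (fst i) \<and> ball (fst i) (snd i) \<subseteq> G" if "i \<in> D" for i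
    using D(2) that by (auto simp: case_prod_beta)
  then have BG: "B i \<subseteq> G" if "i \<in> D" for i using that by (simp add: B_def)
  have Bm: "B i \<in> lmeasurable" for i by (simp add: B_def)
  have "\<forall>i\<in>D. \<exists>p. pert (B i) (fst p) (snd p) \<and> small e (fst p) (snd p) \<and> (\<forall>z\<in>B i. Ok z (jet (snd p z))) \<and>
        (\<forall>l\<in>L. ?m {z \<in> B i. R l z (jet (snd p z))} \<ge> c l * ?m (B i))"
  proof
    fix i assume "i \<in> D"
    then have "fst i \<in> G" "0 < snd i" "snd i < d (fst i)" "ball (fst i) (snd i) \<subseteq> G" using DD by auto
    with d obtain f F where "pert (B i) f F \<and> small e f F \<and> (\<forall>z\<in>B i. Ok z (jet (F z))) \<and>
        (\<forall>l\<in>L. ?m {z \<in> B i. R l z (jet (F z))} \<ge> c l * ?m (B i))" unfolding B_def by blast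
    then show "\<exists>p. pert (B i) (fst p) (snd p) \<and> small e (fst p) (snd p) \<and> (\<forall>z\<in>B i. Ok z (jet (snd p z))) \<and>
        (\<forall>l\<in>L. ?m {z \<in> B i. R l z (jet (snd p z))} \<ge> c l * ?m (B i))" by (intro exI[of _ "(f, F)"]) simp
  qed
  from bchoice[OF this] obtain p where p: "\<forall>i\<in>D. pert (B i) (fst (p i)) (snd (p i)) \<and> small e (fst (p i)) (snd (p i)) \<and>
      (\<forall>z\<in>B i. Ok z (jet (snd (p i) z))) \<and>
        (\<forall>l\<in>L. ?m {z \<in> B i. R l z (jet (snd (p i) z))} \<ge> c l * ?m (B i))" ..
  define f where "f i = fst (p i)" for i
  define F where "F i = snd (p i)" for i
  have f: "pert (B i) (f i) (F i)" "small e (f i) (F i)" "\<forall>z\<in>B i. Ok z (jet (F i z))"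
    "\<forall>l\<in>L. ?m {z \<in> B i. R l z (jet (F i z))} \<ge> c l * ?m (B i)" if "i \<in> D" for i
    using p that unfolding f_def F_def by auto
  obtain g K where g: "pert (\<Union>i\<in>D. B i) g K" "small e g K" "\<forall>i\<in>D. \<forall>y\<in>B i. jet (K y) = jet (F i y)"
      "\<forall>y. y \<notin> (\<Union>i\<in>D. B i) \<longrightarrow> jet (K y) = 0"
    using pert_sum_disjoint[OF D(1), of B f F e] f(1,2) D(3) e unfolding B_def[symmetric] by blast
  have gG: "pert G g K" by (rule pert_mono[OF g(1)]) (use BG in auto)
  have disj: "disjoint_family_on B D"
    using D(3) by (auto simp: disjoint_family_on_def pairwise_def disjnt_def B_def)
  show ?thesis
  proof (intro exI[of _ g] exI[of _ K] conjI ballI)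
    fix z assume "z \<in> G"
    then show "Ok z (jet (K z))" using g(3,4) f(3) ok0 by (cases "z \<in> (\<Union>i\<in>D. B i)") auto
  next
    fix l assume l: "l \<in> L"
    let ?S = "{z \<in> G. R l z (jet (K z))}"
    have Sm: "?S \<in> lmeasurable" by (rule meas[OF l gG])
    have SB: "?S \<inter> B i \<in> lmeasurable" for i by (rule fmeasurable.Int[OF Sm Bm])
    have "(\<Sum>i\<in>D. c l * ?m (B i)) \<le> (\<Sum>i\<in>D. ?m (?S \<inter> B i))"
    proof (rule sum_mono)
      fix i assume i: "i \<in> D"
      have "?S \<inter> B i = {z \<in> B i. R l z (jet (F i z))}" using g(3) i BG[OF i] by auto
      then show "c l * ?m (B i) \<le> ?m (?S \<inter> B i)" using f(4)[OF i] l by auto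
    qed
    also have "\<dots> = ?m (\<Union>i\<in>D. ?S \<inter> B i)"
    proof (rule measure_finite_Union[symmetric, OF D(1)])
      show "disjoint_family_on (\<lambda>i. ?S \<inter> B i) D" using disj unfolding disjoint_family_on_def by blast
      show "(\<lambda>i. ?S \<inter> B i) ` D \<subseteq> sets lebesgue" using SB by blast
      show "emeasure lebesgue (?S \<inter> B i) \<noteq> \<infinity>" for i using fmeasurableD2[OF SB] by simp
    qed
    also have "\<dots> \<le> ?m ?S"
    proof (rule measure_mono_fmeasurable[OF _ _ Sm])
      show "(\<Union>i\<in>D. ?S \<inter> B i) \<in> sets lebesgue" using SB by (intro sets.finite_UN[OF D(1)]) blast
    qed blast
    finally have 1: "c l * (\<Sum>i\<in>D. ?m (B i)) \<le> ?m ?S" by (simp add: sum_distrib_left)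
    have "(\<Sum>i\<in>D. ?m (B i)) = ?m (\<Union>i\<in>D. B i)"
    proof (rule measure_finite_Union[symmetric, OF D(1) _ disj])
      show "B ` D \<subseteq> sets lebesgue" using Bm by blast
      show "emeasure lebesgue (B i) \<noteq> \<infinity>" for i using fmeasurableD2[OF Bm] by simp
    qed
    moreover have "(\<Union>(y, r)\<in>D. ball y r) = (\<Union>i\<in>D. B i)" by (auto simp: B_def case_prod_beta)
    ultimately have 2: "(\<Sum>i\<in>D. ?m (B i)) > ?m G - \<eta>" using D(4) by simp
    show "c l * ?m G - \<eta> \<le> ?m ?S"
    proof (cases "c l \<ge> 0")
      case True
      have "c l * (?m G - \<eta>) \<le> c l * (\<Sum>i\<in>D. ?m (B i))" using 2 True by (intro mult_left_mono) auto
      moreover have "c l * \<eta> \<le> 1 * \<eta>" using c[OF l] \<eta> by (intro mult_right_mono) auto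
      ultimately show ?thesis using 1 by (simp add: algebra_simps)
    next
      case False
      then have "c l * ?m G \<le> 0" by (simp add: mult_nonpos_nonneg)
      then show ?thesis using \<eta> by (smt (verit) measure_nonneg)
    qed
  qed (use gG g(2) in auto)
qed

section \<open>Volume fractions reachable by perturbations\<close>

definition attains :: "'l set \<Rightarrow> ('n::finite, 'm::finite) pt set \<Rightarrow> ('l \<Rightarrow> ('n, 'm) pt set) \<Rightarrow> ('l \<Rightarrow> real) \<Rightarrow> real \<Rightarrow>
    ((real ^ 'n) \<times> real) set \<Rightarrow> ((real ^ 'n) \<times> real \<Rightarrow> ('n, 'm) pt) \<Rightarrow> bool" where
  "attains L U V c \<epsilon> G W \<longleftrightarrow> (\<exists>f F. pert G f F \<and> small \<epsilon> f F \<and> (\<forall>y\<in>G. W y + jet (F y) \<in> U) \<and>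
      (\<forall>l\<in>L. measure lebesgue {y \<in> G. W y + jet (F y) \<in> V l} \<ge> (c l - \<epsilon>) * measure lebesgue G))"

text \<open>\<open>c l\<close> bounds from below the volume fraction that can be moved from near \<open>w\<close> into \<open>V l\<close>.\<close>
definition attainable :: "'l set \<Rightarrow> ('n::finite, 'm::finite) pt set \<Rightarrow> ('l \<Rightarrow> ('n, 'm) pt set) \<Rightarrow> ('n, 'm) pt \<Rightarrow> ('l \<Rightarrow> real) \<Rightarrow> bool" where
  "attainable L U V w c \<longleftrightarrow> (\<forall>\<epsilon>>0. \<exists>\<rho>>0. \<forall>G W. open G \<longrightarrow> bounded G \<longrightarrow> continuous_on G W \<longrightarrow> W ` G \<subseteq> ball w \<rho> \<longrightarrow>
     attains L U V c \<epsilon> G W)"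

lemma attains_mono:
  assumes "attains L U V c \<epsilon> G W" "\<And>l. l \<in> L \<Longrightarrow> c' l \<le> c l"
  shows "attains L U V c' \<epsilon> G W"
proof -
  have "(c' l - \<epsilon>) * measure lebesgue G \<le> (c l - \<epsilon>) * measure lebesgue G" if "l \<in> L" for l
    using assms(2)[OF that] by (intro mult_right_mono) auto
  with assms(1) show ?thesis unfolding attains_def by (meson order_trans)
qed

lemma attainable_mono:
  assumes "attainable L U V w c" "\<And>l. l \<in> L \<Longrightarrow> c' l \<le> c l"
  shows "attainable L U V w c'"
  unfolding attainable_def
proof (intro allI impI)
  fix \<epsilon> :: real assume "\<epsilon> > 0"
  from assms(1)[unfolded attainable_def, rule_format, OF this] obtain \<rho> where r: "\<rho> > 0"
    "\<forall>G W. open G \<longrightarrow> bounded G \<longrightarrow> continuous_on G W \<longrightarrow> W ` G \<subseteq> ball w \<rho> \<longrightarrow> attains L U V c \<epsilon> G W" by (elim exE conjE)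
  show "\<exists>\<rho>>0. \<forall>G W. open G \<longrightarrow> bounded G \<longrightarrow> continuous_on G W \<longrightarrow> W ` G \<subseteq> ball w \<rho> \<longrightarrow> attains L U V c' \<epsilon> G W"
    by (intro exI[of _ \<rho>] conjI allI impI r(1) attains_mono[OF _ assms(2)] r(2)[rule_format])
qed

text \<open>The zero perturbation: a field close enough to \<open>w\<close> already lies in every
  open set of the family that contains \<open>w\<close>.\<close>

lemma attainable_trivial:
  assumes L: "finite L" and U: "open U" "w \<in> U" and V: "\<And>l. l \<in> L \<Longrightarrow> open (V l)"
  shows "attainable L U V w (\<lambda>l. if w \<in> V l then 1 else 0)"
  unfolding attainable_def
proof (intro allI impI)
  fix \<epsilon> :: real assume eps: "\<epsilon> > 0"
  have "open (U \<inter> (\<Inter>l\<in>{l \<in> L. w \<in> V l}. V l))" by (intro open_Int U open_INT) (use L V in auto)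
  then obtain \<rho> where r: "\<rho> > 0" "ball w \<rho> \<subseteq> U \<inter> (\<Inter>l\<in>{l \<in> L. w \<in> V l}. V l)"
    using U(2) open_contains_ball by blast
  have "attains L U V (\<lambda>l. if w \<in> V l then 1 else 0) \<epsilon> G W" if G: "W ` G \<subseteq> ball w \<rho>" for G W
    unfolding attains_def
  proof (intro exI[of _ "\<lambda>y. 0"] exI[of _ "\<lambda>y h. 0"] conjI ballI)
    fix l assume "l \<in> L"
    show "measure lebesgue {y \<in> G. W y + jet (\<lambda>h. 0) \<in> V l} \<ge> ((if w \<in> V l then 1 else 0) - \<epsilon>) * measure lebesgue G"
    proof (cases "w \<in> V l")
      case True
      then have "{y \<in> G. W y + jet (\<lambda>h. 0) \<in> V l} = G" using G r(2) \<open>l \<in> L\<close> by auto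
      moreover have "\<epsilon> * measure lebesgue G \<ge> 0" using eps by simp
      ultimately show ?thesis using True by (simp add: algebra_simps)
    next
      case False
      then have "((if w \<in> V l then 1 else 0) - \<epsilon>) * measure lebesgue G \<le> 0" using eps by (simp add: mult_nonpos_nonneg)
      then show ?thesis using measure_nonneg order_trans by blast
    qed
  next
    show "W y + jet (\<lambda>h. 0) \<in> U" if "y \<in> G" for y using that G r(2) by auto
  qed (use eps in simp_all)
  then show "\<exists>\<rho>>0. \<forall>G W. open G \<longrightarrow> bounded G \<longrightarrow> continuous_on G W \<longrightarrow> W ` G \<subseteq> ball w \<rho> \<longrightarrow>
     attains L U V (\<lambda>l. if w \<in> V l then 1 else 0) \<epsilon> G W" using r(1) by blast
qed

text \<open>Building blocks along \<alpha> - \<beta> first bring the field close to \<alpha> on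
  nearly the fraction \<theta> of the volume and close to \<beta> on nearly all of the rest. On
  these two disjoint open sets the perturbations available at \<alpha> and at \<beta> are added. In
  between, the values stay near the segment, hence in \<open>U\<close>, and the fractions combine
  linearly.\<close>

lemma attainable_split:
  fixes \<alpha> \<beta> :: "('n::finite, 'm::finite) pt"
  assumes cone: "\<alpha> - \<beta> \<in> wave_cone" and ne: "\<alpha> \<noteq> \<beta>" and th: "0 < \<theta>" "\<theta> < 1"
    and U: "open U" "closed_segment \<alpha> \<beta> \<subseteq> U" and V: "\<And>l. l \<in> L \<Longrightarrow> open (V l)"
    and c1: "attainable L U V \<alpha> c1" "\<And>l. l \<in> L \<Longrightarrow> 0 \<le> c1 l \<and> c1 l \<le> 1"
    and c2: "attainable L U V \<beta> c2" "\<And>l. l \<in> L \<Longrightarrow> 0 \<le> c2 l \<and> c2 l \<le> 1"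
  shows "attainable L U V (\<theta> *\<^sub>R \<alpha> + (1 - \<theta>) *\<^sub>R \<beta>) (\<lambda>l. \<theta> * c1 l + (1 - \<theta>) * c2 l)"
  unfolding attainable_def
proof (intro allI impI)
  fix \<epsilon> :: real assume eps: "\<epsilon> > 0"
  let ?m = "measure lebesgue"
  define w where "w = \<theta> *\<^sub>R \<alpha> + (1 - \<theta>) *\<^sub>R \<beta>"
  obtain p a B where g: "\<alpha> - \<beta> = (outerp p a, B)" "a \<noteq> 0" "B *v a = 0"
    using cone unfolding wave_cone_def by blast
  define \<gamma> where "\<gamma> = (outerp p a, B)"
  have al: "\<alpha> = w + (1 - \<theta>) *\<^sub>R \<gamma>" and be: "\<beta> = w + (- \<theta>) *\<^sub>R \<gamma>"
    unfolding w_def \<gamma>_def g(1)[symmetric] by (simp_all add: algebra_simps)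
  have "\<epsilon> / 4 > 0" using eps by simp
  note e4 = this
  from c1(1)[unfolded attainable_def, rule_format, OF e4] obtain \<rho>1 where r1: "\<rho>1 > 0" "\<forall>G W. open G \<longrightarrow> bounded G \<longrightarrow> continuous_on G W \<longrightarrow> W ` G \<subseteq> ball \<alpha> \<rho>1 \<longrightarrow>
       attains L U V c1 (\<epsilon>/4) G W" by (elim exE conjE)
  from c2(1)[unfolded attainable_def, rule_format, OF e4] obtain \<rho>2 where r2: "\<rho>2 > 0" "\<forall>G W. open G \<longrightarrow> bounded G \<longrightarrow> continuous_on G W \<longrightarrow> W ` G \<subseteq> ball \<beta> \<rho>2 \<longrightarrow>
       attains L U V c2 (\<epsilon>/4) G W"
    by (elim exE conjE)
  obtain \<tau> where tau: "\<tau> > 0" "(\<Union>x\<in>closed_segment \<alpha> \<beta>. ball x \<tau>) \<subseteq> U"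
    using compact_subset_open_imp_ball_epsilon_subset[OF compact_segment U] by metis
  \<comment> \<open>Half the distance makes the balls about \<alpha> and \<beta> disjoint; the other
    bounds make the hypotheses at the two end points applicable.\<close>
  define \<rho>0 where "\<rho>0 = min \<rho>1 (min \<rho>2 (dist \<alpha> \<beta> / 2))"
  have r0: "\<rho>0 > 0" "\<rho>0 \<le> \<rho>1" "\<rho>0 \<le> \<rho>2" "2 * \<rho>0 \<le> dist \<alpha> \<beta>" using r1 r2 ne by (auto simp: \<rho>0_def)
  define \<rho> where "\<rho> = min \<rho>0 \<tau> / 4"
  have r: "\<rho> > 0" "2 * \<rho> < \<rho>0" "2 * \<rho> < \<tau>" using r0 tau by (auto simp: \<rho>_def min_def)
  define e where "e = min \<rho> (\<epsilon> / 8)"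
  have e: "e > 0" "e \<le> \<rho>" "e \<le> \<epsilon> / 8" using r eps by (auto simp: e_def)
  show "\<exists>\<rho>>0. \<forall>G W. open G \<longrightarrow> bounded G \<longrightarrow> continuous_on G W \<longrightarrow> W ` G \<subseteq> ball (\<theta> *\<^sub>R \<alpha> + (1 - \<theta>) *\<^sub>R \<beta>) \<rho> \<longrightarrow>
     attains L U V (\<lambda>l. \<theta> * c1 l + (1 - \<theta>) * c2 l) \<epsilon> G W"
    unfolding w_def[symmetric]
  proof (intro exI[of _ \<rho>] conjI allI impI r(1))
    fix G :: "((real ^ 'n) \<times> real) set" and W :: "(real ^ 'n) \<times> real \<Rightarrow> ('n, 'm) pt"
    assume G: "open G" "bounded G" and W: "continuous_on G W" "W ` G \<subseteq> ball w \<rho>"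
    have Gm: "G \<in> lmeasurable" using G by (rule lmeasurable_open_bounded)
    \<comment> \<open>The admissible loss is proportional to the volume of \<open>G\<close>. The
      value 1 for null \<open>G\<close> only keeps \<eta> positive; the volume estimate is then
      trivial.\<close>
    define \<eta> where "\<eta> = (if ?m G = 0 then 1 else e * ?m G)"
    have eta: "\<eta> > 0" using e by (auto simp: \<eta>_def zero_less_measure_iff)
    have near: "dist (W z + x) (w + y) < 2 * \<rho>" if "z \<in> G" "dist x y \<le> e" for z x y
    proof -
      have "dist (W z + x) (w + y) \<le> dist (W z) w + dist x y" by (rule dist_triangle_add)
      moreover have "dist (W z) w < \<rho>" using W(2) that(1) by (auto simp: dist_commute)
      ultimately show ?thesis using that e by linarith
    qed
    \<comment> \<open>Boolean label: \<open>True\<close> stands for the part near \<alpha>,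
      \<open>False\<close> for the part near \<beta>.\<close>
    define R where "R l z x \<longleftrightarrow> W z + x \<in> ball (if l then \<alpha> else \<beta>) \<rho>0" for l z x
    have "\<exists>f F. pert G f F \<and> small (\<epsilon>/4) f F \<and> (\<forall>z\<in>G. W z + jet (F z) \<in> U) \<and>
        (\<forall>l\<in>UNIV. ?m {z \<in> G. R l z (jet (F z))} \<ge> (if l then \<theta> - e else 1 - \<theta> - e) * ?m G - \<eta>)"
    proof (rule paste_local_perturbations[OF G _ eta])
      show "\<epsilon> / 4 \<ge> 0" using eps by simp
      show "(if l then \<theta> - e else 1 - \<theta> - e) \<le> 1" for l using th e by auto
      have seg: "w + t *\<^sub>R \<gamma> \<in> closed_segment \<alpha> \<beta>" if "t \<in> {-\<theta>..1-\<theta>}" for t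
      proof -
        have "w + t *\<^sub>R \<gamma> = (1 - (1 - \<theta> - t)) *\<^sub>R \<alpha> + (1 - \<theta> - t) *\<^sub>R \<beta>"
          unfolding al be by (simp add: algebra_simps)
        then show ?thesis using that unfolding closed_segment_def by (intro CollectI exI[of _ "1 - \<theta> - t"]) auto
      qed
      have inU: "W z + x \<in> U" if "z \<in> G" "t \<in> {-\<theta>..1-\<theta>}" "dist x (t *\<^sub>R \<gamma>) \<le> e" for z x t
      proof -
        have "W z + x \<in> ball (w + t *\<^sub>R \<gamma>) \<tau>" using near[OF that(1,3)] r by (simp add: dist_commute)
        then show ?thesis using tau(2) seg[OF that(2)] by blast
      qed
      show "W y + 0 \<in> U" if "y \<in> G" for y using inU[OF that, of 0 0] th e by simp
      show "{y \<in> G. R l y (jet (F y))} \<in> lmeasurable" if "pert G f F" for f F l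
        unfolding R_def by (rule lmeasurable_level_set[OF G W(1) that open_ball])
      show "\<exists>d>0. \<forall>r. 0 < r \<longrightarrow> r < d \<longrightarrow> ball y r \<subseteq> G \<longrightarrow>
        (\<exists>f F. pert (ball y r) f F \<and> small (\<epsilon>/4) f F \<and> (\<forall>z\<in>ball y r. W z + jet (F z) \<in> U) \<and>
          (\<forall>l\<in>UNIV. ?m {z \<in> ball y r. R l z (jet (F z))} \<ge> (if l then \<theta> - e else 1 - \<theta> - e) * ?m (ball y r)))"
        if "y \<in> G" for y
      proof (intro exI[of _ 1] conjI allI impI)
        fix r :: real assume r: "0 < r" "ball y r \<subseteq> G"
        obtain f F where f: "pert (ball y r) f F" "small e f F"
          "\<forall>z. \<exists>t\<in>{-\<theta>..1-\<theta>}. dist (jet (F z)) (t *\<^sub>R \<gamma>) \<le> e"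
          "?m {z \<in> ball y r. dist (jet (F z)) ((1 - \<theta>) *\<^sub>R \<gamma>) < e} \<ge> (\<theta> - e) * ?m (ball y r)"
          "?m {z \<in> ball y r. dist (jet (F z)) ((- \<theta>) *\<^sub>R \<gamma>) < e} \<ge> (1 - \<theta> - e) * ?m (ball y r)"
          using building_block[OF g(2,3) th e(1) r(1), of y p] unfolding \<gamma>_def[symmetric] by blast
        have sub: "?m {z \<in> ball y r. dist (jet (F z)) (t *\<^sub>R \<gamma>) < e} \<le> ?m {z \<in> ball y r. W z + jet (F z) \<in> ball (w + t *\<^sub>R \<gamma>) \<rho>0}" for t
        proof (rule measure_mono_fmeasurable)
          show "{z \<in> ball y r. dist (jet (F z)) (t *\<^sub>R \<gamma>) < e} \<subseteq> {z \<in> ball y r. W z + jet (F z) \<in> ball (w + t *\<^sub>R \<gamma>) \<rho>0}"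
          proof safe
            fix z assume z: "z \<in> ball y r" "dist (jet (F z)) (t *\<^sub>R \<gamma>) < e"
            then have "dist (W z + jet (F z)) (w + t *\<^sub>R \<gamma>) < 2 * \<rho>" using near r(2) by (meson less_imp_le subsetD)
            then show "W z + jet (F z) \<in> ball (w + t *\<^sub>R \<gamma>) \<rho>0" using \<open>2 * \<rho> < \<rho>0\<close> by (simp add: dist_commute)
          qed
          have "open {z \<in> ball y r. 0 + jet (F z) \<in> ball (t *\<^sub>R \<gamma>) e}"
            by (rule open_level_set[OF open_ball _ f(1)]) auto
          then show "{z \<in> ball y r. dist (jet (F z)) (t *\<^sub>R \<gamma>) < e} \<in> sets lebesgue" by (simp add: dist_commute)
          show "{z \<in> ball y r. W z + jet (F z) \<in> ball (w + t *\<^sub>R \<gamma>) \<rho>0} \<in> lmeasurable"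
            by (rule lmeasurable_level_set[OF _ _ _ f(1)]) (use W(1) r continuous_on_subset in auto)
        qed
        show "\<exists>f F. pert (ball y r) f F \<and> small (\<epsilon>/4) f F \<and> (\<forall>z\<in>ball y r. W z + jet (F z) \<in> U) \<and>
          (\<forall>l\<in>UNIV. ?m {z \<in> ball y r. R l z (jet (F z))} \<ge> (if l then \<theta> - e else 1 - \<theta> - e) * ?m (ball y r))"
        proof (intro exI[of _ f] exI[of _ F] conjI ballI f(1))
          show "small (\<epsilon>/4) f F" by (rule small_mono[OF f(2)]) (use e eps in linarith)
          show "W z + jet (F z) \<in> U" if "z \<in> ball y r" for z using f(3) inU r(2) that by blast
          show "?m {z \<in> ball y r. R l z (jet (F z))} \<ge> (if l then \<theta> - e else 1 - \<theta> - e) * ?m (ball y r)" for l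
            using order_trans[OF f(4) sub] order_trans[OF f(5) sub] unfolding al[symmetric] be[symmetric] R_def by (cases l) simp_all
        qed
      qed simp
    qed
    then obtain f1 F1 where f1: "pert G f1 F1" "small (\<epsilon>/4) f1 F1" "\<forall>z\<in>G. W z + jet (F1 z) \<in> U"
        "\<forall>l\<in>UNIV. ?m {z \<in> G. R l z (jet (F1 z))} \<ge> (if l then \<theta> - e else 1 - \<theta> - e) * ?m G - \<eta>"
      by (elim exE conjE)
    define W1 where "W1 z = W z + jet (F1 z)" for z
    have W1: "continuous_on G W1" unfolding W1_def
      by (intro continuous_intros W continuous_on_subset[OF pert_jet_continuous[OF f1(1)]]) auto
    define Ga where "Ga = {z \<in> G. W1 z \<in> ball \<alpha> \<rho>0}"
    define Gb where "Gb = {z \<in> G. W1 z \<in> ball \<beta> \<rho>0}"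
    have Ga: "open Ga" "bounded Ga" "Ga \<subseteq> G" and Gb: "open Gb" "bounded Gb" "Gb \<subseteq> G"
      unfolding Ga_def Gb_def W1_def
      using open_level_set[OF G(1) W(1) f1(1) open_ball] bounded_subset[OF G(2)] by auto
    have disj: "Ga \<inter> Gb = {}"
    proof -
      have False if "dist \<alpha> x < \<rho>0" "dist \<beta> x < \<rho>0" for x
        using that r0(4) dist_triangle_half_l[of \<alpha> x "2 * \<rho>0" \<beta>] by (simp add: dist_commute)
      then show ?thesis unfolding Ga_def Gb_def mem_ball by blast
    qed
    obtain f2 F2 where f2: "pert Ga f2 F2" "small (\<epsilon>/4) f2 F2" "\<forall>y\<in>Ga. W1 y + jet (F2 y) \<in> U"
       "\<forall>l\<in>L. ?m {y \<in> Ga. W1 y + jet (F2 y) \<in> V l} \<ge> (c1 l - \<epsilon>/4) * ?m Ga"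
    proof -
      have "W1 ` Ga \<subseteq> ball \<alpha> \<rho>1" using r0 by (auto simp: Ga_def)
      with r1(2) Ga(1,2) continuous_on_subset[OF W1 Ga(3)] have "attains L U V c1 (\<epsilon>/4) Ga W1" by blast
      then show thesis using that unfolding attains_def by blast
    qed
    obtain f3 F3 where f3: "pert Gb f3 F3" "small (\<epsilon>/4) f3 F3" "\<forall>y\<in>Gb. W1 y + jet (F3 y) \<in> U"
       "\<forall>l\<in>L. ?m {y \<in> Gb. W1 y + jet (F3 y) \<in> V l} \<ge> (c2 l - \<epsilon>/4) * ?m Gb"
    proof -
      have "W1 ` Gb \<subseteq> ball \<beta> \<rho>2" using r0 by (auto simp: Gb_def)
      with r2(2) Gb(1,2) continuous_on_subset[OF W1 Gb(3)] have "attains L U V c2 (\<epsilon>/4) Gb W1" by blast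
      then show thesis using that unfolding attains_def by blast
    qed
    define f where "f y = f1 y + (f2 y + f3 y)" for y
    define F where "F y h = F1 y h + (F2 y h + F3 y h)" for y h
    have jF: "W y + jet (F y) = W1 y + (jet (F2 y) + jet (F3 y))" for y
      unfolding F_def[abs_def] W1_def by (simp add: jet_add add.assoc)
    have jFa: "W y + jet (F y) = W1 y + jet (F2 y)" if "y \<notin> Gb" for y
      using pert_outside(3)[OF f3(1) that] by (simp add: jF)
    have jFb: "W y + jet (F y) = W1 y + jet (F3 y)" if "y \<notin> Ga" for y
      using pert_outside(3)[OF f2(1) that] by (simp add: jF)
    have pf: "pert G f F" unfolding f_def[abs_def] F_def[abs_def]
      by (intro pert_add f1(1) pert_mono[OF f2(1) Ga(3)] pert_mono[OF f3(1) Gb(3)])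
    show "attains L U V (\<lambda>l. \<theta> * c1 l + (1 - \<theta>) * c2 l) \<epsilon> G W"
      unfolding attains_def
    proof (intro exI[of _ f] exI[of _ F] conjI ballI pf)
      show "small \<epsilon> f F" unfolding f_def[abs_def] F_def[abs_def]
        by (rule small_mono[OF small_add[OF f1(2) small_add_disjoint[OF f2(2) f3(2) f2(1) f3(1) disj]]]) (use eps in auto)
      fix y assume y: "y \<in> G"
      show "W y + jet (F y) \<in> U"
      proof (cases "y \<in> Ga")
        case True
        then have "y \<notin> Gb" using disj by blast
        with True show ?thesis using jFa[of y] f2(3) by simp
      next
        case False
        show ?thesis
        proof (cases "y \<in> Gb")
          case True then show ?thesis using jFb[OF False] f3(3) by simp
        next
          case 2: False
          show ?thesis using jFb[OF False] pert_outside(3)[OF f3(1) 2] f1(3) y by (simp add: W1_def)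
        qed
      qed
    next
      fix l assume l: "l \<in> L"
      let ?Sa = "{y \<in> Ga. W1 y + jet (F2 y) \<in> V l}" and ?Sb = "{y \<in> Gb. W1 y + jet (F3 y) \<in> V l}"
      have Sa: "?Sa \<in> lmeasurable"
        by (rule lmeasurable_level_set[OF Ga(1,2) continuous_on_subset[OF W1 Ga(3)] f2(1) V[OF l]])
      have Sb: "?Sb \<in> lmeasurable"
        by (rule lmeasurable_level_set[OF Gb(1,2) continuous_on_subset[OF W1 Gb(3)] f3(1) V[OF l]])
      have "?m ?Sa + ?m ?Sb = ?m (?Sa \<union> ?Sb)"
        by (rule measure_Un2[OF Sa Sb, THEN trans, symmetric]) (use disj in \<open>auto intro!: arg_cong[where f = ?m]\<close>)
      also have "\<dots> \<le> ?m {y \<in> G. W y + jet (F y) \<in> V l}"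
      proof (rule measure_mono_fmeasurable)
        show "?Sa \<union> ?Sb \<subseteq> {y \<in> G. W y + jet (F y) \<in> V l}" using jFa jFb disj Ga(3) Gb(3) by force
        show "?Sa \<union> ?Sb \<in> sets lebesgue" using Sa Sb by auto
        show "{y \<in> G. W y + jet (F y) \<in> V l} \<in> lmeasurable" by (rule lmeasurable_level_set[OF G W(1) pf V[OF l]])
      qed
      finally have 1: "?m ?Sa + ?m ?Sb \<le> ?m {y \<in> G. W y + jet (F y) \<in> V l}" .
      have 2: "(c1 l - \<epsilon>/4) * ?m Ga \<le> ?m ?Sa" "(c2 l - \<epsilon>/4) * ?m Gb \<le> ?m ?Sb" using f2(4) f3(4) l by auto
      have "Gb - Ga = Gb" using disj by blast
      then have "?m Ga + ?m Gb = ?m (Ga \<union> Gb)"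
        using measure_Un2[OF lmeasurable_open_bounded[OF Ga(1,2)] lmeasurable_open_bounded[OF Gb(1,2)]] by simp
      also have "\<dots> \<le> ?m G" by (rule measure_mono_fmeasurable[OF _ _ Gm]) (use Ga Gb in auto)
      finally have 3: "?m Ga + ?m Gb \<le> ?m G" .
      show "(\<theta> * c1 l + (1 - \<theta>) * c2 l - \<epsilon>) * ?m G \<le> ?m {y \<in> G. W y + jet (F y) \<in> V l}"
      proof (cases "?m G = 0")
        case True then show ?thesis by simp
      next
        case False
        have 4: "?m Ga \<ge> (\<theta> - 2 * e) * ?m G" "?m Gb \<ge> (1 - \<theta> - 2 * e) * ?m G"
          using bspec[OF f1(4) UNIV_I, of True] bspec[OF f1(4) UNIV_I, of False] False
          unfolding Ga_def Gb_def W1_def R_def \<eta>_def by (simp_all add: algebra_simps)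
        have "c1 l * ?m Ga \<ge> c1 l * ((\<theta> - 2 * e) * ?m G)" "c2 l * ?m Gb \<ge> c2 l * ((1 - \<theta> - 2 * e) * ?m G)"
          using 4 c1(2)[OF l] c2(2)[OF l] by (auto intro!: mult_left_mono)
        moreover have "c1 l * (e * ?m G) \<le> 1 * (e * ?m G)" "c2 l * (e * ?m G) \<le> 1 * (e * ?m G)"
          using c1(2)[OF l] c2(2)[OF l] e by (intro mult_right_mono; simp)+
        moreover have "c1 l * ((\<theta> - 2 * e) * ?m G) = \<theta> * c1 l * ?m G - 2 * (c1 l * (e * ?m G))"
          "c2 l * ((1 - \<theta> - 2 * e) * ?m G) = (1 - \<theta>) * c2 l * ?m G - 2 * (c2 l * (e * ?m G))"
          by (simp_all add: algebra_simps)
        ultimately have 5: "c1 l * ?m Ga + c2 l * ?m Gb \<ge> \<theta> * c1 l * ?m G + (1 - \<theta>) * c2 l * ?m G - 4 * (e * ?m G)"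
          by linarith
        have 6: "e * ?m G \<le> \<epsilon>/8 * ?m G" using e by (intro mult_right_mono) auto
        have 7: "\<epsilon>/4 * (?m Ga + ?m Gb) \<le> \<epsilon>/4 * ?m G" using 3 eps by (intro mult_left_mono) auto
        have 8: "\<epsilon> * ?m G \<ge> 0" using eps by simp
        have "(c1 l - \<epsilon>/4) * ?m Ga + (c2 l - \<epsilon>/4) * ?m Gb = c1 l * ?m Ga + c2 l * ?m Gb - \<epsilon>/4 * (?m Ga + ?m Gb)"
          "(\<theta> * c1 l + (1 - \<theta>) * c2 l - \<epsilon>) * ?m G = \<theta> * c1 l * ?m G + (1 - \<theta>) * c2 l * ?m G - \<epsilon> * ?m G"
          by (simp_all add: algebra_simps)
        with 1 2 5 6 7 8 show ?thesis by linarith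
      qed
    qed
  qed
qed

section \<open>Consequences of Condition O\<close>

lemma wave_cone_scaleR: "x \<in> wave_cone \<Longrightarrow> t *\<^sub>R x \<in> wave_cone"
proof -
  assume "x \<in> wave_cone"
  then obtain p a B where x: "x = (outerp p a, B)" "a \<noteq> 0" "B *v a = 0" unfolding wave_cone_def by blast
  have "t *\<^sub>R x = (outerp (t *\<^sub>R p) a, t *\<^sub>R B)" using x(1) by (simp add: outerp_def vec_eq_iff)
  moreover have "(t *\<^sub>R B) *v a = 0" using x(3) by (simp add: scaleR_matrix_vector_assoc[symmetric])
  ultimately show ?thesis using x(2) unfolding wave_cone_def by blast
qed

locale condition_O_locale =
  fixes N :: nat and \<sigma> :: "real ^ 'n::finite ^ 'm::finite \<Rightarrow> real ^ 'n ^ 'm" and r0 \<delta>1 \<delta>2 \<delta>0 :: real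
    and \<kappa> :: "nat \<Rightarrow> ('n, 'm) pt \<Rightarrow> real" and \<gamma> :: "nat \<Rightarrow> ('n, 'm) pt \<Rightarrow> ('n, 'm) pt"
  assumes cond: "condition_O N \<sigma> r0 \<delta>1 \<delta>2 \<delta>0 \<kappa> \<gamma>" and N2: "N \<ge> 2"
begin

text \<open>\<open>cor i\<close> is the corner \<pi>_i of the loop, and \<open>tip i\<close> the
  point \<xi>_i of the graph on the prolonged edge that starts there.\<close>

abbreviation "cor \<equiv> piN \<gamma>"
abbreviation "tip \<equiv> xiN \<kappa> \<gamma>"
abbreviation "S i l \<equiv> S_set \<kappa> \<gamma> i r0 l"
abbreviation "Sig l \<equiv> Sigma_r N \<delta>0 \<kappa> \<gamma> r0 l"
definition "A i l \<rho> = l *\<^sub>R tip i \<rho> + (1 - l) *\<^sub>R cor i \<rho>"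
definition "TT l = (\<Union>i\<in>{1..N}. S i l)"
text \<open>Cyclic predecessor: the edge \<gamma> at index \<open>pr i\<close> runs from corner
  \<open>pr i\<close> to corner \<open>i\<close>, also for i = 1, because the edges sum to
  zero.\<close>

definition "pr i = (if i = 1 then N else i - 1)"

lemma params: "r0 > 0" "0 < \<delta>1" "\<delta>1 < \<delta>2" "\<delta>2 < \<delta>0" "\<delta>0 < 1" "0 < \<delta>0" "\<delta>1 < 1"
  using cond unfolding condition_O_def by auto

lemma kappa_gamma:
  assumes "i \<in> {1..N}" "\<rho> \<in> cball 0 r0"
  shows "1 / \<delta>2 \<le> \<kappa> i \<rho>" "\<kappa> i \<rho> \<le> 1 / \<delta>1" "\<gamma> i \<rho> \<in> wave_cone" "\<kappa> i \<rho> > 0"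
proof -
  show "1 / \<delta>2 \<le> \<kappa> i \<rho>" "\<kappa> i \<rho> \<le> 1 / \<delta>1" "\<gamma> i \<rho> \<in> wave_cone"
    using cond assms unfolding condition_O_def by auto
  moreover have "1 / \<delta>2 > 0" using params by simp
  ultimately show "\<kappa> i \<rho> > 0" by linarith
qed

lemma cont_\<kappa>\<gamma>:
  assumes "i \<in> {1..N}" shows "continuous_on (cball 0 r0) (\<kappa> i)" "continuous_on (cball 0 r0) (\<gamma> i)"
  using cond assms unfolding condition_O_def by auto

lemma gamma_sum: "\<rho> \<in> cball 0 r0 \<Longrightarrow> (\<Sum>i\<in>{1..N}. \<gamma> i \<rho>) = 0"
  using cond unfolding condition_O_def by auto

lemma Xi_graph: "i \<in> {1..N} \<Longrightarrow> \<rho> \<in> cball 0 r0 \<Longrightarrow> tip i \<rho> \<in> graph_of \<sigma>"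
  using cond unfolding condition_O_def by auto

lemma fst_disjoint:
  assumes "i \<in> {1..N}" "j \<in> {1..N}" "i \<noteq> j"
  shows "fst ` tip i ` cball 0 r0 \<inter> fst ` tip j ` cball 0 r0 = {}" "fst ` cor i ` cball 0 r0 \<inter> fst ` cor j ` cball 0 r0 = {}"
  using cond assms unfolding condition_O_def by auto

lemma open_S: "i \<in> {1..N} \<Longrightarrow> l \<in> {0} \<union> {\<delta>0..<1} \<Longrightarrow> open (S i l)"
  using cond unfolding condition_O_def by auto

lemma open_TT: "l \<in> {\<delta>0..<1} \<Longrightarrow> open (TT l)"
  unfolding TT_def by (intro open_UN ballI open_S) auto

lemma cont_cor:
  assumes "i \<in> {1..Suc N}" shows "continuous_on (cball 0 r0) (cor i)"
proof -
  have "continuous_on (cball 0 r0) (\<gamma> k)" if "k \<in> {1..<i}" for k using that assms by (intro cont_\<kappa>\<gamma>) auto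
  then show ?thesis unfolding piN_def by (intro continuous_intros)
qed

lemma cont_tip:
  assumes "i \<in> {1..N}" shows "continuous_on (cball 0 r0) (tip i)"
  unfolding xiN_def by (intro continuous_intros cont_cor cont_\<kappa>\<gamma>) (use assms in auto)

lemma pr_mem: "i \<in> {1..N} \<Longrightarrow> pr i \<in> {1..N}" "i \<in> {1..N} \<Longrightarrow> pr i \<noteq> i"
  using N2 by (auto simp: pr_def)

lemma cor_pr:
  assumes "i \<in> {1..N}" "\<rho> \<in> cball 0 r0"
  shows "cor i \<rho> = cor (pr i) \<rho> + \<gamma> (pr i) \<rho>"
proof (cases "i = 1")
  case True
  have "{1..N} = insert N {1..<N}" using N2 by auto
  then have "(\<Sum>k\<in>{1..<N}. \<gamma> k \<rho>) + \<gamma> N \<rho> = 0" using gamma_sum[OF assms(2)] by (simp add: add.commute)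
  then show ?thesis using True by (simp add: pr_def piN_def add.assoc)
next
  case False
  then have "{1..<i} = insert (i - 1) {1..<i - 1}" using assms(1) by auto
  then show ?thesis using False by (simp add: pr_def piN_def add_ac)
qed

text \<open>A vanishing edge would make two consecutive corners coincide, against the disjointness
  in (P1)(ii).\<close>

lemma gamma_nz:
  assumes "i \<in> {1..N}" "\<rho> \<in> cball 0 r0"
  shows "\<gamma> (pr i) \<rho> \<noteq> 0"
proof
  assume "\<gamma> (pr i) \<rho> = 0"
  then have "cor i \<rho> = cor (pr i) \<rho>" using cor_pr[OF assms] by simp
  moreover have "fst (cor i \<rho>) \<in> fst ` cor i ` cball 0 r0" "fst (cor (pr i) \<rho>) \<in> fst ` cor (pr i) ` cball 0 r0"
    using assms(2) by (intro imageI; assumption)+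
  ultimately have "fst (cor i \<rho>) \<in> fst ` cor i ` cball 0 r0 \<inter> fst ` cor (pr i) ` cball 0 r0" by simp
  then show False using fst_disjoint(2)[of i "pr i"] pr_mem[OF assms(1)] assms(1) by auto
qed

lemma pr_surj:
  assumes "j \<in> {1..N}" shows "\<exists>i\<in>{1..N}. pr i = j"
proof (cases "j = N")
  case True then show ?thesis using N2 by (intro bexI[of _ 1]) (auto simp: pr_def)
next
  case False then show ?thesis using assms by (intro bexI[of _ "Suc j"]) (auto simp: pr_def)
qed

lemma gamma_nz': "i \<in> {1..N} \<Longrightarrow> \<rho> \<in> cball 0 r0 \<Longrightarrow> \<gamma> i \<rho> \<noteq> 0"
  using gamma_nz pr_surj by metis

lemma A_eq: "A i l \<rho> = cor i \<rho> + (l * \<kappa> i \<rho>) *\<^sub>R \<gamma> i \<rho>"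
  by (simp add: A_def xiN_def algebra_simps)

lemma S_iff: "w \<in> S i l \<longleftrightarrow> (\<exists>\<rho>\<in>ball 0 r0. w = A i l \<rho>)"
  by (auto simp: S_set_def A_def)

lemma S_0: "w \<in> S i 0 \<longleftrightarrow> (\<exists>\<rho>\<in>ball 0 r0. w = cor i \<rho>)"
  by (auto simp: S_set_def)

lemma A_mem:
  assumes "i \<in> {1..N}" "\<rho> \<in> ball 0 r0" shows "A i l \<rho> \<in> S i l" "A i l \<rho> \<in> TT l"
proof -
  show "A i l \<rho> \<in> S i l" using assms(2) S_iff by blast
  then show "A i l \<rho> \<in> TT l" using assms(1) unfolding TT_def by blast
qed

lemma Sig_mono: "l \<le> l' \<Longrightarrow> Sig l \<subseteq> Sig l'"
  unfolding Sigma_r_def by (intro UN_mono) auto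

lemma SigI:
  assumes "\<delta>0 \<le> l'" "l' \<le> l" "i \<in> {1..N}" "\<alpha> \<in> S i l'" "\<beta> \<in> S i 0" "\<alpha> - \<beta> \<in> wave_cone"
  shows "closed_segment \<alpha> \<beta> \<subseteq> Sig l"
  using assms unfolding Sigma_r_def Lall_def L_set_def by fastforce

lemma SigE:
  assumes "w \<in> Sig l"
  obtains i l' \<alpha> \<beta> where "\<delta>0 \<le> l'" "l' \<le> l" "i \<in> {1..N}" "\<alpha> \<in> S i l'" "\<beta> \<in> S i 0" "\<alpha> - \<beta> \<in> wave_cone"
    "w \<in> closed_segment \<alpha> \<beta>"
  using assms unfolding Sigma_r_def Lall_def L_set_def by fastforce

text \<open>Translating both end points of a segment by the same small vector keeps their difference
  in the cone and, by (P2), keeps them in the open sets of admissible end points.\<close>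

lemma open_Sig:
  assumes "l < 1" shows "open (Sig l)"
  unfolding open_contains_ball
proof
  fix w assume "w \<in> Sig l"
  then obtain i l' \<alpha> \<beta> where s: "\<delta>0 \<le> l'" "l' \<le> l" "i \<in> {1..N}" "\<alpha> \<in> S i l'" "\<beta> \<in> S i 0" "\<alpha> - \<beta> \<in> wave_cone"
    "w \<in> closed_segment \<alpha> \<beta>" by (rule SigE)
  have "open (S i l')" "open (S i 0)" using s assms by (auto intro!: open_S)
  then obtain e1 e2 where e: "e1 > 0" "ball \<alpha> e1 \<subseteq> S i l'" "e2 > 0" "ball \<beta> e2 \<subseteq> S i 0"
    using s(4,5) by (metis openE)
  have "ball w (min e1 e2) \<subseteq> Sig l"
  proof
    fix y assume y: "y \<in> ball w (min e1 e2)"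
    define d where "d = y - w"
    have d: "norm d < e1" "norm d < e2" using y by (auto simp: d_def dist_norm norm_minus_commute)
    have "\<alpha> + d \<in> ball \<alpha> e1" "\<beta> + d \<in> ball \<beta> e2" using d by (simp_all add: dist_norm)
    then have "\<alpha> + d \<in> S i l'" "\<beta> + d \<in> S i 0" using e(2,4) by blast+
    moreover have "(\<alpha> + d) - (\<beta> + d) \<in> wave_cone" using s by simp
    ultimately have "closed_segment (\<alpha> + d) (\<beta> + d) \<subseteq> Sig l" using s by (intro SigI) auto
    moreover have "w + d \<in> closed_segment (\<alpha> + d) (\<beta> + d)"
    proof -
      have "d + w \<in> (\<lambda>x. d + x) ` closed_segment \<alpha> \<beta>" using s(7) by (rule imageI)
      then have "d + w \<in> closed_segment (d + \<alpha>) (d + \<beta>)" by (simp only: closed_segment_translation)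
      then show ?thesis by (simp only: add.commute)
    qed
    moreover have "w + d = y" by (simp add: d_def)
    ultimately show "y \<in> Sig l" by blast
  qed
  then show "\<exists>e>0. ball w e \<subseteq> Sig l" using e by (intro exI[of _ "min e1 e2"]) auto
qed

lemma segment_Sig:
  assumes "i \<in> {1..N}" "\<rho> \<in> ball 0 r0" "\<delta>0 \<le> l'" "l' \<le> l"
  shows "closed_segment (A i l' \<rho>) (cor i \<rho>) \<subseteq> Sig l" "A i l' \<rho> - cor i \<rho> \<in> wave_cone" "A i l' \<rho> \<noteq> cor i \<rho>"
    "A i l' \<rho> \<in> Sig l" "cor i \<rho> \<in> Sig l"
proof -
  have r: "\<rho> \<in> cball 0 r0" using assms(2) by auto
  show w: "A i l' \<rho> - cor i \<rho> \<in> wave_cone"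
    using kappa_gamma(3)[OF assms(1) r] by (simp add: A_eq wave_cone_scaleR)
  show "A i l' \<rho> \<noteq> cor i \<rho>"
    using gamma_nz'[OF assms(1) r] kappa_gamma(4)[OF assms(1) r] assms(3) params by (simp add: A_eq)
  show s: "closed_segment (A i l' \<rho>) (cor i \<rho>) \<subseteq> Sig l"
    by (rule SigI[OF assms(3,4,1) _ _ w]) (use assms(2) S_iff S_0 in blast)+
  then show "A i l' \<rho> \<in> Sig l" "cor i \<rho> \<in> Sig l" by auto
qed

lemma TT_Sig: "\<delta>0 \<le> l \<Longrightarrow> TT l \<subseteq> Sig l"
  unfolding TT_def using segment_Sig(4)[of _ _ l l] by (auto simp: S_iff)

lemma bounded_all: "\<exists>C>0. (\<forall>i\<in>{1..N}. \<forall>\<rho>\<in>cball 0 r0. norm (tip i \<rho>) \<le> C \<and> norm (cor i \<rho>) \<le> C) \<and>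
    (\<forall>l<1. \<forall>w\<in>Sig l. norm w \<le> C)"
proof -
  have "compact (tip i ` cball 0 r0 \<union> cor i ` cball 0 r0)" if "i \<in> {1..N}" for i
    using that by (intro compact_Un compact_continuous_image cont_tip cont_cor) auto
  then have "bounded (\<Union>i\<in>{1..N}. tip i ` cball 0 r0 \<union> cor i ` cball 0 r0)"
    by (intro bounded_UN ballI compact_imp_bounded) auto
  then obtain C where C: "C > 0" "\<forall>x\<in>(\<Union>i\<in>{1..N}. tip i ` cball 0 r0 \<union> cor i ` cball 0 r0). norm x \<le> C"
    using bounded_pos by blast
  have P: "norm (tip i \<rho>) \<le> C" "norm (cor i \<rho>) \<le> C" if "i \<in> {1..N}" "\<rho> \<in> cball 0 r0" for i \<rho>
    using C(2) that by blast+
  have AA: "norm (A i l \<rho>) \<le> C" if "i \<in> {1..N}" "\<rho> \<in> cball 0 r0" "0 \<le> l" "l \<le> 1" for i \<rho> l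
  proof -
    have "A i l \<rho> = (1 - (1 - l)) *\<^sub>R tip i \<rho> + (1 - l) *\<^sub>R cor i \<rho>" by (simp add: A_def)
    moreover have "tip i \<rho> \<in> cball 0 C" "cor i \<rho> \<in> cball 0 C" using P that by auto
    ultimately have "A i l \<rho> \<in> cball 0 C"
      using convexD[OF convex_cball[of 0 C], of "tip i \<rho>" "cor i \<rho>" l "1 - l"] that by simp
    then show ?thesis by simp
  qed
  have "norm w \<le> C" if l: "l < 1" "w \<in> Sig l" for l w
  proof -
    obtain i l' \<alpha> \<beta> where s: "\<delta>0 \<le> l'" "l' \<le> l" "i \<in> {1..N}" "\<alpha> \<in> S i l'" "\<beta> \<in> S i 0" "\<alpha> - \<beta> \<in> wave_cone"
      "w \<in> closed_segment \<alpha> \<beta>" using l(2) by (rule SigE)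
    obtain \<rho> \<rho>' where "\<rho> \<in> ball 0 r0" "\<alpha> = A i l' \<rho>" "\<rho>' \<in> ball 0 r0" "\<beta> = cor i \<rho>'" using s(4,5) S_iff S_0 by metis
    then have "\<alpha> \<in> cball 0 C" "\<beta> \<in> cball 0 C" using AA[of i \<rho> l'] P[of i \<rho>'] s l params by auto
    then have "closed_segment \<alpha> \<beta> \<subseteq> cball 0 C" by (intro closed_segment_subset) auto
    then show ?thesis using s(7) by auto
  qed
  then show ?thesis using C(1) P by blast
qed

section \<open>Splitting around the loop of corners\<close>

text \<open>Bounds the fraction that one splitting at a corner leaves outside the target.\<close>

definition "qq = 1 - \<delta>1"

lemma qq: "0 < qq" "qq < 1" using params by (auto simp: qq_def)

text \<open>\<open>\<pi>\<^sub>i\<close> splits along \<open>\<gamma>\<close> of the cyclic predecessor: a fraction at least \<open>\<delta>\<^sub>1\<close> lands in the target, and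
  the rest at the preceding corner of the \<open>T\<^sub>N\<close>-configuration, where the splitting is iterated.\<close>
lemma attainable_corner_step:
  assumes l: "\<delta>0 \<le> l" "l < 1" and L: "finite L" and V: "\<And>j. j \<in> L \<Longrightarrow> open (V j)"
    and i: "i \<in> {1..N}" and \<rho>: "\<rho> \<in> ball 0 r0"
    and c: "attainable L (Sig l) V (cor (pr i) \<rho>) c" "\<And>j. j \<in> L \<Longrightarrow> 0 \<le> c j \<and> c j \<le> 1"
  shows "\<exists>t. \<delta>1 \<le> t \<and> t \<le> 1 \<and> attainable L (Sig l) V (cor i \<rho>)
     (\<lambda>j. t * (if A (pr i) l \<rho> \<in> V j then 1 else 0) + (1 - t) * c j)"
proof -
  let ?k = "pr i"
  have k: "?k \<in> {1..N}" by (rule pr_mem(1)[OF i])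
  have r: "\<rho> \<in> cball 0 r0" using \<rho> by auto
  have l0: "l > 0" using l params by linarith
  \<comment> \<open>\<open>cor i \<rho>\<close> lies on the segment from
    \<open>cor (pr i) \<rho>\<close> to \<open>A (pr i) l \<rho>\<close>, and \<open>t\<close> is
    the weight of the latter. The product in the denominator is at least \<delta>0/\<delta>2 > 1, so
    \<open>t < 1\<close>; it is at most 1/\<delta>1, so \<open>t\<close> is at least
    \<delta>1.\<close>
  define t where "t = 1 / (l * \<kappa> ?k \<rho>)"
  note kg = kappa_gamma[OF k r]
  have t0: "t > 0" using kg(4) l0 by (simp add: t_def)
  have t1: "t < 1"
  proof -
    have "l * \<kappa> ?k \<rho> \<ge> \<delta>0 * (1 / \<delta>2)" using kg l params by (intro mult_mono) auto
    moreover have "\<delta>0 * (1 / \<delta>2) > 1" using params by simp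
    ultimately show ?thesis by (simp add: t_def)
  qed
  have td: "t \<ge> \<delta>1"
  proof -
    have "l * \<kappa> ?k \<rho> \<le> 1 * (1 / \<delta>1)" using kg l l0 by (intro mult_mono) auto
    then show ?thesis unfolding t_def using kg(4) l0 params by (simp add: field_simps)
  qed
  have eq: "cor i \<rho> = t *\<^sub>R A ?k l \<rho> + (1 - t) *\<^sub>R cor ?k \<rho>"
    unfolding cor_pr[OF i r] A_eq using kg(4) l0 by (simp add: t_def algebra_simps)
  have "attainable L (Sig l) V (t *\<^sub>R A ?k l \<rho> + (1 - t) *\<^sub>R cor ?k \<rho>)
     (\<lambda>j. t * (if A ?k l \<rho> \<in> V j then 1 else 0) + (1 - t) * c j)"
    by (rule attainable_split[OF segment_Sig(2,3)[OF k \<rho> l(1) order_refl] t0 t1 open_Sig[OF l(2)]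
          segment_Sig(1)[OF k \<rho> l(1) order_refl] V
          attainable_trivial[OF L open_Sig[OF l(2)] segment_Sig(4)[OF k \<rho> l(1) order_refl] V] _ c])
       auto
  then show ?thesis unfolding eq[symmetric] using t1 td by (intro exI[of _ t]) auto
qed

text \<open>Induction on the number of splittings: every passage to the preceding corner multiplies
  the fraction still missing by at most \<open>qq\<close>. The order of the corners is cyclic, so
  the induction can go on for any \<open>n\<close>.\<close>

lemma attainable_corner:
  assumes l: "\<delta>0 \<le> l" "l < 1" and L: "finite L" and V: "\<And>j. j \<in> L \<Longrightarrow> open (V j)"
    and T: "V t0 = TT l" and i: "i \<in> {1..N}" and \<rho>: "\<rho> \<in> ball 0 r0"
  shows "attainable L (Sig l) V (cor i \<rho>) (\<lambda>j. if j = t0 then 1 - qq ^ n else 0)"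
  using i
proof (induction n arbitrary: i)
  case 0
  show ?case
    by (rule attainable_mono[OF attainable_trivial[OF L open_Sig[OF l(2)] segment_Sig(5)[OF 0 \<rho> l(1) order_refl] V]]) auto
next
  case (Suc n)
  have k: "pr i \<in> {1..N}" by (rule pr_mem(1)[OF Suc.prems])
  have q: "qq ^ n \<le> 1" "qq ^ n \<ge> 0" using qq by (simp_all add: power_le_one)
  have "\<exists>t. \<delta>1 \<le> t \<and> t \<le> 1 \<and> attainable L (Sig l) V (cor i \<rho>)
     (\<lambda>j. t * (if A (pr i) l \<rho> \<in> V j then 1 else 0) + (1 - t) * (if j = t0 then 1 - qq ^ n else 0))"
    by (rule attainable_corner_step[OF l L V Suc.prems \<rho> Suc.IH[OF k]]) (use q in auto)
  then obtain t where t: "\<delta>1 \<le> t" "t \<le> 1" "attainable L (Sig l) V (cor i \<rho>)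
     (\<lambda>j. t * (if A (pr i) l \<rho> \<in> V j then 1 else 0) + (1 - t) * (if j = t0 then 1 - qq ^ n else 0))"
    by (elim exE conjE)
  have "A (pr i) l \<rho> \<in> V t0" using A_mem(2)[OF k \<rho>] by (simp add: T)
  moreover have "(1 - t) * qq ^ n \<le> qq * qq ^ n" using t q by (intro mult_right_mono) (auto simp: qq_def)
  ultimately show ?case
    using t(1) params by (intro attainable_mono[OF t(3)]) (use t in \<open>auto simp: algebra_simps\<close>)
qed

text \<open>The first splitting is singled out: it puts at least \<delta>1 into the component of the
  predecessor, and the remainder is sent to the whole target. That identified component later
  produces the oscillation of the gradient.\<close>

lemma attainable_corner_pr:
  assumes l: "\<delta>0 \<le> l" "l < 1" and L: "finite L" and V: "\<And>j. j \<in> L \<Longrightarrow> open (V j)"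
    and T: "V t0 = TT l" and i: "i \<in> {1..N}" and \<rho>: "\<rho> \<in> ball 0 r0"
    and s: "V s = S (pr i) l" "s \<noteq> t0"
  shows "attainable L (Sig l) V (cor i \<rho>) (\<lambda>j. if j = t0 then 1 - qq ^ n else if j = s then \<delta>1 else 0)"
proof -
  have k: "pr i \<in> {1..N}" by (rule pr_mem(1)[OF i])
  have q: "qq ^ n \<le> 1" "qq ^ n \<ge> 0" using qq by (simp_all add: power_le_one)
  have a: "attainable L (Sig l) V (cor (pr i) \<rho>) (\<lambda>j. if j = t0 then 1 - qq ^ n else 0)"
    by (rule attainable_corner[where V = V and ?t0.0 = t0]) (use l L V T k \<rho> in auto)
  have "\<exists>t. \<delta>1 \<le> t \<and> t \<le> 1 \<and> attainable L (Sig l) V (cor i \<rho>)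
     (\<lambda>j. t * (if A (pr i) l \<rho> \<in> V j then 1 else 0) + (1 - t) * (if j = t0 then 1 - qq ^ n else 0))"
    by (rule attainable_corner_step[OF l L V i \<rho> a]) (use q in auto)
  then obtain t where t: "\<delta>1 \<le> t" "t \<le> 1" "attainable L (Sig l) V (cor i \<rho>)
     (\<lambda>j. t * (if A (pr i) l \<rho> \<in> V j then 1 else 0) + (1 - t) * (if j = t0 then 1 - qq ^ n else 0))"
    by (elim exE conjE)
  have m: "A (pr i) l \<rho> \<in> V t0" "A (pr i) l \<rho> \<in> V s" using A_mem[OF k \<rho>] s by (simp_all add: T)
  have t0: "0 \<le> t" using t(1) params by linarith
  have tq: "(1 - t) * qq ^ n \<le> qq ^ n" using t q params by (intro mult_left_le_one_le) auto
  show ?thesis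
    using t0 by (intro attainable_mono[OF t(3)]) (use t m tq s in \<open>auto simp: algebra_simps\<close>)
qed

lemma A_convex:
  assumes "l > 0"
  shows "A i l' \<rho> = (l' / l) *\<^sub>R A i l \<rho> + (1 - l' / l) *\<^sub>R cor i \<rho>"
  using assms by (simp add: A_eq algebra_simps)

text \<open>\<open>A i l' \<rho>\<close> lies on the segment from its corner to
  \<open>A i l \<rho>\<close>, with weight l'/l on the latter. When l' and l are both near 1, most
  of the volume thus moves only a short way along this segment, and just the fraction 1 - l'/l is
  sent to the corner.\<close>

lemma attainable_S:
  assumes l: "\<delta>0 \<le> l" "l < 1" "\<delta>0 \<le> l'" "l' < l" and L: "finite L" and V: "\<And>j. j \<in> L \<Longrightarrow> open (V j)"
    and i: "i \<in> {1..N}" and \<rho>: "\<rho> \<in> ball 0 r0"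
    and c: "attainable L (Sig l) V (cor i \<rho>) c" "\<And>j. j \<in> L \<Longrightarrow> 0 \<le> c j \<and> c j \<le> 1"
  shows "attainable L (Sig l) V (A i l' \<rho>)
     (\<lambda>j. (l' / l) * (if A i l \<rho> \<in> V j then 1 else 0) + (1 - l' / l) * c j)"
proof -
  have l0: "l > 0" using l params by linarith
  have "0 < l' / l" "l' / l < 1" using l l0 params by auto
  then show ?thesis
    unfolding A_convex[OF l0, of i l']
    by (intro attainable_split[OF segment_Sig(2,3)[OF i \<rho> l(1) order_refl] _ _ open_Sig[OF l(2)]
          segment_Sig(1)[OF i \<rho> l(1) order_refl] V
          attainable_trivial[OF L open_Sig[OF l(2)] segment_Sig(4)[OF i \<rho> l(1) order_refl] V] _ c])
       auto
qed

text \<open>A point of \<open>Sig l\<close> lies on a segment whose two end points both reach the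
  target up to \<open>qq ^ n\<close>. Splitting along that segment averages two equal
  fractions.\<close>

lemma attainable_Sig:
  assumes l: "\<delta>0 \<le> l" "l < 1" and L: "finite L" and V: "\<And>j. j \<in> L \<Longrightarrow> open (V j)"
    and T: "V t0 = TT l" and w: "w \<in> Sig l"
  shows "attainable L (Sig l) V w (\<lambda>j. if j = t0 then 1 - qq ^ n else 0)"
proof -
  obtain i l' \<alpha> \<beta> where s: "\<delta>0 \<le> l'" "l' \<le> l" "i \<in> {1..N}" "\<alpha> \<in> S i l'" "\<beta> \<in> S i 0" "\<alpha> - \<beta> \<in> wave_cone"
    "w \<in> closed_segment \<alpha> \<beta>" using w by (rule SigE)
  have q: "qq ^ n \<le> 1" "qq ^ n \<ge> 0" using qq by (simp_all add: power_le_one)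
  let ?c = "\<lambda>j. if j = t0 then 1 - qq ^ n else 0"
  obtain \<rho> \<rho>' where r: "\<rho> \<in> ball 0 r0" "\<alpha> = A i l' \<rho>" "\<rho>' \<in> ball 0 r0" "\<beta> = cor i \<rho>'" using s(4,5) S_iff S_0 by metis
  have cor: "attainable L (Sig l) V (cor i \<rho>) ?c" if "\<rho> \<in> ball 0 r0" for \<rho>
    by (rule attainable_corner[where V = V and ?t0.0 = t0]) (use l L V T s(3) that in auto)
  have b: "attainable L (Sig l) V \<beta> ?c" unfolding r(4) by (rule cor[OF r(3)])
  have inT: "A i l \<rho> \<in> V t0" using A_mem(2)[OF s(3) r(1)] by (simp add: T)
  have a: "attainable L (Sig l) V \<alpha> ?c"
  proof (cases "l' = l")
    case True
    show ?thesis unfolding r(2) True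
      by (rule attainable_mono[OF attainable_trivial[OF L open_Sig[OF l(2)] segment_Sig(4)[OF s(3) r(1) l(1) order_refl] V]])
         (use inT q in auto)
  next
    case False
    then have l': "l' < l" using s by simp
    have f: "0 \<le> l' / l" using s(1) l params by simp
    have "attainable L (Sig l) V \<alpha> (\<lambda>j. (l' / l) * (if A i l \<rho> \<in> V j then 1 else 0) + (1 - l' / l) * ?c j)"
      unfolding r(2)
      by (rule attainable_S[OF l s(1) l' L V s(3) r(1) cor[OF r(1)]]) (use q in auto)
    then show ?thesis
    proof (rule attainable_mono)
      fix j
      define x where "x = l' / l"
      have "(1 - x) * qq ^ n \<le> 1 * qq ^ n" using f q by (intro mult_right_mono) (auto simp: x_def)
      then show "?c j \<le> (l' / l) * (if A i l \<rho> \<in> V j then 1 else 0) + (1 - l' / l) * ?c j"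
        using inT f unfolding x_def[symmetric] by (auto simp: algebra_simps)
    qed
  qed
  obtain u where u: "0 \<le> u" "u \<le> 1" "w = (1 - u) *\<^sub>R \<alpha> + u *\<^sub>R \<beta>" using s(7) unfolding closed_segment_def by blast
  \<comment> \<open>The end points and the degenerate segment are separated off, since a genuine
    splitting needs a weight strictly between 0 and 1 and two distinct points.\<close>
  consider "u = 0 \<or> \<alpha> = \<beta>" | "u = 1" | "0 < u" "u < 1" "\<alpha> \<noteq> \<beta>" using u by linarith
  then show ?thesis
  proof cases
    case 1
    then have "w = \<alpha>" using u by (auto simp: algebra_simps)
    then show ?thesis using a by simp
  next
    case 2 then show ?thesis using b u by simp
  next
    case 3
    have "attainable L (Sig l) V ((1 - u) *\<^sub>R \<alpha> + (1 - (1 - u)) *\<^sub>R \<beta>) (\<lambda>j. (1 - u) * ?c j + (1 - (1 - u)) * ?c j)"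
      by (rule attainable_split[OF s(6) 3(3) _ _ open_Sig[OF l(2)] SigI[OF s(1-6)] V a _ b]) (use 3 q in auto)
    moreover have "(\<lambda>j. (1 - u) * ?c j + (1 - (1 - u)) * ?c j) = ?c" by (simp add: fun_eq_iff algebra_simps)
    ultimately show ?thesis unfolding u(3) by simp
  qed
qed

end

section \<open>One step of the iteration\<close>

lemma measure_compl_le:
  assumes "S \<in> lmeasurable" "{y \<in> S. P y} \<in> lmeasurable" "measure lebesgue {y \<in> S. P y} \<ge> x"
  shows "measure lebesgue {y \<in> S. \<not> P y} \<le> measure lebesgue S - x"
proof -
  have "{y \<in> S. \<not> P y} = S - {y \<in> S. P y}" by auto
  then have "measure lebesgue {y \<in> S. \<not> P y} = measure lebesgue S - measure lebesgue {y \<in> S. P y}"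
    using measurable_measure_Diff[of S lebesgue "{y \<in> S. P y}"] assms(1,2) by auto
  then show ?thesis using assms(3) by simp
qed

lemma inner_compact:
  fixes G :: "'a::euclidean_space set"
  assumes "open G" "bounded G" "e > 0" "compact C" "C \<subseteq> G"
  obtains K where "compact K" "K \<subseteq> G" "C \<subseteq> K" "measure lebesgue (G - K) \<le> e"
proof -
  have G: "G \<in> lmeasurable" by (rule lmeasurable_open_bounded[OF assms(1,2)])
  obtain K where K: "compact K" "K \<subseteq> G" "measure lebesgue (G - K) < e"
  proof -
    obtain T where T: "closed T" "T \<subseteq> G" "G - T \<in> lmeasurable" "emeasure lebesgue (G - T) < ennreal e"
      using sets_lebesgue_inner_closed[of G e] G assms(3) by (metis fmeasurableD)
    then have "compact T" using assms(2) bounded_subset compact_eq_bounded_closed by blast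
    moreover have "measure lebesgue (G - T) < e"
      using T(4) assms(3) emeasure_eq_measure2[OF T(3)] by (simp add: ennreal_less_iff)
    ultimately show thesis using T(2) that by blast
  qed
  have m: "G - K \<in> lmeasurable" by (rule fmeasurable_Diff[OF G fmeasurableD[OF lmeasurable_compact[OF K(1)]]])
  have "measure lebesgue (G - (K \<union> C)) \<le> measure lebesgue (G - K)"
    by (rule measure_mono_fmeasurable[OF _ _ m])
       (use fmeasurableD[OF fmeasurable_Diff[OF G fmeasurableD[OF lmeasurable_compact[OF compact_Un[OF K(1) assms(4)]]]]] in blast)+
  then show thesis using K assms(4,5) by (intro that[of "K \<union> C"]) (auto intro: compact_Un)
qed

text \<open>Passage from single values to a whole field: by continuity, near each \<open>y\<close>
  the field is close to \<open>W y\<close>, and the local perturbations are pasted. The index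
  \<open>b\<close> is special: its set is a ball about the current value and so depends on the
  point. In the conclusion it becomes a bound on the jet of the perturbation.\<close>

lemma attainable_cover:
  fixes G :: "((real ^ 'n::finite) \<times> real) set" and U :: "('n, 'm::finite) pt set"
  assumes G: "open G" "bounded G" and W: "continuous_on G W" "W ` G \<subseteq> U" and \<epsilon>: "\<epsilon> > 0" and R: "R > 0" and b: "b \<in> L"
    and V: "\<And>j. j \<in> L \<Longrightarrow> open (V j)" and c: "\<And>j. j \<in> L \<Longrightarrow> c j \<le> 1"
    and att: "\<And>y. y \<in> G \<Longrightarrow> \<exists>V'. attainable L U V' (W y) c \<and> V' b = ball (W y) R \<and> (\<forall>j\<in>L. j \<noteq> b \<longrightarrow> 0 < c j \<longrightarrow> V' j = V j)"
  shows "\<exists>f F. pert G f F \<and> small \<epsilon> f F \<and> (\<forall>y\<in>G. W y + jet (F y) \<in> U) \<and>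
    (\<forall>j\<in>L. j \<noteq> b \<longrightarrow> measure lebesgue {y \<in> G. W y + jet (F y) \<in> V j} \<ge> (c j - \<epsilon>) * measure lebesgue G) \<and>
    measure lebesgue {y \<in> G. norm (jet (F y)) < 2 * R} \<ge> (c b - \<epsilon>) * measure lebesgue G"
proof (cases "measure lebesgue G = 0")
  case True
  show ?thesis
  proof (intro exI[of _ "\<lambda>y. 0"] exI[of _ "\<lambda>y h. 0"] conjI ballI impI)
    show "W y + jet (\<lambda>h. 0) \<in> U" if "y \<in> G" for y using W(2) that by auto
    show "small \<epsilon> (\<lambda>y. 0) (\<lambda>y h. 0)" using \<epsilon> by simp
  qed (simp_all only: pert_0 True mult_zero_right measure_nonneg)
next
  case False
  let ?m = "measure lebesgue"
  have mG: "?m G > 0" using False measure_nonneg[of lebesgue G] by linarith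
  define Rl where "Rl j y x \<longleftrightarrow> (if j = b then norm x < 2 * R else W y + x \<in> V j)" for j y x
  have "\<exists>f F. pert G f F \<and> small \<epsilon> f F \<and> (\<forall>z\<in>G. W z + jet (F z) \<in> U) \<and>
        (\<forall>j\<in>L. ?m {z \<in> G. Rl j z (jet (F z))} \<ge> (c j - \<epsilon>/2) * ?m G - \<epsilon>/2 * ?m G)"
  proof (rule paste_local_perturbations[OF G])
    show "0 \<le> \<epsilon>" using \<epsilon> by simp
    show "0 < \<epsilon> / 2 * ?m G" using \<epsilon> mG by simp
    show "c j - \<epsilon> / 2 \<le> 1" if "j \<in> L" for j using c[OF that] \<epsilon> by simp
    show "W y + 0 \<in> U" if "y \<in> G" for y using W(2) that by auto
    show "{y \<in> G. Rl j y (jet (F y))} \<in> lmeasurable" if "j \<in> L" "pert G f F" for f F j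
    proof (cases "j = b")
      case True
      have "{y \<in> G. 0 + jet (F y) \<in> ball 0 (2 * R)} \<in> lmeasurable"
        by (rule lmeasurable_level_set[OF G _ that(2)]) auto
      then show ?thesis using True by (simp add: Rl_def)
    next
      case False
      then show ?thesis using lmeasurable_level_set[OF G W(1) that(2) V[OF that(1)]] by (simp add: Rl_def)
    qed
    show "\<exists>d>0. \<forall>r. 0 < r \<longrightarrow> r < d \<longrightarrow> ball y r \<subseteq> G \<longrightarrow>
      (\<exists>f F. pert (ball y r) f F \<and> small \<epsilon> f F \<and> (\<forall>z\<in>ball y r. W z + jet (F z) \<in> U) \<and>
        (\<forall>j\<in>L. ?m {z \<in> ball y r. Rl j z (jet (F z))} \<ge> (c j - \<epsilon>/2) * ?m (ball y r)))" if y: "y \<in> G" for y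
    proof -
      obtain V' where V': "attainable L U V' (W y) c" "V' b = ball (W y) R" "\<forall>j\<in>L. j \<noteq> b \<longrightarrow> 0 < c j \<longrightarrow> V' j = V j"
        using att[OF y] by blast
      have e2: "\<epsilon> / 2 > 0" using \<epsilon> by simp
      from V'(1)[unfolded attainable_def, rule_format, OF e2] obtain \<rho> where rho: "\<rho> > 0"
        "\<forall>G Wa. open G \<longrightarrow> bounded G \<longrightarrow> continuous_on G Wa \<longrightarrow> Wa ` G \<subseteq> ball (W y) \<rho> \<longrightarrow> attains L U V' c (\<epsilon>/2) G Wa"
        by (elim exE conjE)
      have "isCont W y" using W(1) G(1) y continuous_on_eq_continuous_at by blast
      moreover have "min \<rho> R > 0" using rho(1) R by simp
      ultimately obtain d where d: "d > 0" "\<forall>z. dist z y < d \<longrightarrow> dist (W z) (W y) < min \<rho> R"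
        unfolding continuous_at_eps_delta by blast
      show ?thesis
      proof (intro exI[of _ d] conjI allI impI d(1))
        fix r assume r: "0 < r" "r < d" "ball y r \<subseteq> G"
        have near: "dist (W y) (W z) < min \<rho> R" if "z \<in> ball y r" for z
        proof -
          have "dist z y < d" using that r(2) by (simp add: dist_commute)
          then have "dist (W z) (W y) < min \<rho> R" using d(2) by blast
          then show ?thesis by (simp only: dist_commute)
        qed
        have Wc: "continuous_on (ball y r) W" by (rule continuous_on_subset[OF W(1) r(3)])
        have "W ` ball y r \<subseteq> ball (W y) \<rho>" by (intro image_subsetI) (use near in simp)
        then have "attains L U V' c (\<epsilon>/2) (ball y r) W"
          by (rule rho(2)[rule_format, OF open_ball bounded_ball Wc])
        then obtain f F where f: "pert (ball y r) f F" "small (\<epsilon>/2) f F" "\<forall>z\<in>ball y r. W z + jet (F z) \<in> U"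
          "\<forall>j\<in>L. ?m {z \<in> ball y r. W z + jet (F z) \<in> V' j} \<ge> (c j - \<epsilon>/2) * ?m (ball y r)"
          unfolding attains_def by (elim exE conjE)
        show "\<exists>f F. pert (ball y r) f F \<and> small \<epsilon> f F \<and> (\<forall>z\<in>ball y r. W z + jet (F z) \<in> U) \<and>
          (\<forall>j\<in>L. ?m {z \<in> ball y r. Rl j z (jet (F z))} \<ge> (c j - \<epsilon>/2) * ?m (ball y r))"
        proof (intro exI[of _ f] exI[of _ F] conjI ballI f(1))
          show "small \<epsilon> f F" by (rule small_mono[OF f(2)]) (use \<epsilon> in simp)
          show "W z + jet (F z) \<in> U" if "z \<in> ball y r" for z using f(3) that by blast
          fix j assume j: "j \<in> L"
          consider "j = b" | "j \<noteq> b" "c j > 0" | "j \<noteq> b" "c j \<le> 0" by linarith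
          then show "?m {z \<in> ball y r. Rl j z (jet (F z))} \<ge> (c j - \<epsilon>/2) * ?m (ball y r)"
          proof cases
            case 1
            have "(c j - \<epsilon>/2) * ?m (ball y r) \<le> ?m {z \<in> ball y r. W z + jet (F z) \<in> ball (W y) R}"
              using f(4) j V'(2) 1 by auto
            also have "\<dots> \<le> ?m {z \<in> ball y r. 0 + jet (F z) \<in> ball 0 (2 * R)}"
            proof (rule measure_mono_fmeasurable)
              show "{z \<in> ball y r. W z + jet (F z) \<in> ball (W y) R} \<subseteq> {z \<in> ball y r. 0 + jet (F z) \<in> ball 0 (2 * R)}"
              proof
                fix z assume z: "z \<in> {z \<in> ball y r. W z + jet (F z) \<in> ball (W y) R}"
                have "norm (jet (F z)) = dist (W z + jet (F z)) (W z)" by (simp add: dist_norm)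
                also have "\<dots> \<le> dist (W y) (W z + jet (F z)) + dist (W y) (W z)" by (metis dist_commute dist_triangle)
                also have "\<dots> < R + R" using z near[of z] by (intro add_strict_mono) auto
                finally show "z \<in> {z \<in> ball y r. 0 + jet (F z) \<in> ball 0 (2 * R)}" using z by simp
              qed
              show "{z \<in> ball y r. W z + jet (F z) \<in> ball (W y) R} \<in> sets lebesgue"
                by (intro fmeasurableD lmeasurable_level_set[OF open_ball bounded_ball Wc f(1) open_ball])
              show "{z \<in> ball y r. 0 + jet (F z) \<in> ball 0 (2 * R)} \<in> lmeasurable"
                by (rule lmeasurable_level_set[OF open_ball bounded_ball _ f(1)]) auto
            qed
            finally show ?thesis using 1 by (simp add: Rl_def)
          next
            case 2
            then have "V' j = V j" using V'(3) j by blast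
            then show ?thesis using f(4) j 2 by (auto simp: Rl_def)
          next
            case 3
            then have "(c j - \<epsilon>/2) * ?m (ball y r) \<le> 0" using \<epsilon> by (intro mult_nonpos_nonneg) auto
            then show ?thesis using measure_nonneg order_trans by blast
          qed
        qed
      qed
    qed
  qed
  then obtain f F where f: "pert G f F" "small \<epsilon> f F" "\<forall>z\<in>G. W z + jet (F z) \<in> U"
      "\<forall>j\<in>L. ?m {z \<in> G. Rl j z (jet (F z))} \<ge> (c j - \<epsilon>/2) * ?m G - \<epsilon>/2 * ?m G" by (elim exE conjE)
  have eq: "(c j - \<epsilon>/2) * ?m G - \<epsilon>/2 * ?m G = (c j - \<epsilon>) * ?m G" for j by (simp add: algebra_simps)
  show ?thesis
  proof (intro exI[of _ f] exI[of _ F] conjI f(1-3) ballI impI)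
    show "?m {y \<in> G. W y + jet (F y) \<in> V j} \<ge> (c j - \<epsilon>) * ?m G" if "j \<in> L" "j \<noteq> b" for j
      using f(4) that unfolding eq by (auto simp: Rl_def)
    show "?m {y \<in> G. norm (jet (F y)) < 2 * R} \<ge> (c b - \<epsilon>) * ?m G"
      using f(4) b unfolding eq by (auto simp: Rl_def)
  qed
qed

text \<open>\<open>K\<close> carries almost all the volume of \<open>G\<close>, and off
  \<open>K\<close> the jet is zero. Later perturbations placed in the open complement of
  \<open>K\<close> therefore do not interfere with this one.\<close>

lemma pert_compact_support:
  fixes G :: "((real ^ 'n::finite) \<times> real) set"
  assumes "open G" "bounded G" "pert G f F" "e > 0"
  obtains K where "compact K" "K \<subseteq> G" "measure lebesgue (G - K) \<le> e" "\<And>y. y \<notin> K \<Longrightarrow> jet (F y) = 0"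
proof -
  obtain C where C: "compact C" "C \<subseteq> G" "\<forall>y. y \<notin> C \<longrightarrow> f y = 0 \<and> (\<forall>h. F y h = 0)"
    using assms(3) unfolding pert_def by blast
  obtain K where K: "compact K" "K \<subseteq> G" "C \<subseteq> K" "measure lebesgue (G - K) \<le> e"
    using inner_compact[OF assms(1,2,4) C(1,2)] by blast
  have "jet (F y) = 0" if "y \<notin> K" for y
  proof -
    have "F y = (\<lambda>h. 0)" using C(3) K(3) that by (intro ext) blast
    then show ?thesis by simp
  qed
  with K that show thesis by blast
qed

context condition_O_locale
begin

definition "bnd = (SOME C. C > 0 \<and> (\<forall>i\<in>{1..N}. \<forall>\<rho>\<in>cball 0 r0. norm (tip i \<rho>) \<le> C \<and> norm (cor i \<rho>) \<le> C) \<and>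
    (\<forall>l<1. \<forall>w\<in>Sig l. norm w \<le> C))"

lemma bnd: "bnd > 0" "i \<in> {1..N} \<Longrightarrow> \<rho> \<in> cball 0 r0 \<Longrightarrow> norm (tip i \<rho>) \<le> bnd"
  "i \<in> {1..N} \<Longrightarrow> \<rho> \<in> cball 0 r0 \<Longrightarrow> norm (cor i \<rho>) \<le> bnd" "l < 1 \<Longrightarrow> w \<in> Sig l \<Longrightarrow> norm w \<le> bnd"
  using someI_ex[OF bounded_all] unfolding bnd_def[symmetric] by blast+

lemma dist_A:
  assumes "i \<in> {1..N}" "\<rho> \<in> cball 0 r0"
  shows "dist (A i l \<rho>) (A i l' \<rho>) \<le> \<bar>l - l'\<bar> * (2 * bnd)" "dist (A i l \<rho>) (tip i \<rho>) \<le> \<bar>1 - l\<bar> * (2 * bnd)"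
proof -
  have n: "norm (tip i \<rho> - cor i \<rho>) \<le> 2 * bnd"
    using norm_triangle_ineq4[of "tip i \<rho>" "cor i \<rho>"] bnd(2,3)[OF assms] by linarith
  have "A i l \<rho> - A i l' \<rho> = (l - l') *\<^sub>R (tip i \<rho> - cor i \<rho>)" for l l' by (simp add: A_def algebra_simps)
  then have *: "dist (A i l \<rho>) (A i l' \<rho>) \<le> \<bar>l - l'\<bar> * (2 * bnd)" for l l'
    unfolding dist_norm using n by (simp add: mult_left_mono)
  show "dist (A i l \<rho>) (A i l' \<rho>) \<le> \<bar>l - l'\<bar> * (2 * bnd)" by (rule *)
  have "A i 1 \<rho> = tip i \<rho>" by (simp add: A_def)
  then show "dist (A i l \<rho>) (tip i \<rho>) \<le> \<bar>1 - l\<bar> * (2 * bnd)" using *[of l 1] by (simp add: abs_minus_commute)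
qed

text \<open>Index 1 gets the empty set as a placeholder: its actual set is a ball about the current
  value and is filled in by function update.\<close>

definition "idx l i j = (if j = (0::nat) then TT l else if j = 2 then S i l else if j = 3 then S (pr i) l else {})"

text \<open>Index 0 stands for the whole target, 1 for a small ball around the starting point, 2 and 3 for
  the two components of the target that both receive a positive fraction.\<close>
lemma attainable_S_step:
  assumes l: "\<delta>0 \<le> l'" "l' < l" "l < 1" and i: "i \<in> {1..N}" and w: "w \<in> S i l'"
    and R: "R > (l - l') * (2 * bnd)"
  shows "attainable {0,1,2,3} (Sig l) ((idx l i)(1 := ball w R)) w
     (\<lambda>j. if j = 0 then 1 - qq ^ n else if j = 3 then (1 - l' / l) * \<delta>1 else l' / l)"
proof -
  let ?V = "(idx l i)(1 := ball w R)"
  obtain \<rho> where r: "\<rho> \<in> ball 0 r0" "w = A i l' \<rho>" using w S_iff by blast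
  have dl: "\<delta>0 \<le> l" using l by simp
  have l0: "l > 0" using dl params by linarith
  have q: "qq ^ n \<le> 1" "qq ^ n \<ge> 0" using qq by (simp_all add: power_le_one)
  have V: "open (?V j)" if "j \<in> {0,1,2,3}" for j
    using open_TT[of l] open_S[OF i, of l] open_S[OF pr_mem(1)[OF i], of l] dl l by (auto simp: idx_def)
  let ?c = "\<lambda>j::nat. if j = 0 then 1 - qq ^ n else if j = 3 then \<delta>1 else 0"
  have a: "attainable {0,1,2,3} (Sig l) ?V (cor i \<rho>) ?c"
    by (rule attainable_corner_pr[OF dl l(3) _ V _ i r(1)]) (auto simp: idx_def)
  have "attainable {0,1,2,3} (Sig l) ?V (A i l' \<rho>) (\<lambda>j. (l' / l) * (if A i l \<rho> \<in> ?V j then 1 else 0) + (1 - l' / l) * ?c j)"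
    by (rule attainable_S[OF dl l(3) l(1,2) _ V i r(1) a]) (use q params in auto)
  then have b: "attainable {0,1,2,3} (Sig l) ?V w (\<lambda>j. (l' / l) * (if A i l \<rho> \<in> ?V j then 1 else 0) + (1 - l' / l) * ?c j)"
    by (simp only: r(2))
  have "dist w (A i l \<rho>) \<le> (l - l') * (2 * bnd)"
    using dist_A(1)[OF i, of \<rho> l' l] r l by (simp add: abs_minus_commute)
  then have m: "A i l \<rho> \<in> ball w R" using R by simp
  define x where "x = l' / l"
  have x: "0 \<le> x" "x \<le> 1" using l l0 params by (auto simp: x_def)
  have "(1 - x) * qq ^ n \<le> 1 * qq ^ n" using x q by (intro mult_right_mono) auto
  moreover have "(1 - x) * \<delta>1 \<ge> 0" using x params by simp
  ultimately show ?thesis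
    using b A_mem[OF i r(1), of l] m x unfolding x_def[symmetric]
    by (intro attainable_mono[OF b[unfolded x_def[symmetric]]]) (auto simp: idx_def algebra_simps)
qed

end

context condition_O_locale
begin

text \<open>Three perturbations are superposed. On \<open>G1\<close>, the part of \<open>B\<close>
  in one component of the old target, the volumes sent to that component and to its predecessor are
  both recorded. On \<open>G2\<close>, the rest of the old target up to a compact set, the field is
  moved to the new target while most of it moves only a little. On the small remainder
  \<open>G3\<close> it is pushed into the new target without control of the distance. Compact sets
  \<open>K1\<close> and \<open>K2\<close> that nearly fill \<open>G1\<close> and \<open>G2\<close>
  keep the layers apart.\<close>

lemma iteration_step:
  fixes W :: "(real ^ 'n) \<times> real \<Rightarrow> ('n, 'm) pt"
  assumes Q: "open Q" "bounded Q" and lam: "\<delta>0 \<le> lm" "lm < l" "l < 1" "(1 + lm) / 2 \<le> l"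
    and W: "continuous_on Q W" "W ` Q \<subseteq> Sig lm"
    and bad: "measure lebesgue {y \<in> Q. W y \<notin> TT lm} \<le> \<epsilon>0" and \<epsilon>1: "\<epsilon>1 > 0"
    and B: "open B" "B \<subseteq> Q" "measure lebesgue B > 0"
  defines "R \<equiv> (1 - lm) * (2 * bnd + 1)"
    and "\<eta> \<equiv> \<delta>1 * (1 - lm) * measure lebesgue B / (8 * N)"
  shows "\<exists>f F. pert Q f F \<and> small \<epsilon>1 f F \<and> (\<forall>y\<in>Q. W y + jet (F y) \<in> Sig l) \<and>
    measure lebesgue {y \<in> Q. W y + jet (F y) \<notin> TT l} \<le> \<epsilon>1 \<and>
    measure lebesgue {y \<in> Q. \<not> norm (jet (F y)) < 2 * R} \<le> 2 * (1 - lm + \<epsilon>1) * measure lebesgue Q + \<epsilon>0 + \<epsilon>1 \<and>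
    (\<epsilon>0 \<le> measure lebesgue B / 2 \<longrightarrow> (\<exists>i\<in>{1..N}. \<eta> \<le> measure lebesgue {y \<in> B. W y + jet (F y) \<in> S i l} \<and>
       \<eta> \<le> measure lebesgue {y \<in> B. W y + jet (F y) \<in> S (pr i) l}))"
proof -
  let ?m = "measure lebesgue" and ?L = "{0, 1, 2, 3 :: nat}"
  have lmr: "lm \<in> {\<delta>0..<1}" "l \<in> {\<delta>0..<1}" and l0: "l > 0" using lam params by auto
  have Qm: "Q \<in> lmeasurable" by (rule lmeasurable_open_bounded[OF Q])
  have Bb: "bounded B" by (rule bounded_subset[OF Q(2) B(2)])
  have Bm: "B \<in> lmeasurable" by (rule lmeasurable_open_bounded[OF B(1) Bb])
  have WB: "continuous_on B W" by (rule continuous_on_subset[OF W(1) B(2)])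
  have olev: "open {y \<in> G. W y \<in> V}" if "open G" "G \<subseteq> Q" "open V" for G V
  proof -
    have "open (G \<inter> W -` V)"
      by (rule continuous_open_preimage[OF continuous_on_subset[OF W(1) that(2)] that(1,3)])
    then show ?thesis by (simp add: vimage_def Int_def)
  qed
  have mlev: "{y \<in> G. W y \<in> V} \<in> lmeasurable" if "open G" "G \<subseteq> Q" "open V" for G V
    by (rule lmeasurable_open_bounded[OF olev[OF that]], rule bounded_subset[OF Q(2)]) (use that(2) in blast)
  have npos: "real N > 0" using N2 by simp
  define \<mu> where "\<mu> = 1 - lm"
  have mu: "\<mu> > 0" using lam by (simp add: \<mu>_def)
  have eta: "\<eta> > 0" using B(3) mu params npos by (simp add: \<eta>_def \<mu>_def)
  \<comment> \<open>The three bounds serve the sum of three small perturbations, the volume missed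
    by the target in three layers, and the lower bound \<eta> for the two recorded
    components.\<close>
  define e where "e = min (\<epsilon>1 / 3) (min (\<epsilon>1 / (6 * ?m Q + 1)) (\<eta> / (?m B + 1)))"
  have mQ: "?m Q \<ge> 0" by simp
  have e0: "e > 0"
  proof -
    have "\<epsilon>1 / (6 * ?m Q + 1) > 0" using \<epsilon>1 mQ by (intro divide_pos_pos) linarith+
    moreover have "\<eta> / (?m B + 1) > 0" using eta B(3) by (intro divide_pos_pos) linarith+
    ultimately show ?thesis using \<epsilon>1 by (simp add: e_def)
  qed
  have e1: "3 * e \<le> \<epsilon>1" by (simp add: e_def)
  have e2: "6 * e * ?m Q \<le> \<epsilon>1"
  proof -
    have "e \<le> \<epsilon>1 / (6 * ?m Q + 1)" by (simp add: e_def)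
    moreover have "6 * ?m Q + 1 > 0" using mQ by linarith
    ultimately have "e * (6 * ?m Q + 1) \<le> \<epsilon>1" by (simp add: pos_le_divide_eq)
    then show ?thesis using e0 by (simp add: algebra_simps)
  qed
  have e3: "e * (?m B + 1) \<le> \<eta>"
  proof -
    have "e \<le> \<eta> / (?m B + 1)" by (simp add: e_def)
    then show ?thesis using B(3) by (simp add: pos_le_divide_eq)
  qed
  obtain n where n: "qq ^ n < e" using real_arch_pow_inv[OF e0 qq(2)] by blast
  have R: "R > (l - lm) * (2 * bnd)" "R > 0"
  proof -
    have "(l - lm) * (2 * bnd) < \<mu> * (2 * bnd)" using lam bnd(1) by (simp add: \<mu>_def)
    moreover have "R = \<mu> * (2 * bnd) + \<mu>" by (simp add: R_def \<mu>_def algebra_simps)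
    ultimately show "R > (l - lm) * (2 * bnd)" using mu by linarith
    show "R > 0" using mu bnd(1) by (simp add: R_def \<mu>_def)
  qed
  \<comment> \<open>\<open>x\<close> is the fraction that moves only a little. Its complement is
    comparable to \<mu> = 1 - lm: the bound from below comes from the hypothesis that
    \<open>l\<close> is at least halfway from \<open>lm\<close> to 1.\<close>
  define x where "x = lm / l"
  have x: "0 < x" "x < 1" "\<delta>1 * \<mu> / 2 \<le> x" "1 - x \<ge> \<mu> / 2" "1 - x \<le> \<mu>"
  proof -
    have "lm > 0" using lam params by linarith
    then show "0 < x" "x < 1" using lam l0 by (auto simp: x_def)
    have "lm * l \<le> lm * 1" using \<open>lm > 0\<close> lam by (intro mult_left_mono) auto
    then have xl: "x \<ge> lm" using l0 by (simp add: x_def field_simps)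
    then show "1 - x \<le> \<mu>" by (simp add: \<mu>_def)
    have "\<delta>1 * \<mu> \<le> \<delta>1 * 1" using params \<open>lm > 0\<close> by (intro mult_left_mono) (auto simp: \<mu>_def)
    then show "\<delta>1 * \<mu> / 2 \<le> x" using xl lam params by linarith
    have "(1 - x) * l = l - lm" using l0 by (simp add: x_def algebra_simps)
    moreover have "(1 - x) * l \<le> (1 - x) * 1" using \<open>x < 1\<close> lam by (intro mult_left_mono) auto
    ultimately show "1 - x \<ge> \<mu> / 2" using lam by (simp add: \<mu>_def)
  qed
  \<comment> \<open>Pigeonhole: if the old target misses at most half of \<open>B\<close>, then one
    of its \<open>N\<close> components occupies at least the share 1/(2N) of
    \<open>B\<close>.\<close>
  have "\<exists>i\<in>{1..N}. \<epsilon>0 \<le> ?m B / 2 \<longrightarrow> ?m B / (2 * N) \<le> ?m {y \<in> B. W y \<in> S i lm}"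
  proof (rule ccontr)
    assume "\<not> ?thesis"
    then have c': "\<epsilon>0 \<le> ?m B / 2 \<and> ?m {y \<in> B. W y \<in> S i lm} < ?m B / (2 * N)" if "i \<in> {1..N}" for i
      using that by (meson not_le)
    have "1 \<in> {1..N}" using N2 by simp
    note c = conjunct1[OF c'[OF this]] conjunct2[OF c']
    have Si: "{y \<in> B. W y \<in> S i lm} \<in> lmeasurable" if "i \<in> {1..N}" for i
      by (rule mlev[OF B(1,2) open_S]) (use that lmr in auto)
    have "?m B \<le> ?m ({y \<in> B. \<not> W y \<in> TT lm} \<union> (\<Union>i\<in>{1..N}. {y \<in> B. W y \<in> S i lm}))"
    proof (rule measure_mono_fmeasurable)
      show "B \<subseteq> {y \<in> B. \<not> W y \<in> TT lm} \<union> (\<Union>i\<in>{1..N}. {y \<in> B. W y \<in> S i lm})" by (auto simp: TT_def)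
      have "{y \<in> B. \<not> W y \<in> TT lm} = B - {y \<in> B. W y \<in> TT lm}" by auto
      then have "{y \<in> B. \<not> W y \<in> TT lm} \<in> lmeasurable"
        using fmeasurable_Diff[OF Bm fmeasurableD[OF mlev[OF B(1,2) open_TT[OF lmr(1)]]]] by simp
      then show "{y \<in> B. \<not> W y \<in> TT lm} \<union> (\<Union>i\<in>{1..N}. {y \<in> B. W y \<in> S i lm}) \<in> lmeasurable"
        by (intro fmeasurable.Un fmeasurable.finite_UN Si) auto
    qed (use Bm in auto)
    also have "\<dots> \<le> ?m {y \<in> B. \<not> W y \<in> TT lm} + ?m (\<Union>i\<in>{1..N}. {y \<in> B. W y \<in> S i lm})"
    proof (rule measure_Un_le)
      have "{y \<in> B. \<not> W y \<in> TT lm} = B - {y \<in> B. W y \<in> TT lm}" by auto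
      then show "{y \<in> B. \<not> W y \<in> TT lm} \<in> sets lebesgue"
        using fmeasurableD[OF fmeasurable_Diff[OF Bm fmeasurableD[OF mlev[OF B(1,2) open_TT[OF lmr(1)]]]]] by simp
      show "(\<Union>i\<in>{1..N}. {y \<in> B. W y \<in> S i lm}) \<in> sets lebesgue"
        by (intro sets.finite_UN fmeasurableD Si) auto
    qed
    also have "?m {y \<in> B. \<not> W y \<in> TT lm} \<le> ?m {y \<in> Q. W y \<notin> TT lm}"
    proof (rule measure_mono_fmeasurable)
      have "{y \<in> B. \<not> W y \<in> TT lm} = B - {y \<in> B. W y \<in> TT lm}" by auto
      then show "{y \<in> B. \<not> W y \<in> TT lm} \<in> sets lebesgue"
        using fmeasurableD[OF fmeasurable_Diff[OF Bm fmeasurableD[OF mlev[OF B(1,2) open_TT[OF lmr(1)]]]]] by simp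
      have "{y \<in> Q. W y \<notin> TT lm} = Q - {y \<in> Q. W y \<in> TT lm}" by auto
      then show "{y \<in> Q. W y \<notin> TT lm} \<in> lmeasurable"
        using fmeasurable_Diff[OF Qm fmeasurableD[OF mlev[OF Q(1) order_refl open_TT[OF lmr(1)]]]] by simp
    qed (use B in auto)
    also have "?m (\<Union>i\<in>{1..N}. {y \<in> B. W y \<in> S i lm}) \<le> (\<Sum>i\<in>{1..N}. ?m {y \<in> B. W y \<in> S i lm})"
      by (rule measure_UNION_le) (use Si in auto)
    also have "\<dots> < (\<Sum>i\<in>{1..N}. ?m B / (2 * N))"
      by (rule sum_strict_mono) (use c(2) N2 in auto)
    also have "\<dots> = ?m B / 2" using npos by simp
    finally show False using c(1) bad by simp
  qed
  then obtain i where i: "i \<in> {1..N}" "\<epsilon>0 \<le> ?m B / 2 \<longrightarrow> ?m B / (2 * N) \<le> ?m {y \<in> B. W y \<in> S i lm}"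
    by blast
  have oS: "open (S i lm)" "open (S i l)" "open (S (pr i) l)" "open (TT l)" "open (TT lm)"
    using open_S[OF i(1)] open_S[OF pr_mem(1)[OF i(1)]] open_TT lmr by auto
  have oV: "open (idx l i j)" for j using oS by (simp add: idx_def)
  have WS: "W ` G \<subseteq> Sig l" if "G \<subseteq> Q" for G
  proof -
    have "Sig lm \<subseteq> Sig l" by (rule Sig_mono) (use lam in simp)
    then show ?thesis using W(2) image_mono[OF that, of W] by (meson order_trans)
  qed
  have dl: "\<delta>0 \<le> l" using lmr by simp
  have bL: "1 \<in> ?L" by simp
  have qn: "0 \<le> qq ^ n" using qq by simp

  \<comment> \<open>First layer: all four indices are tracked, with the fixed component
    \<open>i\<close>.\<close>
  define G1 where "G1 = {y \<in> B. W y \<in> S i lm}"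
  have G1: "open G1" "G1 \<subseteq> B" "bounded G1" unfolding G1_def
    using olev[OF B(1,2) oS(1)] bounded_subset[OF Bb] by auto
  have G1Q: "G1 \<subseteq> Q" using G1(2) B(2) by blast
  have "\<exists>f F. pert G1 f F \<and> small e f F \<and> (\<forall>y\<in>G1. W y + jet (F y) \<in> Sig l) \<and>
    (\<forall>j\<in>?L. j \<noteq> 1 \<longrightarrow> ?m {y \<in> G1. W y + jet (F y) \<in> idx l i j} \<ge>
       ((if j = 0 then 1 - qq ^ n else if j = 3 then (1 - x) * \<delta>1 else x) - e) * ?m G1) \<and>
    ?m {y \<in> G1. norm (jet (F y)) < 2 * R} \<ge> ((if (1::nat) = 0 then 1 - qq ^ n else if (1::nat) = 3 then (1 - x) * \<delta>1 else x) - e) * ?m G1"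
  proof (rule attainable_cover[OF G1(1,3) continuous_on_subset[OF W(1) G1Q] WS[OF G1Q] e0 R(2) bL oV])
    show "(if j = 0 then 1 - qq ^ n else if j = 3 then (1 - x) * \<delta>1 else x) \<le> 1" if "j \<in> ?L" for j
      using x qn params mult_mono[of "1 - x" 1 \<delta>1 1] by auto
    show "\<exists>V'. attainable ?L (Sig l) V' (W y) (\<lambda>j. if j = 0 then 1 - qq ^ n else if j = 3 then (1 - x) * \<delta>1 else x) \<and>
       V' 1 = ball (W y) R \<and> (\<forall>j\<in>?L. j \<noteq> 1 \<longrightarrow> 0 < (if j = 0 then 1 - qq ^ n else if j = 3 then (1 - x) * \<delta>1 else x) \<longrightarrow> V' j = idx l i j)"
      if "y \<in> G1" for y
      using attainable_S_step[OF lam(1-3) i(1) _ R(1), of "W y" n] that unfolding x_def[symmetric]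
      by (intro exI[of _ "(idx l i)(1 := ball (W y) R)"]) (auto simp: G1_def)
  qed
  then obtain f1 F1 where f1: "pert G1 f1 F1" "small e f1 F1" "\<forall>y\<in>G1. W y + jet (F1 y) \<in> Sig l"
    "\<forall>j\<in>?L. j \<noteq> 1 \<longrightarrow> ?m {y \<in> G1. W y + jet (F1 y) \<in> idx l i j} \<ge>
       ((if j = 0 then 1 - qq ^ n else if j = 3 then (1 - x) * \<delta>1 else x) - e) * ?m G1"
    "?m {y \<in> G1. norm (jet (F1 y)) < 2 * R} \<ge> ((if (1::nat) = 0 then 1 - qq ^ n else if (1::nat) = 3 then (1 - x) * \<delta>1 else x) - e) * ?m G1"
    by (elim exE conjE)
  have f1': "?m {y \<in> G1. W y + jet (F1 y) \<in> TT l} \<ge> (1 - qq ^ n - e) * ?m G1"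
    "?m {y \<in> G1. W y + jet (F1 y) \<in> S i l} \<ge> (x - e) * ?m G1"
    "?m {y \<in> G1. W y + jet (F1 y) \<in> S (pr i) l} \<ge> ((1 - x) * \<delta>1 - e) * ?m G1"
    "?m {y \<in> G1. norm (jet (F1 y)) < 2 * R} \<ge> (x - e) * ?m G1"
    using bspec[OF f1(4), of 0] bspec[OF f1(4), of 2] bspec[OF f1(4), of 3] f1(5) by (simp_all add: idx_def)
  obtain K1 where K1: "compact K1" "K1 \<subseteq> G1" "?m (G1 - K1) \<le> e" "\<And>y. y \<notin> K1 \<Longrightarrow> jet (F1 y) = 0"
    using pert_compact_support[OF G1(1,3) f1(1) e0] by blast

  \<comment> \<open>Second layer: the points of the old target at which the first perturbation has
    zero jet.\<close>
  define A1 where "A1 = {y \<in> Q. W y \<in> TT lm}"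
  define G2 where "G2 = A1 - K1"
  have G2: "open G2" "G2 \<subseteq> Q" "bounded G2"
    unfolding G2_def A1_def using olev[OF Q(1) order_refl oS(5)] K1(1) bounded_subset[OF Q(2)]
    by (auto intro!: open_Diff compact_imp_closed)
  have "\<exists>f F. pert G2 f F \<and> small e f F \<and> (\<forall>y\<in>G2. W y + jet (F y) \<in> Sig l) \<and>
    (\<forall>j\<in>?L. j \<noteq> 1 \<longrightarrow> ?m {y \<in> G2. W y + jet (F y) \<in> idx l i j} \<ge>
       ((if j = 0 then 1 - qq ^ n else if j = 1 then x else 0) - e) * ?m G2) \<and>
    ?m {y \<in> G2. norm (jet (F y)) < 2 * R} \<ge> ((if (1::nat) = 0 then 1 - qq ^ n else if (1::nat) = 1 then x else 0) - e) * ?m G2"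
  proof (rule attainable_cover[OF G2(1,3) continuous_on_subset[OF W(1) G2(2)] WS[OF G2(2)] e0 R(2) bL oV])
    show "(if j = 0 then 1 - qq ^ n else if j = 1 then x else 0) \<le> 1" if "j \<in> ?L" for j
      using x qn by auto
    show "\<exists>V'. attainable ?L (Sig l) V' (W y) (\<lambda>j. if j = 0 then 1 - qq ^ n else if j = 1 then x else 0) \<and>
       V' 1 = ball (W y) R \<and> (\<forall>j\<in>?L. j \<noteq> 1 \<longrightarrow> 0 < (if j = 0 then 1 - qq ^ n else if j = 1 then x else 0) \<longrightarrow> V' j = idx l i j)"
      if yG: "y \<in> G2" for y
    proof -
      \<comment> \<open>The component \<open>i'\<close> varies with the point, so only the whole
        target and the distance are tracked; for indices 2 and 3 the fraction is lowered to
        0.\<close>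
      obtain i' where i': "i' \<in> {1..N}" "W y \<in> S i' lm" using yG unfolding G2_def A1_def TT_def by blast
      have "attainable ?L (Sig l) ((idx l i')(1 := ball (W y) R)) (W y)
          (\<lambda>j. if j = 0 then 1 - qq ^ n else if j = 1 then x else 0)"
        by (rule attainable_mono[OF attainable_S_step[OF lam(1-3) i' R(1), of n]])
           (use x params in \<open>auto simp: x_def[symmetric]\<close>)
      then show ?thesis by (intro exI[of _ "(idx l i')(1 := ball (W y) R)"]) (auto simp: idx_def)
    qed
  qed
  then obtain f2 F2 where f2: "pert G2 f2 F2" "small e f2 F2" "\<forall>y\<in>G2. W y + jet (F2 y) \<in> Sig l"
    "\<forall>j\<in>?L. j \<noteq> 1 \<longrightarrow> ?m {y \<in> G2. W y + jet (F2 y) \<in> idx l i j} \<ge>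
       ((if j = 0 then 1 - qq ^ n else if j = 1 then x else 0) - e) * ?m G2"
    "?m {y \<in> G2. norm (jet (F2 y)) < 2 * R} \<ge> ((if (1::nat) = 0 then 1 - qq ^ n else if (1::nat) = 1 then x else 0) - e) * ?m G2"
    by (elim exE conjE)
  have f2': "?m {y \<in> G2. W y + jet (F2 y) \<in> TT l} \<ge> (1 - qq ^ n - e) * ?m G2"
    "?m {y \<in> G2. norm (jet (F2 y)) < 2 * R} \<ge> (x - e) * ?m G2"
    using bspec[OF f2(4), of 0] f2(5) by (simp_all add: idx_def)
  obtain K2 where K2: "compact K2" "K2 \<subseteq> G2" "?m (G2 - K2) \<le> e" "\<And>y. y \<notin> K2 \<Longrightarrow> jet (F2 y) = 0"
    using pert_compact_support[OF G2(1,3) f2(1) e0] by blast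

  \<comment> \<open>Third layer: what \<open>K1\<close> and \<open>K2\<close> leave over. Its volume
    is at most that of the points outside the old target plus \<open>e\<close>.\<close>
  define G3 where "G3 = Q - (K1 \<union> K2)"
  have G3: "open G3" "G3 \<subseteq> Q" "bounded G3"
    unfolding G3_def using Q K1(1) K2(1) bounded_subset[OF Q(2)]
    by (auto intro!: open_Diff closed_Un compact_imp_closed)
  have "\<exists>f F. pert G3 f F \<and> small e f F \<and> (\<forall>y\<in>G3. W y + jet (F y) \<in> Sig l) \<and>
    (\<forall>j\<in>?L. j \<noteq> 1 \<longrightarrow> ?m {y \<in> G3. W y + jet (F y) \<in> idx l i j} \<ge>
       ((if j = 0 then 1 - qq ^ n else 0) - e) * ?m G3) \<and>
    ?m {y \<in> G3. norm (jet (F y)) < 2 * R} \<ge> ((if (1::nat) = 0 then 1 - qq ^ n else 0) - e) * ?m G3"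
  proof (rule attainable_cover[OF G3(1,3) continuous_on_subset[OF W(1) G3(2)] WS[OF G3(2)] e0 R(2) bL oV])
    show "(if j = 0 then 1 - qq ^ n else 0) \<le> 1" if "j \<in> ?L" for j
      using qn by auto
    show "\<exists>V'. attainable ?L (Sig l) V' (W y) (\<lambda>j. if j = 0 then 1 - qq ^ n else 0) \<and>
       V' 1 = ball (W y) R \<and> (\<forall>j\<in>?L. j \<noteq> 1 \<longrightarrow> 0 < (if j = 0 then 1 - qq ^ n else 0) \<longrightarrow> V' j = idx l i j)"
      if "y \<in> G3" for y
    proof -
      have "W y \<in> Sig l" using that WS[OF G3(2)] by blast
      then have "attainable ?L (Sig l) ((idx l i)(1 := ball (W y) R)) (W y) (\<lambda>j. if j = 0 then 1 - qq ^ n else 0)"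
        by (intro attainable_Sig[OF dl lam(3)]) (use oV in \<open>auto simp: idx_def\<close>)
      then show ?thesis by (intro exI[of _ "(idx l i)(1 := ball (W y) R)"]) auto
    qed
  qed
  then obtain f3 F3 where f3: "pert G3 f3 F3" "small e f3 F3" "\<forall>y\<in>G3. W y + jet (F3 y) \<in> Sig l"
    "\<forall>j\<in>?L. j \<noteq> 1 \<longrightarrow> ?m {y \<in> G3. W y + jet (F3 y) \<in> idx l i j} \<ge>
       ((if j = 0 then 1 - qq ^ n else 0) - e) * ?m G3"
    by (elim exE conjE)
  have f3': "?m {y \<in> G3. W y + jet (F3 y) \<in> TT l} \<ge> (1 - qq ^ n - e) * ?m G3"
    using bspec[OF f3(4), of 0] by (simp add: idx_def)

  define f where "f y = f1 y + (f2 y + f3 y)" for y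
  define F where "F y h = F1 y h + (F2 y h + F3 y h)" for y h
  have jF: "jet (F y) = jet (F1 y) + (jet (F2 y) + jet (F3 y))" for y
    unfolding F_def[abs_def] by (simp add: jet_add)
  have F3z: "jet (F3 y) = 0" if "y \<notin> G3" for y using pert_outside(3)[OF f3(1) that] .
  \<comment> \<open>Supports overlap only where the jet of the earlier perturbation vanishes, so on
    each of \<open>K1\<close>, \<open>K2\<close> and \<open>G3\<close> a single perturbation
    determines the jet.\<close>
  have jK1: "jet (F y) = jet (F1 y)" if "y \<in> K1" for y
    using F3z[of y] K2(4)[of y] that K2(2) by (auto simp: jF G2_def G3_def)
  have jK2: "jet (F y) = jet (F2 y)" if "y \<in> K2" for y
    using F3z[of y] K1(4)[of y] that K2(2) by (auto simp: jF G2_def G3_def)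
  have jG3: "jet (F y) = jet (F3 y)" if "y \<in> G3" for y
    using K1(4)[of y] K2(4)[of y] that by (auto simp: jF G3_def)
  have split: "y \<in> K1 \<or> y \<in> K2 \<or> y \<in> G3" if "y \<in> Q" for y using that by (auto simp: G3_def)
  have pf: "pert Q f F" unfolding f_def[abs_def] F_def[abs_def]
    by (intro pert_add pert_mono[OF f1(1) G1Q] pert_mono[OF f2(1) G2(2)] pert_mono[OF f3(1) G3(2)])
  note Gm = lmeasurable_open_bounded[OF G1(1,3)] lmeasurable_open_bounded[OF G2(1,3)] lmeasurable_open_bounded[OF G3(1,3)]
  have vol: "?m G1 \<le> ?m Q" "?m G2 \<le> ?m Q" "?m G3 \<le> ?m Q"
    using Gm Qm G1Q G2(2) G3(2) by (auto intro!: measure_mono_fmeasurable)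
  have lev: "{y \<in> G. W y + jet (K y) \<in> V} \<in> lmeasurable" if "open G" "G \<subseteq> Q" "pert G' g K" "open V" for G G' g K V
    by (rule lmeasurable_level_set[OF that(1) _ continuous_on_subset[OF W(1) that(2)] that(3,4)])
       (rule bounded_subset[OF Q(2) that(2)])
  have nlev: "{y \<in> G. norm (jet (K y)) < r} \<in> lmeasurable" if "open G" "G \<subseteq> Q" "pert G' g K" for G G' g K r
    using lmeasurable_level_set[OF that(1) bounded_subset[OF Q(2) that(2)] continuous_on_const that(3) open_ball, of 0 0 r] by simp
  have neg: "{y \<in> G. \<not> P y} \<in> lmeasurable" if "G \<in> lmeasurable" "{y \<in> G. P y} \<in> lmeasurable" for G P
  proof -
    have "{y \<in> G. \<not> P y} = G - {y \<in> G. P y}" by auto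
    then show ?thesis using fmeasurable_Diff[OF that(1) fmeasurableD[OF that(2)]] by simp
  qed
  have comp: "?m {y \<in> G. \<not> P y} \<le> (1 - z) * ?m G" if "G \<in> lmeasurable" "{y \<in> G. P y} \<in> lmeasurable" "z * ?m G \<le> ?m {y \<in> G. P y}" for G P z
    using measure_compl_le[OF that] by (simp add: algebra_simps)
  have un3: "?m X \<le> ?m X1 + (?m X2 + ?m X3)" if "X \<subseteq> X1 \<union> (X2 \<union> X3)" "X \<in> lmeasurable" "X1 \<in> lmeasurable" "X2 \<in> lmeasurable" "X3 \<in> lmeasurable" for X X1 X2 X3
  proof -
    have "?m X \<le> ?m (X1 \<union> (X2 \<union> X3))" by (rule measure_mono_fmeasurable) (use that in auto)
    also have "\<dots> \<le> ?m X1 + ?m (X2 \<union> X3)" by (rule measure_Un_le) (use that in auto)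
    also have "?m (X2 \<union> X3) \<le> ?m X2 + ?m X3" by (rule measure_Un_le) (use that in auto)
    finally show ?thesis by simp
  qed
  show ?thesis
  proof (intro exI[of _ f] exI[of _ F] conjI pf ballI impI)
    show "small \<epsilon>1 f F" unfolding f_def[abs_def] F_def[abs_def]
      by (rule small_mono[OF small_add[OF f1(2) small_add[OF f2(2) f3(2)]]]) (use e1 in simp)
    show "W y + jet (F y) \<in> Sig l" if "y \<in> Q" for y
      using split[OF that]
    proof (elim disjE)
      assume "y \<in> K1" then show ?thesis using f1(3) jK1 K1(2) by auto
    next
      assume "y \<in> K2" then show ?thesis using f2(3) jK2 K2(2) by auto
    next
      assume "y \<in> G3" then show ?thesis using f3(3) jG3 by auto
    qed
  next
    let ?X1 = "{y \<in> G1. \<not> W y + jet (F1 y) \<in> TT l}" and ?X2 = "{y \<in> G2. \<not> W y + jet (F2 y) \<in> TT l}"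
      and ?X3 = "{y \<in> G3. \<not> W y + jet (F3 y) \<in> TT l}"
    have "?m {y \<in> Q. \<not> W y + jet (F y) \<in> TT l} \<le> ?m ?X1 + (?m ?X2 + ?m ?X3)"
    proof (rule un3)
      show "{y \<in> Q. \<not> W y + jet (F y) \<in> TT l} \<subseteq> ?X1 \<union> (?X2 \<union> ?X3)"
      proof
        fix y assume y: "y \<in> {y \<in> Q. \<not> W y + jet (F y) \<in> TT l}"
        then have "y \<in> Q" by simp
        from split[OF this] y show "y \<in> ?X1 \<union> (?X2 \<union> ?X3)"
          using jK1[of y] jK2[of y] jG3[of y] K1(2) K2(2) by auto
      qed
    qed (intro neg Gm Qm lev[OF G1(1) G1Q f1(1) oS(4)] lev[OF G2(1,2) f2(1) oS(4)] lev[OF G3(1,2) f3(1) oS(4)]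
           lev[OF Q(1) order_refl pf oS(4)])+
    also have "?m ?X1 \<le> (1 - (1 - qq ^ n - e)) * ?m G1"
      by (rule comp[OF Gm(1) lev[OF G1(1) G1Q f1(1) oS(4)] f1'(1)])
    also have "?m ?X2 \<le> (1 - (1 - qq ^ n - e)) * ?m G2"
      by (rule comp[OF Gm(2) lev[OF G2(1,2) f2(1) oS(4)] f2'(1)])
    also have "?m ?X3 \<le> (1 - (1 - qq ^ n - e)) * ?m G3"
      by (rule comp[OF Gm(3) lev[OF G3(1,2) f3(1) oS(4)] f3'])
    finally have 1: "?m {y \<in> Q. \<not> W y + jet (F y) \<in> TT l} \<le> (qq ^ n + e) * ?m G1 + ((qq ^ n + e) * ?m G2 + (qq ^ n + e) * ?m G3)"
      by simp
    have 2: "(qq ^ n + e) * ?m G \<le> (2 * e) * ?m Q" if "?m G \<le> ?m Q" for G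
      by (rule mult_mono) (use that n e0 in auto)
    show "?m {y \<in> Q. W y + jet (F y) \<notin> TT l} \<le> \<epsilon>1"
      using 1 2[OF vol(1)] 2[OF vol(2)] 2[OF vol(3)] e2 by linarith
  next
    let ?X1 = "{y \<in> G1. \<not> norm (jet (F1 y)) < 2 * R}" and ?X2 = "{y \<in> G2. \<not> norm (jet (F2 y)) < 2 * R}"
    have "?m {y \<in> Q. \<not> norm (jet (F y)) < 2 * R} \<le> ?m ?X1 + (?m ?X2 + ?m G3)"
    proof (rule un3)
      show "{y \<in> Q. \<not> norm (jet (F y)) < 2 * R} \<subseteq> ?X1 \<union> (?X2 \<union> G3)"
      proof
        fix y assume y: "y \<in> {y \<in> Q. \<not> norm (jet (F y)) < 2 * R}"
        then have "y \<in> Q" by simp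
        from split[OF this] y show "y \<in> ?X1 \<union> (?X2 \<union> G3)"
          using jK1[of y] jK2[of y] K1(2) K2(2) by auto
      qed
    qed (intro neg Gm Qm nlev[OF G1(1) G1Q f1(1)] nlev[OF G2(1,2) f2(1)] nlev[OF Q(1) order_refl pf])+
    also have "?m ?X1 \<le> (1 - (x - e)) * ?m G1" by (rule comp[OF Gm(1) nlev[OF G1(1) G1Q f1(1)] f1'(4)])
    also have "?m ?X2 \<le> (1 - (x - e)) * ?m G2" by (rule comp[OF Gm(2) nlev[OF G2(1,2) f2(1)] f2'(2)])
    finally have 1: "?m {y \<in> Q. \<not> norm (jet (F y)) < 2 * R} \<le> (1 - (x - e)) * ?m G1 + ((1 - (x - e)) * ?m G2 + ?m G3)" by simp
    have 2: "(1 - (x - e)) * ?m G \<le> (\<mu> + \<epsilon>1) * ?m Q" if "?m G \<le> ?m Q" for G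
      by (rule mult_mono) (use that x e0 e1 mu in auto)
    have A1m: "A1 \<in> lmeasurable" unfolding A1_def by (rule mlev[OF Q(1) order_refl oS(5)])
    have QA: "{y \<in> Q. W y \<notin> TT lm} \<in> lmeasurable" by (rule neg[OF Qm]) (use A1m in \<open>simp add: A1_def\<close>)
    have GK: "G2 - K2 \<in> lmeasurable" by (rule fmeasurable_Diff[OF Gm(2) fmeasurableD[OF lmeasurable_compact[OF K2(1)]]])
    have "?m G3 \<le> ?m ({y \<in> Q. W y \<notin> TT lm} \<union> (G2 - K2))"
      by (rule measure_mono_fmeasurable) (use Gm(3) QA GK in \<open>auto simp: G3_def G2_def A1_def\<close>)
    also have "\<dots> \<le> ?m {y \<in> Q. W y \<notin> TT lm} + ?m (G2 - K2)"
      by (rule measure_Un_le) (use QA GK in auto)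
    also have "\<dots> \<le> \<epsilon>0 + e" using bad K2(3) by simp
    finally have 3: "?m G3 \<le> \<epsilon>0 + e" .
    have "2 * (1 - lm + \<epsilon>1) * ?m Q = (\<mu> + \<epsilon>1) * ?m Q + (\<mu> + \<epsilon>1) * ?m Q" by (simp add: \<mu>_def algebra_simps)
    then show "?m {y \<in> Q. \<not> norm (jet (F y)) < 2 * R} \<le> 2 * (1 - lm + \<epsilon>1) * ?m Q + \<epsilon>0 + \<epsilon>1"
      using 1 2[OF vol(1)] 2[OF vol(2)] 3 e0 e1 by linarith
  next
    assume "\<epsilon>0 \<le> ?m B / 2"
    then have g: "?m G1 \<ge> ?m B / (2 * N)" using i(2) by (simp add: G1_def)
    have gB: "?m G1 \<le> ?m B" by (rule measure_mono_fmeasurable[OF G1(2) fmeasurableD[OF Gm(1)] Bm])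
    have low: "\<eta> \<le> ?m {y \<in> B. W y + jet (F y) \<in> V}"
      if V: "open V" and z: "\<delta>1 * \<mu> / 2 \<le> z" "(z - e) * ?m G1 \<le> ?m {y \<in> G1. W y + jet (F1 y) \<in> V}" for V z
    proof -
      have "?m {y \<in> G1. W y + jet (F1 y) \<in> V} \<le> ?m ({y \<in> B. W y + jet (F y) \<in> V} \<union> (G1 - K1))"
      proof (rule measure_mono_fmeasurable)
        show "{y \<in> G1. W y + jet (F1 y) \<in> V} \<subseteq> {y \<in> B. W y + jet (F y) \<in> V} \<union> (G1 - K1)"
          using jK1 G1(2) by auto
        show "{y \<in> G1. W y + jet (F1 y) \<in> V} \<in> sets lebesgue"
          by (rule fmeasurableD[OF lev[OF G1(1) G1Q f1(1) V]])
        show "{y \<in> B. W y + jet (F y) \<in> V} \<union> (G1 - K1) \<in> lmeasurable"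
          by (intro fmeasurable.Un lev[OF B(1,2) pf V] fmeasurable_Diff[OF Gm(1) fmeasurableD[OF lmeasurable_compact[OF K1(1)]]])
      qed
      also have "\<dots> \<le> ?m {y \<in> B. W y + jet (F y) \<in> V} + ?m (G1 - K1)"
        by (intro measure_Un_le fmeasurableD lev[OF B(1,2) pf V] fmeasurable_Diff[OF Gm(1) fmeasurableD[OF lmeasurable_compact[OF K1(1)]]])
      finally have 1: "(z - e) * ?m G1 - e \<le> ?m {y \<in> B. W y + jet (F y) \<in> V}" using z(2) K1(3) by linarith
      have "\<delta>1 * \<mu> / 2 > 0" using mu params by simp
      then have "0 \<le> z" using z(1) by linarith
      \<comment> \<open>The left side equals 2\<eta>, and one \<eta> pays for the losses of size
        \<open>e\<close>; this explains the factor 8 in \<eta>.\<close>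
      then have "(\<delta>1 * \<mu> / 2) * (?m B / (2 * N)) \<le> z * ?m G1"
        using z(1) g npos by (intro mult_mono) auto
      moreover have "(\<delta>1 * \<mu> / 2) * (?m B / (2 * N)) = 2 * \<eta>" using npos by (simp add: \<eta>_def \<mu>_def)
      moreover have "e * ?m G1 \<le> e * ?m B" using gB e0 by (intro mult_left_mono) auto
      moreover have "e * ?m B + e \<le> \<eta>" using e3 by (simp add: algebra_simps)
      ultimately have "\<eta> \<le> z * ?m G1 - e * ?m G1 - e" by linarith
      also have "\<dots> = (z - e) * ?m G1 - e" by (simp add: algebra_simps)
      finally show ?thesis using 1 by linarith
    qed
    have "\<delta>1 * \<mu> / 2 \<le> (1 - x) * \<delta>1"
      using mult_right_mono[OF x(4), of \<delta>1] params by (simp add: algebra_simps)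
    then show "\<exists>i\<in>{1..N}. \<eta> \<le> ?m {y \<in> B. W y + jet (F y) \<in> S i l} \<and> \<eta> \<le> ?m {y \<in> B. W y + jet (F y) \<in> S (pr i) l}"
      using low[OF oS(2) x(3) f1'(2)] low[OF oS(3) _ f1'(3)] i(1) by blast
  qed
qed

end

section \<open>The approximating sequence\<close>

lemma measure_pos_open:
  fixes U :: "'a::euclidean_space set"
  assumes "open U" "bounded U" "U \<noteq> {}"
  shows "measure lebesgue U > 0"
proof -
  obtain x r where r: "r > 0" "ball x r \<subseteq> U" using assms by (metis ex_in_conv openE)
  have "0 < measure lebesgue (ball x r)" using r by (simp add: content_ball_pos)
  also have "\<dots> \<le> measure lebesgue U"
    by (rule measure_mono_fmeasurable[OF r(2) _ lmeasurable_open_bounded[OF assms(1,2)]]) simp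
  finally show ?thesis .
qed

text \<open>The nonempty members of a countable basis inside Q, enumerated so that each of them also
  occurs at an index \<open>k \<ge> 1\<close>: at stage 0 of the iteration nothing is known about
  the volume outside the target.\<close>

lemma countable_open_subsets:
  fixes Q :: "'a::second_countable_topology set"
  assumes "open Q" "Q \<noteq> {}"
  shows "\<exists>B :: nat \<Rightarrow> 'a set. (\<forall>k. open (B k) \<and> B k \<noteq> {} \<and> B k \<subseteq> Q) \<and>
    (\<forall>U. open U \<longrightarrow> U \<subseteq> Q \<longrightarrow> U \<noteq> {} \<longrightarrow> (\<exists>k\<ge>1. B k \<subseteq> U))"
proof -
  obtain \<B> :: "'a set set" where b: "countable \<B>" "topological_basis \<B>" using ex_countable_basis by blast
  define \<C> where "\<C> = {b \<in> \<B>. b \<noteq> {} \<and> b \<subseteq> Q}"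
  have c: "countable \<C>" unfolding \<C>_def using b(1) by (rule countable_Collect)
  have sub: "\<exists>b\<in>\<C>. b \<subseteq> U" if U: "open U" "U \<subseteq> Q" "U \<noteq> {}" for U
  proof -
    obtain x where "x \<in> U" using U by blast
    then obtain b' where "b' \<in> \<B>" "x \<in> b'" "b' \<subseteq> U" using topological_basisE[OF b(2) U(1)] by blast
    then show ?thesis using U by (intro bexI[of _ b']) (auto simp: \<C>_def)
  qed
  have ne: "\<C> \<noteq> {}" using sub[OF assms(1) order_refl assms(2)] by blast
  define B where "B k = from_nat_into \<C> (k - 1)" for k
  have BC: "B k \<in> \<C>" for k unfolding B_def by (rule from_nat_into[OF ne])
  show ?thesis
  proof (intro exI[of _ B] conjI allI impI)
    show "open (B k)" for k using BC[of k] topological_basis_open[OF b(2)] by (auto simp: \<C>_def)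
    show "B k \<noteq> {}" "B k \<subseteq> Q" for k using BC[of k] by (auto simp: \<C>_def)
    fix U assume "open U" "U \<subseteq> Q" "U \<noteq> {}"
    then obtain b' where b': "b' \<in> \<C>" "b' \<subseteq> U" using sub by blast
    obtain n where "from_nat_into \<C> n = b'" using from_nat_into_surj[OF c b'(1)] by blast
    then show "\<exists>k\<ge>1. B k \<subseteq> U" using b'(2) by (intro exI[of _ "Suc n"]) (simp add: B_def)
  qed
qed

context condition_O_locale
begin

text \<open>Compactness turns the disjointness in (P1)(ii) into a positive distance, and only
  finitely many pairs of indices occur.\<close>

lemma tip_separation:
  "\<exists>d>0. \<forall>i\<in>{1..N}. \<forall>j\<in>{1..N}. i \<noteq> j \<longrightarrow> (\<forall>\<rho>\<in>cball 0 r0. \<forall>\<rho>'\<in>cball 0 r0. d \<le> dist (fst (tip i \<rho>)) (fst (tip j \<rho>')))"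
proof -
  let ?T = "\<lambda>i. fst ` tip i ` cball 0 r0"
  let ?I = "{(i, j). i \<in> {1..N} \<and> j \<in> {1..N} \<and> i \<noteq> j}"
  have comp: "compact (?T i)" if "i \<in> {1..N}" for i
    by (intro compact_continuous_image continuous_on_fst continuous_on_id cont_tip[OF that] compact_cball)
  have "\<forall>p\<in>?I. \<exists>d>0. \<forall>x\<in>?T (fst p). \<forall>y\<in>?T (snd p). d \<le> dist x y"
  proof
    fix p assume p: "p \<in> ?I"
    then have "fst p \<in> {1..N}" "snd p \<in> {1..N}" "fst p \<noteq> snd p" by auto
    then show "\<exists>d>0. \<forall>x\<in>?T (fst p). \<forall>y\<in>?T (snd p). d \<le> dist x y"
      by (intro separate_compact_closed comp compact_imp_closed fst_disjoint(1))
  qed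
  from bchoice[OF this] obtain d where d: "\<forall>p\<in>?I. d p > 0 \<and> (\<forall>x\<in>?T (fst p). \<forall>y\<in>?T (snd p). d p \<le> dist x y)" ..
  have fin: "finite ?I" by (rule finite_subset[of _ "{1..N} \<times> {1..N}"]) auto
  define D where "D = Min (insert 1 (d ` ?I))"
  have "D > 0" using d fin by (simp add: D_def)
  moreover have "D \<le> dist (fst (tip i \<rho>)) (fst (tip j \<rho>'))"
    if "i \<in> {1..N}" "j \<in> {1..N}" "i \<noteq> j" "\<rho> \<in> cball 0 r0" "\<rho>' \<in> cball 0 r0" for i j \<rho> \<rho>'
  proof -
    have I: "(i, j) \<in> ?I" using that by auto
    have "D \<le> d (i, j)" unfolding D_def using fin I by (intro Min_le) auto
    also have "\<dots> \<le> dist (fst (tip i \<rho>)) (fst (tip j \<rho>'))" using bspec[OF d I] that(4,5) by auto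
    finally show ?thesis .
  qed
  ultimately show ?thesis by blast
qed

text \<open>\<mu> k stands for 1 - \<lambda>_k. Halving makes it summable, the bound by
  \<open>c\<close> keeps all later displacements small against the separation of the tips, and the
  bound with \<open>8 * V + 8\<close> makes the volume disturbed later smaller than what the two
  components gain at stage k. \<epsilon> k bounds the volume outside the target; it starts with the
  full volume \<open>V\<close>.\<close>

lemma parameter_sequences:
  fixes b :: "nat \<Rightarrow> real"
  assumes "\<mu>0 > 0" "V \<ge> 0" "c > 0" "e > 0" "\<And>k. b k > 0"
  shows "\<exists>\<mu> \<epsilon> :: nat \<Rightarrow> real. \<mu> 0 = \<mu>0 \<and> (\<forall>k. \<mu> k > 0) \<and> (\<forall>k. \<mu> (Suc k) \<le> \<mu> k / 2) \<and> (\<forall>k. \<mu> (Suc k) \<le> c) \<and>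
    (\<forall>k. (8 * V + 8) * \<mu> (Suc k) \<le> \<delta>1 * \<mu> k * b k / (8 * N)) \<and>
    \<epsilon> 0 = V \<and> (\<forall>k. \<epsilon> (Suc k) > 0) \<and> (\<forall>k. \<epsilon> (Suc k) \<le> \<mu> (Suc k)) \<and> (\<forall>k. \<epsilon> (Suc k) \<le> b (Suc k) / 2) \<and>
    (\<forall>k. \<epsilon> (Suc k) \<le> e / 2 ^ Suc k)"
proof -
  define g where "g k m = min (m / 2) (min c (\<delta>1 * m * b k / (8 * N) / (8 * V + 8)))" for k m
  define \<mu> where "\<mu> = rec_nat \<mu>0 g"
  define \<epsilon> where "\<epsilon> k = (if k = 0 then V else min (\<mu> k) (min (b k / 2) (e / 2 ^ k)))" for k
  have m0: "\<mu> 0 = \<mu>0" and mS: "\<mu> (Suc k) = g k (\<mu> k)" for k by (simp_all add: \<mu>_def)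
  have V8: "8 * V + 8 > 0" using assms(2) by simp
  have pos: "\<mu> k > 0" for k
  proof (induction k)
    case (Suc k)
    have "\<delta>1 * \<mu> k * b k / (8 * N) / (8 * V + 8) > 0" using Suc assms(5)[of k] V8 params N2 by simp
    then show ?case using Suc assms(3) by (simp add: mS g_def)
  qed (simp add: m0 assms)
  show ?thesis
  proof (rule exI[of _ \<mu>], rule exI[of _ \<epsilon>], intro conjI allI)
    show "\<mu> (Suc k) \<le> \<mu> k / 2" "\<mu> (Suc k) \<le> c" for k by (simp_all add: mS g_def)
    show "(8 * V + 8) * \<mu> (Suc k) \<le> \<delta>1 * \<mu> k * b k / (8 * N)" for k
    proof -
      have "\<mu> (Suc k) \<le> \<delta>1 * \<mu> k * b k / (8 * N) / (8 * V + 8)" by (simp add: mS g_def)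
      then show ?thesis unfolding pos_le_divide_eq[OF V8] by (simp add: mult.commute)
    qed
    show "\<epsilon> (Suc k) > 0" for k using pos[of "Suc k"] assms(4,5) by (simp add: \<epsilon>_def)
  qed (simp_all add: m0 pos \<epsilon>_def)
qed

lemma halving_sum:
  fixes \<mu> :: "nat \<Rightarrow> real"
  assumes "\<And>k. \<mu> k > 0" "\<And>k. \<mu> (Suc k) \<le> \<mu> k / 2"
  shows "(\<Sum>l\<in>{k..<n}. \<mu> l) \<le> 2 * \<mu> k" "summable \<mu>"
proof -
  have *: "(\<Sum>l\<in>{k..<k + j}. \<mu> l) \<le> 2 * \<mu> k - 2 * \<mu> (k + j)" for k j
  proof (induction j)
    case (Suc j)
    then show ?case using assms(2)[of "k + j"] by simp
  qed simp
  show 1: "(\<Sum>l\<in>{k..<n}. \<mu> l) \<le> 2 * \<mu> k" for k n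
  proof (cases "k \<le> n")
    case True
    then have "n = k + (n - k)" by simp
    then show ?thesis using *[of k "n - k"] assms(1)[of n] by (smt (verit))
  next
    case False then show ?thesis using assms(1)[of k] by simp
  qed
  show "summable \<mu>"
    by (rule bounded_imp_summable[of _ "2 * \<mu> 0"]) (use assms(1) 1[of 0] in \<open>simp_all only: less_imp_le lessThan_Suc_atMost[symmetric] atLeast0LessThan\<close>)
qed

text \<open>Points of the target at parameter \<lambda> are within a multiple of 1 - \<lambda> of
  tips, which lie on the graph, and the graph is closed by continuity of \<sigma>.\<close>

lemma S_limit_graph:
  fixes X :: "('n, 'm) pt"
  assumes w: "\<And>k. k \<ge> K \<Longrightarrow> w k \<in> TT (lam k)" and lam: "lam \<longlonglongrightarrow> 1" and l1: "\<And>k. lam k < 1" and lim: "w \<longlonglongrightarrow> X"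
  shows "snd X = \<sigma> (fst X)"
proof -
  have "\<forall>k\<in>{K..}. \<exists>z. dist (w k) z \<le> (1 - lam k) * (2 * bnd) \<and> z \<in> graph_of \<sigma>"
  proof
    fix k assume "k \<in> {K..}"
    then have "w k \<in> TT (lam k)" using w by simp
    then obtain i \<rho> where i: "i \<in> {1..N}" "\<rho> \<in> ball 0 r0" "w k = A i (lam k) \<rho>"
      unfolding TT_def using S_iff by blast
    then have "dist (w k) (tip i \<rho>) \<le> (1 - lam k) * (2 * bnd)" "tip i \<rho> \<in> graph_of \<sigma>"
      using dist_A(2)[of i \<rho> "lam k"] l1[of k] Xi_graph[of i \<rho>] by auto
    then show "\<exists>z. dist (w k) z \<le> (1 - lam k) * (2 * bnd) \<and> z \<in> graph_of \<sigma>" by blast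
  qed
  from bchoice[OF this] obtain z where z: "\<forall>k\<in>{K..}. dist (w k) (z k) \<le> (1 - lam k) * (2 * bnd) \<and> z k \<in> graph_of \<sigma>" ..
  have "(\<lambda>k. (1 - lam k) * (2 * bnd)) \<longlonglongrightarrow> (1 - 1) * (2 * bnd)" by (intro tendsto_intros lam)
  then have "(\<lambda>k. dist (w k) (z k)) \<longlonglongrightarrow> 0"
    by (intro Lim_null_comparison[where f = "\<lambda>k. dist (w k) (z k)" and g = "\<lambda>k. (1 - lam k) * (2 * bnd)"])
       (use z in \<open>auto intro!: eventually_sequentiallyI[of K]\<close>)
  then have "(\<lambda>k. w k - z k) \<longlonglongrightarrow> 0" by (simp add: dist_norm tendsto_norm_zero_iff)
  from tendsto_diff[OF lim this] have zl: "z \<longlonglongrightarrow> X" by simp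
  have "continuous_on UNIV \<sigma>" using cond by (auto simp: condition_O_def)
  then have L1: "(\<lambda>k. \<sigma> (fst (z k))) \<longlonglongrightarrow> \<sigma> (fst X)"
    by (intro isCont_tendsto_compose[OF _ tendsto_fst[OF zl]]) (simp add: continuous_on_eq_continuous_at)
  have ev: "\<forall>\<^sub>F k in sequentially. \<sigma> (fst (z k)) = snd (z k)"
  proof (rule eventually_sequentiallyI[of K])
    fix k assume "K \<le> k"
    then have "z k \<in> graph_of \<sigma>" using z by simp
    then show "\<sigma> (fst (z k)) = snd (z k)" by (auto simp: graph_of_def)
  qed
  from Lim_transform_eventually[OF L1 ev] show ?thesis
    by (rule LIMSEQ_unique[OF tendsto_snd[OF zl]])
qed

text \<open>The step is iterated with \<lambda>_k tending to 1, treating the open set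
  \<open>B k\<close> at stage k. Jumps above \<open>2 * R k\<close> and points outside the target
  occur on sets of summable measure, and the \<open>R k\<close> are themselves summable, so the
  fields converge almost everywhere to a limit on the graph. In \<open>B k\<close> two components
  gain volume \<eta> k at stage k, and everything disturbed afterwards has smaller volume.\<close>

lemma approximating_sequence:
  fixes W0 :: "(real ^ 'n) \<times> real \<Rightarrow> ('n, 'm) pt"
  assumes Q: "open Q" "bounded Q" "Q \<noteq> {}" and lam0: "\<delta>0 \<le> lm0" "lm0 < 1"
    and W0: "continuous_on Q W0" "W0 ` Q \<subseteq> Sig lm0" and e: "e > 0"
  shows "\<exists>p P W. (\<forall>k. pert Q (p k) (P k)) \<and> (\<forall>y h. p 0 y = 0 \<and> P 0 y h = 0) \<and>
    (\<forall>k. small (e / 2 ^ Suc k) (\<lambda>y. p (Suc k) y - p k y) (\<lambda>y h. P (Suc k) y h - P k y h)) \<and>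
    (\<forall>k. \<forall>y\<in>Q. norm (W0 y + jet (P k y)) \<le> bnd) \<and>
    W \<in> borel_measurable borel \<and>
    (AE y in lborel. y \<in> Q \<longrightarrow> (\<lambda>k. W0 y + jet (P k y)) \<longlonglongrightarrow> W y \<and> snd (W y) = \<sigma> (fst (W y))) \<and>
    (\<exists>d>0. \<forall>U. open U \<longrightarrow> U \<subseteq> Q \<longrightarrow> U \<noteq> {} \<longrightarrow> (\<exists>E1 E2. E1 \<in> sets borel \<and> E2 \<in> sets borel \<and> E1 \<subseteq> U \<and> E2 \<subseteq> U \<and>
        emeasure lborel E1 > 0 \<and> emeasure lborel E2 > 0 \<and> (\<forall>y\<in>E1. \<forall>z\<in>E2. d \<le> dist (fst (W y)) (fst (W z)))))"
proof -
  let ?m = "measure lebesgue"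
  define V where "V = ?m Q"
  have V: "V \<ge> 0" by (simp add: V_def)
  from countable_open_subsets[OF Q(1,3)] obtain B :: "nat \<Rightarrow> ((real ^ 'n) \<times> real) set" where B': "(\<forall>k. open (B k) \<and> B k \<noteq> {} \<and> B k \<subseteq> Q) \<and>
      (\<forall>U. open U \<longrightarrow> U \<subseteq> Q \<longrightarrow> U \<noteq> {} \<longrightarrow> (\<exists>k\<ge>1. B k \<subseteq> U))" ..
  note B1 = conjunct1[OF B', rule_format] and B4 = conjunct2[OF B']
  have B: "open (B k)" "B k \<noteq> {}" "B k \<subseteq> Q" for k using B1[of k] by blast+
  define b where "b k = ?m (B k)" for k
  have Bb: "bounded (B k)" for k by (rule bounded_subset[OF Q(2) B(3)])
  have b: "b k > 0" for k unfolding b_def by (rule measure_pos_open[OF B(1) Bb B(2)])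
  obtain d0 where d0: "d0 > 0" "\<forall>i\<in>{1..N}. \<forall>j\<in>{1..N}. i \<noteq> j \<longrightarrow>
      (\<forall>\<rho>\<in>cball 0 r0. \<forall>\<rho>'\<in>cball 0 r0. d0 \<le> dist (fst (tip i \<rho>)) (fst (tip j \<rho>')))"
    using tip_separation by blast
  have bn: "bnd > 0" by (rule bnd(1))
  \<comment> \<open>10 bnd + 4 is the sum of 4 (2 bnd + 1), for all later displacements, and 2 bnd,
    for the distance from the target to a tip, each in units of \<mu>; see the fact
    \<open>near\<close> below.\<close>
  have c: "d0 / (4 * (10 * bnd + 4)) > 0" using d0 bn by simp
  have mu0: "1 - lm0 > 0" using lam0 by simp
  from parameter_sequences[where b = b, OF mu0 V c e b] obtain \<mu> \<epsilon> :: "nat \<Rightarrow> real" where mu': "\<mu> 0 = 1 - lm0" "\<forall>k. \<mu> k > 0"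
    "\<forall>k. \<mu> (Suc k) \<le> \<mu> k / 2" "\<forall>k. \<mu> (Suc k) \<le> d0 / (4 * (10 * bnd + 4))"
    "\<forall>k. (8 * V + 8) * \<mu> (Suc k) \<le> \<delta>1 * \<mu> k * b k / (8 * N)"
    and ep': "\<epsilon> 0 = V" "\<forall>k. \<epsilon> (Suc k) > 0" "\<forall>k. \<epsilon> (Suc k) \<le> \<mu> (Suc k)" "\<forall>k. \<epsilon> (Suc k) \<le> b (Suc k) / 2"
      "\<forall>k. \<epsilon> (Suc k) \<le> e / 2 ^ Suc k"
    by (elim exE conjE)
  note mu = mu'(1) mu'(2-5)[rule_format] and ep = ep'(1) ep'(2-5)[rule_format]
  define lam where "lam k = 1 - \<mu> k" for k
  define R where "R k = \<mu> k * (2 * bnd + 1)" for k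
  define \<eta> where "\<eta> k = \<delta>1 * \<mu> k * b k / (8 * N)" for k
  have mule: "\<mu> k \<le> 1 - lm0" for k
  proof (induction k)
    case (Suc k) then show ?case using mu(2)[of k] mu(3)[of k] by simp
  qed (simp add: mu(1))
  have lam: "\<delta>0 \<le> lam k" "lam k < lam (Suc k)" "lam (Suc k) < 1" "(1 + lam k) / 2 \<le> lam (Suc k)" "lam k < 1" for k
    using mule[of k] mu(2)[of k] mu(2)[of "Suc k"] mu(3)[of k] lam0 by (auto simp: lam_def)
  define WW where "WW s y = W0 y + jet (snd s y)"
    for s :: "((real ^ 'n) \<times> real \<Rightarrow> (real ^ 'm) \<times> (real ^ 'n ^ 'm)) \<times>
      ((real ^ 'n) \<times> real \<Rightarrow> (real ^ 'n) \<times> real \<Rightarrow> (real ^ 'm) \<times> (real ^ 'n ^ 'm))" and y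
  \<comment> \<open>A state is the total perturbation so far with its derivative. \<open>AA\<close>
    is the invariant of stage k and \<open>RR\<close> the relation between consecutive stages; stage
    0 is pinned to the zero perturbation.\<close>
  define AA where "AA k s \<longleftrightarrow> pert Q (fst s) (snd s) \<and> (\<forall>y\<in>Q. WW s y \<in> Sig (lam k)) \<and>
      ?m {y \<in> Q. WW s y \<notin> TT (lam k)} \<le> \<epsilon> k \<and> (k = 0 \<longrightarrow> s = (\<lambda>y. 0, \<lambda>y h. 0))" for k s
  define RR where "RR k s s' \<longleftrightarrow> small (\<epsilon> (Suc k)) (\<lambda>y. fst s' y - fst s y) (\<lambda>y h. snd s' y h - snd s y h) \<and>
      ?m {y \<in> Q. \<not> norm (jet (snd s' y) - jet (snd s y)) < 2 * R k} \<le> 2 * (\<mu> k + \<epsilon> (Suc k)) * V + \<epsilon> k + \<epsilon> (Suc k) \<and>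
      (\<epsilon> k \<le> b k / 2 \<longrightarrow> (\<exists>i\<in>{1..N}. \<eta> k \<le> ?m {y \<in> B k. WW s' y \<in> S i (lam (Suc k))} \<and>
         \<eta> k \<le> ?m {y \<in> B k. WW s' y \<in> S (pr i) (lam (Suc k))}))" for k s s'
  have contWW: "continuous_on Q (WW s)" if "pert Q (fst s) (snd s)" for s
    unfolding WW_def by (intro continuous_intros W0 continuous_on_subset[OF pert_jet_continuous[OF that]]) auto
  have Qm: "Q \<in> lmeasurable" by (rule lmeasurable_open_bounded[OF Q(1,2)])
  have "\<exists>s. \<forall>k. AA k (s k) \<and> RR k (s k) (s (Suc k))"
  proof (rule dependent_nat_choice)
    have "AA 0 (\<lambda>y. 0, \<lambda>y h. 0)"
      unfolding AA_def
    proof (intro conjI ballI impI refl)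
      show "WW (\<lambda>y. 0, \<lambda>y h. 0) y \<in> Sig (lam 0)" if "y \<in> Q" for y
        using W0(2) that by (auto simp: WW_def lam_def mu(1))
      have w: "WW (\<lambda>y. 0, \<lambda>y h. 0) = W0" by (simp add: WW_def fun_eq_iff)
      have "open (Q \<inter> W0 -` TT (lam 0))"
        by (rule continuous_open_preimage[OF W0(1) Q(1) open_TT]) (use lam[of 0] in auto)
      then have o: "Q \<inter> W0 -` TT (lam 0) \<in> sets lebesgue" by simp
      have "{y \<in> Q. WW (\<lambda>y. 0, \<lambda>y h. 0) y \<notin> TT (lam 0)} = Q - Q \<inter> W0 -` TT (lam 0)"
        unfolding w by auto
      then show "?m {y \<in> Q. WW (\<lambda>y. 0, \<lambda>y h. 0) y \<notin> TT (lam 0)} \<le> \<epsilon> 0"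
        using o Qm by (auto simp: ep(1) V_def intro!: measure_mono_fmeasurable sets.Diff)
    qed auto
    then show "\<exists>s. AA 0 s" ..
  next
    fix s k assume A: "AA k s"
    then have ps: "pert Q (fst s) (snd s)" and im: "WW s ` Q \<subseteq> Sig (lam k)"
      and bd: "?m {y \<in> Q. WW s y \<notin> TT (lam k)} \<le> \<epsilon> k" by (auto simp: AA_def)
    have bk: "?m (B k) > 0" using b[of k] by (simp add: b_def)
    from iteration_step[OF Q(1,2) lam(1,2,3,4) contWW[OF ps] im bd ep(2)[of k] B(1,3) bk]
    obtain f F where f: "pert Q f F" "small (\<epsilon> (Suc k)) f F" "\<forall>y\<in>Q. WW s y + jet (F y) \<in> Sig (lam (Suc k))"
      "?m {y \<in> Q. WW s y + jet (F y) \<notin> TT (lam (Suc k))} \<le> \<epsilon> (Suc k)"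
      "?m {y \<in> Q. \<not> norm (jet (F y)) < 2 * ((1 - lam k) * (2 * bnd + 1))} \<le> 2 * (1 - lam k + \<epsilon> (Suc k)) * ?m Q + \<epsilon> k + \<epsilon> (Suc k)"
      "\<epsilon> k \<le> ?m (B k) / 2 \<longrightarrow> (\<exists>i\<in>{1..N}. \<delta>1 * (1 - lam k) * ?m (B k) / (8 * N) \<le> ?m {y \<in> B k. WW s y + jet (F y) \<in> S i (lam (Suc k))} \<and>
         \<delta>1 * (1 - lam k) * ?m (B k) / (8 * N) \<le> ?m {y \<in> B k. WW s y + jet (F y) \<in> S (pr i) (lam (Suc k))})"
      by (elim exE conjE)
    define s' where "s' = (\<lambda>y. fst s y + f y, \<lambda>y h. snd s y h + F y h)"
    have j: "jet (snd s' y) = jet (snd s y) + jet (F y)" for y by (simp add: s'_def jet_add)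
    have w: "WW s' y = WW s y + jet (F y)" for y by (simp add: WW_def j add.assoc)
    have "AA (Suc k) s'" unfolding AA_def w using f(3,4) pert_add[OF ps f(1)] by (simp add: s'_def)
    moreover have "RR k s s'" unfolding RR_def w j
      using f(2,5,6) by (simp add: s'_def R_def \<eta>_def b_def V_def lam_def)
    ultimately show "\<exists>s'. AA (Suc k) s' \<and> RR k s s'" by blast
  qed
  then obtain s where s: "\<And>k. AA k (s k)" "\<And>k. RR k (s k) (s (Suc k))" by blast
  define p where "p k = fst (s k)" for k
  define P where "P k = snd (s k)" for k
  have pp: "pert Q (p k) (P k)" for k using s(1)[of k] by (simp add: AA_def p_def P_def)
  have WP: "WW (s k) y = W0 y + jet (P k y)" for k y by (simp add: WW_def P_def)
  define Bd where "Bd k = {y \<in> Q. \<not> norm (jet (P (Suc k) y) - jet (P k y)) < 2 * R k}" for k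
  define Td where "Td k = {y \<in> Q. WW (s k) y \<notin> TT (lam k)}" for k
  have Bdb: "Bd k \<in> sets borel" for k
  proof -
    have "open {y. norm (jet (P (Suc k) y) - jet (P k y)) < 2 * R k}"
      by (intro open_Collect_less continuous_intros pert_jet_continuous[OF pp])
    then have "Q - {y. norm (jet (P (Suc k) y) - jet (P k y)) < 2 * R k} \<in> sets borel" using Q(1) by auto
    moreover have "Bd k = Q - {y. norm (jet (P (Suc k) y) - jet (P k y)) < 2 * R k}" by (auto simp: Bd_def)
    ultimately show ?thesis by simp
  qed
  have lev: "{y \<in> G. WW (s k) y \<in> U} \<in> sets borel" if "open G" "G \<subseteq> Q" "open U" for k G U
  proof -
    have "open (G \<inter> WW (s k) -` U)"
      by (rule continuous_open_preimage[OF continuous_on_subset[OF contWW that(2)] that(1,3)]) (use pp in \<open>simp add: p_def P_def\<close>)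
    then show ?thesis by (simp add: vimage_def Int_def)
  qed
  have Tdb: "Td k \<in> sets borel" for k
  proof -
    have "Td k = Q - {y \<in> Q. WW (s k) y \<in> TT (lam k)}" by (auto simp: Td_def)
    then show ?thesis using lev[OF Q(1) order_refl open_TT, of "lam k" k] lam[of k] Q(1) by auto
  qed
  have md: "measure lborel X = ?m X" if "X \<in> sets borel" for X :: "((real ^ 'n) \<times> real) set"
    using measure_completion[of X lborel] that by simp
  have fin: "emeasure lborel X < \<infinity>" if "X \<subseteq> Q" for X
    by (rule emeasure_bounded_finite) (use bounded_subset[OF Q(2) that] in auto)
  have em: "emeasure lborel X = ennreal (?m X)" if "X \<subseteq> Q" "X \<in> sets borel" for X
    using emeasure_eq_ennreal_measure[of lborel X] fin[OF that(1)] md[OF that(2)] by simp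
  have sumu: "summable \<mu>" by (rule halving_sum(2)) (use mu in auto)
  have mBd: "?m (Bd (Suc k)) \<le> (4 * V + 2) * \<mu> (Suc k)" for k
  proof -
    have "?m (Bd (Suc k)) \<le> 2 * (\<mu> (Suc k) + \<epsilon> (Suc (Suc k))) * V + \<epsilon> (Suc k) + \<epsilon> (Suc (Suc k))"
      using s(2)[of "Suc k"] by (simp add: RR_def Bd_def P_def)
    moreover have e2: "\<epsilon> (Suc (Suc k)) \<le> \<mu> (Suc k)" using ep(3)[of "Suc k"] mu(3)[of "Suc k"] mu(2)[of "Suc k"] by linarith
    moreover have "(\<mu> (Suc k) + \<epsilon> (Suc (Suc k))) * V \<le> (2 * \<mu> (Suc k)) * V" using e2 V by (intro mult_right_mono) auto
    moreover have "(4 * V + 2) * \<mu> (Suc k) = 2 * ((2 * \<mu> (Suc k)) * V) + \<mu> (Suc k) + \<mu> (Suc k)" by (simp add: algebra_simps)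
    ultimately show ?thesis using ep(3)[of k] by linarith
  qed
  have mTd: "?m (Td k) \<le> \<epsilon> k" for k using s(1)[of k] by (simp add: AA_def Td_def)
  have BdQ: "Bd k \<subseteq> Q" and TdQ: "Td k \<subseteq> Q" for k by (auto simp: Bd_def Td_def)
  have sumR: "summable (\<lambda>k. 2 * R k)" unfolding R_def by (intro summable_mult summable_mult2 sumu)
  have convg: "\<exists>X. (\<lambda>k. WW (s k) y) \<longlonglongrightarrow> X" if "y \<in> Q" "\<And>k. k \<ge> K \<Longrightarrow> y \<notin> Bd k" for y K
  proof -
    define a where "a k = jet (P (Suc k) y) - jet (P k y)" for k
    have "summable a"
      by (rule summable_comparison_test'[OF sumR, of K]) (use that in \<open>auto simp: Bd_def a_def less_imp_le\<close>)
    then have "(\<lambda>n. \<Sum>k<n. a k) \<longlonglongrightarrow> suminf a" by (rule summable_LIMSEQ)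
    moreover have "(\<Sum>k<n. a k) = jet (P n y) - jet (P 0 y)" for n
      unfolding a_def by (rule sum_lessThan_telescope)
    ultimately have "(\<lambda>n. jet (P n y) - jet (P 0 y)) \<longlonglongrightarrow> suminf a" by simp
    from tendsto_add[OF tendsto_const this, of "W0 y + jet (P 0 y)"] show ?thesis unfolding WP by auto
  qed
  \<comment> \<open>Extended by zero outside Q, so that the pointwise limit is taken of Borel
    functions on the whole space.\<close>
  define g where "g k y = (if y \<in> Q then WW (s k) y else 0)" for k y
  have gb: "g k \<in> borel_measurable borel" for k
  proof -
    have "(\<lambda>y. indicator Q y *\<^sub>R WW (s k) y) \<in> borel_measurable borel"
      by (rule borel_measurable_continuous_on_indicator[OF _ contWW]) (use Q(1) pp in \<open>auto simp: p_def P_def\<close>)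
    moreover have "g k = (\<lambda>y. indicator Q y *\<^sub>R WW (s k) y)" by (simp add: g_def fun_eq_iff indicator_def)
    ultimately show ?thesis by simp
  qed
  define W where "W y = lim (\<lambda>k. g k y)" for y
  have Wb: "W \<in> borel_measurable borel" unfolding W_def by (rule borel_measurable_lim_metric[OF gb])
  have Wlim: "(\<lambda>k. WW (s k) y) \<longlonglongrightarrow> W y" if yB: "y \<in> Q" "\<And>k. k \<ge> K \<Longrightarrow> y \<notin> Bd k" for y K
  proof -
    obtain X where X: "(\<lambda>k. WW (s k) y) \<longlonglongrightarrow> X" using convg[OF yB] by blast
    moreover have "W y = X" unfolding W_def using limI[OF X] yB(1) by (simp add: g_def)
    ultimately show ?thesis by simp
  qed
  have lam1: "lam \<longlonglongrightarrow> 1"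
    using tendsto_diff[OF tendsto_const summable_LIMSEQ_zero[OF sumu], of 1] by (simp add: lam_def[abs_def])
  \<comment> \<open>Borel-Cantelli: almost every point makes only finitely many large jumps; below,
    likewise, it lies outside the target at only finitely many stages.\<close>
  have "AE y in lborel. eventually (\<lambda>n. y \<in> space lborel - Bd n) sequentially"
  proof (rule borel_cantelli_AE1)
    show "summable (\<lambda>n. measure lborel (Bd n))"
    proof (subst summable_Suc_iff[symmetric], rule summable_comparison_test')
      show "summable (\<lambda>k. (4 * V + 2) * \<mu> (Suc k))" using sumu by (intro summable_mult) (simp add: summable_Suc_iff)
      show "norm (measure lborel (Bd (Suc k))) \<le> (4 * V + 2) * \<mu> (Suc k)" if "k \<ge> 0" for k
        using mBd[of k] md[OF Bdb] by simp
    qed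
  qed (use Bdb fin[OF BdQ] in auto)
  moreover have "AE y in lborel. eventually (\<lambda>n. y \<in> space lborel - Td n) sequentially"
  proof (rule borel_cantelli_AE1)
    show "summable (\<lambda>n. measure lborel (Td n))"
    proof (subst summable_Suc_iff[symmetric], rule summable_comparison_test')
      show "summable (\<lambda>k. \<mu> (Suc k))" using sumu by (simp add: summable_Suc_iff)
      show "norm (measure lborel (Td (Suc k))) \<le> \<mu> (Suc k)" if "k \<ge> 0" for k
        using order_trans[OF mTd ep(3)] md[OF Tdb] by simp
    qed
  qed (use Tdb fin[OF TdQ] in auto)
  ultimately have ae: "AE y in lborel. y \<in> Q \<longrightarrow> (\<lambda>k. W0 y + jet (P k y)) \<longlonglongrightarrow> W y \<and> snd (W y) = \<sigma> (fst (W y))"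
  proof eventually_elim
    case (elim y)
    show ?case
    proof
      assume y: "y \<in> Q"
      obtain K1 where K1: "\<And>k. k \<ge> K1 \<Longrightarrow> y \<notin> Bd k" using elim(1) unfolding eventually_sequentially by auto
      obtain K2 where K2: "\<And>k. k \<ge> K2 \<Longrightarrow> y \<notin> Td k" using elim(2) unfolding eventually_sequentially by auto
      have l: "(\<lambda>k. WW (s k) y) \<longlonglongrightarrow> W y" by (rule Wlim[OF y K1])
      moreover have "snd (W y) = \<sigma> (fst (W y))"
        by (rule S_limit_graph[OF _ lam1 lam(5) l, of K2]) (use K2 y in \<open>auto simp: Td_def\<close>)
      ultimately show "(\<lambda>k. W0 y + jet (P k y)) \<longlonglongrightarrow> W y \<and> snd (W y) = \<sigma> (fst (W y))" by (simp add: WP)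
    qed
  qed
  have osc: "\<exists>E1 E2. E1 \<in> sets borel \<and> E2 \<in> sets borel \<and> E1 \<subseteq> U \<and> E2 \<subseteq> U \<and>
        emeasure lborel E1 > 0 \<and> emeasure lborel E2 > 0 \<and> (\<forall>y\<in>E1. \<forall>z\<in>E2. d0 / 2 \<le> dist (fst (W y)) (fst (W z)))"
    if U: "open U" "U \<subseteq> Q" "U \<noteq> {}" for U
  proof -
    obtain k where k: "k \<ge> 1" "B k \<subseteq> U" using B4 U by blast
    then obtain k' where k': "k = Suc k'" by (cases k) auto
    obtain i where i: "i \<in> {1..N}" "\<eta> k \<le> ?m {y \<in> B k. WW (s (Suc k)) y \<in> S i (lam (Suc k))}"
      "\<eta> k \<le> ?m {y \<in> B k. WW (s (Suc k)) y \<in> S (pr i) (lam (Suc k))}"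
      using s(2)[of k] ep(4)[of k'] unfolding RR_def k' by blast
    \<comment> \<open>All points that make a large jump after stage k + 1 is reached. The geometric
      series bounds the volume of \<open>Z\<close> by a quantity smaller than \<eta> k.\<close>
    define Z where "Z = (\<Union>l. Bd (l + Suc k))"
    have Zb: "Z \<in> sets borel" unfolding Z_def using Bdb by blast
    have sk: "summable (\<lambda>l. (4 * V + 2) * \<mu> (l + Suc k))"
      by (intro summable_mult summable_ignore_initial_segment sumu)
    have Zm: "emeasure lborel Z \<le> ennreal ((8 * V + 4) * \<mu> (Suc k))"
    proof -
      have "emeasure lborel Z \<le> (\<Sum>l. emeasure lborel (Bd (l + Suc k)))"
        unfolding Z_def by (rule emeasure_subadditive_countably) (use Bdb in auto)
      also have "\<dots> \<le> (\<Sum>l. ennreal ((4 * V + 2) * \<mu> (l + Suc k)))"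
      proof (rule suminf_le)
        show "emeasure lborel (Bd (l + Suc k)) \<le> ennreal ((4 * V + 2) * \<mu> (l + Suc k))" for l
          using em[OF BdQ Bdb] mBd[of "l + k"] by (auto intro!: ennreal_leI)
      qed auto
      also have "\<dots> = ennreal (\<Sum>l. (4 * V + 2) * \<mu> (l + Suc k))"
      proof (rule suminf_ennreal2[OF _ sk])
        show "0 \<le> (4 * V + 2) * \<mu> (l + Suc k)" for l
          using V less_imp_le[OF mu(2)[of "l + Suc k"]] by (intro mult_nonneg_nonneg) auto
      qed
      also have "\<dots> \<le> ennreal ((8 * V + 4) * \<mu> (Suc k))"
      proof (rule ennreal_leI, rule suminf_le_const)
        show "summable (\<lambda>l. (4 * V + 2) * \<mu> (l + Suc k))" by (rule sk)
        fix n
        have "(\<Sum>l<n. \<mu> (l + Suc k)) = (\<Sum>l\<in>{Suc k..<Suc k + n}. \<mu> l)"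
        proof -
          have "sum \<mu> {0 + Suc k..<n + Suc k} = (\<Sum>l\<in>{0..<n}. \<mu> (l + Suc k))" by (rule sum.shift_bounds_nat_ivl)
          then show ?thesis by (simp only: atLeast0LessThan add_0 add.commute[of n])
        qed
        also have "\<dots> \<le> 2 * \<mu> (Suc k)" by (rule halving_sum(1)) (use mu in auto)
        finally have part: "(4 * V + 2) * (\<Sum>l<n. \<mu> (l + Suc k)) \<le> (4 * V + 2) * (2 * \<mu> (Suc k))"
          using V by (intro mult_left_mono) auto
        then show "(\<Sum>l<n. (4 * V + 2) * \<mu> (l + Suc k)) \<le> (8 * V + 4) * \<mu> (Suc k)"
        proof -
          have "(4 * V + 2) * (2 * \<mu> (Suc k)) = (8 * V + 4) * \<mu> (Suc k)" by (simp add: algebra_simps)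
          moreover have "(\<Sum>l<n. (4 * V + 2) * \<mu> (l + Suc k)) = (4 * V + 2) * (\<Sum>l<n. \<mu> (l + Suc k))"
            by (rule sum_distrib_left[symmetric])
          ultimately show ?thesis using part by linarith
        qed
      qed
      finally show ?thesis .
    qed
    \<comment> \<open>Points of component \<open>j\<close> that stay close to it for ever; the set
      has positive measure since \<open>Z\<close> is too small to cover the gain.\<close>
    define E where "E j = {y \<in> B k. WW (s (Suc k)) y \<in> S j (lam (Suc k))} - Z" for j
    have Eb: "E j \<in> sets borel" if "j \<in> {1..N}" for j
      unfolding E_def using lev[OF B(1,3) open_S[OF that]] lam(1)[of "Suc k"] lam(5)[of "Suc k"] Zb by auto
    have Epos: "emeasure lborel (E j) > 0" if j: "j \<in> {1..N}" "\<eta> k \<le> ?m {y \<in> B k. WW (s (Suc k)) y \<in> S j (lam (Suc k))}" for j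
    proof (rule ccontr)
      assume "\<not> ?thesis"
      then have E0: "emeasure lborel (E j) = 0" by simp
      let ?X = "{y \<in> B k. WW (s (Suc k)) y \<in> S j (lam (Suc k))}"
      have Xb: "?X \<in> sets borel" using lev[OF B(1,3) open_S[OF j(1)]] lam(1)[of "Suc k"] lam(5)[of "Suc k"] by auto
      have XQ: "?X \<subseteq> Q" using B(3) by auto
      have "ennreal (\<eta> k) \<le> emeasure lborel ?X" unfolding em[OF XQ Xb] by (rule ennreal_leI[OF j(2)])
      also have "\<dots> \<le> emeasure lborel (E j \<union> Z)"       proof (rule emeasure_mono)
        show "?X \<subseteq> E j \<union> Z" by (auto simp: E_def)
        show "E j \<union> Z \<in> sets lborel" using Eb[OF j(1)] Zb by simp
      qed
      also have "\<dots> \<le> emeasure lborel (E j) + emeasure lborel Z" by (rule emeasure_subadditive) (use Eb[OF j(1)] Zb in auto)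
      also have "\<dots> \<le> ennreal ((8 * V + 4) * \<mu> (Suc k))" using Zm by (simp add: E0)
      finally have "\<eta> k \<le> (8 * V + 4) * \<mu> (Suc k)" using V mu(2)[of "Suc k"] by (subst (asm) ennreal_le_iff) auto
      moreover have "(8 * V + 4) * \<mu> (Suc k) < (8 * V + 8) * \<mu> (Suc k)" using mu(2)[of "Suc k"] by (intro mult_strict_right_mono) auto
      ultimately show False using mu(5)[of k] by (simp add: \<eta>_def)
    qed
    \<comment> \<open>The displacements after stage k + 1 sum to a multiple of \<mu> (Suc k), so the
      limit is within d0/4 of a tip of index \<open>j\<close>. Two components then remain d0 - 2
      (d0/4) = d0/2 apart.\<close>
    have near: "\<exists>\<rho>\<in>cball 0 r0. dist (W y) (tip j \<rho>) \<le> d0 / 4" if j: "j \<in> {1..N}" and y: "y \<in> E j" for j y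
    proof -
      have yQ: "y \<in> Q" using y B(3) by (auto simp: E_def)
      have yB: "y \<notin> Bd l" if "l \<ge> Suc k" for l
      proof -
        have "Bd ((l - Suc k) + Suc k) \<subseteq> Z" unfolding Z_def by (rule UN_upper) simp
        then have "Bd l \<subseteq> Z" using that by simp
        then show ?thesis using y unfolding E_def by blast
      qed
      have lim: "(\<lambda>n. WW (s n) y) \<longlonglongrightarrow> W y" by (rule Wlim[OF yQ yB])
      have part: "dist (WW (s (Suc k + n)) y) (WW (s (Suc k)) y) \<le> (\<Sum>l\<in>{Suc k..<Suc k + n}. 2 * R l)" for n
      proof (induction n)
        case (Suc n)
        have "dist (WW (s (Suc k + Suc n)) y) (WW (s (Suc k + n)) y) \<le> 2 * R (Suc k + n)"
          using yB[of "Suc k + n"] yQ by (auto simp: Bd_def WP dist_norm)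
        then have "dist (WW (s (Suc k + Suc n)) y) (WW (s (Suc k)) y) \<le> 2 * R (Suc k + n) + (\<Sum>l\<in>{Suc k..<Suc k + n}. 2 * R l)"
          by (rule order_trans[OF dist_triangle add_mono[OF _ Suc]])
        then show ?case by simp
      qed simp
      have "(\<Sum>l\<in>{Suc k..<Suc k + n}. 2 * R l) \<le> (4 * (2 * bnd + 1)) * \<mu> (Suc k)" for n
      proof -
        have "(\<Sum>l\<in>{Suc k..<Suc k + n}. 2 * R l) = (2 * (2 * bnd + 1)) * (\<Sum>l\<in>{Suc k..<Suc k + n}. \<mu> l)"
          unfolding sum_distrib_left R_def by (intro sum.cong refl) (simp add: algebra_simps)
        also have "\<dots> \<le> (2 * (2 * bnd + 1)) * (2 * \<mu> (Suc k))"
          by (intro mult_left_mono halving_sum(1)) (use mu bn in auto)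
        finally show ?thesis by (simp add: algebra_simps)
      qed
      then have "dist (WW (s (Suc k + n)) y) (WW (s (Suc k)) y) \<le> (4 * (2 * bnd + 1)) * \<mu> (Suc k)" for n
        using part order_trans by blast
      moreover have "(\<lambda>n. dist (WW (s (Suc k + n)) y) (WW (s (Suc k)) y)) \<longlonglongrightarrow> dist (W y) (WW (s (Suc k)) y)"
        by (intro tendsto_intros LIMSEQ_ignore_initial_segment[OF lim, of "Suc k", unfolded add.commute[of _ "Suc k"]])
      ultimately have d1: "dist (W y) (WW (s (Suc k)) y) \<le> (4 * (2 * bnd + 1)) * \<mu> (Suc k)"
        by (intro Lim_bounded) auto
      obtain \<rho> where r: "\<rho> \<in> ball 0 r0" "WW (s (Suc k)) y = A j (lam (Suc k)) \<rho>" using y S_iff unfolding E_def by blast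
      then have "dist (WW (s (Suc k)) y) (tip j \<rho>) \<le> \<mu> (Suc k) * (2 * bnd)"
        using dist_A(2)[OF j, of \<rho> "lam (Suc k)"] mu(2)[of "Suc k"] by (simp add: lam_def)
      then have "dist (W y) (tip j \<rho>) \<le> (4 * (2 * bnd + 1)) * \<mu> (Suc k) + \<mu> (Suc k) * (2 * bnd)"
        by (rule order_trans[OF dist_triangle add_mono[OF d1]])
      also have "\<dots> = (10 * bnd + 4) * \<mu> (Suc k)" by (simp add: algebra_simps)
      also have "\<dots> \<le> (10 * bnd + 4) * (d0 / (4 * (10 * bnd + 4)))" by (intro mult_left_mono mu(4)) (use bn in auto)
      also have "\<dots> = d0 / 4"
      proof -
        have x: "x * (d0 / (4 * x)) = d0 / 4" if "x > 0" for x :: real using that by simp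
        show ?thesis by (rule x) (use bn in simp)
      qed
      finally show ?thesis using r by (intro bexI[of _ \<rho>]) auto
    qed
    have "d0 / 2 \<le> dist (fst (W y)) (fst (W z))" if yz: "y \<in> E i" "z \<in> E (pr i)" for y z
    proof -
      obtain \<rho> where r: "\<rho> \<in> cball 0 r0" "dist (W y) (tip i \<rho>) \<le> d0 / 4" using near[OF i(1) yz(1)] by blast
      obtain \<rho>' where r': "\<rho>' \<in> cball 0 r0" "dist (W z) (tip (pr i) \<rho>') \<le> d0 / 4" using near[OF pr_mem(1)[OF i(1)] yz(2)] by blast
      have "d0 \<le> dist (fst (tip i \<rho>)) (fst (tip (pr i) \<rho>'))"
        using d0(2)[rule_format, OF i(1) pr_mem(1)[OF i(1)] pr_mem(2)[OF i(1), symmetric] r(1) r'(1)] .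
      moreover have "dist (fst (W y)) (fst (tip i \<rho>)) \<le> d0 / 4" by (rule order_trans[OF dist_fst_le r(2)])
      moreover have "dist (fst (W z)) (fst (tip (pr i) \<rho>')) \<le> d0 / 4" by (rule order_trans[OF dist_fst_le r'(2)])
      moreover have "dist (fst (tip i \<rho>)) (fst (tip (pr i) \<rho>')) \<le> dist (fst (W y)) (fst (tip i \<rho>)) +
          (dist (fst (W y)) (fst (W z)) + dist (fst (W z)) (fst (tip (pr i) \<rho>')))"
        using dist_triangle3[of "fst (tip i \<rho>)" "fst (tip (pr i) \<rho>')" "fst (W y)"]
          dist_triangle[of "fst (W y)" "fst (tip (pr i) \<rho>')" "fst (W z)"] by linarith
      ultimately show ?thesis by linarith
    qed
    then show ?thesis
      using Eb[OF i(1)] Eb[OF pr_mem(1)[OF i(1)]] Epos[OF i(1,2)] Epos[OF pr_mem(1)[OF i(1)] i(3)] k(2)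
      by (intro exI[of _ "E i"] exI[of _ "E (pr i)"] conjI ballI) (auto simp: E_def)
  qed
  show ?thesis
  proof (intro exI[of _ p] exI[of _ P] exI[of _ W] conjI allI ballI pp Wb ae)
    show "p 0 y = 0" "P 0 y h = 0" for y h using s(1)[of 0] by (auto simp: AA_def p_def P_def)
    show "small (e / 2 ^ Suc k) (\<lambda>y. p (Suc k) y - p k y) (\<lambda>y h. P (Suc k) y h - P k y h)" for k
      using s(2)[of k] small_mono[OF _ ep(5)] unfolding RR_def p_def P_def by blast
    show "norm (W0 y + jet (P k y)) \<le> bnd" if "y \<in> Q" for y k
      unfolding WP[symmetric] by (rule bnd(4)[OF lam(5)[of k]]) (use s(1)[of k] that in \<open>simp add: AA_def\<close>)
    show "\<exists>d>0. \<forall>U. open U \<longrightarrow> U \<subseteq> Q \<longrightarrow> U \<noteq> {} \<longrightarrow> (\<exists>E1 E2. E1 \<in> sets borel \<and> E2 \<in> sets borel \<and> E1 \<subseteq> U \<and> E2 \<subseteq> U \<and>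
        emeasure lborel E1 > 0 \<and> emeasure lborel E2 > 0 \<and> (\<forall>y\<in>E1. \<forall>z\<in>E2. d \<le> dist (fst (W y)) (fst (W z))))"
    proof (rule exI[of _ "d0 / 2"], rule conjI)
      show "d0 / 2 > 0" using d0(1) by simp
    qed (intro allI impI, rule osc)
  qed
qed

end

section \<open>Integration by parts and smooth test functions\<close>

lemma continuous_extension_zero:
  assumes "open G" "continuous_on G g" "compact C" "C \<subseteq> G" "\<And>y. y \<notin> C \<Longrightarrow> g y = 0"
  shows "continuous_on UNIV (g :: 'a::t2_space \<Rightarrow> 'b::real_normed_vector)"
proof -
  have "closed C" by (rule compact_imp_closed[OF assms(3)])
  then have o: "open (- C)" by (rule open_Compl)
  have "continuous_on (- C) (\<lambda>y. 0::'b)" by (rule continuous_on_const)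
  then have "continuous_on (- C) g" by (rule continuous_on_eq) (use assms(5) in auto)
  then have "continuous_on (G \<union> - C) g" by (rule continuous_on_open_Un[OF assms(1) o assms(2)])
  moreover have "G \<union> - C = UNIV" using assms(4) by auto
  ultimately show ?thesis by simp
qed

lemma integrable_compact_support:
  fixes g :: "'a::euclidean_space \<Rightarrow> 'b::{banach, second_countable_topology}"
  assumes "continuous_on UNIV g" "compact C" "\<And>y. y \<notin> C \<Longrightarrow> g y = 0"
  shows "integrable lborel g"
proof -
  have "integrable lborel (\<lambda>x. indicator C x *\<^sub>R g x)"
    by (rule borel_integrable_compact[OF assms(2) continuous_on_subset[OF assms(1)]]) simp
  moreover have "(\<lambda>x. indicator C x *\<^sub>R g x) = g" using assms(3) by (auto simp: fun_eq_iff indicator_def)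
  ultimately show ?thesis by simp
qed

lemma lborel_integral_translation:
  fixes g :: "'a::euclidean_space \<Rightarrow> 'b::{banach, second_countable_topology}"
  assumes "integrable lborel g"
  shows "integral\<^sup>L lborel (\<lambda>y. g (y + t)) = integral\<^sup>L lborel g"
    and "integrable lborel (\<lambda>y. g (y + t))"
proof -
  have m: "(+) t \<in> lborel \<rightarrow>\<^sub>M borel" "g \<in> borel_measurable borel" using assms by auto
  have "integral\<^sup>L (distr lborel borel ((+) t)) g = integral\<^sup>L lborel (\<lambda>y. g (t + y))" by (rule integral_distr[OF m])
  then show "integral\<^sup>L lborel (\<lambda>y. g (y + t)) = integral\<^sup>L lborel g" by (simp only: lborel_distr_plus add.commute[of t])
  have "integrable (distr lborel borel ((+) t)) g" using assms by (simp only: lborel_distr_plus)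
  then have "integrable lborel (\<lambda>y. g (t + y))" by (simp only: integrable_distr_eq[OF m])
  then show "integrable lborel (\<lambda>y. g (y + t))" by (simp only: add.commute[of t])
qed

text \<open>The integral of a difference quotient vanishes by translation invariance.\<close>
lemma integral_derivative_zero:
  fixes g :: "'a::euclidean_space \<Rightarrow> real"
  assumes d: "\<And>y. (g has_derivative D y) (at y)" and c: "continuous_on UNIV (\<lambda>y. D y e)"
    and C: "compact C" "\<And>y. y \<notin> C \<Longrightarrow> g y = 0" "\<And>y. y \<notin> C \<Longrightarrow> D y e = 0"
  shows "integral\<^sup>L lborel (\<lambda>y. D y e) = 0"
proof -
  have gc: "continuous_on UNIV g" using d by (meson continuous_at_imp_continuous_on has_derivative_continuous)
  have gi: "integrable lborel g" by (rule integrable_compact_support[OF gc C(1,2)])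
  obtain M where M: "M > 0" "\<And>y. norm (D y e) \<le> M"
    using continuous_compact_support_bounded[OF c C(1,3)] by blast
  obtain r where r: "\<And>y. y \<in> C \<Longrightarrow> norm y \<le> r" using compact_imp_bounded[OF C(1)] bounded_iff by metis
  define t where "t n = 1 / real (Suc n)" for n
  have t: "t n > 0" "t n \<le> 1" for n by (auto simp: t_def)
  have tl: "t \<longlonglongrightarrow> 0" unfolding t_def by (rule LIMSEQ_Suc[OF lim_1_over_n])
  define q where "q n y = (g (y + t n *\<^sub>R e) - g y) / t n" for n y
  have dline: "((\<lambda>s. g (y + s *\<^sub>R e)) has_real_derivative D (y + s *\<^sub>R e) e) (at s)" for y s
  proof -
    have "((\<lambda>s. y + s *\<^sub>R e) has_derivative (\<lambda>s. s *\<^sub>R e)) (at s)" by (auto intro!: derivative_eq_intros)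
    from has_derivative_compose[OF this d[of "y + s *\<^sub>R e"]]
    have "((\<lambda>s. g (y + s *\<^sub>R e)) has_derivative (\<lambda>x. D (y + s *\<^sub>R e) (x *\<^sub>R e))) (at s)" .
    moreover have "D (y + s *\<^sub>R e) (x *\<^sub>R e) = D (y + s *\<^sub>R e) e * x" for x
      using linear_scale[OF has_derivative_linear[OF d[of "y + s *\<^sub>R e"]]] by (simp add: mult.commute)
    ultimately show ?thesis by (simp add: has_field_derivative_def mult_commute_abs)
  qed
  have "(\<lambda>n. integral\<^sup>L lborel (q n)) \<longlonglongrightarrow> integral\<^sup>L lborel (\<lambda>y. D y e)"
  \<comment> \<open>The mean value theorem bounds the quotients by \<open>M\<close>, and steps of
    size at most 1 keep their supports in a fixed ball.\<close>
  proof (rule integral_dominated_convergence[where w = "\<lambda>y. indicator (cball 0 (r + norm e)) y *\<^sub>R M"])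
    show "(\<lambda>y. D y e) \<in> borel_measurable lborel" using c by (simp add: borel_measurable_continuous_onI)
    have "t n \<noteq> 0" for n using t(1)[of n] by linarith
    then have "continuous_on UNIV (q n)" for n unfolding q_def
      by (intro continuous_intros gc continuous_on_compose2[OF gc]) simp_all
    then show "q n \<in> borel_measurable lborel" for n by (simp add: borel_measurable_continuous_onI)
    show "integrable lborel (\<lambda>y. indicator (cball (0::'a) (r + norm e)) y *\<^sub>R M)"
      by (rule borel_integrable_compact) auto
    show "AE y in lborel. (\<lambda>n. q n y) \<longlonglongrightarrow> D y e"
    proof (rule AE_I2)
      fix y
      have "((\<lambda>s. (g (y + s *\<^sub>R e) - g y) / s) \<longlongrightarrow> D y e) (at 0)"
        using dline[of y 0] by (simp add: has_field_derivative_iff)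
      moreover have "t n \<noteq> 0" for n using t(1)[of n] by linarith
      then have "filterlim t (at 0) sequentially" using tl by (simp add: filterlim_at)
      ultimately have "(\<lambda>n. (g (y + t n *\<^sub>R e) - g y) / t n) \<longlonglongrightarrow> D y e" by (rule filterlim_compose)
      then show "(\<lambda>n. q n y) \<longlonglongrightarrow> D y e" by (simp only: q_def)
    qed
    show "AE y in lborel. norm (q n y) \<le> indicator (cball 0 (r + norm e)) y *\<^sub>R M" for n
    proof (rule AE_I2)
      fix y
      show "norm (q n y) \<le> indicator (cball 0 (r + norm e)) y *\<^sub>R M"
      proof (cases "y \<in> cball 0 (r + norm e)")
        case True
        have "norm (g (y + t n *\<^sub>R e) - g (y + 0 *\<^sub>R e)) \<le> M * norm (t n - 0)"
          by (rule field_differentiable_bound[of UNIV "\<lambda>s. g (y + s *\<^sub>R e)" "\<lambda>s. D (y + s *\<^sub>R e) e"])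
             (use dline M in auto)
        then have "\<bar>g (y + t n *\<^sub>R e) - g y\<bar> \<le> M * t n" using t[of n] by simp
        then show ?thesis using True t(1)[of n] by (simp add: q_def abs_divide pos_divide_le_eq)
      next
        case False
        then have ny: "norm y > r + norm e" by simp
        then have "y \<notin> C" using r[of y] norm_ge_zero[of e] by linarith
        moreover have "y + t n *\<^sub>R e \<notin> C"
        proof
          assume "y + t n *\<^sub>R e \<in> C"
          then have "norm (y + t n *\<^sub>R e) \<le> r" by (rule r)
          moreover have "norm y \<le> norm (y + t n *\<^sub>R e) + norm (t n *\<^sub>R e)"
            using norm_triangle_ineq4[of "y + t n *\<^sub>R e" "t n *\<^sub>R e"] by simp
          moreover have "norm (t n *\<^sub>R e) \<le> norm e" using t[of n] by (simp add: mult_left_le_one_le)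
          ultimately show False using ny by linarith
        qed
        ultimately have "q n y = 0" using C(2) by (simp add: q_def)
        then show ?thesis using M(1) by (simp add: indicator_def)
      qed
    qed
  qed
  moreover have "integral\<^sup>L lborel (q n) = 0" for n
  proof -
    have "integral\<^sup>L lborel (\<lambda>y. g (y + t n *\<^sub>R e) - g y) = 0"
      using lborel_integral_translation[OF gi] gi by (simp add: Bochner_Integration.integral_diff)
    then show ?thesis unfolding q_def by simp
  qed
  ultimately show ?thesis by (simp add: LIMSEQ_const_iff)
qed

text \<open>The product \<eta> u vanishes off the compact set \<open>C\<close> inside G, so it is
  differentiable on the whole space although \<open>u\<close> is only assumed differentiable on G.
  The integral of its directional derivative is zero.\<close>

lemma integration_by_parts:
  fixes u \<eta> :: "'a::euclidean_space \<Rightarrow> real"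
  assumes G: "open G" and u: "\<And>y. y \<in> G \<Longrightarrow> (u has_derivative U y) (at y)" "continuous_on G (\<lambda>y. U y e)"
    and n: "\<And>y. (\<eta> has_derivative D y) (at y)" "continuous_on UNIV (\<lambda>y. D y e)"
    and C: "compact C" "C \<subseteq> G" "\<And>y. y \<notin> C \<Longrightarrow> \<eta> y = 0" "\<And>y. y \<notin> C \<Longrightarrow> D y e = 0"
  shows "integral\<^sup>L lborel (\<lambda>y. D y e * u y) = - integral\<^sup>L lborel (\<lambda>y. \<eta> y * U y e)"
    "integrable lborel (\<lambda>y. D y e * u y)" "integrable lborel (\<lambda>y. \<eta> y * U y e)"
    "continuous_on UNIV (\<lambda>y. D y e * u y)" "continuous_on UNIV (\<lambda>y. \<eta> y * U y e)"
proof -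
  have uc: "continuous_on G u" using u(1) by (meson continuous_at_imp_continuous_on has_derivative_continuous)
  have nc: "continuous_on UNIV \<eta>" using n(1) by (meson continuous_at_imp_continuous_on has_derivative_continuous)
  show c1: "continuous_on UNIV (\<lambda>y. D y e * u y)"
    by (rule continuous_extension_zero[OF G _ C(1,2)])
       (use C(4) in \<open>auto intro!: continuous_intros uc continuous_on_subset[OF n(2)]\<close>)
  show c2: "continuous_on UNIV (\<lambda>y. \<eta> y * U y e)"
    by (rule continuous_extension_zero[OF G _ C(1,2)])
       (use C(3) in \<open>auto intro!: continuous_intros u(2) continuous_on_subset[OF nc]\<close>)
  show i1: "integrable lborel (\<lambda>y. D y e * u y)"
    by (rule integrable_compact_support[OF c1 C(1)]) (use C(4) in auto)
  show i2: "integrable lborel (\<lambda>y. \<eta> y * U y e)"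
    by (rule integrable_compact_support[OF c2 C(1)]) (use C(3) in auto)
  define K where "K y h = (if y \<in> G then \<eta> y * U y h + D y h * u y else 0)" for y h
  have Ke: "K y e = \<eta> y * U y e + D y e * u y" for y
  proof (cases "y \<in> G")
    case False
    then have "y \<notin> C" using C(2) by blast
    then show ?thesis using C(3,4) False by (simp add: K_def)
  qed (simp add: K_def)
  have "((\<lambda>y. \<eta> y * u y) has_derivative K y) (at y)" for y
  proof (cases "y \<in> G")
    case True
    then show ?thesis using has_derivative_mult[OF n(1) u(1)[OF True]] by (simp add: K_def[abs_def])
  next
    case False
    then have K0: "K y = (\<lambda>h. 0)" by (simp add: K_def fun_eq_iff)
    have o: "open (- C)" using C(1) compact_imp_closed by blast
    have y: "y \<in> - C" using False C(2) by blast
    have "((\<lambda>y. 0::real) has_derivative (\<lambda>h. 0)) (at y)" by simp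
    then show ?thesis unfolding K0
      by (rule has_derivative_transform_within_open[OF _ o y]) (use C(3) in auto)
  qed
  moreover have "continuous_on UNIV (\<lambda>y. K y e)" unfolding Ke by (intro continuous_intros c1 c2)
  ultimately have "integral\<^sup>L lborel (\<lambda>y. K y e) = 0"
    by (rule integral_derivative_zero[OF _ _ C(1)]) (use C(3,4) Ke in auto)
  then show "integral\<^sup>L lborel (\<lambda>y. D y e * u y) = - integral\<^sup>L lborel (\<lambda>y. \<eta> y * U y e)"
    unfolding Ke using i1 i2 by simp
qed

text \<open>Both mixed derivatives are limits of the same second difference quotient.\<close>
lemma mixed_derivatives_commute:
  fixes \<eta> :: "'a::real_normed_vector \<Rightarrow> real"
  assumes d: "\<And>y. (\<eta> has_derivative D y) (at y)"
    and da: "\<And>y. ((\<lambda>y. D y a) has_derivative Ea y) (at y)" "continuous_on UNIV (\<lambda>y. Ea y b)"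
    and db: "\<And>y. ((\<lambda>y. D y b) has_derivative Eb y) (at y)" "continuous_on UNIV (\<lambda>y. Eb y a)"
  shows "Ea y b = Eb y a"
proof -
  have line: "((\<lambda>s. f (x + s *\<^sub>R v)) has_real_derivative F (x + s *\<^sub>R v) v) (at s)"
    if "\<And>y. (f has_derivative F y) (at y)" for f :: "'a \<Rightarrow> real" and F x v s
  proof -
    have "((\<lambda>s. x + s *\<^sub>R v) has_derivative (\<lambda>s. s *\<^sub>R v)) (at s)" by (auto intro!: derivative_eq_intros)
    from has_derivative_compose[OF this that[of "x + s *\<^sub>R v"]]
    have "((\<lambda>s. f (x + s *\<^sub>R v)) has_derivative (\<lambda>r. F (x + s *\<^sub>R v) (r *\<^sub>R v))) (at s)" .
    moreover have "F (x + s *\<^sub>R v) (r *\<^sub>R v) = F (x + s *\<^sub>R v) v * r" for r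
      using linear_scale[OF has_derivative_linear[OF that[of "x + s *\<^sub>R v"]]] by (simp add: mult.commute)
    ultimately show ?thesis by (simp add: has_field_derivative_def mult_commute_abs)
  qed
  \<comment> \<open>Mean value theorem first in direction \<open>a\<close>, for the increment in
    \<open>b\<close>, and then in direction \<open>b\<close>, for the derivative along
    \<open>a\<close>.\<close>
  have second: "\<exists>s r. 0 < s \<and> s < t \<and> 0 < r \<and> r < t \<and>
      \<eta> (y + t *\<^sub>R a + t *\<^sub>R b) - \<eta> (y + t *\<^sub>R a) - (\<eta> (y + t *\<^sub>R b) - \<eta> y) = t * t * E (y + s *\<^sub>R a + r *\<^sub>R b) b"
    if t: "t > 0" and E: "\<And>y. ((\<lambda>y. D y a) has_derivative E y) (at y)" for t a b E
  proof -
    define \<phi> where "\<phi> s = \<eta> (y + t *\<^sub>R b + s *\<^sub>R a) - \<eta> (y + s *\<^sub>R a)" for s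
    have "(\<phi> has_real_derivative D (y + t *\<^sub>R b + s *\<^sub>R a) a - D (y + s *\<^sub>R a) a) (at s)" for s
      unfolding \<phi>_def by (intro DERIV_diff line[OF d])
    from MVT2[OF t this] obtain s where s: "0 < s" "s < t" "\<phi> t - \<phi> 0 = (t - 0) * (D (y + t *\<^sub>R b + s *\<^sub>R a) a - D (y + s *\<^sub>R a) a)"
      by (elim exE conjE)
    have "((\<lambda>r. D (y + s *\<^sub>R a + r *\<^sub>R b) a) has_real_derivative E (y + s *\<^sub>R a + r *\<^sub>R b) b) (at r)" for r
      by (rule line[OF E])
    from MVT2[OF t this] obtain r where r: "0 < r" "r < t" "D (y + s *\<^sub>R a + t *\<^sub>R b) a - D (y + s *\<^sub>R a + 0 *\<^sub>R b) a = (t - 0) * E (y + s *\<^sub>R a + r *\<^sub>R b) b"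
      by (elim exE conjE)
    have e: "y + t *\<^sub>R b + s *\<^sub>R a = y + s *\<^sub>R a + t *\<^sub>R b" "y + t *\<^sub>R b + t *\<^sub>R a = y + t *\<^sub>R a + t *\<^sub>R b" by (simp_all only: add_ac)
    have "\<eta> (y + t *\<^sub>R a + t *\<^sub>R b) - \<eta> (y + t *\<^sub>R a) - (\<eta> (y + t *\<^sub>R b) - \<eta> y) = t * t * E (y + s *\<^sub>R a + r *\<^sub>R b) b"
      using s(3) r(3) unfolding \<phi>_def e by (simp only: scaleR_zero_left add_0_right diff_0_right mult.assoc)
    then show ?thesis using s(1,2) r(1,2) by (intro exI[of _ s] exI[of _ r] conjI)
  qed
  show ?thesis
  proof (rule ccontr)
    assume "Ea y b \<noteq> Eb y a"
    define \<epsilon> where "\<epsilon> = dist (Ea y b) (Eb y a) / 2"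
    have eps: "\<epsilon> > 0" using \<open>Ea y b \<noteq> Eb y a\<close> by (simp add: \<epsilon>_def)
    have "isCont (\<lambda>y. Ea y b) y" "isCont (\<lambda>y. Eb y a) y" using da(2) db(2) by (simp_all add: continuous_on_eq_continuous_at)
    then have ex: "\<exists>d>0. \<forall>x. dist x y < d \<longrightarrow> dist (Ea x b) (Ea y b) < \<epsilon>" "\<exists>d>0. \<forall>x. dist x y < d \<longrightarrow> dist (Eb x a) (Eb y a) < \<epsilon>"
      using eps unfolding continuous_at_eps_delta by simp_all
    obtain d1 where d1: "d1 > 0" "\<And>x. dist x y < d1 \<Longrightarrow> dist (Ea x b) (Ea y b) < \<epsilon>" using ex(1) by blast
    obtain d2 where d2: "d2 > 0" "\<And>x. dist x y < d2 \<Longrightarrow> dist (Eb x a) (Eb y a) < \<epsilon>" using ex(2) by blast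
    define m where "m = norm a + norm b + 1"
    have m: "m > 0" by (simp add: m_def add_nonneg_pos)
    define t where "t = min d1 d2 / m"
    have t: "t > 0" "t * m \<le> d1" "t * m \<le> d2" using d1(1) d2(1) m by (simp_all add: t_def)
    have near: "dist (y + s *\<^sub>R v + r *\<^sub>R w) y < t * m" if "0 < s" "s < t" "0 < r" "r < t" "norm v + norm w + 1 = m" for s r v w
    proof -
      have "dist (y + s *\<^sub>R v + r *\<^sub>R w) y = norm (s *\<^sub>R v + r *\<^sub>R w)" by (simp add: dist_norm add.assoc)
      also have "\<dots> \<le> s * norm v + r * norm w" using norm_triangle_ineq[of "s *\<^sub>R v" "r *\<^sub>R w"] that by simp
      also have "\<dots> \<le> t * norm v + t * norm w" using that by (intro add_mono mult_right_mono) auto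
      also have "\<dots> < t * norm v + t * norm w + t * 1" using t(1) by simp
      also have "\<dots> = t * m" unfolding that(5)[symmetric] by (simp only: distrib_left)
      finally show ?thesis .
    qed
    obtain s r where 1: "0 < s" "s < t" "0 < r" "r < t"
      "\<eta> (y + t *\<^sub>R a + t *\<^sub>R b) - \<eta> (y + t *\<^sub>R a) - (\<eta> (y + t *\<^sub>R b) - \<eta> y) = t * t * Ea (y + s *\<^sub>R a + r *\<^sub>R b) b"
      using second[OF t(1) da(1), of b] by (elim exE conjE)
    obtain s' r' where 2: "0 < s'" "s' < t" "0 < r'" "r' < t"
      "\<eta> (y + t *\<^sub>R b + t *\<^sub>R a) - \<eta> (y + t *\<^sub>R b) - (\<eta> (y + t *\<^sub>R a) - \<eta> y) = t * t * Eb (y + s' *\<^sub>R b + r' *\<^sub>R a) a"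
      using second[OF t(1) db(1), of a] by (elim exE conjE)
    have e: "y + t *\<^sub>R b + t *\<^sub>R a = y + t *\<^sub>R a + t *\<^sub>R b" by (simp only: add_ac)
    have "t * t * Ea (y + s *\<^sub>R a + r *\<^sub>R b) b = t * t * Eb (y + s' *\<^sub>R b + r' *\<^sub>R a) a"
      using 1(5) 2(5) unfolding e by linarith
    then have eq: "Ea (y + s *\<^sub>R a + r *\<^sub>R b) b = Eb (y + s' *\<^sub>R b + r' *\<^sub>R a) a" using t(1) by simp
    have "dist (Ea (y + s *\<^sub>R a + r *\<^sub>R b) b) (Ea y b) < \<epsilon>"
      by (rule d1(2), rule less_le_trans[OF near[OF 1(1-4)] t(2)]) (simp add: m_def)
    moreover have "dist (Eb (y + s' *\<^sub>R b + r' *\<^sub>R a) a) (Eb y a) < \<epsilon>"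
      by (rule d2(2), rule less_le_trans[OF near[OF 2(1-4)] t(3)]) (simp add: m_def)
    ultimately have "dist (Ea y b) (Eb y a) < dist (Ea y b) (Eb y a)" unfolding eq \<epsilon>_def by (rule dist_triangle_half_r)
    then show False by simp
  qed
qed

section \<open>Test functions and the weak form of the divergence constraint\<close>

lemma Ck_fun_SucD: "Ck_fun (Suc k) f \<Longrightarrow> Ck_fun k f"
proof (induction k arbitrary: f)
  case 0
  then show ?case by (simp add: differentiable_imp_continuous_on)
next
  case (Suc k)
  then show ?case by simp
qed

lemma smooth_fun_has_derivative:
  assumes "smooth_fun f" shows "(f has_derivative frechet_derivative f (at y)) (at y)"
proof -
  have "Ck_fun (Suc 0) f" using assms unfolding smooth_fun_def by blast
  then have "f differentiable (at y)" by (simp add: differentiable_on_def)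
  then show ?thesis by (simp add: frechet_derivative_works)
qed

lemma smooth_fun_partial:
  assumes "smooth_fun f" "b \<in> Basis" shows "smooth_fun (\<lambda>y. frechet_derivative f (at y) b)"
  unfolding smooth_fun_def
proof
  fix k
  have "Ck_fun (Suc k) f" using assms(1) unfolding smooth_fun_def by blast
  then show "Ck_fun k (\<lambda>y. frechet_derivative f (at y) b)" using assms(2) by simp
qed

lemma smooth_fun_continuous: "smooth_fun f \<Longrightarrow> continuous_on UNIV f"
  using smooth_fun_has_derivative by (meson continuous_at_imp_continuous_on has_derivative_continuous)

lemma Ck_fun_linear:
  assumes "bounded_linear L" shows "Ck_fun k f \<Longrightarrow> Ck_fun k (\<lambda>y. L (f y))"
proof (induction k arbitrary: f)
  case 0
  then show ?case using bounded_linear.continuous_on[OF assms] by simp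
next
  case (Suc k)
  have d: "(f has_derivative frechet_derivative f (at y)) (at y)" for y
    using Suc.prems by (simp add: differentiable_on_def frechet_derivative_works)
  have d': "((\<lambda>y. L (f y)) has_derivative (\<lambda>h. L (frechet_derivative f (at y) h))) (at y)" for y
    by (rule bounded_linear.has_derivative[OF assms d])
  then have "frechet_derivative (\<lambda>y. L (f y)) (at y) = (\<lambda>h. L (frechet_derivative f (at y) h))" for y
    by (rule frechet_derivative_at[symmetric])
  then show ?case using Suc d' by (auto simp: differentiable_on_def differentiable_def)
qed

lemma frechet_derivative_outside:
  assumes "y \<notin> closure {y. f y \<noteq> 0}"
  shows "frechet_derivative f (at y) = (\<lambda>h. 0)"
proof -
  have "((\<lambda>y. 0) has_derivative (\<lambda>h. 0)) (at y)" by simp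
  then have "(f has_derivative (\<lambda>h. 0)) (at y)"
    by (rule has_derivative_transform_within_open[of _ _ _ _ "- closure {y. f y \<noteq> 0}"])
       (use assms closure_subset[of "{y. f y \<noteq> 0}"] in auto)
  then show ?thesis by (rule frechet_derivative_at[symmetric])
qed

lemma test_fun_partial:
  assumes "test_fun G f" "b \<in> Basis" shows "test_fun G (\<lambda>y. frechet_derivative f (at y) b)"
proof -
  let ?C = "closure {y. f y \<noteq> 0}" and ?D = "closure {y. frechet_derivative f (at y) b \<noteq> 0}"
  have "{y. frechet_derivative f (at y) b \<noteq> 0} \<subseteq> ?C" using frechet_derivative_outside[of _ f] by fastforce
  then have "?D \<subseteq> ?C" by (intro closure_minimal) auto
  moreover have "compact ?C" "?C \<subseteq> G" using assms by (auto simp: test_fun_def)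
  ultimately have "compact ?D" "?D \<subseteq> G"
    using compact_Int_closed[of ?C ?D] by (auto simp: Int_absorb1)
  then show ?thesis using assms smooth_fun_partial by (auto simp: test_fun_def)
qed

lemma test_fun_linear:
  assumes "test_fun G f" "bounded_linear L" shows "test_fun G (\<lambda>y. L (f y))"
proof -
  let ?C = "closure {y. f y \<noteq> 0}" and ?D = "closure {y. L (f y) \<noteq> 0}"
  have "{y. L (f y) \<noteq> 0} \<subseteq> {y. f y \<noteq> 0}" using linear_0[OF bounded_linear.linear[OF assms(2)]] by auto
  then have "?D \<subseteq> ?C" by (rule closure_mono)
  moreover have "compact ?C" "?C \<subseteq> G" using assms by (auto simp: test_fun_def)
  ultimately have "compact ?D" "?D \<subseteq> G"
    using compact_Int_closed[of ?C ?D] by (auto simp: Int_absorb1)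
  moreover have "smooth_fun f" using assms(1) by (simp add: test_fun_def)
  then have "smooth_fun (\<lambda>y. L (f y))" unfolding smooth_fun_def by (blast intro: Ck_fun_linear[OF assms(2)])
  ultimately show ?thesis by (simp add: test_fun_def)
qed

lemma test_funD:
  assumes "test_fun G f"
  shows "(f has_derivative frechet_derivative f (at y)) (at y)"
    "continuous_on UNIV f" "b \<in> Basis \<Longrightarrow> continuous_on UNIV (\<lambda>y. frechet_derivative f (at y) b)"
    "compact (closure {y. f y \<noteq> 0})" "closure {y. f y \<noteq> 0} \<subseteq> G"
    "y \<notin> closure {y. f y \<noteq> 0} \<Longrightarrow> f y = 0"
    "y \<notin> closure {y. f y \<noteq> 0} \<Longrightarrow> frechet_derivative f (at y) h = 0"
proof -
  have s: "smooth_fun f" using assms by (simp add: test_fun_def)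
  show "(f has_derivative frechet_derivative f (at y)) (at y)" by (rule smooth_fun_has_derivative[OF s])
  show "continuous_on UNIV f" by (rule smooth_fun_continuous[OF s])
  show "continuous_on UNIV (\<lambda>y. frechet_derivative f (at y) b)" if "b \<in> Basis"
    by (rule smooth_fun_continuous[OF smooth_fun_partial[OF s that]])
  show "compact (closure {y. f y \<noteq> 0})" "closure {y. f y \<noteq> 0} \<subseteq> G" using assms by (simp_all add: test_fun_def)
  show "f y = 0" if "y \<notin> closure {y. f y \<noteq> 0}" using that closure_subset[of "{y. f y \<noteq> 0}"] by blast
  show "frechet_derivative f (at y) h = 0" if "y \<notin> closure {y. f y \<noteq> 0}" by (simp add: frechet_derivative_outside[OF that])
qed

text \<open>Integrating by parts twice moves the derivative from \<open>a\<close> to \<open>b\<close>.\<close>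
lemma exchange_derivatives:
  fixes u \<eta> :: "'a::euclidean_space \<Rightarrow> real"
  assumes G: "open G" and u: "\<And>y. y \<in> G \<Longrightarrow> (u has_derivative U y) (at y)" "\<And>h. continuous_on G (\<lambda>y. U y h)"
    and t: "test_fun G \<eta>" and ab: "a \<in> Basis" "b \<in> Basis"
  shows "integral\<^sup>L lborel (\<lambda>y. frechet_derivative \<eta> (at y) b * U y a) = integral\<^sup>L lborel (\<lambda>y. frechet_derivative \<eta> (at y) a * U y b)"
    "integrable lborel (\<lambda>y. frechet_derivative \<eta> (at y) b * U y a)"
proof -
  let ?D = "\<lambda>b y. frechet_derivative \<eta> (at y) b"
  have tp: "test_fun G (?D v)" if "v \<in> Basis" for v by (rule test_fun_partial[OF t that])
  let ?E = "\<lambda>b y a. frechet_derivative (?D b) (at y) a"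
  have p: "integral\<^sup>L lborel (\<lambda>y. ?E v y w * u y) = - integral\<^sup>L lborel (\<lambda>y. ?D v y * U y w) \<and> integrable lborel (\<lambda>y. ?D v y * U y w)"
    if "v \<in> Basis" "w \<in> Basis" for v w
    using integration_by_parts(1,3)[OF G u(1) u(2) test_funD(1)[OF tp[OF that(1)]] test_funD(3)[OF tp[OF that(1)] that(2)]
        test_funD(4,5,6,7)[OF tp[OF that(1)]]] by blast
  have "?E a y b = ?E b y a" for y
    by (rule mixed_derivatives_commute[OF test_funD(1)[OF t] test_funD(1)[OF tp[OF ab(1)]] test_funD(3)[OF tp[OF ab(1)] ab(2)]
          test_funD(1)[OF tp[OF ab(2)]] test_funD(3)[OF tp[OF ab(2)] ab(1)]])
  then show "integral\<^sup>L lborel (\<lambda>y. ?D b y * U y a) = integral\<^sup>L lborel (\<lambda>y. ?D a y * U y b)"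
    using p[OF ab(1,2)] p[OF ab(2,1)] by simp
  show "integrable lborel (\<lambda>y. ?D b y * U y a)" using p[OF ab(2,1)] by blast
qed

text \<open>For u = div v the integrand is the sum over i, j of \<partial>_t \<phi>_i \<partial>_j
  v_ij - \<partial>_j \<phi>_i \<partial>_t v_ij. Each term integrates to zero by exchanging the two
  derivatives, and the second derivatives fall on the test function alone.\<close>

lemma weak_identity:
  fixes f :: "(real ^ 'n::finite) \<times> real \<Rightarrow> (real ^ 'm::finite) \<times> (real ^ 'n ^ 'm)"
  assumes Q: "open Q" and f: "\<And>y. y \<in> Q \<Longrightarrow> (f has_derivative F y) (at y)" "\<And>h. continuous_on Q (\<lambda>y. F y h)"
    and div: "\<And>y. y \<in> Q \<Longrightarrow> fst (f y) = divx (\<lambda>h. snd (F y h))" and t: "test_fun Q \<phi>"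
  shows "integral\<^sup>L lborel (\<lambda>y. fst (f y) \<bullet> Dt (frechet_derivative \<phi> (at y)) - snd (jet (F y)) \<bullet> Dx (frechet_derivative \<phi> (at y))) = 0"
proof -
  let ?T = "(0, 1) :: (real ^ 'n) \<times> real"
  let ?X = "\<lambda>j. (axis j 1, 0) :: (real ^ 'n) \<times> real"
  let ?d = "\<lambda>i y h. frechet_derivative (\<lambda>y. \<phi> y $ i) (at y) h"
  have T: "?T \<in> Basis" "?X j \<in> Basis" for j by (auto simp: Basis_prod_def axis_in_Basis_iff)
  have ti: "test_fun Q (\<lambda>y. \<phi> y $ i)" for i by (rule test_fun_linear[OF t bounded_linear_vec_nth])
  have comp: "frechet_derivative \<phi> (at y) h $ i = ?d i y h" for y h i
    using frechet_derivative_at[OF bounded_linear.has_derivative[OF bounded_linear_vec_nth test_funD(1)[OF t]]]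
    by metis
  have u: "((\<lambda>y. snd (f y) $ i $ j) has_derivative (\<lambda>h. snd (F y h) $ i $ j)) (at y)" if "y \<in> Q" for y i j
    by (intro bounded_linear.has_derivative[OF bounded_linear_vec_nth] bounded_linear.has_derivative[OF bounded_linear_snd] f(1) that)
  have uc: "continuous_on Q (\<lambda>y. snd (F y h) $ i $ j)" for h i j by (intro continuous_intros f(2))
  have ex: "integral\<^sup>L lborel (\<lambda>y. ?d i y ?T * snd (F y (?X j)) $ i $ j) = integral\<^sup>L lborel (\<lambda>y. ?d i y (?X j) * snd (F y ?T) $ i $ j)"
    "integrable lborel (\<lambda>y. ?d i y ?T * snd (F y (?X j)) $ i $ j)" "integrable lborel (\<lambda>y. ?d i y (?X j) * snd (F y ?T) $ i $ j)" for i j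
    by (rule exchange_derivatives[OF Q u uc ti T(2) T(1)] exchange_derivatives[OF Q u uc ti T(1) T(2)]; assumption)+
  have trm: "integrable lborel (\<lambda>y. ?d i y ?T * snd (F y (?X j)) $ i $ j - ?d i y (?X j) * snd (F y ?T) $ i $ j)" for i j
    by (rule Bochner_Integration.integrable_diff[OF ex(2,3)])
  have "fst (f y) \<bullet> Dt (frechet_derivative \<phi> (at y)) - snd (jet (F y)) \<bullet> Dx (frechet_derivative \<phi> (at y)) =
     (\<Sum>i\<in>UNIV. \<Sum>j\<in>UNIV. ?d i y ?T * snd (F y (?X j)) $ i $ j - ?d i y (?X j) * snd (F y ?T) $ i $ j)" for y
  proof (cases "y \<in> Q")
    case True
    have "fst (f y) \<bullet> Dt (frechet_derivative \<phi> (at y)) - snd (jet (F y)) \<bullet> Dx (frechet_derivative \<phi> (at y)) =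
       (\<Sum>i\<in>UNIV. \<Sum>j\<in>UNIV. snd (F y (?X j)) $ i $ j * ?d i y ?T - snd (F y ?T) $ i $ j * ?d i y (?X j))"
      by (simp add: div[OF True] divx_def jet_def Dt_def Dx_def inner_vec_def comp sum_subtractf sum_distrib_right)
    then show ?thesis by (simp only: mult.commute)
  next
    case False
    then have "frechet_derivative \<phi> (at y) h = 0" for h using test_funD(5,7)[OF t] by blast
    then show ?thesis by (simp add: comp[symmetric] Dt_def Dx_def inner_vec_def)
  qed
  then have "integral\<^sup>L lborel (\<lambda>y. fst (f y) \<bullet> Dt (frechet_derivative \<phi> (at y)) - snd (jet (F y)) \<bullet> Dx (frechet_derivative \<phi> (at y))) =
     integral\<^sup>L lborel (\<lambda>y. \<Sum>i\<in>UNIV. \<Sum>j\<in>UNIV. ?d i y ?T * snd (F y (?X j)) $ i $ j - ?d i y (?X j) * snd (F y ?T) $ i $ j)"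
    by simp
  also have "\<dots> = (\<Sum>i\<in>UNIV. \<Sum>j\<in>UNIV. integral\<^sup>L lborel (\<lambda>y. ?d i y ?T * snd (F y (?X j)) $ i $ j - ?d i y (?X j) * snd (F y ?T) $ i $ j))"
  proof -
    have "integral\<^sup>L lborel (\<lambda>y. \<Sum>i\<in>UNIV. \<Sum>j\<in>UNIV. t i j y) = (\<Sum>i\<in>UNIV. \<Sum>j\<in>UNIV. integral\<^sup>L lborel (t i j))"
      if "\<And>i j. integrable lborel (t i j)" for t :: "'m \<Rightarrow> 'n \<Rightarrow> (real ^ 'n) \<times> real \<Rightarrow> real"
      by (simp add: that)
    from this[OF trm] show ?thesis .
  qed
  also have "\<dots> = 0"
    by (intro sum.neutral ballI) (simp only: Bochner_Integration.integral_diff[OF ex(2,3)] ex(1) diff_self)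
  finally show ?thesis .
qed

section \<open>Limits of the approximating sequence\<close>

lemma AE_lebesgue_on_iff:
  assumes "S \<in> sets borel" shows "(AE y in lebesgue_on S. P y) \<longleftrightarrow> (AE y in lborel. y \<in> S \<longrightarrow> P y)"
  using assms by (subst AE_restrict_space_iff) (auto simp: AE_completion_iff)

lemma integral_lebesgue_on_eq_lborel:
  fixes g :: "'a::euclidean_space \<Rightarrow> 'b::{banach, second_countable_topology}"
  assumes "S \<in> sets borel" "g \<in> borel_measurable borel" "\<And>y. y \<notin> S \<Longrightarrow> g y = 0"
  shows "integral\<^sup>L (lebesgue_on S) g = integral\<^sup>L lborel g"
proof -
  have "(\<lambda>y. indicator S y *\<^sub>R g y) = g" using assms(3) by (auto simp: fun_eq_iff indicator_def)
  moreover have "integral\<^sup>L (lebesgue_on S) g = integral\<^sup>L lebesgue (\<lambda>y. indicator S y *\<^sub>R g y)"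
    by (rule integral_restrict_space) (use assms(1) in simp)
  ultimately show ?thesis using integral_completion[of g lborel] assms(2) by simp
qed

lemma geometric_limit:
  fixes a :: "nat \<Rightarrow> 'a \<Rightarrow> 'b::banach"
  assumes "\<And>k y. norm (a (Suc k) y - a k y) \<le> e / 2 ^ Suc k"
  shows "\<exists>l. \<forall>k y. norm (l y - a k y) \<le> e / 2 ^ k"
proof -
  have e: "e \<ge> 0" using order_trans[OF norm_ge_zero assms[of 0]] by simp
  have half: "e / 2 ^ Suc n + e / 2 ^ Suc n = e / 2 ^ n" for n by (simp add: field_simps)
  have tele: "norm (a (k + m) y - a k y) \<le> e / 2 ^ k - e / 2 ^ (k + m)" for k m y
  proof (induction m)
    case (Suc m)
    have "norm (a (k + Suc m) y - a k y) \<le> norm (a (Suc (k + m)) y - a (k + m) y) + norm (a (k + m) y - a k y)"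
      using norm_triangle_ineq[of "a (Suc (k + m)) y - a (k + m) y" "a (k + m) y - a k y"] by simp
    also have "\<dots> \<le> e / 2 ^ Suc (k + m) + (e / 2 ^ k - e / 2 ^ (k + m))" by (rule add_mono[OF assms Suc])
    also have "\<dots> = e / 2 ^ k - e / 2 ^ (k + Suc m)" using half[of "k + m"] by (simp only: add_Suc_right)
    finally show ?case .
  qed simp
  have near: "norm (a n y - a k y) \<le> e / 2 ^ k" if "k \<le> n" for n k y
  proof -
    from le_Suc_ex[OF that] obtain m where "n = k + m" ..
    moreover have "0 \<le> e / 2 ^ (k + m)" using e by simp
    ultimately show ?thesis using tele[of k m y] by (simp only:)
  qed
  have lim: "(\<lambda>k. e / 2 ^ k) \<longlonglongrightarrow> 0"
    using tendsto_mult_right_zero[OF LIMSEQ_power_zero[of "1/2::real"], of e] by (simp add: power_divide)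
  have "convergent (\<lambda>k. a k y)" for y
  proof (rule Cauchy_convergent, rule CauchyI)
    fix r :: real assume "0 < r"
    then obtain K where "e / 2 ^ K < r / 2" using order_tendstoD(2)[OF lim, of "r / 2"] by (auto simp: eventually_sequentially)
    moreover have "norm (a m y - a n y) \<le> e / 2 ^ K + e / 2 ^ K" if "m \<ge> K" "n \<ge> K" for m n
      using norm_triangle_ineq4[of "a m y - a K y" "a n y - a K y"] near[OF that(1), of y] near[OF that(2), of y] by simp
    moreover have "e / 2 ^ K + e / 2 ^ K < r" if "e / 2 ^ K < r / 2" using that by linarith
    ultimately show "\<exists>K. \<forall>m\<ge>K. \<forall>n\<ge>K. norm (a m y - a n y) < r" using le_less_trans by blast
  qed
  then have L: "(\<lambda>n. a n y) \<longlonglongrightarrow> lim (\<lambda>n. a n y)" for y by (simp only: convergent_LIMSEQ_iff)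
  have "norm (lim (\<lambda>n. a n y) - a k y) \<le> e / 2 ^ k" for k y
    by (rule Lim_bounded[OF tendsto_norm[OF tendsto_diff[OF L tendsto_const]], of k]) (use near in auto)
  then show ?thesis by (intro exI[of _ "\<lambda>y. lim (\<lambda>n. a n y)"]) simp
qed

lemma geometric_limit_tendsto:
  fixes a :: "nat \<Rightarrow> 'a::topological_space \<Rightarrow> 'b::real_normed_vector"
  assumes "\<And>k y. norm (l y - a k y) \<le> e / 2 ^ k"
  shows "(\<lambda>k. a k y) \<longlonglongrightarrow> l y" "(\<And>k. continuous_on S (a k)) \<Longrightarrow> continuous_on S l"
proof -
  have lim: "(\<lambda>k. e / 2 ^ k) \<longlonglongrightarrow> 0"
    using tendsto_mult_right_zero[OF LIMSEQ_power_zero[of "1/2::real"], of e] by (simp add: power_divide)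
  have ul: "uniform_limit S a l sequentially"
  proof (rule uniform_limitI)
    fix r :: real assume "0 < r"
    from order_tendstoD(2)[OF lim this] show "\<forall>\<^sub>F k in sequentially. \<forall>y\<in>S. dist (a k y) (l y) < r"
      by eventually_elim (use assms in \<open>auto simp: dist_norm norm_minus_commute intro: order_le_less_trans\<close>)
  qed
  show "continuous_on S l" if "\<And>k. continuous_on S (a k)"
  proof -
    have "\<forall>k. continuous_on S (a k)" using that by blast
    then show ?thesis using uniform_limit_theorem[OF always_eventually ul] by simp
  qed
  have "(\<lambda>k. norm (a k y - l y)) \<longlonglongrightarrow> 0"
    by (rule tendsto_sandwich[OF _ _ tendsto_const lim]) (use assms[of y] in \<open>auto simp: norm_minus_commute\<close>)
  then show "(\<lambda>k. a k y) \<longlonglongrightarrow> l y" using tendsto_norm_zero_iff LIM_zero_iff by blast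
qed

lemma bounded_support_limit:
  fixes s :: "nat \<Rightarrow> 'a::euclidean_space \<Rightarrow> 'b::{banach, second_countable_topology}"
  assumes Q: "open Q" "bounded Q" and m: "\<And>k. s k \<in> borel_measurable borel" "l \<in> borel_measurable borel"
    and b: "\<And>k y. y \<in> Q \<Longrightarrow> norm (s k y) \<le> B" and z: "\<And>k y. y \<notin> Q \<Longrightarrow> s k y = 0" "\<And>y. y \<notin> Q \<Longrightarrow> l y = 0"
    and ae: "AE y in lborel. y \<in> Q \<longrightarrow> (\<lambda>k. s k y) \<longlonglongrightarrow> l y"
  shows "(\<lambda>k. integral\<^sup>L lborel (s k)) \<longlonglongrightarrow> integral\<^sup>L lborel l" "integrable lborel l"
proof -
  have "emeasure lborel Q < \<infinity>" by (rule emeasure_bounded_finite[OF Q(2)])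
  then have i: "integrable lborel (\<lambda>y. indicator Q y *\<^sub>R B)"
    using Q(1) by (intro integrable_scaleR_left) (auto simp: less_top)
  have a: "AE y in lborel. (\<lambda>k. s k y) \<longlonglongrightarrow> l y" using ae
  proof eventually_elim
    case (elim y)
    then show ?case using z by (cases "y \<in> Q") simp_all
  qed
  have d: "AE y in lborel. norm (s k y) \<le> indicator Q y *\<^sub>R B" for k
    by (rule AE_I2) (use b z in \<open>auto simp: indicator_def\<close>)
  show "(\<lambda>k. integral\<^sup>L lborel (s k)) \<longlonglongrightarrow> integral\<^sup>L lborel l"
    by (rule integral_dominated_convergence[OF _ _ i a d]) (use m in simp_all)
  show "integrable lborel l"
    by (rule integrable_dominated_convergence[OF _ _ i a d]) (use m in simp_all)
qed

lemma integration_by_parts_vec: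
  fixes u :: "'a::euclidean_space \<Rightarrow> real ^ 'm::finite"
  assumes G: "open G" and u: "\<And>y. y \<in> G \<Longrightarrow> (u has_derivative U y) (at y)" "continuous_on G (\<lambda>y. U y e)"
    and n: "\<And>y. (\<eta> has_derivative D y) (at y)" "continuous_on UNIV (\<lambda>y. D y e)"
    and C: "compact C" "C \<subseteq> G" "\<And>y. y \<notin> C \<Longrightarrow> \<eta> y = 0" "\<And>y. y \<notin> C \<Longrightarrow> D y e = 0"
  shows "integral\<^sup>L lborel (\<lambda>y. D y e *\<^sub>R u y) = - integral\<^sup>L lborel (\<lambda>y. \<eta> y *\<^sub>R U y e)"
    "continuous_on UNIV (\<lambda>y. D y e *\<^sub>R u y)" "continuous_on UNIV (\<lambda>y. \<eta> y *\<^sub>R U y e)"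
proof -
  have uc: "continuous_on G u" using u(1) by (meson continuous_at_imp_continuous_on has_derivative_continuous)
  have nc: "continuous_on UNIV \<eta>" using n(1) by (meson continuous_at_imp_continuous_on has_derivative_continuous)
  show c1: "continuous_on UNIV (\<lambda>y. D y e *\<^sub>R u y)"
    by (rule continuous_extension_zero[OF G _ C(1,2)])
       (use C(4) in \<open>auto intro!: continuous_intros uc continuous_on_subset[OF n(2)]\<close>)
  show c2: "continuous_on UNIV (\<lambda>y. \<eta> y *\<^sub>R U y e)"
    by (rule continuous_extension_zero[OF G _ C(1,2)])
       (use C(3) in \<open>auto intro!: continuous_intros u(2) continuous_on_subset[OF nc]\<close>)
  have i1: "integrable lborel (\<lambda>y. D y e *\<^sub>R u y)"
    by (rule integrable_compact_support[OF c1 C(1)]) (use C(4) in auto)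
  have i2: "integrable lborel (\<lambda>y. \<eta> y *\<^sub>R U y e)"
    by (rule integrable_compact_support[OF c2 C(1)]) (use C(3) in auto)
  show "integral\<^sup>L lborel (\<lambda>y. D y e *\<^sub>R u y) = - integral\<^sup>L lborel (\<lambda>y. \<eta> y *\<^sub>R U y e)"
  proof (subst vec_eq_iff, rule allI)
    fix i
    have ui: "((\<lambda>y. u y $ i) has_derivative (\<lambda>h. U y h $ i)) (at y)" if "y \<in> G" for y
      by (rule bounded_linear.has_derivative[OF bounded_linear_vec_nth u(1)[OF that]])
    have uci: "continuous_on G (\<lambda>y. U y e $ i)" by (intro continuous_intros u(2))
    show "integral\<^sup>L lborel (\<lambda>y. D y e *\<^sub>R u y) $ i = (- integral\<^sup>L lborel (\<lambda>y. \<eta> y *\<^sub>R U y e)) $ i"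
      using integral_bounded_linear[OF bounded_linear_vec_nth i1, of i] integral_bounded_linear[OF bounded_linear_vec_nth i2, of i]
        integration_by_parts(1)[OF G ui uci n C] by simp
  qed
qed

text \<open>In every neighbourhood U the product of E1 and E2 has positive measure in U \<times> U,
  and there the difference is at least \<open>d\<close>; hence no essential supremum over U \<times>
  U can be smaller.\<close>

lemma ess_osc_ge:
  fixes f :: "'a::euclidean_space \<Rightarrow> 'b::real_normed_vector"
  assumes "\<And>U. open U \<Longrightarrow> U \<subseteq> G \<Longrightarrow> y0 \<in> U \<Longrightarrow> \<exists>E1 E2. E1 \<in> sets borel \<and> E2 \<in> sets borel \<and> E1 \<subseteq> U \<and> E2 \<subseteq> U \<and>
        emeasure lborel E1 > 0 \<and> emeasure lborel E2 > 0 \<and> (\<forall>y\<in>E1. \<forall>z\<in>E2. d \<le> dist (f y) (f z))"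
  shows "ereal d \<le> ess_osc f G y0"
  unfolding ess_osc_def
proof (rule INF_greatest)
  fix U assume "U \<in> {U. open U \<and> U \<subseteq> G \<and> y0 \<in> U}"
  then have U: "open U" "U \<subseteq> G" "y0 \<in> U" by blast+
  obtain E1 E2 where E: "E1 \<in> sets borel" "E2 \<in> sets borel" "E1 \<subseteq> U" "E2 \<subseteq> U"
    "emeasure lborel E1 > 0" "emeasure lborel E2 > 0" "\<forall>y\<in>E1. \<forall>z\<in>E2. d \<le> dist (f y) (f z)"
    using assms[OF U] by (elim exE conjE)
  let ?h = "\<lambda>p. ereal (norm (f (fst p) - f (snd p)))"
  let ?s = "esssup (lebesgue_on (U \<times> U)) ?h"
  have UU: "U \<times> U \<in> sets borel" using U(1) by (simp add: borel_open open_Times)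
  show "ereal d \<le> ?s"
  proof (rule ccontr)
    assume "\<not> ereal d \<le> ?s"
    then have less: "?s < ereal d" by simp
    have "AE p in lebesgue_on (U \<times> U). ?h p \<le> ?s" by (rule esssup_AE)
    then have "AE p in lborel. p \<in> U \<times> U \<longrightarrow> ?h p \<le> ?s" by (simp only: AE_lebesgue_on_iff[OF UU])
    then have "AE p in lborel. p \<notin> E1 \<times> E2"
    proof eventually_elim
      case (elim p)
      show ?case
      proof
        assume p: "p \<in> E1 \<times> E2"
        then have "?h p \<le> ?s" using elim E(3,4) by (auto simp: mem_Times_iff)
        moreover have "d \<le> norm (f (fst p) - f (snd p))" using p E(7) by (auto simp: mem_Times_iff dist_norm)
        then have "ereal d \<le> ?h p" by simp
        ultimately have "ereal d \<le> ?s" by (metis (no_types) order_trans)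
        then show False using less leD by blast
      qed
    qed
    moreover have "E1 \<times> E2 \<in> sets (lborel \<Otimes>\<^sub>M lborel)" by (rule pair_measureI) (use E(1,2) in simp_all)
    then have ms: "E1 \<times> E2 \<in> sets lborel" by (simp only: lborel_prod)
    ultimately have "E1 \<times> E2 \<in> null_sets lborel" using AE_iff_null_sets[OF ms] by simp
    then have "emeasure lborel (E1 \<times> E2) = 0" by (rule null_setsD1)
    moreover have "emeasure lborel (E1 \<times> E2) = emeasure lborel E1 * emeasure lborel E2"
      using lborel.emeasure_pair_measure_Times[of E1 lborel E2] E(1,2) by (simp add: lborel_prod)
    ultimately show False using E(5,6) by auto
  qed
qed

section \<open>Derivatives of sequences that tend to zero\<close>

lemma real_polynomial_function_C1:
  assumes "real_polynomial_function g"
  shows "\<exists>G. (\<forall>y. (g has_derivative G y) (at y)) \<and> (\<forall>h. continuous_on UNIV (\<lambda>y. G y h))"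
  using assms
proof induction
  case (linear f)
  then show ?case by (intro exI[of _ "\<lambda>y. f"]) (simp add: bounded_linear.has_derivative bounded_linear_imp_has_derivative)
next
  case (const c)
  show ?case by (intro exI[of _ "\<lambda>y h. 0"]) simp
next
  case (add f g)
  obtain F G where d: "\<forall>y. (f has_derivative F y) (at y)" "\<forall>h. continuous_on UNIV (\<lambda>y. F y h)"
    "\<forall>y. (g has_derivative G y) (at y)" "\<forall>h. continuous_on UNIV (\<lambda>y. G y h)" using add.IH by (elim exE conjE)
  show ?case
    by (intro exI[of _ "\<lambda>y h. F y h + G y h"] conjI allI has_derivative_add continuous_on_add)
       (use d in auto)
next
  case (mult f g)
  obtain F G where d: "\<forall>y. (f has_derivative F y) (at y)" "\<forall>h. continuous_on UNIV (\<lambda>y. F y h)"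
    "\<forall>y. (g has_derivative G y) (at y)" "\<forall>h. continuous_on UNIV (\<lambda>y. G y h)" using mult.IH by (elim exE conjE)
  have c: "continuous_on UNIV f" "continuous_on UNIV g"
    using d(1,3) by (meson continuous_at_imp_continuous_on has_derivative_continuous)+
  show ?case
    by (intro exI[of _ "\<lambda>y h. f y * G y h + F y h * g y"] conjI allI has_derivative_mult continuous_on_add continuous_on_mult c)
       (use d in auto)
qed

text \<open>The limit of the derivatives annihilates all polynomials, hence all continuous functions, hence itself.\<close>
lemma derivative_limit_zero:
  fixes a :: "nat \<Rightarrow> 'a::euclidean_space \<Rightarrow> real"
  assumes Q: "open Q" "bounded Q"
    and a: "\<And>k y. (a k has_derivative A k y) (at y)" "\<And>k. continuous_on UNIV (\<lambda>y. A k y e)"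
    and C: "\<And>k. \<exists>C. compact C \<and> C \<subseteq> Q \<and> (\<forall>y. y \<notin> C \<longrightarrow> a k y = 0 \<and> A k y e = 0)"
    and z: "\<And>y. (\<lambda>k. a k y) \<longlonglongrightarrow> 0" and b: "\<And>k y. y \<in> Q \<Longrightarrow> \<bar>a k y\<bar> \<le> M" "\<And>k y. y \<in> Q \<Longrightarrow> \<bar>A k y e\<bar> \<le> M"
    and D: "D \<in> borel_measurable borel" "AE y in lborel. y \<in> Q \<longrightarrow> (\<lambda>k. A k y e) \<longlonglongrightarrow> D y"
  shows "AE y in lborel. y \<in> Q \<longrightarrow> D y = 0"
proof -
  \<comment> \<open>\<open>D\<close> cut off to Q and truncated at height \<open>M\<close>: a
    bounded Borel function on the whole space that agrees with \<open>D\<close> almost everywhere in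
    Q.\<close>
  define E where "E y = indicator Q y * max (- M) (min M (D y))" for y
  have Em: "E \<in> borel_measurable borel" unfolding E_def using D(1) Q(1)
    by (intro borel_measurable_times borel_measurable_indicator borel_measurable_max borel_measurable_min borel_measurable_const) auto
  have ac: "continuous_on UNIV (a k)" for k using a(1) by (meson continuous_at_imp_continuous_on has_derivative_continuous)
  have off: "a k y = 0" "A k y e = 0" if "y \<notin> Q" for k y using C[of k] that by blast+
  have Eoff: "E y = 0" if "y \<notin> Q" for y using that by (simp add: E_def)
  have Ebd: "norm (E y) \<le> indicator Q y * M" for y
  proof (cases "y \<in> Q")
    case True
    then have "0 \<le> M" using b(1)[OF True, of 0] by linarith
    then show ?thesis using True by (simp add: E_def abs_le_iff)
  qed (simp add: E_def)
  have DE: "AE y in lborel. y \<in> Q \<longrightarrow> E y = D y" using D(2)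
  proof eventually_elim
    case (elim y)
    show ?case
    proof
      assume y: "y \<in> Q"
      then have "(\<lambda>k. \<bar>A k y e\<bar>) \<longlonglongrightarrow> \<bar>D y\<bar>" using elim by (intro tendsto_rabs) blast
      then have "\<bar>D y\<bar> \<le> M" by (rule Lim_bounded) (use b(2) y in auto)
      then show "E y = D y" using y by (simp add: E_def abs_le_iff max_def min_def)
    qed
  qed
  have Eae: "AE y in lborel. y \<in> Q \<longrightarrow> (\<lambda>k. A k y e) \<longlonglongrightarrow> E y" using D(2) DE
    by eventually_elim simp
  have Qf: "emeasure lborel Q < \<infinity>" by (rule emeasure_bounded_finite[OF Q(2)])
  have iQ: "integrable lborel (\<lambda>y. indicator Q y * c)" for c :: real
    using Q(1) Qf by (intro integrable_mult_left) (auto simp: less_top)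
  have cl: "compact (closure Q)" using Q(2) by (simp add: compact_closure)
  have bc: "\<exists>B\<ge>0. \<forall>y\<in>Q. \<bar>c y\<bar> \<le> B" if "continuous_on UNIV c" for c :: "'a \<Rightarrow> real"
  proof -
    have "bounded (c ` closure Q)"
      by (rule compact_imp_bounded[OF compact_continuous_image[OF continuous_on_subset[OF that] cl]]) simp
    then obtain B where "\<forall>x\<in>c ` closure Q. norm x \<le> B" unfolding bounded_iff by blast
    then have "\<bar>c y\<bar> \<le> max B 0" if "y \<in> Q" for y using that closure_subset[of Q] by (force simp: le_max_iff_disj)
    then show ?thesis by (intro exI[of _ "max B 0"]) simp
  qed
  have lim: "(\<lambda>k. integral\<^sup>L lborel (\<lambda>y. A k y e * c y)) \<longlonglongrightarrow> integral\<^sup>L lborel (\<lambda>y. E y * c y) \<and> integrable lborel (\<lambda>y. E y * c y)"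
    if c: "c \<in> borel_measurable borel" and cb: "B \<ge> 0" "\<And>y. y \<in> Q \<Longrightarrow> \<bar>c y\<bar> \<le> B" for c :: "'a \<Rightarrow> real" and B
  proof -
    have "AE y in lborel. y \<in> Q \<longrightarrow> (\<lambda>k. A k y e * c y) \<longlonglongrightarrow> E y * c y" using Eae
      by eventually_elim (auto intro: tendsto_mult_right)
    moreover have "norm (A k y e * c y) \<le> M * B" if "y \<in> Q" for k y
    proof -
      have "\<bar>A k y e\<bar> * \<bar>c y\<bar> \<le> M * B" using b(2)[OF that, of k] cb(2)[OF that] by (intro mult_mono) linarith+
      then show ?thesis by (simp add: abs_mult)
    qed
    moreover have "(\<lambda>y. A k y e * c y) \<in> borel_measurable borel" "(\<lambda>y. E y * c y) \<in> borel_measurable borel" for k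
      by (intro borel_measurable_times borel_measurable_continuous_onI a(2) Em c)+
    moreover have "A k y e * c y = 0" "E y * c y = 0" if "y \<notin> Q" for k y using off(2)[OF that] Eoff[OF that] by simp_all
    ultimately show ?thesis by (intro conjI bounded_support_limit[OF Q, of "\<lambda>k y. A k y e * c y"])
  qed
  \<comment> \<open>Integration by parts puts the derivative on the polynomial, and
    \<open>a k\<close> tends to zero.\<close>
  have poly: "integral\<^sup>L lborel (\<lambda>y. E y * g y) = 0" if g: "real_polynomial_function g" for g
  proof -
    from real_polynomial_function_C1[OF g] obtain G where G: "\<forall>y. (g has_derivative G y) (at y)" "\<forall>h. continuous_on UNIV (\<lambda>y. G y h)"
      by (elim exE conjE)
    have gc: "continuous_on UNIV g" using G(1) by (meson continuous_at_imp_continuous_on has_derivative_continuous)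
    obtain B where B: "B \<ge> 0" "\<forall>y\<in>Q. \<bar>g y\<bar> \<le> B" using bc[OF gc] by blast
    obtain B' where B': "B' \<ge> 0" "\<forall>y\<in>Q. \<bar>G y e\<bar> \<le> B'" using bc[OF G(2)[rule_format, of e]] by blast
    have gm: "g \<in> borel_measurable borel" by (rule borel_measurable_continuous_onI[OF gc])
    have 1: "(\<lambda>k. integral\<^sup>L lborel (\<lambda>y. A k y e * g y)) \<longlonglongrightarrow> integral\<^sup>L lborel (\<lambda>y. E y * g y)"
      using lim[OF gm B(1)] B(2) by blast
    have "integral\<^sup>L lborel (\<lambda>y. A k y e * g y) = - integral\<^sup>L lborel (\<lambda>y. a k y * G y e)" for k
    proof -
      obtain C where C: "compact C" "C \<subseteq> Q" "\<forall>y. y \<notin> C \<longrightarrow> a k y = 0 \<and> A k y e = 0" using C[of k] by blast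
      show ?thesis
        by (rule integration_by_parts(1)[OF Q(1) _ _ a(1) a(2) C(1,2)])
           (use G C(3) in \<open>auto intro: continuous_on_subset\<close>)
    qed
    moreover have "(\<lambda>k. integral\<^sup>L lborel (\<lambda>y. a k y * G y e)) \<longlonglongrightarrow> integral\<^sup>L lborel (\<lambda>y::'a. 0)"
    proof (rule bounded_support_limit(1)[OF Q, where B = "M * B'"])
      show "(\<lambda>y. a k y * G y e) \<in> borel_measurable borel" for k
        by (intro borel_measurable_continuous_onI continuous_on_mult ac G(2)[rule_format])
      show "AE y in lborel. y \<in> Q \<longrightarrow> (\<lambda>k. a k y * G y e) \<longlonglongrightarrow> 0"
        by (rule AE_I2) (use z tendsto_mult_left_zero in blast)
      show "norm (a k y * G y e) \<le> M * B'" if "y \<in> Q" for k y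
      proof -
        have "\<bar>a k y\<bar> * \<bar>G y e\<bar> \<le> M * B'" using b(1)[OF that, of k] B'(2) that by (intro mult_mono) fastforce+
        then show ?thesis by (simp add: abs_mult)
      qed
    qed (use off in auto)
    ultimately have "(\<lambda>k. integral\<^sup>L lborel (\<lambda>y. A k y e * g y)) \<longlonglongrightarrow> 0" using tendsto_minus by fastforce
    then show ?thesis using 1 LIMSEQ_unique by blast
  qed
  have cont: "integral\<^sup>L lborel (\<lambda>y. E y * c y) = 0" if c: "continuous_on UNIV c" for c
  proof (rule ccontr)
    assume ne: "integral\<^sup>L lborel (\<lambda>y. E y * c y) \<noteq> 0"
    let ?I = "\<bar>integral\<^sup>L lborel (\<lambda>y. E y * c y)\<bar>"
    define K where "K = integral\<^sup>L lborel (\<lambda>y. indicator Q y * M)"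
    have K: "K \<ge> 0" unfolding K_def
    proof (rule integral_nonneg_AE)
      show "AE y in lborel. 0 \<le> indicator Q y * M" by (rule AE_I2) (rule order_trans[OF norm_ge_zero Ebd])
    qed
    define t where "t = ?I / (2 * (K + 1))"
    have t: "t > 0" "t * K < ?I"
    proof -
      show "t > 0" using ne K by (simp add: t_def)
      have "?I * K < ?I * (2 * (K + 1))" using ne K by (intro mult_strict_left_mono) auto
      then show "t * K < ?I" using K by (simp add: t_def pos_divide_less_eq)
    qed
    obtain g where g: "real_polynomial_function g" "\<And>x. x \<in> closure Q \<Longrightarrow> \<bar>c x - g x\<bar> < t"
      using Stone_Weierstrass_real_polynomial_function[OF cl continuous_on_subset[OF c] t(1)] by blast
    have gc: "continuous_on UNIV g"
      using real_polynomial_function_C1[OF g(1)] by (meson continuous_at_imp_continuous_on has_derivative_continuous)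
    obtain B1 where "B1 \<ge> 0" "\<forall>y\<in>Q. \<bar>c y\<bar> \<le> B1" using bc[OF c] by blast
    then have i1: "integrable lborel (\<lambda>y. E y * c y)" using lim[OF borel_measurable_continuous_onI[OF c]] by blast
    obtain B2 where "B2 \<ge> 0" "\<forall>y\<in>Q. \<bar>g y\<bar> \<le> B2" using bc[OF gc] by blast
    then have i2: "integrable lborel (\<lambda>y. E y * g y)" using lim[OF borel_measurable_continuous_onI[OF gc]] by blast
    have "integral\<^sup>L lborel (\<lambda>y. E y * c y) = integral\<^sup>L lborel (\<lambda>y. E y * c y - E y * g y)"
      using Bochner_Integration.integral_diff[OF i1 i2] poly[OF g(1)] by simp
    then have "?I \<le> integral\<^sup>L lborel (\<lambda>y. norm (E y * c y - E y * g y))"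
      using integral_norm_bound[of lborel "\<lambda>y. E y * c y - E y * g y"] by simp
    also have "\<dots> \<le> integral\<^sup>L lborel (\<lambda>y. t * (indicator Q y * M))"
    proof (rule integral_mono_AE)
      show "integrable lborel (\<lambda>y. norm (E y * c y - E y * g y))"
        by (rule integrable_norm[OF Bochner_Integration.integrable_diff[OF i1 i2]])
      show "integrable lborel (\<lambda>y. t * (indicator Q y * M))" by (rule integrable_mult_right[OF iQ])
      show "AE y in lborel. norm (E y * c y - E y * g y) \<le> t * (indicator Q y * M)"
      proof (rule AE_I2)
        fix y
        show "norm (E y * c y - E y * g y) \<le> t * (indicator Q y * M)"
        proof (cases "y \<in> Q")
          case True
          then have "\<bar>c y - g y\<bar> \<le> t" using g(2)[of y] closure_subset[of Q] by fastforce
          then have "\<bar>c y - g y\<bar> * \<bar>E y\<bar> \<le> t * (indicator Q y * M)" using Ebd[of y] by (intro mult_mono) (use t(1) in auto)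
          then show ?thesis by (simp add: right_diff_distrib[symmetric] abs_mult mult.commute)
        qed (simp add: E_def)
      qed
    qed
    also have "\<dots> = t * K" unfolding K_def by (rule integral_mult_right_zero)
    finally show False using t(2) by linarith
  qed
  \<comment> \<open>\<open>E\<close> itself serves as the multiplier: each \<open>A k y e\<close> is
    continuous in \<open>y\<close>, so its integral against \<open>E\<close> is zero, while these
    integrals tend to the integral of the square of \<open>E\<close>.\<close>
  have EE: "(\<lambda>k. integral\<^sup>L lborel (\<lambda>y. A k y e * E y)) \<longlonglongrightarrow> integral\<^sup>L lborel (\<lambda>y. E y * E y) \<and> integrable lborel (\<lambda>y. E y * E y)"
  proof (rule lim[OF Em, of "max M 0"])
    show "\<bar>E y\<bar> \<le> max M 0" if "y \<in> Q" for y using Ebd[of y] that by simp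
  qed simp
  have "integral\<^sup>L lborel (\<lambda>y. A k y e * E y) = 0" for k using cont[OF a(2), of k] by (simp only: mult.commute)
  then have "integral\<^sup>L lborel (\<lambda>y. E y * E y) = 0" using EE by (simp add: LIMSEQ_const_iff)
  then have "AE y in lborel. E y * E y = 0" using EE by (simp add: integral_nonneg_eq_0_iff_AE)
  then show ?thesis using DE by eventually_elim simp
qed

section \<open>The exact solution\<close>

lemma norm_fst_snd_le: "norm (fst w) \<le> norm w" "norm (snd w) \<le> norm w"
  using norm_fst_le[of "fst w" "snd w"] norm_snd_le[of "snd w" "fst w"] by simp_all

lemma AE_witness:
  assumes "AE y in lborel. P y" "E \<in> sets borel" "emeasure lborel E > 0"
  shows "\<exists>y\<in>E. P y"
proof (rule ccontr)
  assume "\<not> (\<exists>y\<in>E. P y)"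
  then have "AE y in lborel. y \<notin> E" using assms(1) by (auto elim!: eventually_mono)
  then have "E \<in> null_sets lborel" using AE_iff_null_sets[of E lborel] assms(2) by simp
  then show False using assms(3) null_setsD1 by fastforce
qed

locale dirichlet_data = condition_O_locale N \<sigma> r0 \<delta>1 \<delta>2 \<delta>0 \<kappa> \<gamma>
  for N :: nat and \<sigma> :: "real ^ 'n::finite ^ 'm::finite \<Rightarrow> real ^ 'n ^ 'm" and r0 \<delta>1 \<delta>2 \<delta>0 :: real
    and \<kappa> :: "nat \<Rightarrow> ('n, 'm) pt \<Rightarrow> real" and \<gamma> :: "nat \<Rightarrow> ('n, 'm) pt \<Rightarrow> ('n, 'm) pt" +
  fixes Q :: "((real ^ 'n) \<times> real) set" and ubar :: "(real ^ 'n) \<times> real \<Rightarrow> real ^ 'm"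
    and vbar :: "(real ^ 'n) \<times> real \<Rightarrow> real ^ 'n ^ 'm"
    and Fu :: "(real ^ 'n) \<times> real \<Rightarrow> (((real ^ 'n) \<times> real) \<Rightarrow>\<^sub>L (real ^ 'm))"
    and Fv :: "(real ^ 'n) \<times> real \<Rightarrow> (((real ^ 'n) \<times> real) \<Rightarrow>\<^sub>L (real ^ 'n ^ 'm))"
  assumes Q: "open Q" "bounded Q" "Q \<noteq> {}"
    and Cu: "C1_closure Q ubar Fu" and Cv: "C1_closure Q vbar Fv"
    and div: "\<And>y. y \<in> closure Q \<Longrightarrow> ubar y = divx (blinfun_apply (Fv y))"
    and sub: "\<And>y. y \<in> closure Q \<Longrightarrow> (Dx (blinfun_apply (Fu y)), Dt (blinfun_apply (Fv y))) \<in> Sigma1 N r0 \<delta>0 \<kappa> \<gamma>"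
begin

definition "F0 y h = (blinfun_apply (Fu y) h, blinfun_apply (Fv y) h)"
definition "W0 y = jet (F0 y)"

lemma cl: "compact (closure Q)" using Q(2) by (simp add: compact_closure)

lemma Q_borel: "Q \<in> sets borel" using Q(1) by simp

lemma F0_continuous: "continuous_on (closure Q) (\<lambda>y. F0 y h)"
proof -
  have "continuous_on (closure Q) Fu" "continuous_on (closure Q) Fv" using Cu Cv by (auto simp: C1_closure_def)
  then show ?thesis unfolding F0_def
    by (intro continuous_on_Pair bounded_linear.continuous_on[OF blinfun.bounded_linear_left])
qed

lemma F0_derivative: "y \<in> Q \<Longrightarrow> ((\<lambda>y. (ubar y, vbar y)) has_derivative F0 y) (at y)"
  unfolding F0_def[abs_def] by (rule has_derivative_Pair) (use Cu Cv in \<open>auto simp: C1_closure_def\<close>)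

lemma W0_continuous: "continuous_on (closure Q) W0"
  unfolding W0_def[abs_def] by (rule continuous_on_jet[OF F0_continuous])

text \<open>The open sets \<open>Sig l\<close> increase to \<open>Sigma1\<close>, and the image of
  the compact closure of Q is contained in finitely many of them, hence in one with parameter below
  1, where the iteration can start.\<close>

lemma W0_range: "\<exists>lm0. \<delta>0 \<le> lm0 \<and> lm0 < 1 \<and> W0 ` Q \<subseteq> Sig lm0"
proof -
  have K: "compact (W0 ` closure Q)" by (rule compact_continuous_image[OF W0_continuous cl])
  have "W0 y \<in> (\<Union>l\<in>{\<delta>0..<1}. Sig l)" if "y \<in> closure Q" for y
    using sub[OF that] unfolding Sigma1_def W0_def jet_def F0_def by simp
  then have "W0 ` closure Q \<subseteq> (\<Union>l\<in>{\<delta>0..<1}. Sig l)" by blast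
  then obtain C where C: "C \<subseteq> {\<delta>0..<1}" "finite C" "W0 ` closure Q \<subseteq> (\<Union>l\<in>C. Sig l)"
    using compactE_image[OF K, of "{\<delta>0..<1}" Sig] open_Sig by auto
  define lm where "lm = Max (insert \<delta>0 C)"
  have "lm \<in> insert \<delta>0 C" unfolding lm_def by (rule Max_in) (use C(2) in auto)
  then have "\<delta>0 \<le> lm" "lm < 1" using C(1) params(5) by auto
  moreover have "Sig l \<subseteq> Sig lm" if "l \<in> C" for l
    by (rule Sig_mono) (use that C(2) in \<open>simp add: lm_def\<close>)
  then have "W0 ` Q \<subseteq> Sig lm" using C(3) closure_subset[of Q] by blast
  ultimately show ?thesis by blast
qed

lemma sigma_continuous: "continuous_on UNIV \<sigma>"
  using cond by (simp add: condition_O_def)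

lemma bounded_on_Q: "continuous_on (closure Q) g \<Longrightarrow> \<exists>B>0. \<forall>y\<in>Q. norm (g y) \<le> B"
  for g :: "(real ^ 'n) \<times> real \<Rightarrow> 'b::real_normed_vector"
proof -
  assume "continuous_on (closure Q) g"
  then have "bounded (g ` closure Q)" by (intro compact_imp_bounded compact_continuous_image cl)
  then obtain B where "B > 0" "\<forall>x\<in>g ` closure Q. norm x \<le> B" unfolding bounded_pos by blast
  then show ?thesis using closure_subset[of Q] by blast
qed

lemma ubar_continuous: "continuous_on (closure Q) ubar" using Cu by (simp add: C1_closure_def)

end

section \<open>The limit of the approximations\<close>

text \<open>The assumptions on \<open>p\<close>, \<open>P\<close>, \<open>W\<close> and
  \<open>d\<close> are the conclusions of \<open>approximating_sequence\<close>, so that the limit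
  can be studied under fixed names.\<close>

locale approximation = dirichlet_data N \<sigma> r0 \<delta>1 \<delta>2 \<delta>0 \<kappa> \<gamma> Q ubar vbar Fu Fv
  for N :: nat and \<sigma> :: "real ^ 'n::finite ^ 'm::finite \<Rightarrow> real ^ 'n ^ 'm" and r0 \<delta>1 \<delta>2 \<delta>0 :: real
    and \<kappa> :: "nat \<Rightarrow> ('n, 'm) pt \<Rightarrow> real" and \<gamma> :: "nat \<Rightarrow> ('n, 'm) pt \<Rightarrow> ('n, 'm) pt"
    and Q ubar vbar Fu Fv +
  fixes e :: real and p :: "nat \<Rightarrow> (real ^ 'n) \<times> real \<Rightarrow> (real ^ 'm) \<times> (real ^ 'n ^ 'm)"
    and P :: "nat \<Rightarrow> (real ^ 'n) \<times> real \<Rightarrow> (real ^ 'n) \<times> real \<Rightarrow> (real ^ 'm) \<times> (real ^ 'n ^ 'm)"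
    and W :: "(real ^ 'n) \<times> real \<Rightarrow> ('n, 'm) pt" and d :: real
  assumes e: "e > 0" and pP: "\<And>k. pert Q (p k) (P k)" and p0: "\<And>y. p 0 y = 0" "\<And>y h. P 0 y h = 0"
    and sm: "\<And>k. small (e / 2 ^ Suc k) (\<lambda>y. p (Suc k) y - p k y) (\<lambda>y h. P (Suc k) y h - P k y h)"
    and bd: "\<And>k y. y \<in> Q \<Longrightarrow> norm (W0 y + jet (P k y)) \<le> bnd"
    and Wm: "W \<in> borel_measurable borel"
    and Wlim: "AE y in lborel. y \<in> Q \<longrightarrow> (\<lambda>k. W0 y + jet (P k y)) \<longlonglongrightarrow> W y \<and> snd (W y) = \<sigma> (fst (W y))"
    and d: "d > 0" and osc: "\<And>U. open U \<Longrightarrow> U \<subseteq> Q \<Longrightarrow> U \<noteq> {} \<Longrightarrow>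
      \<exists>E1 E2. E1 \<in> sets borel \<and> E2 \<in> sets borel \<and> E1 \<subseteq> U \<and> E2 \<subseteq> U \<and>
        emeasure lborel E1 > 0 \<and> emeasure lborel E2 > 0 \<and> (\<forall>y\<in>E1. \<forall>z\<in>E2. d \<le> dist (fst (W y)) (fst (W z)))"
begin

lemma P: "(p k has_derivative P k y) (at y)" "continuous_on UNIV (\<lambda>y. P k y h)" "fst (p k y) = divx (\<lambda>h. snd (P k y h))"
  using pP[of k] by (auto simp: pert_def div_pair_def)

definition "ulim = (SOME l. \<forall>k y. norm (l y - fst (p k y)) \<le> e / 2 ^ k)"
definition "tlim = (SOME l. \<forall>k y. norm (l y - fst (P k y (0, 1))) \<le> e / 2 ^ k)"
definition "u y = ubar y + ulim y"
definition "ut y = Dt (blinfun_apply (Fu y)) + tlim y"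

lemma ulim_near: "norm (ulim y - fst (p k y)) \<le> e / 2 ^ k"
proof -
  have "\<exists>l. \<forall>k y. norm (l y - fst (p k y)) \<le> e / 2 ^ k"
  proof (rule geometric_limit)
    show "norm (fst (p (Suc k) y) - fst (p k y)) \<le> e / 2 ^ Suc k" for k y
      using order_trans[OF norm_fst_snd_le(1)] sm[of k] unfolding small_def fst_diff[symmetric] by blast
  qed
  from someI_ex[OF this] show ?thesis unfolding ulim_def by blast
qed

lemma tlim_near: "norm (tlim y - fst (P k y (0, 1))) \<le> e / 2 ^ k"
proof -
  have "\<exists>l. \<forall>k y. norm (l y - fst (P k y (0, 1))) \<le> e / 2 ^ k"
    by (rule geometric_limit) (use sm in \<open>simp add: small_def\<close>)
  from someI_ex[OF this] show ?thesis unfolding tlim_def by blast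
qed

lemma ulim: "norm (ulim y) \<le> e" "continuous_on UNIV ulim" "(\<lambda>k. fst (p k y)) \<longlonglongrightarrow> ulim y"
  "y \<notin> Q \<Longrightarrow> ulim y = 0" "norm (fst (p k y)) \<le> 2 * e"
proof -
  show 1: "norm (ulim y) \<le> e" using ulim_near[of y 0] p0 by simp
  show "continuous_on UNIV ulim"
    by (rule geometric_limit_tendsto(2)[OF ulim_near]) (intro continuous_on_fst pert_continuous[OF pP])
  show 2: "(\<lambda>k. fst (p k y)) \<longlonglongrightarrow> ulim y" by (rule geometric_limit_tendsto(1)[OF ulim_near])
  show "ulim y = 0" if "y \<notin> Q"
    using 2 pert_outside(1)[OF pP that] by (simp add: LIMSEQ_const_iff)
  have "e / 2 ^ k \<le> e" using e by (simp add: divide_le_eq)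
  then show "norm (fst (p k y)) \<le> 2 * e"
    using norm_triangle_sub[of "fst (p k y)" "ulim y"] ulim_near[of y k] 1 by (simp add: norm_minus_commute)
qed

lemma tlim: "norm (tlim y) \<le> e" "continuous_on UNIV tlim" "(\<lambda>k. fst (P k y (0, 1))) \<longlonglongrightarrow> tlim y"
  "norm (fst (P k y (0, 1))) \<le> 2 * e"
proof -
  show 1: "norm (tlim y) \<le> e" using tlim_near[of y 0] p0 by simp
  show "continuous_on UNIV tlim"
    by (rule geometric_limit_tendsto(2)[OF tlim_near]) (intro continuous_on_fst P(2))
  show 2: "(\<lambda>k. fst (P k y (0, 1))) \<longlonglongrightarrow> tlim y" by (rule geometric_limit_tendsto(1)[OF tlim_near])
  have "e / 2 ^ k \<le> e" using e by (simp add: divide_le_eq)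
  then show "norm (fst (P k y (0, 1))) \<le> 2 * e"
    using norm_triangle_sub[of "fst (P k y (0, 1))" "tlim y"] tlim_near[of y k] 1 by (simp add: norm_minus_commute)
qed

definition "uk k y = ubar y + fst (p k y)"
definition "UK k y h = fst (F0 y h) + fst (P k y h)"

lemma uk: "y \<in> Q \<Longrightarrow> (uk k has_derivative UK k y) (at y)" "continuous_on Q (\<lambda>y. UK k y h)" "continuous_on Q (uk k)"
proof -
  show 1: "(uk k has_derivative UK k y) (at y)" if "y \<in> Q" for y
    unfolding uk_def UK_def[abs_def]
    using has_derivative_add[OF has_derivative_fst[OF F0_derivative[OF that]] has_derivative_fst[OF P(1)[of k y]]] by simp
  show "continuous_on Q (uk k)" using 1 by (meson continuous_at_imp_continuous_on has_derivative_continuous)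
  show "continuous_on Q (\<lambda>y. UK k y h)" unfolding UK_def
    by (intro continuous_on_add continuous_on_fst continuous_on_subset[OF F0_continuous closure_subset] continuous_on_subset[OF P(2)]) simp
qed

lemma u_continuous: "continuous_on (closure Q) u"
  unfolding u_def[abs_def] by (intro continuous_on_add ubar_continuous continuous_on_subset[OF ulim(2)]) simp

lemma ut_continuous: "continuous_on (closure Q) ut"
proof -
  have "continuous_on (closure Q) (\<lambda>y. Dt (blinfun_apply (Fu y)))"
    using continuous_on_fst[OF F0_continuous[of "(0, 1)"]] by (simp add: F0_def Dt_def)
  then show ?thesis unfolding ut_def[abs_def] by (intro continuous_on_add continuous_on_subset[OF tlim(2)]) simp_all
qed

lemma uk_bounded: "\<exists>B>0. \<forall>k. \<forall>y\<in>Q. norm (uk k y) \<le> B"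
proof -
  obtain B where B: "B > 0" "\<forall>y\<in>Q. norm (ubar y) \<le> B" using bounded_on_Q[OF ubar_continuous] by blast
  have "norm (uk k y) \<le> B + 2 * e" if "y \<in> Q" for k y
    using norm_triangle_mono[OF B(2)[rule_format, OF that] ulim(5)] by (simp add: uk_def)
  then show ?thesis using B(1) e by (intro exI[of _ "B + 2 * e"]) auto
qed

lemma uk_limit: "(\<lambda>k. uk k y) \<longlonglongrightarrow> u y"
  unfolding uk_def u_def by (intro tendsto_intros ulim(3))

text \<open>Integration by parts holds for the differentiable approximations \<open>uk k\<close>,
  and both sides pass to the limit by dominated convergence. For this the derivatives need only
  converge almost everywhere and be bounded uniformly on Q.\<close>

lemma weak_derivative:
  assumes t: "test_fun Q \<phi>" and h: "h \<in> Basis" and V: "(\<lambda>y. \<phi> y *\<^sub>R V y) \<in> borel_measurable borel"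
    and b: "\<And>k y. y \<in> Q \<Longrightarrow> norm (UK k y h) \<le> B" and l: "AE y in lborel. y \<in> Q \<longrightarrow> (\<lambda>k. UK k y h) \<longlonglongrightarrow> V y"
  shows "integral\<^sup>L (lebesgue_on Q) (\<lambda>y. frechet_derivative \<phi> (at y) h *\<^sub>R u y) = - integral\<^sup>L (lebesgue_on Q) (\<lambda>y. \<phi> y *\<^sub>R V y)"
proof -
  let ?D = "\<lambda>y. frechet_derivative \<phi> (at y)"
  let ?C = "closure {y. \<phi> y \<noteq> 0}"
  note tD = test_funD[OF t]
  have off: "\<phi> y = 0" "?D y h = 0" if "y \<notin> Q" for y using tD(5,6,7) that by blast+
  have ibp: "integral\<^sup>L lborel (\<lambda>y. ?D y h *\<^sub>R uk k y) = - integral\<^sup>L lborel (\<lambda>y. \<phi> y *\<^sub>R UK k y h)"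
    "continuous_on UNIV (\<lambda>y. ?D y h *\<^sub>R uk k y)" "continuous_on UNIV (\<lambda>y. \<phi> y *\<^sub>R UK k y h)" for k
    by (rule integration_by_parts_vec[OF Q(1) uk(1) uk(2) tD(1) tD(3)[OF h] tD(4,5,6,7)]; assumption)+
  have uc: "continuous_on UNIV (\<lambda>y. ?D y h *\<^sub>R u y)"
  proof (rule continuous_extension_zero[OF Q(1) _ tD(4,5)])
    show "continuous_on Q (\<lambda>y. ?D y h *\<^sub>R u y)"
      by (intro continuous_on_scaleR continuous_on_subset[OF tD(3)[OF h]] continuous_on_subset[OF u_continuous closure_subset]) simp
  qed (simp add: tD(7))
  obtain B1 where B1: "B1 > 0" "\<And>y. norm (?D y h) \<le> B1"
    using continuous_compact_support_bounded[OF tD(3)[OF h] tD(4) tD(7)] by blast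
  obtain B2 where B2: "B2 > 0" "\<And>y. norm (\<phi> y) \<le> B2"
    using continuous_compact_support_bounded[OF tD(2) tD(4) tD(6)] by blast
  obtain B3 where B3: "B3 > 0" "\<forall>k. \<forall>y\<in>Q. norm (uk k y) \<le> B3" using uk_bounded by blast
  have "(\<lambda>k. integral\<^sup>L lborel (\<lambda>y. ?D y h *\<^sub>R uk k y)) \<longlonglongrightarrow> integral\<^sup>L lborel (\<lambda>y. ?D y h *\<^sub>R u y)"
  proof (rule bounded_support_limit(1)[OF Q(1,2)])
    show "(\<lambda>y. ?D y h *\<^sub>R uk k y) \<in> borel_measurable borel" for k by (rule borel_measurable_continuous_onI[OF ibp(2)])
    show "(\<lambda>y. ?D y h *\<^sub>R u y) \<in> borel_measurable borel" by (rule borel_measurable_continuous_onI[OF uc])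
    show "norm (?D y h *\<^sub>R uk k y) \<le> B1 * B3" if "y \<in> Q" for k y
      unfolding norm_scaleR real_norm_def[symmetric] by (rule mult_mono) (use B1 B3 that in auto)
    show "AE y in lborel. y \<in> Q \<longrightarrow> (\<lambda>k. ?D y h *\<^sub>R uk k y) \<longlonglongrightarrow> ?D y h *\<^sub>R u y"
      by (intro AE_I2 impI tendsto_scaleR tendsto_const uk_limit)
  qed (simp_all add: off)
  moreover have "(\<lambda>k. integral\<^sup>L lborel (\<lambda>y. \<phi> y *\<^sub>R UK k y h)) \<longlonglongrightarrow> integral\<^sup>L lborel (\<lambda>y. \<phi> y *\<^sub>R V y)"
  proof (rule bounded_support_limit(1)[OF Q(1,2) _ V])
    show "(\<lambda>y. \<phi> y *\<^sub>R UK k y h) \<in> borel_measurable borel" for k by (rule borel_measurable_continuous_onI[OF ibp(3)])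
    show "norm (\<phi> y *\<^sub>R UK k y h) \<le> B2 * B" if "y \<in> Q" for k y
      unfolding norm_scaleR real_norm_def[symmetric] by (rule mult_mono) (use B2 b[OF that] less_imp_le[OF B2(1)] in auto)
    show "AE y in lborel. y \<in> Q \<longrightarrow> (\<lambda>k. \<phi> y *\<^sub>R UK k y h) \<longlonglongrightarrow> \<phi> y *\<^sub>R V y" using l
      by eventually_elim (auto intro: tendsto_scaleR)
  qed (simp_all add: off)
  then have "(\<lambda>k. integral\<^sup>L lborel (\<lambda>y. ?D y h *\<^sub>R uk k y)) \<longlonglongrightarrow> - integral\<^sup>L lborel (\<lambda>y. \<phi> y *\<^sub>R V y)"
    unfolding ibp(1) by (rule tendsto_minus)
  ultimately have "integral\<^sup>L lborel (\<lambda>y. ?D y h *\<^sub>R u y) = - integral\<^sup>L lborel (\<lambda>y. \<phi> y *\<^sub>R V y)" by (rule LIMSEQ_unique)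
  then show ?thesis
    using integral_lebesgue_on_eq_lborel[OF Q_borel V] integral_lebesgue_on_eq_lborel[OF Q_borel borel_measurable_continuous_onI[OF uc]]
    by (simp add: off)
qed

lemma jet_UK: "(\<chi> i. fst (W0 y + jet (P k y)) $ i $ j) = UK k y (axis j 1, 0)"
  by (simp add: vec_eq_iff W0_def jet_def Dx_def UK_def)

lemma bounded_linear_column: "bounded_linear (\<lambda>A :: real ^ 'n ^ 'm. \<chi> i. A $ i $ j)"
  by (rule linear_conv_bounded_linear[THEN iffD1], rule linearI) (simp_all add: vec_eq_iff)

lemma fst_W_measurable: "(\<lambda>y. fst (W y)) \<in> borel_measurable borel"
  by (rule measurable_compose[OF Wm borel_measurable_continuous_onI]) (intro continuous_intros)

lemma W_bounded: "AE y in lborel. y \<in> Q \<longrightarrow> norm (fst (W y)) \<le> bnd"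
  using Wlim
proof eventually_elim
  case (elim y)
  show ?case
  proof
    assume y: "y \<in> Q"
    have "(\<lambda>k. norm (W0 y + jet (P k y))) \<longlonglongrightarrow> norm (W y)" by (rule tendsto_norm) (use elim y in blast)
    then have "norm (W y) \<le> bnd" by (rule Lim_bounded[of _ _ 0]) (use bd[OF y] in auto)
    then show "norm (fst (W y)) \<le> bnd" by (rule order_trans[OF norm_fst_snd_le(1)])
  qed
qed

lemma Linf_continuous: "continuous_on (closure Q) g \<Longrightarrow> Linf_fun Q g" for g :: "(real ^ 'n) \<times> real \<Rightarrow> real ^ 'm"
proof -
  assume g: "continuous_on (closure Q) g"
  obtain B where "\<forall>y\<in>Q. norm (g y) \<le> B" using bounded_on_Q[OF g] by blast
  then have "AE y in lebesgue_on Q. norm (g y) \<le> B" by (simp add: AE_lebesgue_on_iff[OF Q_borel])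
  moreover have "g \<in> borel_measurable (lebesgue_on Q)"
    by (rule continuous_imp_measurable_on_sets_lebesgue[OF continuous_on_subset[OF g closure_subset]]) (use Q(1) in simp)
  ultimately show ?thesis unfolding Linf_fun_def by blast
qed

lemma W1inf: "W1inf Q u (\<lambda>y. fst (W y)) ut"
  unfolding W1inf_def
proof (intro conjI allI impI)
  show "Linf_fun Q u" by (rule Linf_continuous[OF u_continuous])
  show "Linf_fun Q ut" by (rule Linf_continuous[OF ut_continuous])
  have "(\<lambda>y. fst (W y)) \<in> borel_measurable (lebesgue_on Q)"
    using fst_W_measurable by (intro measurable_restrict_space1 measurable_completion) simp
  moreover have "AE y in lebesgue_on Q. norm (fst (W y)) \<le> bnd"
    using W_bounded by (simp only: AE_lebesgue_on_iff[OF Q_borel])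
  ultimately show "Linf_fun Q (\<lambda>y. fst (W y))" unfolding Linf_fun_def by blast
  fix \<phi> :: "(real ^ 'n) \<times> real \<Rightarrow> real" assume t: "test_fun Q \<phi>"
  have pm: "\<phi> \<in> borel_measurable borel" by (rule borel_measurable_continuous_onI[OF test_funD(2)[OF t]])
  show "integral\<^sup>L (lebesgue_on Q) (\<lambda>y. frechet_derivative \<phi> (at y) (axis j 1, 0) *\<^sub>R u y)
              = - integral\<^sup>L (lebesgue_on Q) (\<lambda>y. \<phi> y *\<^sub>R (\<chi> i. fst (W y) $ i $ j))" for j
  proof -
    obtain K where K: "K > 0" "\<And>A :: real ^ 'n ^ 'm. norm (\<chi> i. A $ i $ j) \<le> norm A * K"
      using bounded_linear.pos_bounded[OF bounded_linear_column[of j]] by blast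
    show ?thesis
    proof (rule weak_derivative[OF t])
      show "(axis j 1, 0) \<in> (Basis :: ((real ^ 'n) \<times> real) set)" by (auto simp: Basis_prod_def axis_in_Basis_iff)
      have "(\<lambda>y. \<chi> i. fst (W y) $ i $ j) \<in> borel_measurable borel"
        by (rule measurable_compose[OF fst_W_measurable borel_measurable_continuous_onI])
           (rule linear_continuous_on[OF bounded_linear_column])
      then show "(\<lambda>y. \<phi> y *\<^sub>R (\<chi> i. fst (W y) $ i $ j)) \<in> borel_measurable borel"
        by (rule borel_measurable_scaleR[OF pm])
      show "norm (UK k y (axis j 1, 0)) \<le> bnd * K" if "y \<in> Q" for k y
      proof -
        have "norm (UK k y (axis j 1, 0)) \<le> norm (fst (W0 y + jet (P k y))) * K"
          unfolding jet_UK[symmetric] by (rule K(2))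
        also have "\<dots> \<le> bnd * K"
          by (rule mult_right_mono[OF order_trans[OF norm_fst_snd_le(1) bd[OF that]]]) (use K(1) in simp)
        finally show ?thesis .
      qed
      show "AE y in lborel. y \<in> Q \<longrightarrow> (\<lambda>k. UK k y (axis j 1, 0)) \<longlonglongrightarrow> (\<chi> i. fst (W y) $ i $ j)" using Wlim
      proof eventually_elim
        case (elim y)
        show ?case unfolding jet_UK[symmetric]
          using elim bounded_linear.tendsto[OF bounded_linear_column, OF tendsto_fst] by blast
      qed
    qed
  qed
  show "integral\<^sup>L (lebesgue_on Q) (\<lambda>y. frechet_derivative \<phi> (at y) (0, 1) *\<^sub>R u y)
              = - integral\<^sup>L (lebesgue_on Q) (\<lambda>y. \<phi> y *\<^sub>R ut y)"
  proof -
    have c0: "continuous_on (closure Q) (\<lambda>y. fst (F0 y (0, 1)))" by (intro continuous_on_fst F0_continuous)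
    obtain B where B: "B > 0" "\<forall>y\<in>Q. norm (fst (F0 y (0, 1))) \<le> B" using bounded_on_Q[OF c0] by blast
    show ?thesis
    proof (rule weak_derivative[OF t])
      show "(0, 1) \<in> (Basis :: ((real ^ 'n) \<times> real) set)" by (auto simp: Basis_prod_def)
      have "continuous_on UNIV (\<lambda>y. \<phi> y *\<^sub>R ut y)"
      proof (rule continuous_extension_zero[OF Q(1) _ test_funD(4,5)[OF t]])
        show "continuous_on Q (\<lambda>y. \<phi> y *\<^sub>R ut y)"
          by (intro continuous_on_scaleR continuous_on_subset[OF test_funD(2)[OF t]] continuous_on_subset[OF ut_continuous closure_subset]) simp
        show "\<phi> y *\<^sub>R ut y = 0" if "y \<notin> closure {y. \<phi> y \<noteq> 0}" for y
          unfolding test_funD(6)[OF t that] by (rule scaleR_zero_left)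
      qed
      then show "(\<lambda>y. \<phi> y *\<^sub>R ut y) \<in> borel_measurable borel" by (rule borel_measurable_continuous_onI)
      show "norm (UK k y (0, 1)) \<le> B + 2 * e" if "y \<in> Q" for k y
        unfolding UK_def by (rule norm_triangle_mono[OF B(2)[rule_format, OF that] tlim(4)])
      show "AE y in lborel. y \<in> Q \<longrightarrow> (\<lambda>k. UK k y (0, 1)) \<longlonglongrightarrow> ut y"
        unfolding UK_def ut_def F0_def Dt_def fst_conv by (intro AE_I2 impI tendsto_add tendsto_const tlim(3))
    qed
  qed
qed

text \<open>The approximations satisfy the identity exactly with the time derivative of v in place
  of \<sigma>(Du). Almost everywhere that derivative tends to \<open>snd (W y)\<close>, which equals
  \<sigma> of \<open>fst (W y)\<close>, so no limit has to be taken inside \<sigma>.\<close>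

lemma weak_equation:
  assumes t: "test_fun Q \<phi>"
  shows "integral\<^sup>L (lebesgue_on Q) (\<lambda>y. u y \<bullet> Dt (frechet_derivative \<phi> (at y)) - \<sigma> (fst (W y)) \<bullet> Dx (frechet_derivative \<phi> (at y))) = 0"
proof -
  let ?D = "\<lambda>y. frechet_derivative \<phi> (at y)"
  let ?C = "closure {y. \<phi> y \<noteq> 0}"
  note tD = test_funD[OF t]
  have T: "(0, 1) \<in> (Basis :: ((real ^ 'n) \<times> real) set)" "(axis j 1, 0) \<in> (Basis :: ((real ^ 'n) \<times> real) set)" for j
    by (auto simp: Basis_prod_def axis_in_Basis_iff)
  have c: "continuous_on UNIV (\<lambda>y. Dt (?D y))" "continuous_on UNIV (\<lambda>y. Dx (?D y))"
    unfolding Dt_def Dx_def by (intro tD(3) T continuous_on_vec_lambda continuous_on_component)+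
  have z: "Dt (?D y) = 0" "Dx (?D y) = 0" if "y \<notin> ?C" for y using tD(7)[OF that] by (simp_all add: Dt_def Dx_def vec_eq_iff)
  have zQ: "Dt (?D y) = 0" "Dx (?D y) = 0" if "y \<notin> Q" for y using z tD(5) that by blast+
  obtain B1 where B1: "B1 > 0" "\<And>y. norm (Dt (?D y)) \<le> B1"
    using continuous_compact_support_bounded[OF c(1) tD(4) z(1)] by blast
  obtain B2 where B2: "B2 > 0" "\<And>y. norm (Dx (?D y)) \<le> B2"
    using continuous_compact_support_bounded[OF c(2) tD(4) z(2)] by blast
  obtain B3 where B3: "B3 > 0" "\<forall>k. \<forall>y\<in>Q. norm (uk k y) \<le> B3" using uk_bounded by blast
  define s where "s k y = uk k y \<bullet> Dt (?D y) - snd (W0 y + jet (P k y)) \<bullet> Dx (?D y)" for k y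
  define l where "l y = u y \<bullet> Dt (?D y) - \<sigma> (fst (W y)) \<bullet> Dx (?D y)" for y
  have s0: "integral\<^sup>L lborel (s k) = 0" for k
  proof -
    let ?f = "\<lambda>y. (ubar y, vbar y) + p k y" and ?F = "\<lambda>y h. F0 y h + P k y h"
    have "integral\<^sup>L lborel (\<lambda>y. fst (?f y) \<bullet> Dt (?D y) - snd (jet (?F y)) \<bullet> Dx (?D y)) = 0"
    proof (rule weak_identity[OF Q(1) _ _ _ t])
      show "(?f has_derivative ?F y) (at y)" if "y \<in> Q" for y
        by (rule has_derivative_add[OF F0_derivative[OF that] P(1)])
      show "continuous_on Q (\<lambda>y. ?F y h)" for h
        by (intro continuous_on_add continuous_on_subset[OF F0_continuous closure_subset] continuous_on_subset[OF P(2)]) simp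
      show "fst (?f y) = divx (\<lambda>h. snd (?F y h))" if "y \<in> Q" for y
      proof -
        have "ubar y = divx (\<lambda>h. snd (F0 y h))" using div[of y] that closure_subset[of Q] by (auto simp: F0_def)
        then show ?thesis using P(3)[of k y] by (simp add: divx_add)
      qed
    qed
    then show ?thesis by (simp add: s_def[abs_def] uk_def W0_def jet_add)
  qed
  have uc: "continuous_on UNIV (\<lambda>y. u y \<bullet> Dt (?D y))"
  proof (rule continuous_extension_zero[OF Q(1) _ tD(4,5)])
    show "continuous_on Q (\<lambda>y. u y \<bullet> Dt (?D y))"
      by (intro continuous_on_inner continuous_on_subset[OF c(1)] continuous_on_subset[OF u_continuous closure_subset]) simp
  qed (simp add: z)
  have sg: "(\<lambda>y. \<sigma> (fst (W y))) \<in> borel_measurable borel"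
    by (rule measurable_compose[OF fst_W_measurable borel_measurable_continuous_onI[OF sigma_continuous]])
  have lm: "l \<in> borel_measurable borel" unfolding l_def
    by (intro borel_measurable_diff borel_measurable_inner sg borel_measurable_continuous_onI uc c(2))
  have "(\<lambda>k. integral\<^sup>L lborel (s k)) \<longlonglongrightarrow> integral\<^sup>L lborel l"
  proof (rule bounded_support_limit(1)[OF Q(1,2) _ lm])
    show "s k \<in> borel_measurable borel" for k
    proof (rule borel_measurable_continuous_onI, rule continuous_extension_zero[OF Q(1) _ tD(4,5)])
      show "continuous_on Q (s k)" unfolding s_def
        by (intro continuous_on_diff continuous_on_inner continuous_on_snd continuous_on_add uk(3) continuous_on_subset[OF c(1)] continuous_on_subset[OF c(2)]
            continuous_on_subset[OF W0_continuous closure_subset] continuous_on_subset[OF pert_jet_continuous[OF pP]]) simp_all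
    qed (simp add: s_def z)
    show "norm (s k y) \<le> B3 * B1 + bnd * B2" if "y \<in> Q" for k y
    proof -
      have "norm (uk k y \<bullet> Dt (?D y)) \<le> norm (uk k y) * norm (Dt (?D y))" by (simp add: Cauchy_Schwarz_ineq2)
      also have "\<dots> \<le> B3 * B1" by (rule mult_mono) (use B1 B3 that less_imp_le[OF B3(1)] in auto)
      finally have 1: "norm (uk k y \<bullet> Dt (?D y)) \<le> B3 * B1" .
      have sn: "norm (snd (W0 y + jet (P k y))) \<le> bnd"
        by (rule order_trans[OF norm_fst_snd_le(2) bd[OF that]])
      have "norm (snd (W0 y + jet (P k y)) \<bullet> Dx (?D y)) \<le> norm (snd (W0 y + jet (P k y))) * norm (Dx (?D y))" by (simp only: real_norm_def Cauchy_Schwarz_ineq2)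
      also have "\<dots> \<le> bnd * B2" by (rule mult_mono[OF sn B2(2)]) (use bnd(1) in auto)
      finally show ?thesis unfolding s_def using 1 by (rule_tac order_trans[OF norm_triangle_ineq4]) (rule add_mono)
    qed
    show "AE y in lborel. y \<in> Q \<longrightarrow> (\<lambda>k. s k y) \<longlonglongrightarrow> l y" using Wlim
    proof eventually_elim
      case (elim y)
      show ?case
      proof
        assume "y \<in> Q"
        then have w: "(\<lambda>k. W0 y + jet (P k y)) \<longlonglongrightarrow> W y" "snd (W y) = \<sigma> (fst (W y))" using elim by blast+
        show "(\<lambda>k. s k y) \<longlonglongrightarrow> l y" unfolding s_def l_def w(2)[symmetric]
          by (intro tendsto_diff tendsto_inner tendsto_const uk_limit tendsto_snd w(1))
      qed
    qed
  qed (simp_all add: s_def l_def zQ)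
  then have "integral\<^sup>L lborel l = 0" by (simp add: s0 LIMSEQ_const_iff)
  moreover have "integral\<^sup>L (lebesgue_on Q) l = integral\<^sup>L lborel l"
    by (rule integral_lebesgue_on_eq_lborel[OF Q_borel lm]) (simp add: l_def zQ)
  ultimately show ?thesis by (simp add: l_def[abs_def])
qed

lemma solution: "weak_solution \<sigma> Q ubar u (\<lambda>y. fst (W y)) ut"
  unfolding weak_solution_def
proof (intro conjI allI impI ballI W1inf weak_equation u_continuous)
  fix y assume "y \<in> frontier Q"
  then have "y \<notin> Q" using Q(1) by (simp add: frontier_def interior_open)
  then show "u y = ubar y" by (simp add: u_def ulim(4))
qed

lemma nowhere_continuous: "y \<in> Q \<Longrightarrow> \<not> ess_continuous_at (\<lambda>y. fst (W y)) Q y"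
proof -
  assume "y \<in> Q"
  have "ereal d \<le> ess_osc (\<lambda>y. fst (W y)) Q y" by (rule ess_osc_ge) (rule osc; blast)
  moreover have "0 < ereal d" using d by simp
  ultimately show ?thesis unfolding ess_continuous_at_def by (metis leD)
qed

text \<open>If u were \<open>ubar\<close>, the first components of \<open>p k\<close> would tend to
  zero with bounded derivatives that converge almost everywhere; by
  \<open>derivative_limit_zero\<close> these derivatives would tend to zero. The limit gradient
  would then agree almost everywhere with the continuous first component of \<open>W0\<close>,
  against the oscillation by \<open>d\<close> in a small neighbourhood.\<close>

lemma nontrivial: "\<exists>y\<in>Q. u y \<noteq> ubar y"
proof (rule ccontr)
  assume "\<not> (\<exists>y\<in>Q. u y \<noteq> ubar y)"
  then have u0: "ulim y = 0" for y using ulim(4)[of y] by (cases "y \<in> Q") (auto simp: u_def)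
  have W0Q: "continuous_on Q W0" by (rule continuous_on_subset[OF W0_continuous closure_subset])
  have comp: "AE y in lborel. y \<in> Q \<longrightarrow> fst (W y) $ i $ j = fst (W0 y) $ i $ j" for i j
  proof -
    let ?D = "\<lambda>y. fst (W y) $ i $ j - indicator Q y *\<^sub>R (fst (W0 y) $ i $ j)"
    let ?X = "(axis j 1, 0) :: (real ^ 'n) \<times> real"
    have j: "fst (P k y ?X) $ i = fst (jet (P k y)) $ i $ j" for k y by (simp add: jet_def Dx_def)
    have le: "\<bar>fst w $ i $ j\<bar> \<le> norm w" for w :: "('n, 'm) pt"
      by (rule order_trans[OF component_le_norm_cart order_trans[OF Finite_Cartesian_Product.norm_nth_le norm_fst_snd_le(1)]])
    have "AE y in lborel. y \<in> Q \<longrightarrow> ?D y = 0"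
    proof (rule derivative_limit_zero[OF Q(1,2), where M = "max (2 * bnd) (2 * e)" and a = "\<lambda>k y. fst (p k y) $ i" and A = "\<lambda>k y h. fst (P k y h) $ i" and e = ?X])
      show "((\<lambda>y. fst (p k y) $ i) has_derivative (\<lambda>h. fst (P k y h) $ i)) (at y)" for k y
        by (rule bounded_linear.has_derivative[OF bounded_linear_vec_nth has_derivative_fst[OF P(1)]])
      show "continuous_on UNIV (\<lambda>y. fst (P k y ?X) $ i)" for k by (intro continuous_on_component continuous_on_fst P(2))
      show "\<exists>C. compact C \<and> C \<subseteq> Q \<and> (\<forall>y. y \<notin> C \<longrightarrow> fst (p k y) $ i = 0 \<and> fst (P k y ?X) $ i = 0)" for k
      proof -
        obtain C where "compact C" "C \<subseteq> Q" "\<forall>y. y \<notin> C \<longrightarrow> p k y = 0 \<and> (\<forall>h. P k y h = 0)" using pP[of k] unfolding pert_def by blast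
        then show ?thesis by (intro exI[of _ C]) simp
      qed
      show "(\<lambda>k. fst (p k y) $ i) \<longlonglongrightarrow> 0" for y using tendsto_vec_nth[OF ulim(3)[of y], of i] by (simp add: u0)
      show "\<bar>fst (p k y) $ i\<bar> \<le> max (2 * bnd) (2 * e)" for k y
        using order_trans[OF component_le_norm_cart ulim(5)[of k y], of i] by linarith
      show "\<bar>fst (P k y ?X) $ i\<bar> \<le> max (2 * bnd) (2 * e)" if "y \<in> Q" for k y
      proof -
        have "jet (P 0 y) = 0" using p0(2) by (simp add: jet_def Dx_def Dt_def vec_eq_iff prod_eq_iff)
        then have "norm (W0 y) \<le> bnd" using bd[OF that, of 0] by simp
        then have "norm (jet (P k y)) \<le> 2 * bnd" using norm_triangle_ineq4[of "W0 y + jet (P k y)" "W0 y"] bd[OF that, of k] by simp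
        then show ?thesis using le[of "jet (P k y)"] unfolding j by linarith
      qed
      have "(\<lambda>y. indicator Q y *\<^sub>R (fst (W0 y) $ i $ j)) \<in> borel_measurable borel"
        by (rule borel_measurable_continuous_on_indicator[OF Q_borel]) (intro continuous_on_component continuous_on_fst W0Q)
      moreover have "(\<lambda>y. fst (W y) $ i $ j) \<in> borel_measurable borel"
        by (rule measurable_compose[OF fst_W_measurable borel_measurable_continuous_onI]) (intro continuous_intros)
      ultimately show "?D \<in> borel_measurable borel" by (intro borel_measurable_diff)
      show "AE y in lborel. y \<in> Q \<longrightarrow> (\<lambda>k. fst (P k y ?X) $ i) \<longlonglongrightarrow> ?D y" using Wlim
      proof eventually_elim
        case (elim y)
        show ?case
        proof
          assume y: "y \<in> Q"
          then have "(\<lambda>k. fst (W0 y + jet (P k y)) $ i $ j - fst (W0 y) $ i $ j) \<longlonglongrightarrow> fst (W y) $ i $ j - fst (W0 y) $ i $ j"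
            using elim by (intro tendsto_diff tendsto_vec_nth tendsto_fst tendsto_const) blast
          then show "(\<lambda>k. fst (P k y ?X) $ i) \<longlonglongrightarrow> ?D y" using y by (simp add: j)
        qed
      qed
    qed
    then show ?thesis by eventually_elim simp
  qed
  have "AE y in lborel. \<forall>i\<in>UNIV. \<forall>j\<in>UNIV. y \<in> Q \<longrightarrow> fst (W y) $ i $ j = fst (W0 y) $ i $ j"
    by (intro AE_finite_allI finite comp)
  then have eq: "AE y in lborel. y \<in> Q \<longrightarrow> fst (W y) = fst (W0 y)" by eventually_elim (simp add: vec_eq_iff)
  obtain y0 where y0: "y0 \<in> Q" using Q(3) by blast
  have "isCont W0 y0" using W0Q y0 Q(1) by (simp add: continuous_on_eq_continuous_at)
  then obtain r where r: "r > 0" "\<And>y. dist y y0 < r \<Longrightarrow> dist (W0 y) (W0 y0) < d / 2"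
    using d unfolding continuous_at_eps_delta by (meson half_gt_zero)
  let ?U = "Q \<inter> ball y0 r"
  have "open ?U" "?U \<subseteq> Q" "?U \<noteq> {}" using Q(1) y0 r(1) by auto
  from osc[OF this] obtain E1 E2 where E: "E1 \<in> sets borel" "E2 \<in> sets borel" "E1 \<subseteq> ?U" "E2 \<subseteq> ?U"
    "emeasure lborel E1 > 0" "emeasure lborel E2 > 0" "\<forall>y\<in>E1. \<forall>z\<in>E2. d \<le> dist (fst (W y)) (fst (W z))" by (elim exE conjE)
  obtain y where y: "y \<in> E1" "y \<in> Q \<longrightarrow> fst (W y) = fst (W0 y)" using AE_witness[OF eq E(1,5)] by blast
  obtain z where z: "z \<in> E2" "z \<in> Q \<longrightarrow> fst (W z) = fst (W0 z)" using AE_witness[OF eq E(2,6)] by blast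
  have "d \<le> dist (fst (W0 y)) (fst (W0 z))" using E(3,4,7) y z by (metis IntD1 subsetD)
  also have "\<dots> \<le> dist (W0 y) (W0 z)" by (rule dist_fst_le)
  also have "\<dots> < d"
  proof (rule dist_triangle_half_l)
    show "dist (W0 y) (W0 y0) < d / 2" by (rule r(2)) (use y(1) E(3) in \<open>auto simp: dist_commute\<close>)
    show "dist (W0 z) (W0 y0) < d / 2" by (rule r(2)) (use z(1) E(4) in \<open>auto simp: dist_commute\<close>)
  qed
  finally show False by simp
qed

end

section \<open>Existence and infinitely many solutions\<close>

context dirichlet_data begin

text \<open>The pointwise bound and the inequality with \<open>ubar\<close> are recorded for the
  sake of the infinitely many solutions.\<close>

lemma existence:
  assumes e: "e > 0"
  shows "\<exists>u Du ut. weak_solution \<sigma> Q ubar u Du ut \<and> (\<forall>y\<in>Q. norm (u y - ubar y) \<le> e) \<and>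
    Linf_norm Q (\<lambda>y. u y - ubar y) \<le> ereal e \<and> Linf_norm Q (\<lambda>y. ut y - Dt (blinfun_apply (Fu y))) \<le> ereal e \<and>
    (\<forall>y\<in>Q. \<not> ess_continuous_at Du Q y) \<and> (\<exists>y\<in>Q. u y \<noteq> ubar y)"
proof -
  from W0_range obtain lm0 where lm: "\<delta>0 \<le> lm0" "lm0 < 1" "W0 ` Q \<subseteq> Sig lm0" by (elim exE conjE)
  from approximating_sequence[OF Q lm(1,2) continuous_on_subset[OF W0_continuous closure_subset] lm(3) e]
  obtain p P W d where a: "\<forall>k. pert Q (p k) (P k)" "\<forall>y h. p 0 y = 0 \<and> P 0 y h = 0"
    "\<forall>k. small (e / 2 ^ Suc k) (\<lambda>y. p (Suc k) y - p k y) (\<lambda>y h. P (Suc k) y h - P k y h)"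
    "\<forall>k. \<forall>y\<in>Q. norm (W0 y + jet (P k y)) \<le> bnd" "W \<in> borel_measurable borel"
    "AE y in lborel. y \<in> Q \<longrightarrow> (\<lambda>k. W0 y + jet (P k y)) \<longlonglongrightarrow> W y \<and> snd (W y) = \<sigma> (fst (W y))"
    "d > 0" "\<forall>U. open U \<longrightarrow> U \<subseteq> Q \<longrightarrow> U \<noteq> {} \<longrightarrow> (\<exists>E1 E2. E1 \<in> sets borel \<and> E2 \<in> sets borel \<and> E1 \<subseteq> U \<and> E2 \<subseteq> U \<and>
        emeasure lborel E1 > 0 \<and> emeasure lborel E2 > 0 \<and> (\<forall>y\<in>E1. \<forall>z\<in>E2. d \<le> dist (fst (W y)) (fst (W z))))"
    by (elim exE conjE)
  interpret A: approximation N \<sigma> r0 \<delta>1 \<delta>2 \<delta>0 \<kappa> \<gamma> Q ubar vbar Fu Fv e p P W d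
    by unfold_locales
       (rule e a(1,3,4,8)[rule_format] a(5,6,7) conjunct1[OF a(2)[rule_format]] conjunct2[OF a(2)[rule_format]]; assumption)+
  have L: "Linf_norm Q g \<le> ereal e" if "continuous_on UNIV g" "\<And>y. norm (g y) \<le> e" for g :: "(real ^ 'n) \<times> real \<Rightarrow> real ^ 'm"
    unfolding Linf_norm_def
  proof (rule esssup_I)
    have "g \<in> borel_measurable (lebesgue_on Q)"
      by (rule continuous_imp_measurable_on_sets_lebesgue[OF continuous_on_subset[OF that(1)]]) (use Q(1) in simp_all)
    then show "(\<lambda>y. ereal (norm (g y))) \<in> borel_measurable (lebesgue_on Q)" by measurable
    show "AE y in lebesgue_on Q. ereal (norm (g y)) \<le> ereal e" using that(2) by simp
  qed
  show ?thesis
    by (rule exI[of _ A.u], rule exI[of _ "\<lambda>y. fst (W y)"], rule exI[of _ A.ut])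
       (use A.solution A.nowhere_continuous A.nontrivial A.ulim(1) L[OF A.ulim(2,1)] L[OF A.tlim(2,1)] in
         \<open>simp add: A.u_def A.ut_def\<close>)
qed

text \<open>A solution closer to \<open>ubar\<close> than any of finitely many solutions distinct from \<open>ubar\<close> is new.\<close>
lemma infinitely_many:
  "infinite ((\<lambda>u. \<lambda>y. if y \<in> closure Q then u y else 0) `
     {u. \<exists>Du ut. weak_solution \<sigma> Q ubar u Du ut \<and> (\<forall>y\<in>Q. \<not> ess_continuous_at Du Q y)})"
  (is "infinite (?\<rho> ` ?U)")
proof
  assume fin: "finite (?\<rho> ` ?U)"
  define V where "V = {v \<in> ?\<rho> ` ?U. \<exists>y\<in>Q. v y \<noteq> ubar y}"
  have "\<forall>v\<in>V. \<exists>y. y \<in> Q \<and> v y \<noteq> ubar y" by (auto simp: V_def)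
  from bchoice[OF this] obtain Y where Y: "\<forall>v\<in>V. Y v \<in> Q \<and> v (Y v) \<noteq> ubar (Y v)" ..
  \<comment> \<open>Smallest deviation from \<open>ubar\<close> among the given solutions, each
    measured at one point where it differs from \<open>ubar\<close>. The 1 keeps the set nonempty in
    case there is no such solution.\<close>
  define m where "m = Min (insert 1 ((\<lambda>v. norm (v (Y v) - ubar (Y v))) ` V))"
  have fV: "finite V" using fin by (simp add: V_def)
  have "m \<in> insert 1 ((\<lambda>v. norm (v (Y v) - ubar (Y v))) ` V)" unfolding m_def by (rule Min_in) (use fV in auto)
  then have m: "m > 0" using Y by auto
  have mv: "m \<le> norm (v (Y v) - ubar (Y v))" if "v \<in> V" for v unfolding m_def by (rule Min_le) (use fV that in auto)
  have "m / 2 > 0" using m by simp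
  from existence[OF this] obtain u Du ut where u: "weak_solution \<sigma> Q ubar u Du ut" "\<forall>y\<in>Q. norm (u y - ubar y) \<le> m / 2"
    "\<forall>y\<in>Q. \<not> ess_continuous_at Du Q y" "\<exists>y\<in>Q. u y \<noteq> ubar y" by (elim exE conjE)
  have ru: "?\<rho> u y = u y" if "y \<in> Q" for y using subsetD[OF closure_subset that] by (rule if_P)
  have "u \<in> ?U" using u(1,3) by blast
  then have "?\<rho> u \<in> ?\<rho> ` ?U" by (rule imageI)
  moreover obtain y where y: "y \<in> Q" "u y \<noteq> ubar y" using u(4) by blast
  then have "?\<rho> u y \<noteq> ubar y" using ru by simp
  ultimately have "?\<rho> u \<in> V" using y(1) unfolding V_def by blast
  then have "m \<le> norm (u (Y (?\<rho> u)) - ubar (Y (?\<rho> u)))" "Y (?\<rho> u) \<in> Q" using mv[of "?\<rho> u"] Y ru by auto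
  then show False using u(2) m by fastforce
qed

end

theorem theorem2p1:
  fixes \<Omega> :: "(real ^ 'n) set" and T :: real and N :: nat
    and \<sigma> :: "real ^ 'n ^ 'm \<Rightarrow> real ^ 'n ^ 'm"
    and r0 \<delta>1 \<delta>2 \<delta>0 :: real
    and \<kappa> :: "nat \<Rightarrow> ('n,'m) pt \<Rightarrow> real" and \<gamma> :: "nat \<Rightarrow> ('n,'m) pt \<Rightarrow> ('n,'m) pt"
    and ubar :: "(real ^ 'n) \<times> real \<Rightarrow> real ^ 'm"
    and vbar :: "(real ^ 'n) \<times> real \<Rightarrow> real ^ 'n ^ 'm"
    and Fu :: "(real ^ 'n) \<times> real \<Rightarrow> (((real ^ 'n) \<times> real) \<Rightarrow>\<^sub>L (real ^ 'm))"
    and Fv :: "(real ^ 'n) \<times> real \<Rightarrow> (((real ^ 'n) \<times> real) \<Rightarrow>\<^sub>L (real ^ 'n ^ 'm))"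
    and \<delta> :: real
  assumes "N \<ge> 2"
    and "open \<Omega>" and "connected \<Omega>" and "bounded \<Omega>" and "\<Omega> \<noteq> {}" and "T > 0"
    and "loc_lipschitz \<sigma>"
    and "condition_O N \<sigma> r0 \<delta>1 \<delta>2 \<delta>0 \<kappa> \<gamma>"
    and "C1_closure (cyl \<Omega> T) ubar Fu" and "C1_closure (cyl \<Omega> T) vbar Fv"
    and "\<forall>y\<in>closure (cyl \<Omega> T). ubar y = divx (blinfun_apply (Fv y)) \<and>
           (Dx (blinfun_apply (Fu y)), Dt (blinfun_apply (Fv y))) \<in> Sigma1 N r0 \<delta>0 \<kappa> \<gamma>"
    and "0 < \<delta>" and "\<delta> < 1"
  shows "(\<exists>u Du ut. weak_solution \<sigma> (cyl \<Omega> T) ubar u Du ut \<and>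
            Linf_norm (cyl \<Omega> T) (\<lambda>y. u y - ubar y)
              + Linf_norm (cyl \<Omega> T) (\<lambda>y. ut y - Dt (blinfun_apply (Fu y))) < ereal \<delta> \<and>
            (\<forall>y\<in>cyl \<Omega> T. \<not> ess_continuous_at Du (cyl \<Omega> T) y))
       \<and> infinite ((\<lambda>u. \<lambda>y. if y \<in> closure (cyl \<Omega> T) then u y else 0) `
            {u. \<exists>Du ut. weak_solution \<sigma> (cyl \<Omega> T) ubar u Du ut \<and>
                 (\<forall>y\<in>cyl \<Omega> T. \<not> ess_continuous_at Du (cyl \<Omega> T) y)})"
proof -
  have Q: "open (cyl \<Omega> T)" "bounded (cyl \<Omega> T)" "cyl \<Omega> T \<noteq> {}"
    unfolding cyl_def using assms(2,4,5,6) by (auto intro: open_Times bounded_Times)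
  interpret dirichlet_data N \<sigma> r0 \<delta>1 \<delta>2 \<delta>0 \<kappa> \<gamma> "cyl \<Omega> T" ubar vbar Fu Fv
    by unfold_locales (use assms Q in blast)+
  \<comment> \<open>A third for each of the two norms leaves room for the strict inequality.\<close>
  have "\<delta> / 3 > 0" using assms(12) by simp
  from existence[OF this] obtain u Du ut where u: "weak_solution \<sigma> (cyl \<Omega> T) ubar u Du ut"
    "Linf_norm (cyl \<Omega> T) (\<lambda>y. u y - ubar y) \<le> ereal (\<delta> / 3)"
    "Linf_norm (cyl \<Omega> T) (\<lambda>y. ut y - Dt (blinfun_apply (Fu y))) \<le> ereal (\<delta> / 3)"
    "\<forall>y\<in>cyl \<Omega> T. \<not> ess_continuous_at Du (cyl \<Omega> T) y" by (elim exE conjE)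
  have "ereal (\<delta> / 3) + ereal (\<delta> / 3) < ereal \<delta>" using assms(12) by simp
  then have "Linf_norm (cyl \<Omega> T) (\<lambda>y. u y - ubar y) + Linf_norm (cyl \<Omega> T) (\<lambda>y. ut y - Dt (blinfun_apply (Fu y))) < ereal \<delta>"
    using add_mono[OF u(2,3)] by (rule le_less_trans[rotated])
  then show ?thesis using u(1,4) infinitely_many by blast
qed

end
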